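(* Let $E\to M$ be a Courant algebroid, $V_+\subset E$ a generalized metric, $\operatorname{div}$ a divergence on $E$, $\tau:M'\to M$ a smooth map, and let $\tau^*E\to M'$ be a CA-pullback of $E$. Then $$\mathcal R^{\tau^*E}_{\tau^*V_+,\tau^*\operatorname{div}}=\tau^*\bigl(\mathcal R^E_{V_+,\operatorname{div}}\bigr).$$
   Context: A Courant algebroid (CA) is a vector bundle $E\to M$ with a non-degenerate symmetric fibrewise bilinear form $\langle\,,\,\rangle$, a bundle map $\rho:E\to TM$ (the anchor) and an $\mathbb R$-bilinear bracket $[\,,\,]:\Gamma(E)\times\Gamma(E)\to\Gamma(E)$ such that for $u,v,w\in\Gamma(E)$, $f\in C^\infty(M)$: $[u,[v,w]]=[[u,v],w]+[v,[u,w]]$; $[u,fv]=f[u,v]+(u\cdot f)v$; $u\cdot\langle v,w\rangle=\langle[u,v],w\rangle+\langle v,[u,w]\rangle$; $[u,v]+[v,u]=d_E\langle u,v\rangle$. Here $u\cdot f:=\rho(u)f$ and $d_Ef\in\Gamma(E)$ is defined by $\langle u,d_Ef\rangle=u\cdot f$. A generalized pseudometric is a subbundle $V_+\subset E$ on which $\langle\,,\,\rangle$ is non-degenerate; $V_-:=V_+^\perp$. It is a generalized metric if $\langle\,,\,\rangle$ is positive-definite on $V_+$ and negative-definite on $V_-$. The subscript $+$ on a section denotes its orthogonal projection to $V_+$. A divergence on $E$ is an $\mathbb R$-linear map $\operatorname{div}:\Gamma(E)\to C^\infty(M)$ with $\operatorname{div}(fa)=f\operatorname{div}a+a\cdot f$.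 For an everywhere non-zero density $\mu$, $\operatorname{div}_\mu a:=\mu^{-1}\mathcal L_{\rho(a)}\mu$. Laplacian on half-densities: choose a local frame $e_\alpha$ of $E$, the union of a frame $e_a$ of $V_+$ and a frame $e_{\bar a}$ of $V_-$, with $\langle e_\alpha,e_\beta\rangle$ constant; raise and lower indices with $\langle\,,\,\rangle$ and put $c_{\alpha\beta\gamma}:=\langle e_\alpha,[e_\beta,e_\gamma]\rangle$. Then $\Delta_{V_+}:=4\,\mathcal L_{\rho(e^a)}\mathcal L_{\rho(e_a)}-\tfrac16c_{abc}c^{abc}-\tfrac12c_{ab\bar c}c^{ab\bar c}$ (summation over repeated indices; independent of the frame). Generalized scalar curvature: $\mathcal R^E_{V_+,\operatorname{div}}:=\sigma^{-1}\Delta_{V_+}\sigma+\langle e_+,e_+\rangle+2\operatorname{div}_{\sigma^2}e_+\in C^\infty(M)$, where $\sigma$ is any non-vanishing half-density on $M$ and $e\in\Gamma(E)$ is given by $\operatorname{div}-\operatorname{div}_{\sigma^2}=\langle e,\cdot\rangle$. It is independent of $\sigma$; in a local frame $e_\alpha$ of $E$ that is the union of a frame $e_a$ of $V_+$ and a frame $e_{\bar a}$ of $V_-$, with $\langle e_\alpha,e_\beta\rangle$ constant and $c_{\alpha\beta\gamma}=\langle e_\alpha,[e_\beta,e_\gamma]\rangle$, $\mathcal R_{V_+,\operatorname{div}}=(\operatorname{div}e^a)(\operatorname{div}e_a)+2e^a\cdot(\operatorname{div}e_a)-\frac16c_{abc}c^{abc}-\frac12c_{ab\bar c}c^{ab\bar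 c}$. CA-pullback: for a smooth map $\tau:M'\to M$, the vector bundle $\tau^*E\to M'$ is called a CA-pullback of $E$ if it is equipped with a CA structure $(\langle\,,\,\rangle',[\,,\,]',\rho')$ with $\langle\tau^*u,\tau^*v\rangle'=\tau^*\langle u,v\rangle$, $[\tau^*u,\tau^*v]'=\tau^*[u,v]$, $\tau_*(\rho'(\tau^*u))=\rho(u)$ for all $u,v\in\Gamma(E)$. Then $\tau^*V_+\subset\tau^*E$ is a generalized metric, and $\tau^*\operatorname{div}$ is the unique divergence on $\tau^*E$ with $(\tau^*\operatorname{div})(\tau^*u)=\tau^*(\operatorname{div}u)$ for all $u\in\Gamma(E)$. *)

theory Defs
  imports "HOL-Analysis.Analysis"
begin

section \<open>Smooth manifolds\<close>

text \<open>
  A manifold lives on a whole Hausdorff second countable type. Its charts take values in the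
  coordinate subspace of \<open>real ^ 'n\<close> spanned by the axes in \<open>coords\<close>, so that the dimension is
  \<open>card coords\<close>; since \<open>CARD('n) > 0\<close>, a free set of axes is what makes dimension 0
  available (a Courant algebroid over a point is a quadratic Lie algebra).
\<close>

type_synonym ('m, 'n) chart = "'m set \<times> ('m \<Rightarrow> real ^ 'n)"

record ('m, 'n) mfd =
  coords :: "'n set"
  atlas :: "('m, 'n) chart set"

text \<open>The partial derivative of \<open>f\<close> along the \<open>i\<close>-th coordinate of a chart, as a function on the
  manifold.\<close>

definition coord_curve :: "('m, 'n::finite) chart \<Rightarrow> 'n \<Rightarrow> 'm \<Rightarrow> real \<Rightarrow> 'm" where
  "coord_curve c i x t = inv_into (fst c) (snd c) (snd c x + t *\<^sub>R axis i 1)"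

definition partial :: "('m, 'n::finite) chart \<Rightarrow> 'n \<Rightarrow> ('m \<Rightarrow> real) \<Rightarrow> 'm \<Rightarrow> real" where
  "partial c i f x = deriv (\<lambda>t. f (coord_curve c i x t)) 0"

primrec Ck_on ::
  "'n::finite set \<Rightarrow> ('m::topological_space, 'n) chart \<Rightarrow> 'm set \<Rightarrow> nat \<Rightarrow> ('m \<Rightarrow> real) \<Rightarrow> bool"
where
  "Ck_on I c W 0 f \<longleftrightarrow> continuous_on W f"
| "Ck_on I c W (Suc k) f \<longleftrightarrow> continuous_on W f \<and>
     (\<forall>i\<in>I. (\<forall>x\<in>W. (\<lambda>t. f (coord_curve c i x t)) differentiable (at 0)) \<and>
            Ck_on I c W k (partial c i f))"

definition smooth_in_chart ::
  "'n::finite set \<Rightarrow> ('m::topological_space, 'n) chart \<Rightarrow> 'm set \<Rightarrow> ('m \<Rightarrow> real) \<Rightarrow> bool"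
where
  "smooth_in_chart I c W f \<longleftrightarrow> (\<forall>k. Ck_on I c W k f)"

definition manifold ::
  "('m::{t2_space, second_countable_topology}, 'n::finite) mfd \<Rightarrow> bool"
where
  "manifold M \<longleftrightarrow>
     (\<Union>c\<in>atlas M. fst c) = UNIV \<and>
     (\<forall>(U, \<phi>)\<in>atlas M. open U \<and>
        openin (top_of_set {y. \<forall>i. i \<notin> coords M \<longrightarrow> y $ i = 0}) (\<phi> ` U) \<and>
        (\<exists>\<psi>. homeomorphism U (\<phi> ` U) \<phi> \<psi>)) \<and>
     (\<forall>c\<in>atlas M. \<forall>d\<in>atlas M. \<forall>i\<in>coords M.
        smooth_in_chart (coords M) c (fst c \<inter> fst d) (\<lambda>x. snd d x $ i))"

definition smooth_on ::
  "('m::{t2_space, second_countable_topology}, 'n::finite) mfd \<Rightarrow> 'm set \<Rightarrow> ('m \<Rightarrow> real) \<Rightarrow> bool"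
where
  "smooth_on M W f \<longleftrightarrow> (\<forall>c\<in>atlas M. smooth_in_chart (coords M) c (W \<inter> fst c) f)"

definition smooth_functions ::
  "('m::{t2_space, second_countable_topology}, 'n::finite) mfd \<Rightarrow> ('m \<Rightarrow> real) set"
where
  "smooth_functions M = {f. smooth_on M UNIV f}"

definition smooth_map ::
  "('k::{t2_space, second_countable_topology}, 'l::finite) mfd \<Rightarrow>
   ('m::{t2_space, second_countable_topology}, 'n::finite) mfd \<Rightarrow> ('k \<Rightarrow> 'm) \<Rightarrow> bool"
where
  "smooth_map M' M \<tau> \<longleftrightarrow> continuous_on UNIV \<tau> \<and>
     (\<forall>c\<in>atlas M. \<forall>i\<in>coords M. smooth_on M' (\<tau> -` fst c) (\<lambda>x. snd c (\<tau> x) $ i))"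


section \<open>Tangent vectors and vector fields\<close>

text \<open>
  A tangent vector at \<open>x\<close> is an operator on smooth functions of the form
  \<open>f \<mapsto> \<Sum>\<^sub>i \<xi>\<^sub>i (\<partial>\<^sub>i f)(x)\<close>. Its values on functions that are not smooth carry no meaning.
\<close>

type_synonym 'm tangent = "('m \<Rightarrow> real) \<Rightarrow> real"

definition has_components ::
  "('m::{t2_space, second_countable_topology}, 'n::finite) mfd \<Rightarrow> ('m, 'n) chart \<Rightarrow> 'm \<Rightarrow>
   'm tangent \<Rightarrow> real ^ 'n \<Rightarrow> bool"
where
  "has_components M c x D \<xi> \<longleftrightarrow>
     (\<forall>i. i \<notin> coords M \<longrightarrow> \<xi> $ i = 0) \<and>
     (\<forall>f\<in>smooth_functions M. D f = (\<Sum>i\<in>coords M. \<xi> $ i * partial c i f x))"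

definition tangent_vector ::
  "('m::{t2_space, second_countable_topology}, 'n::finite) mfd \<Rightarrow> 'm \<Rightarrow> 'm tangent \<Rightarrow> bool"
where
  "tangent_vector M x D \<longleftrightarrow> (\<forall>c\<in>atlas M. x \<in> fst c \<longrightarrow> (\<exists>\<xi>. has_components M c x D \<xi>))"

definition chart_components ::
  "('m::{t2_space, second_countable_topology}, 'n::finite) mfd \<Rightarrow> ('m, 'n) chart \<Rightarrow> 'm \<Rightarrow>
   'm tangent \<Rightarrow> real ^ 'n"
where
  "chart_components M c x D = (THE \<xi>. has_components M c x D \<xi>)"


section \<open>Densities\<close>

text \<open>
  An \<open>s\<close>-density is given by its coefficients \<open>\<sigma> c\<close> with respect to \<open>\<bar>dx\<bar>\<^sup>s\<close> in the charts \<open>c\<close>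
  of the atlas; a half-density is the case \<open>s = 1/2\<close>, a density the case \<open>s = 1\<close>. In the
  Jacobian matrix of the coordinates of \<open>d\<close> with respect to those of \<open>c\<close>, the unused axes are
  filled up with the identity, which does not change the determinant.
\<close>

type_synonym ('m, 'n) dens = "('m, 'n) chart \<Rightarrow> 'm \<Rightarrow> real"

definition coord_jacobian ::
  "('m, 'n::finite) mfd \<Rightarrow> ('m, 'n) chart \<Rightarrow> ('m, 'n) chart \<Rightarrow> 'm \<Rightarrow> real ^ 'n ^ 'n"
where
  "coord_jacobian M c d x = (\<chi> i j. if i \<in> coords M \<and> j \<in> coords M
     then partial c j (\<lambda>y. snd d y $ i) x else if i = j then 1 else 0)"

definition is_density ::
  "('m::{t2_space, second_countable_topology}, 'n::finite) mfd \<Rightarrow> real \<Rightarrow> ('m, 'n) dens \<Rightarrow> bool"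
where
  "is_density M s \<sigma> \<longleftrightarrow>
     (\<forall>c\<in>atlas M. smooth_on M (fst c) (\<sigma> c)) \<and>
     (\<forall>c\<in>atlas M. \<forall>d\<in>atlas M. \<forall>x\<in>fst c \<inter> fst d.
        \<sigma> c x = \<bar>det (coord_jacobian M c d x)\<bar> powr s * \<sigma> d x)"

definition nonvanishing :: "('m, 'n) mfd \<Rightarrow> ('m, 'n) dens \<Rightarrow> bool" where
  "nonvanishing M \<sigma> \<longleftrightarrow> (\<forall>c\<in>atlas M. \<forall>x\<in>fst c. \<sigma> c x \<noteq> 0)"

text \<open>The Lie derivative of an \<open>s\<close>-density:
  \<open>L\<^sub>X (\<sigma> \<bar>dx\<bar>\<^sup>s) = (X\<^sup>i \<partial>\<^sub>i \<sigma> + s (\<partial>\<^sub>i X\<^sup>i) \<sigma>) \<bar>dx\<bar>\<^sup>s\<close>.\<close>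

definition lie_density ::
  "('m::{t2_space, second_countable_topology}, 'n::finite) mfd \<Rightarrow> real \<Rightarrow> ('m \<Rightarrow> 'm tangent) \<Rightarrow>
   ('m, 'n) dens \<Rightarrow> ('m, 'n) dens"
where
  "lie_density M s X \<sigma> c x =
     (\<Sum>i\<in>coords M. chart_components M c x (X x) $ i * partial c i (\<sigma> c) x) +
     s * (\<Sum>i\<in>coords M. partial c i (\<lambda>y. chart_components M c y (X y) $ i) x) * \<sigma> c x"

text \<open>The function \<open>\<mu>\<^sup>-\<^sup>1 \<nu>\<close> for two \<open>s\<close>-densities, \<open>\<mu>\<close> being non-vanishing; any chart around
  the point gives the same value.\<close>

definition density_ratio :: "('m, 'n) mfd \<Rightarrow> ('m, 'n) dens \<Rightarrow> ('m, 'n) dens \<Rightarrow> 'm \<Rightarrow> real" where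
  "density_ratio M \<nu> \<mu> x = (let c = (SOME c. c \<in> atlas M \<and> x \<in> fst c) in \<nu> c x / \<mu> c x)"


section \<open>Vector bundles\<close>

text \<open>
  The fibres are subspaces of a vector space \<open>'v\<close> which carries no further structure and plays
  no role of its own: it only serves as a common type for the elements of the fibres (take the
  direct sum of all fibres to see that this is no restriction). The bundle structure consists of
  the local frames in \<open>trivs\<close>, i.e. local trivializations, with smooth transition functions.
\<close>

record ('m, 'v) vbundle =
  fibre :: "'m \<Rightarrow> 'v set"
  fibre_dim :: nat
  trivs :: "('m set \<times> (nat \<Rightarrow> 'm \<Rightarrow> 'v)) set"

definition basis_family :: "'v::real_vector set \<Rightarrow> nat set \<Rightarrow> (nat \<Rightarrow> 'v) \<Rightarrow> bool" where
  "basis_family W J b \<longleftrightarrow> inj_on b J \<and> independent (b ` J) \<and> span (b ` J) = W"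

definition vector_bundle ::
  "('m::{t2_space, second_countable_topology}, 'n::finite) mfd \<Rightarrow>
   ('m, 'v::real_vector, 'z) vbundle_scheme \<Rightarrow> bool"
where
  "vector_bundle M E \<longleftrightarrow>
     (\<forall>x. subspace (fibre E x)) \<and>
     (\<Union>t\<in>trivs E. fst t) = UNIV \<and>
     (\<forall>(U, s)\<in>trivs E. open U \<and>
        (\<forall>x\<in>U. basis_family (fibre E x) {..<fibre_dim E} (\<lambda>i. s i x))) \<and>
     (\<forall>(U, s)\<in>trivs E. \<forall>(U', s')\<in>trivs E. \<forall>j<fibre_dim E. \<exists>g.
        (\<forall>i<fibre_dim E. smooth_on M (U \<inter> U') (g i)) \<and>
        (\<forall>x\<in>U \<inter> U'. s' j x = (\<Sum>i<fibre_dim E. g i x *\<^sub>R s i x)))"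

definition smooth_section_on ::
  "('m::{t2_space, second_countable_topology}, 'n::finite) mfd \<Rightarrow>
   ('m, 'v::real_vector, 'z) vbundle_scheme \<Rightarrow> 'm set \<Rightarrow> ('m \<Rightarrow> 'v) \<Rightarrow> bool"
where
  "smooth_section_on M E W u \<longleftrightarrow>
     (\<forall>x\<in>W. u x \<in> fibre E x) \<and>
     (\<forall>(U, s)\<in>trivs E. \<exists>g.
        (\<forall>i<fibre_dim E. smooth_on M (U \<inter> W) (g i)) \<and>
        (\<forall>x\<in>U \<inter> W. u x = (\<Sum>i<fibre_dim E. g i x *\<^sub>R s i x)))"

definition sections ::
  "('m::{t2_space, second_countable_topology}, 'n::finite) mfd \<Rightarrow>
   ('m, 'v::real_vector, 'z) vbundle_scheme \<Rightarrow> ('m \<Rightarrow> 'v) set"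
where
  "sections M E = {u. smooth_section_on M E UNIV u}"

definition subbundle ::
  "('m::{t2_space, second_countable_topology}, 'n::finite) mfd \<Rightarrow>
   ('m, 'v::real_vector, 'z) vbundle_scheme \<Rightarrow> ('m \<Rightarrow> 'v set) \<Rightarrow> bool"
where
  "subbundle M E V \<longleftrightarrow>
     (\<forall>x. subspace (V x) \<and> V x \<subseteq> fibre E x) \<and>
     (\<exists>p. \<forall>x. \<exists>U e. open U \<and> x \<in> U \<and> (\<forall>a<p. smooth_section_on M E U (e a)) \<and>
        (\<forall>y\<in>U. basis_family (V y) {..<p} (\<lambda>a. e a y)))"

definition pullback_bundle ::
  "('k \<Rightarrow> 'm) \<Rightarrow> ('m, 'v, 'z) vbundle_scheme \<Rightarrow> ('k, 'v) vbundle"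
where
  "pullback_bundle \<tau> E =
     \<lparr>fibre = fibre E \<circ> \<tau>, fibre_dim = fibre_dim E,
      trivs = (\<lambda>(U, s). (\<tau> -` U, \<lambda>i. s i \<circ> \<tau>)) ` trivs E\<rparr>"


section \<open>Courant algebroids\<close>

text \<open>The anchor is a bundle map to the tangent bundle, \<open>anchor E x v f\<close> being the derivative of
  \<open>f\<close> along the image of \<open>v\<close>, an element of the fibre over \<open>x\<close>.\<close>

record ('m, 'v) calg = "('m, 'v) vbundle" +
  pairing :: "'m \<Rightarrow> 'v \<Rightarrow> 'v \<Rightarrow> real"
  anchor :: "'m \<Rightarrow> 'v \<Rightarrow> 'm tangent"
  bracket :: "('m \<Rightarrow> 'v) \<Rightarrow> ('m \<Rightarrow> 'v) \<Rightarrow> 'm \<Rightarrow> 'v"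

definition inner_sec :: "('m, 'v) calg \<Rightarrow> ('m \<Rightarrow> 'v) \<Rightarrow> ('m \<Rightarrow> 'v) \<Rightarrow> 'm \<Rightarrow> real" where
  "inner_sec E u v x = pairing E x (u x) (v x)"

definition rho :: "('m, 'v) calg \<Rightarrow> ('m \<Rightarrow> 'v) \<Rightarrow> 'm \<Rightarrow> 'm tangent" where
  "rho E u x = anchor E x (u x)"

definition act :: "('m, 'v) calg \<Rightarrow> ('m \<Rightarrow> 'v) \<Rightarrow> ('m \<Rightarrow> real) \<Rightarrow> 'm \<Rightarrow> real" where
  "act E u f x = rho E u x f"

definition dE :: "('m, 'v) calg \<Rightarrow> ('m \<Rightarrow> real) \<Rightarrow> 'm \<Rightarrow> 'v" where
  "dE E f x = (THE w. w \<in> fibre E x \<and> (\<forall>v\<in>fibre E x. pairing E x v w = anchor E x v f))"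

definition nondegenerate_on :: "('m, 'v::real_vector) calg \<Rightarrow> ('m \<Rightarrow> 'v set) \<Rightarrow> bool" where
  "nondegenerate_on E V \<longleftrightarrow> (\<forall>x. \<forall>v\<in>V x. (\<forall>w\<in>V x. pairing E x v w = 0) \<longrightarrow> v = 0)"

definition fibre_metric ::
  "('m::{t2_space, second_countable_topology}, 'n::finite) mfd \<Rightarrow> ('m, 'v::real_vector) calg \<Rightarrow> bool"
where
  "fibre_metric M E \<longleftrightarrow>
     (\<forall>x. \<forall>u\<in>fibre E x. \<forall>v\<in>fibre E x. \<forall>w\<in>fibre E x. \<forall>a b.
        pairing E x (a *\<^sub>R u + b *\<^sub>R v) w = a * pairing E x u w + b * pairing E x v w) \<and>
     (\<forall>x. \<forall>u\<in>fibre E x. \<forall>v\<in>fibre E x. pairing E x u v = pairing E x v u) \<and>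
     nondegenerate_on E (fibre E) \<and>
     (\<forall>u\<in>sections M E. \<forall>v\<in>sections M E. inner_sec E u v \<in> smooth_functions M)"

definition anchor_map ::
  "('m::{t2_space, second_countable_topology}, 'n::finite) mfd \<Rightarrow> ('m, 'v::real_vector) calg \<Rightarrow> bool"
where
  "anchor_map M E \<longleftrightarrow>
     (\<forall>x. \<forall>v\<in>fibre E x. tangent_vector M x (anchor E x v)) \<and>
     (\<forall>x. \<forall>v\<in>fibre E x. \<forall>w\<in>fibre E x. \<forall>a b. \<forall>f\<in>smooth_functions M.
        anchor E x (a *\<^sub>R v + b *\<^sub>R w) f = a * anchor E x v f + b * anchor E x w f) \<and>
     (\<forall>u\<in>sections M E. \<forall>f\<in>smooth_functions M. act E u f \<in> smooth_functions M)"

definition courant_bracket ::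
  "('m::{t2_space, second_countable_topology}, 'n::finite) mfd \<Rightarrow> ('m, 'v::real_vector) calg \<Rightarrow> bool"
where
  "courant_bracket M E \<longleftrightarrow>
     (\<forall>u\<in>sections M E. \<forall>v\<in>sections M E. bracket E u v \<in> sections M E) \<and>
     (\<forall>u\<in>sections M E. \<forall>v\<in>sections M E. \<forall>w\<in>sections M E. \<forall>a b.
        bracket E (\<lambda>x. a *\<^sub>R u x + b *\<^sub>R v x) w
          = (\<lambda>x. a *\<^sub>R bracket E u w x + b *\<^sub>R bracket E v w x) \<and>
        bracket E w (\<lambda>x. a *\<^sub>R u x + b *\<^sub>R v x)
          = (\<lambda>x. a *\<^sub>R bracket E w u x + b *\<^sub>R bracket E w v x)) \<and>
     (\<forall>u\<in>sections M E. \<forall>v\<in>sections M E. \<forall>w\<in>sections M E.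
        bracket E u (bracket E v w)
          = (\<lambda>x. bracket E (bracket E u v) w x + bracket E v (bracket E u w) x)) \<and>
     (\<forall>u\<in>sections M E. \<forall>v\<in>sections M E. \<forall>f\<in>smooth_functions M.
        bracket E u (\<lambda>x. f x *\<^sub>R v x) = (\<lambda>x. f x *\<^sub>R bracket E u v x + act E u f x *\<^sub>R v x)) \<and>
     (\<forall>u\<in>sections M E. \<forall>v\<in>sections M E. \<forall>w\<in>sections M E.
        act E u (inner_sec E v w)
          = (\<lambda>x. inner_sec E (bracket E u v) w x + inner_sec E v (bracket E u w) x)) \<and>
     (\<forall>u\<in>sections M E. \<forall>v\<in>sections M E.
        (\<lambda>x. bracket E u v x + bracket E v u x) = dE E (inner_sec E u v))"

definition courant_algebroid ::
  "('m::{t2_space, second_countable_topology}, 'n::finite) mfd \<Rightarrow> ('m, 'v::real_vector) calg \<Rightarrow> bool"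
where
  "courant_algebroid M E \<longleftrightarrow>
     vector_bundle M E \<and> fibre_metric M E \<and> anchor_map M E \<and> courant_bracket M E"

definition perp :: "('m, 'v) calg \<Rightarrow> ('m \<Rightarrow> 'v set) \<Rightarrow> 'm \<Rightarrow> 'v set" where
  "perp E V x = {v \<in> fibre E x. \<forall>w\<in>V x. pairing E x v w = 0}"

definition generalized_pseudometric ::
  "('m::{t2_space, second_countable_topology}, 'n::finite) mfd \<Rightarrow> ('m, 'v::real_vector) calg \<Rightarrow>
   ('m \<Rightarrow> 'v set) \<Rightarrow> bool"
where
  "generalized_pseudometric M E V \<longleftrightarrow> subbundle M E V \<and> nondegenerate_on E V"

definition generalized_metric ::
  "('m::{t2_space, second_countable_topology}, 'n::finite) mfd \<Rightarrow> ('m, 'v::real_vector) calg \<Rightarrow>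
   ('m \<Rightarrow> 'v set) \<Rightarrow> bool"
where
  "generalized_metric M E V \<longleftrightarrow> generalized_pseudometric M E V \<and>
     (\<forall>x. \<forall>v\<in>V x. v \<noteq> 0 \<longrightarrow> pairing E x v v > 0) \<and>
     (\<forall>x. \<forall>v\<in>perp E V x. v \<noteq> 0 \<longrightarrow> pairing E x v v < 0)"

definition proj_plus ::
  "('m, 'v::real_vector) calg \<Rightarrow> ('m \<Rightarrow> 'v set) \<Rightarrow> ('m \<Rightarrow> 'v) \<Rightarrow> 'm \<Rightarrow> 'v"
where
  "proj_plus E V u x = (THE w. w \<in> V x \<and> u x - w \<in> perp E V x)"

definition divergence ::
  "('m::{t2_space, second_countable_topology}, 'n::finite) mfd \<Rightarrow> ('m, 'v::real_vector) calg \<Rightarrow>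
   (('m \<Rightarrow> 'v) \<Rightarrow> 'm \<Rightarrow> real) \<Rightarrow> bool"
where
  "divergence M E D \<longleftrightarrow>
     (\<forall>u\<in>sections M E. D u \<in> smooth_functions M) \<and>
     (\<forall>u\<in>sections M E. \<forall>v\<in>sections M E. \<forall>a b.
        D (\<lambda>x. a *\<^sub>R u x + b *\<^sub>R v x) = (\<lambda>x. a * D u x + b * D v x)) \<and>
     (\<forall>u\<in>sections M E. \<forall>f\<in>smooth_functions M.
        D (\<lambda>x. f x *\<^sub>R u x) = (\<lambda>x. f x * D u x + act E u f x))"

definition div_density ::
  "('m::{t2_space, second_countable_topology}, 'n::finite) mfd \<Rightarrow> ('m, 'v::real_vector) calg \<Rightarrow>
   ('m, 'n) dens \<Rightarrow> ('m \<Rightarrow> 'v) \<Rightarrow> 'm \<Rightarrow> real"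
where
  "div_density M E \<mu> u = density_ratio M (lie_density M 1 (rho E u) \<mu>) \<mu>"


section \<open>Laplacian and generalized scalar curvature\<close>

text \<open>
  A local frame around \<open>x\<close> is represented by global sections which restrict to a frame on some
  neighbourhood of \<open>x\<close>; as everything below is local, only the germ at \<open>x\<close> matters, and every
  local frame has the germ of such sections. The indices \<open>a < p\<close> belong to the frame of \<open>V\<close> and
  the indices \<open>p \<le> a < fibre_dim E\<close> to the frame of its orthogonal complement.
\<close>

definition adapted_frame ::
  "('m::{t2_space, second_countable_topology}, 'n::finite) mfd \<Rightarrow> ('m, 'v::real_vector) calg \<Rightarrow>
   ('m \<Rightarrow> 'v set) \<Rightarrow> 'm \<Rightarrow> nat \<Rightarrow> (nat \<Rightarrow> 'm \<Rightarrow> 'v) \<Rightarrow> bool"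
where
  "adapted_frame M E V x p e \<longleftrightarrow>
     p \<le> fibre_dim E \<and> (\<forall>\<alpha><fibre_dim E. e \<alpha> \<in> sections M E) \<and>
     (\<exists>U. open U \<and> x \<in> U \<and>
        (\<forall>y\<in>U. basis_family (V y) {..<p} (\<lambda>a. e a y) \<and>
               basis_family (perp E V y) {p..<fibre_dim E} (\<lambda>a. e a y)) \<and>
        (\<forall>\<alpha><fibre_dim E. \<forall>\<beta><fibre_dim E. \<forall>y\<in>U.
           inner_sec E (e \<alpha>) (e \<beta>) y = inner_sec E (e \<alpha>) (e \<beta>) x))"

text \<open>The inverse \<open>g\<^sup>\<alpha>\<^sup>\<beta>\<close> of the Gram matrix at \<open>x\<close>, which raises indices.\<close>

definition gram_inverse :: "('m, 'v) calg \<Rightarrow> 'm \<Rightarrow> (nat \<Rightarrow> 'm \<Rightarrow> 'v) \<Rightarrow> nat \<Rightarrow> nat \<Rightarrow> real" where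
  "gram_inverse E x e = (SOME h. \<forall>\<alpha><fibre_dim E. \<forall>\<gamma><fibre_dim E.
     (\<Sum>\<beta><fibre_dim E. h \<alpha> \<beta> * inner_sec E (e \<beta>) (e \<gamma>) x) = (if \<alpha> = \<gamma> then 1 else 0))"

definition raised ::
  "('m, 'v::real_vector) calg \<Rightarrow> 'm \<Rightarrow> (nat \<Rightarrow> 'm \<Rightarrow> 'v) \<Rightarrow> nat \<Rightarrow> 'm \<Rightarrow> 'v"
where
  "raised E x e \<alpha> y = (\<Sum>\<beta><fibre_dim E. gram_inverse E x e \<alpha> \<beta> *\<^sub>R e \<beta> y)"

definition c_low :: "('m, 'v) calg \<Rightarrow> 'm \<Rightarrow> (nat \<Rightarrow> 'm \<Rightarrow> 'v) \<Rightarrow> nat \<Rightarrow> nat \<Rightarrow> nat \<Rightarrow> real" where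
  "c_low E x e \<alpha> \<beta> \<gamma> = inner_sec E (e \<alpha>) (bracket E (e \<beta>) (e \<gamma>)) x"

definition c_up :: "('m, 'v) calg \<Rightarrow> 'm \<Rightarrow> (nat \<Rightarrow> 'm \<Rightarrow> 'v) \<Rightarrow> nat \<Rightarrow> nat \<Rightarrow> nat \<Rightarrow> real" where
  "c_up E x e \<alpha> \<beta> \<gamma> = (\<Sum>\<alpha>'<fibre_dim E. \<Sum>\<beta>'<fibre_dim E. \<Sum>\<gamma>'<fibre_dim E.
     gram_inverse E x e \<alpha> \<alpha>' * gram_inverse E x e \<beta> \<beta>' * gram_inverse E x e \<gamma> \<gamma>' *
     c_low E x e \<alpha>' \<beta>' \<gamma>')"

definition laplacian_in_frame ::
  "('m::{t2_space, second_countable_topology}, 'n::finite) mfd \<Rightarrow> ('m, 'v::real_vector) calg \<Rightarrow>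
   nat \<Rightarrow> (nat \<Rightarrow> 'm \<Rightarrow> 'v) \<Rightarrow> ('m, 'n) dens \<Rightarrow> ('m, 'n) dens"
where
  "laplacian_in_frame M E p e \<sigma> k x =
     4 * (\<Sum>a<p. lie_density M (1/2) (rho E (raised E x e a))
                   (lie_density M (1/2) (rho E (e a)) \<sigma>) k x)
     - 1/6 * (\<Sum>a<p. \<Sum>b<p. \<Sum>c<p. c_low E x e a b c * c_up E x e a b c) * \<sigma> k x
     - 1/2 * (\<Sum>a<p. \<Sum>b<p. \<Sum>c\<in>{p..<fibre_dim E}. c_low E x e a b c * c_up E x e a b c) * \<sigma> k x"

definition laplacian ::
  "('m::{t2_space, second_countable_topology}, 'n::finite) mfd \<Rightarrow> ('m, 'v::real_vector) calg \<Rightarrow>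
   ('m \<Rightarrow> 'v set) \<Rightarrow> ('m, 'n) dens \<Rightarrow> ('m, 'n) dens"
where
  "laplacian M E V \<sigma> k x =
     (let (p, e) = (SOME (p, e). adapted_frame M E V x p e) in laplacian_in_frame M E p e \<sigma> k x)"

definition div_difference ::
  "('m::{t2_space, second_countable_topology}, 'n::finite) mfd \<Rightarrow> ('m, 'v::real_vector) calg \<Rightarrow>
   (('m \<Rightarrow> 'v) \<Rightarrow> 'm \<Rightarrow> real) \<Rightarrow> (('m \<Rightarrow> 'v) \<Rightarrow> 'm \<Rightarrow> real) \<Rightarrow> 'm \<Rightarrow> 'v"
where
  "div_difference M E D D' =
     (THE e. e \<in> sections M E \<and> (\<forall>u\<in>sections M E. \<forall>x. D u x - D' u x = inner_sec E e u x))"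

definition scalar_curvature_via ::
  "('m::{t2_space, second_countable_topology}, 'n::finite) mfd \<Rightarrow> ('m, 'v::real_vector) calg \<Rightarrow>
   ('m \<Rightarrow> 'v set) \<Rightarrow> (('m \<Rightarrow> 'v) \<Rightarrow> 'm \<Rightarrow> real) \<Rightarrow> ('m, 'n) dens \<Rightarrow> 'm \<Rightarrow> real"
where
  "scalar_curvature_via M E V D \<sigma> x =
     (let \<mu> = (\<lambda>k y. (\<sigma> k y)\<^sup>2);
          e = div_difference M E D (div_density M E \<mu>);
          ep = proj_plus E V e
      in density_ratio M (laplacian M E V \<sigma>) \<sigma> x + inner_sec E ep ep x
         + 2 * div_density M E \<mu> ep x)"

text \<open>The result does not depend on the choice of the half-density, nor on the choice of frames
  in the Laplacian.\<close>

definition scalar_curvature ::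
  "('m::{t2_space, second_countable_topology}, 'n::finite) mfd \<Rightarrow> ('m, 'v::real_vector) calg \<Rightarrow>
   ('m \<Rightarrow> 'v set) \<Rightarrow> (('m \<Rightarrow> 'v) \<Rightarrow> 'm \<Rightarrow> real) \<Rightarrow> 'm \<Rightarrow> real"
where
  "scalar_curvature M E V D =
     scalar_curvature_via M E V D (SOME \<sigma>. is_density M (1/2) \<sigma> \<and> nonvanishing M \<sigma>)"


section \<open>Pullbacks\<close>

definition ca_pullback ::
  "('k::{t2_space, second_countable_topology}, 'l::finite) mfd \<Rightarrow>
   ('m::{t2_space, second_countable_topology}, 'n::finite) mfd \<Rightarrow> ('k \<Rightarrow> 'm) \<Rightarrow>
   ('m, 'v::real_vector) calg \<Rightarrow> ('k, 'v) calg \<Rightarrow> bool"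
where
  "ca_pullback M' M \<tau> E E' \<longleftrightarrow>
     vbundle.truncate E' = pullback_bundle \<tau> E \<and> courant_algebroid M' E' \<and>
     (\<forall>u\<in>sections M E. \<forall>v\<in>sections M E.
        inner_sec E' (u \<circ> \<tau>) (v \<circ> \<tau>) = inner_sec E u v \<circ> \<tau> \<and>
        bracket E' (u \<circ> \<tau>) (v \<circ> \<tau>) = bracket E u v \<circ> \<tau>) \<and>
     (\<forall>u\<in>sections M E. \<forall>x. \<forall>f\<in>smooth_functions M.
        rho E' (u \<circ> \<tau>) x (f \<circ> \<tau>) = rho E u (\<tau> x) f)"

definition pullback_divergence ::
  "('k::{t2_space, second_countable_topology}, 'l::finite) mfd \<Rightarrow>
   ('m::{t2_space, second_countable_topology}, 'n::finite) mfd \<Rightarrow> ('k \<Rightarrow> 'm) \<Rightarrow>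
   ('m, 'v::real_vector) calg \<Rightarrow> ('k, 'v) calg \<Rightarrow>
   (('m \<Rightarrow> 'v) \<Rightarrow> 'm \<Rightarrow> real) \<Rightarrow> (('k \<Rightarrow> 'v) \<Rightarrow> 'k \<Rightarrow> real) \<Rightarrow> bool"
where
  "pullback_divergence M' M \<tau> E E' D D' \<longleftrightarrow>
     divergence M' E' D' \<and> (\<forall>u\<in>sections M E. D' (u \<circ> \<tau>) = D u \<circ> \<tau>)"

end

theory Submission
  imports Defs
begin

text \<open>
  The scalar curvature is defined through two choices, a half-density and frames, and the choices on
  \<open>M'\<close> have nothing to do with those on \<open>M\<close>. Everything therefore rests on a local formula free of
  choices. For an orthonormal frame \<open>o\<^sub>a\<close> of \<open>V\<close> near \<open>x\<close> let \<open>S(o)\<close> be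
  \<open>\<Sum>\<^sub>a ((D o\<^sub>a)\<^sup>2 + 2 o\<^sub>a \<cdot> (D o\<^sub>a)) - 1/2 \<Sum>\<^sub>a\<^sub>b \<langle>[o\<^sub>a,o\<^sub>b],[o\<^sub>a,o\<^sub>b]\<rangle> + 1/3 \<Sum>\<^sub>a\<^sub>b\<^sub>c \<langle>o\<^sub>c,[o\<^sub>a,o\<^sub>b]\<rangle>\<^sup>2\<close>
  (\<open>frame_curvature\<close>). The scalar curvature at \<open>x\<close> equals \<open>S(o)\<close> for every such frame
  (\<open>scalar_curvature_eq_frame_curvature\<close>). Each ingredient of \<open>S\<close> is compatible with pullback along
  \<open>\<tau>\<close>, and \<open>o\<^sub>a \<circ> \<tau>\<close> is an orthonormal frame of the pulled back subbundle, so that both sides of the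
  theorem are the same number.

  The formula \<open>S\<close> is the classical one with the structure functions that have an index in the
  complement of \<open>V\<close> eliminated: they are totally antisymmetric, so the sum over the complementary index
  is the square of the bracket minus the sum over \<open>V\<close>.

  Independence of the frame (\<open>frame_curvature_invariant_pointed\<close>): two orthonormal frames differ
  by an orthogonal matrix \<open>A\<close> of functions, and after a constant rotation \<open>A = 1\<close> at \<open>x\<close>. With
  \<open>\<theta>\<^sub>c\<^sub>a\<^sub>b = o\<^sub>c \<cdot> A\<^sub>a\<^sub>b\<close>, antisymmetric in \<open>a, b\<close>, the brackets change at \<open>x\<close> by
  \<open>\<Sum>\<^sub>c (\<theta>\<^sub>a\<^sub>b\<^sub>c - \<theta>\<^sub>b\<^sub>a\<^sub>c) o\<^sub>c + d\<^sub>E A\<^sub>a\<^sub>b\<close>. The second derivatives of \<open>A\<close> in the divergence terms are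
  controlled by differentiating \<open>A A\<^sup>T = 1\<close> twice and by the fact that the anchor is a homomorphism
  of brackets (\<open>act_bracket\<close>), and the squares of \<open>d\<^sub>E A\<^sub>a\<^sub>b\<close> vanish because the anchor kills
  \<open>d\<^sub>E\<close> of a pairing (\<open>anchor_dE_inner\<close>). What remains cancels (\<open>frame_change_algebra\<close>).

  Independence of the half-density: in the frame, the Laplacian divided by the half-density is \<open>S\<close>
  for the divergence \<open>D\<^sub>0\<close> of the squared half-density (\<open>laplacian_ratio\<close>), and passing from \<open>D\<^sub>0\<close> to
  \<open>D = D\<^sub>0 + \<langle>e, \<cdot>\<rangle>\<close> adds exactly \<open>\<langle>e\<^sub>+, e\<^sub>+\<rangle> + 2 D\<^sub>0 e\<^sub>+\<close>. For this to make sense, \<open>D\<^sub>0\<close> must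
  not depend on the chart, which is Jacobi's formula for the derivative of a determinant together with
  the symmetry of second derivatives (\<open>chart_div_change\<close>); nowhere vanishing half-densities must exist
  (\<open>nonvanishing_half_density_exists\<close>, a locally finite sum of bump functions); and orthonormal frames by
  global sections must exist (\<open>orthonormal_frame_exists\<close>, Gram-Schmidt and bump functions).
\<close>

section \<open>Calculus in Euclidean space\<close>

lemma has_real_derivative_recentre:
  fixes p :: "real \<Rightarrow> real"
  assumes "((\<lambda>u. p (a + u)) has_real_derivative D) (at 0)"
  shows "(p has_real_derivative D) (at a)"
  using assms DERIV_shift[of p D 0 a] by (simp add: add.commute)

text \<open>The increment is split into one step per coordinate, and the mean value theorem is applied to
  each step; continuity replaces the intermediate derivatives by those at the point. The induction
  runs over the set of coordinates that have already been moved.\<close>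
lemma continuous_partials_imp_has_derivative:
  fixes F :: "real ^ 'n::finite \<Rightarrow> real"
  assumes op: "open \<Omega>" and y: "y \<in> \<Omega>"
    and D: "\<And>i z. z \<in> \<Omega> \<Longrightarrow> ((\<lambda>t. F (z + t *\<^sub>R axis i 1)) has_real_derivative G i z) (at 0)"
    and C: "\<And>i. continuous_on \<Omega> (G i)"
  shows "(F has_derivative (\<lambda>h. \<Sum>i\<in>UNIV. G i y * h $ i)) (at y)"
proof -
  define R :: "'n set \<Rightarrow> real ^ 'n \<Rightarrow> real ^ 'n" where
    "R S h = (\<chi> i. if i \<in> S then h $ i else 0)" for S h
  have normR: "norm (R S h) \<le> norm h" for S h
    unfolding norm_vec_def by (rule L2_set_mono) (auto simp: R_def)
  have key: "\<forall>e>0. \<exists>d>0. \<forall>h. norm h < d \<longrightarrow>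
      \<bar>F (y + R S h) - F y - (\<Sum>i\<in>S. G i y * h $ i)\<bar> \<le> e * norm h" if "finite S" for S
    using that
  proof induction
    case empty
    have "R {} h = 0" for h by (simp add: R_def vec_eq_iff)
    then show ?case by (auto intro!: exI[of _ 1])
  next
    case (insert j S)
    show ?case
    proof (intro allI impI)
      fix e :: real assume "e > 0"
      then obtain d1 where d1: "d1 > 0" "\<And>h. norm h < d1 \<Longrightarrow>
          \<bar>F (y + R S h) - F y - (\<Sum>i\<in>S. G i y * h $ i)\<bar> \<le> e/2 * norm h"
        using insert.IH[rule_format, of "e/2"] by auto
      have "isCont (G j) y" using C[of j] op y by (simp add: continuous_on_eq_continuous_at)
      then obtain d2 where d2: "d2 > 0" "\<And>z. dist z y < d2 \<Longrightarrow> \<bar>G j z - G j y\<bar> < e/2"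
        using \<open>e > 0\<close> unfolding continuous_at_eps_delta dist_real_def by (metis half_gt_zero)
      obtain d3 where d3: "d3 > 0" "ball y d3 \<subseteq> \<Omega>" using op y openE by blast
      show "\<exists>d>0. \<forall>h. norm h < d \<longrightarrow>
          \<bar>F (y + R (insert j S) h) - F y - (\<Sum>i\<in>insert j S. G i y * h $ i)\<bar> \<le> e * norm h"
      proof (intro exI[of _ "min d1 (min d2 d3)"] conjI allI impI)
        show "min d1 (min d2 d3) > 0" using d1 d2 d3 by auto
        fix h :: "real ^ 'n" assume h: "norm h < min d1 (min d2 d3)"
        define t where "t = h $ j"
        have ins: "R (insert j S) h = R S h + t *\<^sub>R axis j 1"
          using insert.hyps by (auto simp: R_def vec_eq_iff axis_def t_def)
        have nrm: "norm (R S h + s *\<^sub>R axis j 1) \<le> norm h" if "\<bar>s\<bar> \<le> \<bar>t\<bar>" for s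
          unfolding norm_vec_def
          by (rule L2_set_mono) (use that insert.hyps in \<open>auto simp: R_def axis_def t_def\<close>)
        let ?p = "\<lambda>s. F (y + R S h + s *\<^sub>R axis j 1)"
        have inO: "y + R S h + s *\<^sub>R axis j 1 \<in> \<Omega>" if "\<bar>s\<bar> \<le> \<bar>t\<bar>" for s
          using nrm[OF that] h d3 by (auto simp: subset_iff dist_norm norm_minus_commute algebra_simps
              intro!: d3(2)[THEN subsetD])
        have der: "(?p has_real_derivative G j (y + R S h + s *\<^sub>R axis j 1)) (at s)" if "\<bar>s\<bar> \<le> \<bar>t\<bar>" for s
        proof -
          have "((\<lambda>u. F ((y + R S h + s *\<^sub>R axis j 1) + u *\<^sub>R axis j 1)) has_real_derivative
              G j (y + R S h + s *\<^sub>R axis j 1)) (at 0)" by (rule D[OF inO[OF that]])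
          then have "((\<lambda>u. ?p (s + u)) has_real_derivative G j (y + R S h + s *\<^sub>R axis j 1)) (at 0)"
            by (simp add: algebra_simps)
          then show ?thesis by (rule has_real_derivative_recentre)
        qed
        have "\<exists>\<xi>. \<bar>\<xi>\<bar> \<le> \<bar>t\<bar> \<and> ?p t - ?p 0 = t * G j (y + R S h + \<xi> *\<^sub>R axis j 1)"
        proof (cases t "0::real" rule: linorder_cases)
          case less
          obtain z where "t < z" "z < 0" "?p 0 - ?p t = (0 - t) * G j (y + R S h + z *\<^sub>R axis j 1)"
            using MVT2[OF less, of ?p "\<lambda>s. G j (y + R S h + s *\<^sub>R axis j 1)"] der less by fastforce
          then show ?thesis by (intro exI[of _ z]) (auto simp: algebra_simps)
        next
          case equal then show ?thesis by auto
        next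
          case greater
          obtain z where "0 < z" "z < t" "?p t - ?p 0 = (t - 0) * G j (y + R S h + z *\<^sub>R axis j 1)"
            using MVT2[OF greater, of ?p "\<lambda>s. G j (y + R S h + s *\<^sub>R axis j 1)"] der greater by fastforce
          then show ?thesis by (intro exI[of _ z]) (auto simp: algebra_simps)
        qed
        then obtain \<xi> where xi: "\<bar>\<xi>\<bar> \<le> \<bar>t\<bar>" "?p t - ?p 0 = t * G j (y + R S h + \<xi> *\<^sub>R axis j 1)" by auto
        have "dist (y + R S h + \<xi> *\<^sub>R axis j 1) y < d2"
          using nrm[OF xi(1)] h by (simp add: dist_norm add.assoc)
        then have g: "\<bar>G j (y + R S h + \<xi> *\<^sub>R axis j 1) - G j y\<bar> \<le> e/2" using d2(2) by fastforce
        have t: "\<bar>t\<bar> \<le> norm h" unfolding t_def using component_le_norm_cart by blast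
        have 1: "\<bar>?p t - ?p 0 - G j y * t\<bar> \<le> e/2 * norm h"
        proof -
          have "\<bar>?p t - ?p 0 - G j y * t\<bar> = \<bar>t\<bar> * \<bar>G j (y + R S h + \<xi> *\<^sub>R axis j 1) - G j y\<bar>"
            unfolding xi(2) by (simp add: abs_mult[symmetric] algebra_simps)
          also have "\<dots> \<le> norm h * (e/2)" using t g by (intro mult_mono) auto
          finally show ?thesis by (simp add: mult.commute)
        qed
        have 2: "\<bar>F (y + R S h) - F y - (\<Sum>i\<in>S. G i y * h $ i)\<bar> \<le> e/2 * norm h" using d1(2) h by auto
        have "F (y + R (insert j S) h) - F y - (\<Sum>i\<in>insert j S. G i y * h $ i)
            = (?p t - ?p 0 - G j y * t) + (F (y + R S h) - F y - (\<Sum>i\<in>S. G i y * h $ i))"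
          using insert.hyps by (simp add: ins t_def add.assoc)
        then show "\<bar>F (y + R (insert j S) h) - F y - (\<Sum>i\<in>insert j S. G i y * h $ i)\<bar> \<le> e * norm h"
          using 1 2 by linarith
      qed
    qed
  qed
  have RU: "R UNIV h = h" for h by (simp add: R_def vec_eq_iff)
  have bl: "bounded_linear (\<lambda>h. \<Sum>i\<in>UNIV. G i y * h $ i)"
    by (intro bounded_linear_sum bounded_linear_const_mult bounded_linear_vec_nth)
  show ?thesis
    unfolding has_derivative_at_alt
  proof (intro conjI bl allI impI)
    fix e :: real assume "e > 0"
    then obtain d where d: "d > 0" "\<And>h. norm h < d \<Longrightarrow>
      \<bar>F (y + R UNIV h) - F y - (\<Sum>i\<in>UNIV. G i y * h $ i)\<bar> \<le> e * norm h"
      using key[of UNIV] by auto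
    show "\<exists>d>0. \<forall>z. norm (z - y) < d \<longrightarrow>
        norm (F z - F y - (\<Sum>i\<in>UNIV. G i y * (z - y) $ i)) \<le> e * norm (z - y)"
      using d(2)[of "z - y" for z] d(1) by (intro exI[of _ d]) (auto simp: RU)
  qed
qed

text \<open>The mixed second difference over a square of side \<open>s\<close> is \<open>s\<^sup>2\<close> times either mixed derivative at
  some point near the corner; continuity and \<open>s \<rightarrow> 0\<close> identify the two.\<close>
lemma mixed_partials_commute:
  fixes F :: "real ^ 'n::finite \<Rightarrow> real"
  assumes op: "open \<Omega>" and y: "y \<in> \<Omega>"
    and D: "\<And>i z. z \<in> \<Omega> \<Longrightarrow> ((\<lambda>t. F (z + t *\<^sub>R axis i 1)) has_real_derivative G i z) (at 0)"
    and D2: "\<And>i j z. z \<in> \<Omega> \<Longrightarrow> ((\<lambda>t. G i (z + t *\<^sub>R axis j 1)) has_real_derivative H i j z) (at 0)"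
    and C: "\<And>i j. continuous_on \<Omega> (H i j)"
  shows "H i j y = H j i y"
proof (rule ccontr)
  assume ne: "H i j y \<noteq> H j i y"
  have *: "\<exists>p. dist p y \<le> 2 * s \<and>
      F (y + s *\<^sub>R axis i 1 + s *\<^sub>R axis j 1) - F (y + s *\<^sub>R axis i 1) - F (y + s *\<^sub>R axis j 1) + F y
      = s * s * H i j p" if s: "s > 0" "cball y (2 * s) \<subseteq> \<Omega>" for s i j
  proof -
    let ?p = "\<lambda>a b. y + a *\<^sub>R axis i 1 + b *\<^sub>R axis j (1::real)"
    have near: "dist (?p a b) y \<le> 2 * s" if "0 \<le> a" "a \<le> s" "0 \<le> b" "b \<le> s" for a b
    proof -
      have "dist (?p a b) y = norm (a *\<^sub>R axis i 1 + b *\<^sub>R axis j (1::real))" by (simp add: dist_norm)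
      also have "\<dots> \<le> norm (a *\<^sub>R axis i (1::real)) + norm (b *\<^sub>R axis j (1::real))" by (rule norm_triangle_ineq)
      also have "\<dots> \<le> 2 * s" using that by simp
      finally show ?thesis .
    qed
    then have inO: "?p a b \<in> \<Omega>" if "0 \<le> a" "a \<le> s" "0 \<le> b" "b \<le> s" for a b
      using that s by (auto simp: subset_iff dist_commute)
    have d1: "((\<lambda>a. F (?p a b)) has_real_derivative G i (?p a b)) (at a)"
      if "0 \<le> a" "a \<le> s" "0 \<le> b" "b \<le> s" for a b
    proof -
      have "((\<lambda>u. F (?p a b + u *\<^sub>R axis i 1)) has_real_derivative G i (?p a b)) (at 0)"
        by (rule D[OF inO[OF that]])
      then have "((\<lambda>u. F (?p (a + u) b)) has_real_derivative G i (?p a b)) (at 0)"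
        by (simp add: algebra_simps)
      then show ?thesis by (rule has_real_derivative_recentre)
    qed
    have d2: "((\<lambda>b. G i (?p a b)) has_real_derivative H i j (?p a b)) (at b)"
      if "0 \<le> a" "a \<le> s" "0 \<le> b" "b \<le> s" for a b
    proof -
      have "((\<lambda>u. G i (?p a b + u *\<^sub>R axis j 1)) has_real_derivative H i j (?p a b)) (at 0)"
        by (rule D2[OF inO[OF that]])
      then have "((\<lambda>u. G i (?p a (b + u))) has_real_derivative H i j (?p a b)) (at 0)"
        by (simp add: algebra_simps)
      then show ?thesis by (rule has_real_derivative_recentre)
    qed
    have "\<exists>z. 0 < z \<and> z < s \<and> (F (?p s s) - F (?p s 0)) - (F (?p 0 s) - F (?p 0 0))
        = (s - 0) * (G i (?p z s) - G i (?p z 0))"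
      using s by (intro MVT2[of 0 s "\<lambda>a. F (?p a s) - F (?p a 0)"]) (auto intro!: DERIV_diff d1[of _ s] d1[of _ 0, simplified])
    then obtain z where z: "0 < z" "z < s" "(F (?p s s) - F (?p s 0)) - (F (?p 0 s) - F (?p 0 0))
        = s * (G i (?p z s) - G i (?p z 0))" by auto
    obtain w where w: "0 < w" "w < s" "G i (?p z s) - G i (?p z 0) = (s - 0) * H i j (?p z w)"
      using MVT2[of 0 s "\<lambda>b. G i (?p z b)" "\<lambda>b. H i j (?p z b)"] d2 s z by auto
    show ?thesis
    proof (intro exI[of _ "?p z w"] conjI)
      show "dist (?p z w) y \<le> 2 * s" using near z w by auto
      show "F (?p s s) - F (y + s *\<^sub>R axis i 1) - F (y + s *\<^sub>R axis j 1) + F y = s * s * H i j (?p z w)"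
        using z(3) w(3) by simp
    qed
  qed
  define e where "e = \<bar>H i j y - H j i y\<bar> / 2"
  have e: "e > 0" using ne by (simp add: e_def)
  have cont: "isCont (H i j) y" for i j using C[of i j] op y by (simp add: continuous_on_eq_continuous_at)
  obtain d1 where d1: "d1 > 0" "\<And>z. dist z y < d1 \<Longrightarrow> \<bar>H i j z - H i j y\<bar> < e"
    using cont[of i j] e unfolding continuous_at_eps_delta dist_real_def by metis
  obtain d2 where d2: "d2 > 0" "\<And>z. dist z y < d2 \<Longrightarrow> \<bar>H j i z - H j i y\<bar> < e"
    using cont[of j i] e unfolding continuous_at_eps_delta dist_real_def by metis
  obtain d3 where d3: "d3 > 0" "cball y d3 \<subseteq> \<Omega>" using op y open_contains_cball by blast
  define s where "s = min d1 (min d2 d3) / 4"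
  have s: "s > 0" "2 * s < d1" "2 * s < d2" "2 * s \<le> d3" using d1 d2 d3 by (auto simp: s_def)
  have sub: "cball y (2 * s) \<subseteq> \<Omega>" using s d3 by (meson order_trans subset_cball)
  obtain p q where p: "dist p y \<le> 2 * s" "F (y + s *\<^sub>R axis i 1 + s *\<^sub>R axis j 1) - F (y + s *\<^sub>R axis i 1) - F (y + s *\<^sub>R axis j 1) + F y
      = s * s * H i j p" and q: "dist q y \<le> 2 * s" "F (y + s *\<^sub>R axis j 1 + s *\<^sub>R axis i 1) - F (y + s *\<^sub>R axis j 1) - F (y + s *\<^sub>R axis i 1) + F y
      = s * s * H j i q" using *[OF s(1) sub] by metis
  have swap: "y + s *\<^sub>R axis j 1 + s *\<^sub>R axis i 1 = y + s *\<^sub>R axis i 1 + s *\<^sub>R axis j 1"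
    by (simp add: algebra_simps)
  have "s * s * H i j p = s * s * H j i q" using p(2) q(2) unfolding swap by linarith
  then have "H i j p = H j i q" using s by simp
  moreover have "\<bar>H i j p - H i j y\<bar> < e" "\<bar>H j i q - H j i y\<bar> < e" using d1 d2 p q s by auto
  ultimately show False unfolding e_def by (simp add: abs_if split: if_splits)
qed

section \<open>Calculus in a chart\<close>

definition is_chart :: "'n::finite set \<Rightarrow> ('m::t2_space, 'n) chart \<Rightarrow> bool" where
  "is_chart I c \<longleftrightarrow> open (fst c) \<and>
     openin (top_of_set {y. \<forall>i. i \<notin> I \<longrightarrow> y $ i = 0}) (snd c ` fst c) \<and>
     (\<exists>\<psi>. homeomorphism (fst c) (snd c ` fst c) (snd c) \<psi>)"

text \<open>Functions on the chart are transported to an open subset of the full space \<open>real ^ 'n\<close> by making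
  them independent of the coordinates outside \<open>I\<close>. There the calculus of several variables
  applies, and the translates along the axes in \<open>I\<close> are the curves \<open>coord_curve\<close>.\<close>

definition coord_proj :: "'n::finite set \<Rightarrow> real ^ 'n \<Rightarrow> real ^ 'n" where
  "coord_proj I y = (\<chi> i. if i \<in> I then y $ i else 0)"

definition chart_point :: "'n::finite set \<Rightarrow> ('m, 'n) chart \<Rightarrow> real ^ 'n \<Rightarrow> 'm" where
  "chart_point I c y = inv_into (fst c) (snd c) (coord_proj I y)"

lemma coord_proj_nth [simp]: "coord_proj I y $ i = (if i \<in> I then y $ i else 0)"
  by (simp add: coord_proj_def)

lemma coord_proj_add_axis: "i \<in> I \<Longrightarrow> coord_proj I (y + t *\<^sub>R axis i 1) = coord_proj I y + t *\<^sub>R axis i 1"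
  "i \<notin> I \<Longrightarrow> coord_proj I (y + t *\<^sub>R axis i 1) = coord_proj I y"
  by (auto simp: vec_eq_iff axis_def)

lemma continuous_coord_proj: "continuous_on S (coord_proj I)"
proof -
  have "continuous_on S (\<lambda>y. y $ i * (if i \<in> I then 1 else 0))" for i
    by (intro continuous_intros)
  moreover have "coord_proj I = (\<lambda>y. \<chi> i. y $ i * (if i \<in> I then 1 else 0))"
    by (auto simp: fun_eq_iff vec_eq_iff)
  ultimately show ?thesis by (simp add: continuous_on_vec_lambda)
qed

definition chart_region :: "'n::finite set \<Rightarrow> ('m, 'n) chart \<Rightarrow> 'm set \<Rightarrow> (real ^ 'n) set" where
  "chart_region I c W = {y. coord_proj I y \<in> snd c ` W}"

context
  fixes I :: "'n::finite set" and c :: "('m::t2_space, 'n) chart"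
  assumes ch: "is_chart I c"
begin

lemma chart_open: "open (fst c)" using ch by (simp add: is_chart_def)

lemma chart_inj: "inj_on (snd c) (fst c)"
  using ch by (auto simp: is_chart_def homeomorphism_def inj_on_def) metis

lemma chart_inv_cont: "continuous_on (snd c ` fst c) (inv_into (fst c) (snd c))"
proof -
  obtain \<psi> where h: "homeomorphism (fst c) (snd c ` fst c) (snd c) \<psi>" using ch by (auto simp: is_chart_def)
  then have "\<psi> y = inv_into (fst c) (snd c) y" if "y \<in> snd c ` fst c" for y
    using that chart_inj by (auto simp: homeomorphism_def)
  moreover have "continuous_on (snd c ` fst c) \<psi>" using h by (simp add: homeomorphism_def)
  ultimately show ?thesis using continuous_on_eq by blast
qed

lemma chart_zero:
  assumes "x \<in> fst c" "i \<notin> I"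
  shows "snd c x $ i = 0"
proof -
  have "openin (top_of_set {y. \<forall>i. i \<notin> I \<longrightarrow> y $ i = 0}) (snd c ` fst c)"
    using ch by (simp add: is_chart_def)
  from openin_imp_subset[OF this] show ?thesis using assms by auto
qed

lemma coord_proj_chart: "x \<in> fst c \<Longrightarrow> coord_proj I (snd c x) = snd c x"
  by (simp add: vec_eq_iff chart_zero)

lemma chart_point_chart: "x \<in> fst c \<Longrightarrow> chart_point I c (snd c x) = x"
  by (simp add: chart_point_def coord_proj_chart chart_inj)

lemma chart_region_self: "x \<in> W \<Longrightarrow> W \<subseteq> fst c \<Longrightarrow> snd c x \<in> chart_region I c W"
  by (auto simp: chart_region_def coord_proj_chart)

lemma chart_point_in: "y \<in> chart_region I c W \<Longrightarrow> W \<subseteq> fst c \<Longrightarrow> chart_point I c y \<in> W"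
  using chart_inj by (auto simp: chart_region_def chart_point_def subset_iff)

lemma chart_chart_point: "y \<in> chart_region I c W \<Longrightarrow> W \<subseteq> fst c \<Longrightarrow> snd c (chart_point I c y) = coord_proj I y"
  using chart_inj by (auto simp: chart_region_def chart_point_def subset_iff)

lemma open_chart_region:
  assumes "open W" "W \<subseteq> fst c"
  shows "open (chart_region I c W)"
proof -
  obtain \<psi> where h: "homeomorphism (fst c) (snd c ` fst c) (snd c) \<psi>" using ch by (auto simp: is_chart_def)
  have "openin (top_of_set (fst c)) W" using assms by (simp add: openin_subset openin_open_eq chart_open)
  then have "openin (top_of_set (snd c ` fst c)) (snd c ` W)" using h homeomorphism_imp_open_map by blast
  then have "openin (top_of_set {y. \<forall>i. i \<notin> I \<longrightarrow> y $ i = 0}) (snd c ` W)"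
    using ch openin_trans by (auto simp: is_chart_def)
  then obtain T where T: "open T" "snd c ` W = {y. \<forall>i. i \<notin> I \<longrightarrow> y $ i = 0} \<inter> T" by (auto simp: openin_open)
  then have "chart_region I c W = coord_proj I -` T" by (auto simp: chart_region_def)
  then show ?thesis using T(1) continuous_coord_proj[of UNIV I] by (simp add: open_vimage)
qed

lemma chart_point_add_axis:
  assumes "y \<in> chart_region I c W" "W \<subseteq> fst c"
  shows "i \<in> I \<Longrightarrow> chart_point I c (y + t *\<^sub>R axis i 1) = coord_curve c i (chart_point I c y) t"
    and "i \<notin> I \<Longrightarrow> chart_point I c (y + t *\<^sub>R axis i 1) = chart_point I c y"
  using chart_chart_point[OF assms]
  by (simp_all add: chart_point_def coord_curve_def coord_proj_add_axis)

lemma continuous_chart_point: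
  assumes "W \<subseteq> fst c"
  shows "continuous_on (chart_region I c W) (chart_point I c)"
  unfolding chart_point_def
  by (rule continuous_on_compose2[OF chart_inv_cont continuous_coord_proj])
    (use assms in \<open>auto simp: chart_region_def\<close>)

lemma coord_curve_0: "x \<in> fst c \<Longrightarrow> coord_curve c i x 0 = x"
  by (simp add: coord_curve_def chart_inj)

lemma eventually_coord_curve_in:
  assumes "open W" "W \<subseteq> fst c" "x \<in> W" "i \<in> I"
  shows "\<forall>\<^sub>F t in nhds 0. coord_curve c i x t \<in> W \<and> snd c (coord_curve c i x t) = snd c x + t *\<^sub>R axis i 1"
proof -
  let ?y = "snd c x"
  have "continuous_on UNIV (\<lambda>t::real. ?y + t *\<^sub>R axis i 1)" by (intro continuous_intros)
  then have "open ((\<lambda>t::real. ?y + t *\<^sub>R axis i 1) -` chart_region I c W)"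
    using open_chart_region[OF assms(1,2)] by (simp add: open_vimage)
  moreover have "0 \<in> (\<lambda>t::real. ?y + t *\<^sub>R axis i 1) -` chart_region I c W"
    using chart_region_self[OF assms(3,2)] by simp
  ultimately have "\<forall>\<^sub>F t in nhds 0. ?y + t *\<^sub>R axis i 1 \<in> chart_region I c W"
    by (auto simp: eventually_nhds)
  then show ?thesis
  proof (rule eventually_mono)
    fix t assume t: "?y + t *\<^sub>R axis i 1 \<in> chart_region I c W"
    have x: "x \<in> fst c" using assms by auto
    have "chart_point I c (?y + t *\<^sub>R axis i 1) = coord_curve c i x t"
      using chart_point_add_axis(1)[OF chart_region_self[OF assms(3,2)] assms(2,4)] chart_point_chart[OF x] by simp
    then show "coord_curve c i x t \<in> W \<and> snd c (coord_curve c i x t) = snd c x + t *\<^sub>R axis i 1"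
      using chart_point_in[OF t assms(2)] chart_chart_point[OF t assms(2)] coord_proj_add_axis(1)[OF assms(4)]
        coord_proj_chart[OF x] by metis
  qed
qed

lemma partial_eqI: "((\<lambda>t. f (coord_curve c i x t)) has_real_derivative D) (at 0) \<Longrightarrow> partial c i f x = D"
  unfolding partial_def by (rule DERIV_imp_deriv)

lemma eventually_coord_curve_eq:
  assumes "open W" "W \<subseteq> fst c" "x \<in> W" "i \<in> I" "\<And>y. y \<in> W \<Longrightarrow> f y = g y"
  shows "\<forall>\<^sub>F t in nhds 0. f (coord_curve c i x t) = g (coord_curve c i x t)"
  using eventually_coord_curve_in[OF assms(1-4)] by eventually_elim (use assms(5) in auto)

lemma partial_cong:
  assumes "open W" "W \<subseteq> fst c" "x \<in> W" "i \<in> I" "\<And>y. y \<in> W \<Longrightarrow> f y = g y"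
  shows "partial c i f x = partial c i g x"
  unfolding partial_def by (rule deriv_cong_ev[OF eventually_coord_curve_eq[OF assms]]) auto

lemma curve_differentiable_cong:
  fixes f g :: "'m \<Rightarrow> real"
  assumes "open W" "W \<subseteq> fst c" "x \<in> W" "i \<in> I" "\<And>y. y \<in> W \<Longrightarrow> f y = g y"
    and "(\<lambda>t. f (coord_curve c i x t)) differentiable (at 0)"
  shows "(\<lambda>t. g (coord_curve c i x t)) differentiable (at 0)"
proof -
  have "((\<lambda>t. f (coord_curve c i x t)) has_real_derivative D) (at 0) \<longleftrightarrow>
    ((\<lambda>t. g (coord_curve c i x t)) has_real_derivative D) (at 0)" for D
    by (rule DERIV_cong_ev[OF refl eventually_coord_curve_eq[OF assms(1-5)] refl])
  then show ?thesis using assms(6) by (simp add: real_differentiable_def)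
qed

lemma Ck_on_cong:
  assumes "open W" "W \<subseteq> fst c" "\<And>y. y \<in> W \<Longrightarrow> f y = g y"
  shows "Ck_on I c W k f \<Longrightarrow> Ck_on I c W k g"
  using assms(3)
proof (induction k arbitrary: f g)
  case 0
  then show ?case using continuous_on_eq[of W f g] by simp
next
  case (Suc k)
  have "continuous_on W g" using Suc.prems continuous_on_eq[of W f g] by simp
  moreover have "(\<lambda>t. g (coord_curve c i x t)) differentiable (at 0)" if "i \<in> I" "x \<in> W" for i x
    using curve_differentiable_cong[OF assms(1,2) that(2,1), of f g] Suc.prems that by auto
  moreover have "Ck_on I c W k (partial c i g)" if "i \<in> I" for i
    using Suc.IH[of "partial c i f" "partial c i g"] Suc.prems that partial_cong[OF assms(1,2) _ that Suc.prems(2)]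
    by auto
  ultimately show ?case by simp
qed

lemma Ck_on_partial:
  assumes "Ck_on I c W (Suc k) f" "x \<in> W" "i \<in> I"
  shows "((\<lambda>t. f (coord_curve c i x t)) has_real_derivative partial c i f x) (at 0)"
  using assms unfolding partial_def by (simp add: DERIV_deriv_iff_real_differentiable)

lemma Ck_on_Suc_iff:
  "Ck_on I c W (Suc k) f \<longleftrightarrow> continuous_on W f \<and> (\<forall>i\<in>I. (\<forall>x\<in>W.
     ((\<lambda>t. f (coord_curve c i x t)) has_real_derivative partial c i f x) (at 0)) \<and> Ck_on I c W k (partial c i f))"
  by (auto simp: partial_def DERIV_deriv_iff_real_differentiable)

text \<open>The values of \<open>partial c i f\<close> away from \<open>W\<close> carry no information, so regularity is deduced from
  any functions \<open>g i\<close> that are the partial derivatives on \<open>W\<close>.\<close>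
lemma Ck_on_SucI:
  assumes "open W" "W \<subseteq> fst c" "continuous_on W f"
    and "\<And>i x. i \<in> I \<Longrightarrow> x \<in> W \<Longrightarrow> ((\<lambda>t. f (coord_curve c i x t)) has_real_derivative g i x) (at 0)"
    and "\<And>i. i \<in> I \<Longrightarrow> Ck_on I c W k (g i)"
  shows "Ck_on I c W (Suc k) f"
proof -
  have eq: "g i x = partial c i f x" if "i \<in> I" "x \<in> W" for i x
    using partial_eqI[OF assms(4)[OF that]] by simp
  have "Ck_on I c W k (partial c i f)" if "i \<in> I" for i
    by (rule Ck_on_cong[OF assms(1,2) _ assms(5)[OF that]]) (use eq that in auto)
  then show ?thesis using assms(3,4) eq by (auto simp: Ck_on_Suc_iff simp del: Ck_on.simps(2))
qed

lemma Ck_on_continuous: "Ck_on I c W k f \<Longrightarrow> continuous_on W f"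
  by (cases k) auto

lemma Ck_on_SucD: "Ck_on I c W (Suc k) f \<Longrightarrow> Ck_on I c W k f"
  by (induction k arbitrary: f) auto

lemma Ck_on_subset: "Ck_on I c W k f \<Longrightarrow> W' \<subseteq> W \<Longrightarrow> Ck_on I c W' k f"
  by (induction k arbitrary: f) (auto intro: continuous_on_subset)

lemma Ck_on_local:
  assumes "\<And>x. x \<in> W \<Longrightarrow> \<exists>U. open U \<and> x \<in> U \<and> Ck_on I c (W \<inter> U) k f" "open W"
  shows "Ck_on I c W k f"
  using assms(1)
proof (induction k arbitrary: f)
  case 0
  show ?case unfolding Ck_on.simps continuous_on_eq_continuous_at[OF assms(2)]
  proof
    fix x assume "x \<in> W"
    with 0 obtain U where "open U" "x \<in> U" "continuous_on (W \<inter> U) f" by force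
    then show "isCont f x" using \<open>x \<in> W\<close> assms(2) by (simp add: continuous_on_eq_continuous_at open_Int)
  qed
next
  case (Suc k)
  have "Ck_on I c W k f" by (rule Suc.IH) (use Suc.prems Ck_on_SucD in blast)
  moreover have "(\<lambda>t. f (coord_curve c i x t)) differentiable (at 0)" if "i \<in> I" "x \<in> W" for i x
    using Suc.prems[OF that(2)] that by auto
  moreover have "Ck_on I c W k (partial c i f)" if "i \<in> I" for i
    by (rule Suc.IH) (use Suc.prems that in fastforce)
  ultimately show ?case by (simp add: Ck_on_continuous)
qed

lemma Ck_on_const: "Ck_on I c W k (\<lambda>x. a)"
proof (induction k arbitrary: a)
  case (Suc k)
  have "partial c i (\<lambda>x. a) = (\<lambda>x. 0)" for i by (simp add: partial_def fun_eq_iff)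
  then show ?case using Suc by simp
qed simp

lemma Ck_on_add:
  assumes "open W" "W \<subseteq> fst c"
  shows "Ck_on I c W k f \<Longrightarrow> Ck_on I c W k g \<Longrightarrow> Ck_on I c W k (\<lambda>x. f x + g x)"
proof (induction k arbitrary: f g)
  case 0 then show ?case by (auto intro: continuous_intros)
next
  case (Suc k)
  note S = Suc.prems[unfolded Ck_on_Suc_iff]
  show ?case
    by (rule Ck_on_SucI[OF assms, where g = "\<lambda>i x. partial c i f x + partial c i g x"])
      (use S Suc.IH in \<open>auto intro!: continuous_intros DERIV_add\<close>)
qed

lemma Ck_on_mult:
  assumes "open W" "W \<subseteq> fst c"
  shows "Ck_on I c W k f \<Longrightarrow> Ck_on I c W k g \<Longrightarrow> Ck_on I c W k (\<lambda>x. f x * g x)"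
proof (induction k arbitrary: f g)
  case 0 then show ?case by (auto intro: continuous_intros)
next
  case (Suc k)
  note S = Suc.prems[unfolded Ck_on_Suc_iff]
  note L = Suc.prems[THEN Ck_on_SucD]
  show ?case
  proof (rule Ck_on_SucI[OF assms, where g = "\<lambda>i x. partial c i f x * g x + partial c i g x * f x"])
    show "continuous_on W (\<lambda>x. f x * g x)" using S by (auto intro: continuous_intros)
    fix i assume i: "i \<in> I"
    show "Ck_on I c W k (\<lambda>x. partial c i f x * g x + partial c i g x * f x)"
      using S i L by (intro Ck_on_add[OF assms] Suc.IH) auto
    fix x assume x: "x \<in> W"
    then have "coord_curve c i x 0 = x" using assms coord_curve_0 by auto
    then show "((\<lambda>t. f (coord_curve c i x t) * g (coord_curve c i x t)) has_real_derivative
       partial c i f x * g x + partial c i g x * f x) (at 0)"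
      using DERIV_mult[of "\<lambda>t. f (coord_curve c i x t)" "partial c i f x" 0 UNIV
          "\<lambda>t. g (coord_curve c i x t)" "partial c i g x"] S i x by auto
  qed
qed

text \<open>The chain rule: a continuously differentiable function is Frechet differentiable in the
  chart, so it can be differentiated along any curve with differentiable coordinates.\<close>
lemma Ck_on_deriv_along:
  assumes "open W" "W \<subseteq> fst c" and f: "Ck_on I c W (Suc k) f"
    and ev: "\<forall>\<^sub>F t in nhds (0::real). \<gamma> t \<in> W"
    and v: "\<And>i. i \<in> I \<Longrightarrow> ((\<lambda>t. snd c (\<gamma> t) $ i) has_real_derivative v i) (at 0)"
  shows "((\<lambda>t. f (\<gamma> t)) has_real_derivative (\<Sum>i\<in>I. partial c i f (\<gamma> 0) * v i)) (at 0)"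
proof -
  define F where "F y = f (chart_point I c y)" for y
  define G where "G i y = (if i \<in> I then partial c i f (chart_point I c y) else 0)" for i y
  let ?O = "chart_region I c W"
  have g0: "\<gamma> 0 \<in> W" using ev eventually_nhds_x_imp_x by blast
  have "(F has_derivative (\<lambda>h. \<Sum>i\<in>UNIV. G i (snd c (\<gamma> 0)) * h $ i)) (at (snd c (\<gamma> 0)))"
  proof (rule continuous_partials_imp_has_derivative[OF open_chart_region[OF assms(1,2)]])
    show "snd c (\<gamma> 0) \<in> ?O" using chart_region_self[OF g0 assms(2)] .
    show "continuous_on ?O (G i)" for i
    proof (cases "i \<in> I")
      case True
      have "continuous_on W (partial c i f)" using f True Ck_on_continuous by auto
      then have "continuous_on ?O (\<lambda>y. partial c i f (chart_point I c y))"
        by (rule continuous_on_compose2[OF _ continuous_chart_point[OF assms(2)]])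
          (use chart_point_in[OF _ assms(2)] in auto)
      then show ?thesis by (simp add: G_def[abs_def] True)
    qed (simp add: G_def[abs_def])
    fix i y assume y: "y \<in> ?O"
    show "((\<lambda>t. F (y + t *\<^sub>R axis i 1)) has_real_derivative G i y) (at 0)"
      using Ck_on_partial[OF f chart_point_in[OF y assms(2)]] chart_point_add_axis[OF y assms(2)]
      by (cases "i \<in> I") (auto simp: F_def G_def)
  qed
  then have FD: "(F has_derivative (\<lambda>h. \<Sum>i\<in>UNIV. G i (snd c (\<gamma> 0)) * h $ i)) (at (snd c (\<gamma> 0)))" .
  have inW: "\<gamma> t \<in> W \<Longrightarrow> \<gamma> t \<in> fst c" for t using assms(2) by auto
  define w where "w = (\<chi> i. if i \<in> I then v i else 0)"
  define \<delta> where "\<delta> t = (\<chi> i. if i \<in> I then snd c (\<gamma> t) $ i else 0)" for t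
  have "((\<lambda>t. \<delta> t $ i) has_derivative (\<lambda>h. (h *\<^sub>R w) $ i)) (at 0)" for i
    using v[of i] by (cases "i \<in> I") (auto simp: \<delta>_def w_def has_field_derivative_def mult_commute_abs)
  then have "(\<delta> has_derivative (\<lambda>h. h *\<^sub>R w)) (at 0)"
    unfolding has_derivative_componentwise_within[of \<delta>] Basis_vec_def
    by (auto simp: cart_eq_inner_axis[symmetric])
  moreover have "\<delta> 0 = snd c (\<gamma> 0)" using inW[OF g0] chart_zero by (auto simp: \<delta>_def vec_eq_iff)
  ultimately have "((\<lambda>t. F (\<delta> t)) has_derivative (\<lambda>h. \<Sum>i\<in>UNIV. G i (snd c (\<gamma> 0)) * (h *\<^sub>R w) $ i)) (at 0)"
    using has_derivative_compose[of \<delta> "\<lambda>h. h *\<^sub>R w" 0 UNIV F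
        "\<lambda>h. \<Sum>i\<in>UNIV. G i (snd c (\<gamma> 0)) * h $ i"] FD by simp
  moreover have "(\<lambda>h. \<Sum>i\<in>UNIV. G i (snd c (\<gamma> 0)) * (h *\<^sub>R w) $ i)
     = (*) (\<Sum>i\<in>I. partial c i f (\<gamma> 0) * v i)"
  proof
    fix h
    have "(\<Sum>i\<in>UNIV. G i (snd c (\<gamma> 0)) * (h *\<^sub>R w) $ i) = (\<Sum>i\<in>I. G i (snd c (\<gamma> 0)) * (h *\<^sub>R w) $ i)"
      by (rule sum.mono_neutral_right) (auto simp: G_def)
    also have "\<dots> = (\<Sum>i\<in>I. partial c i f (\<gamma> 0) * v i) * h"
      unfolding sum_distrib_right by (rule sum.cong)
        (use chart_point_chart[OF inW[OF g0]] in \<open>auto simp: G_def w_def\<close>)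
    finally show "(\<Sum>i\<in>UNIV. G i (snd c (\<gamma> 0)) * (h *\<^sub>R w) $ i) = (\<Sum>i\<in>I. partial c i f (\<gamma> 0) * v i) * h" .
  qed
  ultimately have "((\<lambda>t. F (\<delta> t)) has_real_derivative (\<Sum>i\<in>I. partial c i f (\<gamma> 0) * v i)) (at 0)"
    by (simp add: has_field_derivative_def)
  moreover have "\<forall>\<^sub>F t in nhds 0. F (\<delta> t) = f (\<gamma> t)"
    using ev
  proof eventually_elim
    case (elim t)
    have "\<delta> t = snd c (\<gamma> t)" using inW[OF elim] chart_zero by (auto simp: \<delta>_def vec_eq_iff)
    then show ?case using chart_point_chart[OF inW[OF elim]] by (simp add: F_def)
  qed
  ultimately show ?thesis using DERIV_cong_ev[OF refl, of "\<lambda>t. F (\<delta> t)" "\<lambda>t. f (\<gamma> t)" 0] by blast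
qed

lemma partial_commute:
  assumes "open W" "W \<subseteq> fst c" and f: "Ck_on I c W (Suc (Suc k)) f" and x: "x \<in> W" and ij: "i \<in> I" "j \<in> I"
  shows "partial c i (partial c j f) x = partial c j (partial c i f) x"
proof -
  define F where "F y = f (chart_point I c y)" for y
  define G where "G i y = (if i \<in> I then partial c i f (chart_point I c y) else 0)" for i y
  define H where "H i j y = (if i \<in> I \<and> j \<in> I then partial c j (partial c i f) (chart_point I c y) else 0)" for i j y
  let ?O = "chart_region I c W"
  have xc: "x \<in> fst c" using x assms(2) by auto
  have "H j i (snd c x) = H i j (snd c x)"
  proof (rule mixed_partials_commute[OF open_chart_region[OF assms(1,2)]])
    show "snd c x \<in> ?O" using chart_region_self[OF x assms(2)] .
    show "continuous_on ?O (H i j)" for i j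
    proof (cases "i \<in> I \<and> j \<in> I")
      case True
      have "continuous_on W (partial c j (partial c i f))" using f True Ck_on_continuous[of W k "partial c j (partial c i f)"] by auto
      then have "continuous_on ?O (\<lambda>y. partial c j (partial c i f) (chart_point I c y))"
        by (rule continuous_on_compose2[OF _ continuous_chart_point[OF assms(2)]])
          (use chart_point_in[OF _ assms(2)] in auto)
      then show ?thesis by (simp add: H_def[abs_def] True)
    qed (auto simp: H_def[abs_def])
    fix i y assume y: "y \<in> ?O"
    show "((\<lambda>t. F (y + t *\<^sub>R axis i 1)) has_real_derivative G i y) (at 0)"
      using Ck_on_partial[OF f chart_point_in[OF y assms(2)]] chart_point_add_axis[OF y assms(2)]
      by (cases "i \<in> I") (auto simp: F_def G_def)
    fix j
    show "((\<lambda>t. G i (y + t *\<^sub>R axis j 1)) has_real_derivative H i j y) (at 0)"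
    proof (cases "i \<in> I")
      case True
      then have "Ck_on I c W (Suc k) (partial c i f)" using f by simp
      from Ck_on_partial[OF this chart_point_in[OF y assms(2)], of j] True
      show ?thesis using chart_point_add_axis[OF y assms(2), of j]
        by (cases "j \<in> I") (auto simp: G_def H_def)
    qed (simp add: G_def H_def)
  qed
  then show ?thesis using ij chart_point_chart[OF xc] by (simp add: H_def)
qed

end

text \<open>By the chain rule the partial derivatives of the composite are sums of products of functions to
  which the induction hypothesis applies.\<close>
lemma Ck_on_compose:
  fixes I :: "'n::finite set" and c :: "('m::t2_space, 'n) chart"
    and J :: "'l::finite set" and d :: "('k::t2_space, 'l) chart"
  assumes c: "is_chart I c" and d: "is_chart J d"
    and W: "open W" "W \<subseteq> fst c" and W': "open W'" "W' \<subseteq> fst d" and im: "\<tau> ` W' \<subseteq> W"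
    and cont: "continuous_on W' \<tau>"
    and co: "\<And>i. i \<in> I \<Longrightarrow> Ck_on J d W' k (\<lambda>x. snd c (\<tau> x) $ i)"
  shows "Ck_on I c W k f \<Longrightarrow> Ck_on J d W' k (\<lambda>x. f (\<tau> x))"
  using co
proof (induction k arbitrary: f)
  case 0
  then show ?case using continuous_on_compose2[OF _ cont im] by auto
next
  case (Suc k)
  have der: "((\<lambda>t. f (\<tau> (coord_curve d j x t))) has_real_derivative
      (\<Sum>i\<in>I. partial c i f (\<tau> x) * partial d j (\<lambda>x. snd c (\<tau> x) $ i) x)) (at 0)"
    if j: "j \<in> J" and x: "x \<in> W'" for j x
  proof -
    have "\<forall>\<^sub>F t in nhds 0. \<tau> (coord_curve d j x t) \<in> W"
      using eventually_coord_curve_in[OF d W' x j] by eventually_elim (use im in auto)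
    moreover have "((\<lambda>t. snd c (\<tau> (coord_curve d j x t)) $ i) has_real_derivative
        partial d j (\<lambda>x. snd c (\<tau> x) $ i) x) (at 0)" if "i \<in> I" for i
      using Ck_on_partial[OF d Suc.prems(2)[OF that] x j] .
    ultimately show ?thesis using Ck_on_deriv_along[OF c W Suc.prems(1)] coord_curve_0[OF d, of x j] W' x by fastforce
  qed
  show ?case
  proof (rule Ck_on_SucI[OF d W' _ der])
    show "continuous_on W' (\<lambda>x. f (\<tau> x))"
      using continuous_on_compose2[OF Ck_on_continuous[OF c Suc.prems(1)] cont im] .
    fix j assume j: "j \<in> J"
    have "Ck_on J d W' k (\<lambda>x. partial c i f (\<tau> x) * partial d j (\<lambda>x. snd c (\<tau> x) $ i) x)" if i: "i \<in> I" for i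
    proof (rule Ck_on_mult[OF d W' Suc.IH])
      show "Ck_on I c W k (partial c i f)" using Suc.prems(1) i by simp
      show "Ck_on J d W' k (\<lambda>x. snd c (\<tau> x) $ i)" if "i \<in> I" for i using Suc.prems(2)[OF that] Ck_on_SucD[OF d] by blast
      show "Ck_on J d W' k (partial d j (\<lambda>x. snd c (\<tau> x) $ i))" using Suc.prems(2)[OF i] j by simp
    qed
    moreover have "finite S \<Longrightarrow> (\<And>i. i \<in> S \<Longrightarrow> Ck_on J d W' k (g i)) \<Longrightarrow> Ck_on J d W' k (\<lambda>x. \<Sum>i\<in>S. g i x)" for g and S :: "'n set"
      by (induction S rule: finite_induct) (auto intro: Ck_on_const[OF d] Ck_on_add[OF d W'])
    ultimately show "Ck_on J d W' k (\<lambda>x. \<Sum>i\<in>I. partial c i f (\<tau> x) * partial d j (\<lambda>x. snd c (\<tau> x) $ i) x)"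
      by simp
  qed
qed

text \<open>The sequence \<open>H\<close> of successive derivatives is part of the data, which makes the set of these
  functions visibly closed under differentiation.\<close>
definition real_smooth :: "real set \<Rightarrow> (real \<Rightarrow> real) \<Rightarrow> bool" where
  "real_smooth S h \<longleftrightarrow> (\<exists>H. H (0::nat) = h \<and> (\<forall>k. \<forall>t\<in>S. (H k has_real_derivative H (Suc k) t) (at t)))"

lemma Ck_on_real_compose:
  fixes I :: "'n::finite set" and c :: "('m::t2_space, 'n) chart"
  assumes c: "is_chart I c" and W: "open W" "W \<subseteq> fst c" and im: "f ` W \<subseteq> S"
    and h: "real_smooth S h"
  shows "Ck_on I c W k f \<Longrightarrow> Ck_on I c W k (\<lambda>x. h (f x))"
proof -
  obtain H where H: "H (0::nat) = h" "\<And>k t. t \<in> S \<Longrightarrow> (H k has_real_derivative H (Suc k) t) (at t)"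
    using h by (auto simp: real_smooth_def)
  have cont: "continuous_on S (H l)" for l
    using H(2) by (meson DERIV_isCont continuous_at_imp_continuous_on)
  have "Ck_on I c W k f \<Longrightarrow> Ck_on I c W k (\<lambda>x. H l (f x))" for l
  proof (induction k arbitrary: l)
    case 0
    then show ?case using continuous_on_compose2[OF cont _ im] by auto
  next
    case (Suc k)
    show ?case
    proof (rule Ck_on_SucI[OF c W, where g = "\<lambda>i x. H (Suc l) (f x) * partial c i f x"])
      show "continuous_on W (\<lambda>x. H l (f x))"
        using continuous_on_compose2[OF cont _ im] Ck_on_continuous[OF c Suc.prems] by auto
      fix i assume i: "i \<in> I"
      show "Ck_on I c W k (\<lambda>x. H (Suc l) (f x) * partial c i f x)"
        using Suc.IH[of "Suc l"] Suc.prems Ck_on_SucD[OF c Suc.prems] i by (auto intro!: Ck_on_mult[OF c W])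
      fix x assume x: "x \<in> W"
      have z: "coord_curve c i x 0 = x" using x W coord_curve_0[OF c] by auto
      show "((\<lambda>t. H l (f (coord_curve c i x t))) has_real_derivative H (Suc l) (f x) * partial c i f x) (at 0)"
        by (rule DERIV_chain2[of "H l"]) (use z H(2) im x Ck_on_partial[OF c Suc.prems x i] in auto)
    qed
  qed
  from this[of 0] show "Ck_on I c W k f \<Longrightarrow> Ck_on I c W k (\<lambda>x. h (f x))" by (simp add: H(1))
qed

section \<open>Smooth functions on manifolds\<close>

lemma smooth_map_continuous: "smooth_map M' M \<tau> \<Longrightarrow> continuous_on S \<tau>"
  unfolding smooth_map_def by (meson continuous_on_subset subset_UNIV)

context
  fixes M :: "('m::{t2_space, second_countable_topology}, 'n::finite) mfd"
  assumes mfd: "manifold M"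
begin

lemma atlas_chart:
  assumes "c \<in> atlas M" shows "is_chart (coords M) c"
proof -
  have "open (fst c) \<and>
        openin (top_of_set {y. \<forall>i. i \<notin> coords M \<longrightarrow> y $ i = 0}) (snd c ` fst c) \<and>
        (\<exists>\<psi>. homeomorphism (fst c) (snd c ` fst c) (snd c) \<psi>)"
    using mfd assms unfolding manifold_def by (cases c) fastforce
  then show ?thesis by (simp add: is_chart_def)
qed

lemma atlas_cover: obtains c where "c \<in> atlas M" "x \<in> fst c"
proof -
  have "x \<in> (\<Union>c\<in>atlas M. fst c)" using mfd by (simp add: manifold_def)
  then show thesis using that by blast
qed

lemma atlas_open: "c \<in> atlas M \<Longrightarrow> open (fst c)"
  using atlas_chart chart_open by blast

lemma smooth_coord:
  assumes "c \<in> atlas M" shows "smooth_on M (fst c) (\<lambda>x. snd c x $ i)"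
proof (cases "i \<in> coords M")
  case True
  have "\<forall>c\<in>atlas M. \<forall>d\<in>atlas M. \<forall>i\<in>coords M.
        smooth_in_chart (coords M) c (fst c \<inter> fst d) (\<lambda>x. snd d x $ i)"
    using mfd by (simp add: manifold_def)
  then show ?thesis using assms True by (simp add: smooth_on_def Int_commute[of "fst c"])
next
  case False
  have "smooth_in_chart (coords M) d (fst c \<inter> fst d) (\<lambda>x. snd c x $ i)" if d: "d \<in> atlas M" for d
    unfolding smooth_in_chart_def
  proof
    fix k
    have "open (fst c \<inter> fst d)" by (intro open_Int atlas_open assms d)
    then show "Ck_on (coords M) d (fst c \<inter> fst d) k (\<lambda>x. snd c x $ i)"
      by (rule Ck_on_cong[OF atlas_chart[OF d] _ _ _ Ck_on_const[OF atlas_chart[OF d], of _ _ 0]])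
        (use chart_zero[OF atlas_chart[OF assms] _ False] in auto)
  qed
  then show ?thesis by (simp add: smooth_on_def)
qed

lemma smooth_on_Ck: "smooth_on M W f \<Longrightarrow> c \<in> atlas M \<Longrightarrow> Ck_on (coords M) c (W \<inter> fst c) k f"
  by (auto simp: smooth_on_def smooth_in_chart_def)

lemma smooth_on_subset: "smooth_on M W f \<Longrightarrow> W' \<subseteq> W \<Longrightarrow> smooth_on M W' f"
  unfolding smooth_on_def smooth_in_chart_def
  by (meson Ck_on_subset atlas_chart Int_mono order_refl)

lemma smooth_on_cong:
  assumes "smooth_on M W f" "open W" "\<And>x. x \<in> W \<Longrightarrow> f x = g x"
  shows "smooth_on M W g"
  unfolding smooth_on_def smooth_in_chart_def
proof (intro ballI allI)
  fix c k assume c: "c \<in> atlas M"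
  show "Ck_on (coords M) c (W \<inter> fst c) k g"
    by (rule Ck_on_cong[OF atlas_chart[OF c] _ _ _ smooth_on_Ck[OF assms(1) c]])
      (use assms atlas_open[OF c] in auto)
qed

lemma smooth_on_local:
  assumes "open W" "\<And>x. x \<in> W \<Longrightarrow> \<exists>U. open U \<and> x \<in> U \<and> smooth_on M (W \<inter> U) f"
  shows "smooth_on M W f"
  unfolding smooth_on_def smooth_in_chart_def
proof (intro ballI allI)
  fix c k assume c: "c \<in> atlas M"
  show "Ck_on (coords M) c (W \<inter> fst c) k f"
  proof (rule Ck_on_local[OF atlas_chart[OF c]])
    show "open (W \<inter> fst c)" using assms(1) atlas_open[OF c] by auto
    fix x assume "x \<in> W \<inter> fst c"
    then obtain U where U: "open U" "x \<in> U" "smooth_on M (W \<inter> U) f" using assms(2) by auto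
    have "Ck_on (coords M) c (W \<inter> fst c \<inter> U) k f" using smooth_on_Ck[OF U(3) c, of k] by (simp add: Int_ac)
    then show "\<exists>U. open U \<and> x \<in> U \<and> Ck_on (coords M) c (W \<inter> fst c \<inter> U) k f" using U by auto
  qed
qed

lemma smooth_on_continuous:
  assumes "smooth_on M W f" "open W" shows "continuous_on W f"
proof -
  have "isCont f x" if x: "x \<in> W" for x
  proof -
    obtain c where c: "c \<in> atlas M" "x \<in> fst c" using atlas_cover by blast
    have "continuous_on (W \<inter> fst c) f" using smooth_on_Ck[OF assms(1) c(1), of 0] by simp
    then show ?thesis using c x assms(2) atlas_open[OF c(1)]
      by (simp add: continuous_on_eq_continuous_at open_Int)
  qed
  then show ?thesis by (simp add: continuous_at_imp_continuous_on)
qed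

lemma smooth_on_const: "smooth_on M W (\<lambda>x. a)"
  unfolding smooth_on_def smooth_in_chart_def using Ck_on_const[OF atlas_chart] by blast

lemma smooth_on_add: "open W \<Longrightarrow> smooth_on M W f \<Longrightarrow> smooth_on M W g \<Longrightarrow> smooth_on M W (\<lambda>x. f x + g x)"
  unfolding smooth_on_def smooth_in_chart_def
  by (intro ballI allI Ck_on_add[OF atlas_chart]) (auto intro: atlas_open)

lemma smooth_on_mult: "open W \<Longrightarrow> smooth_on M W f \<Longrightarrow> smooth_on M W g \<Longrightarrow> smooth_on M W (\<lambda>x. f x * g x)"
  unfolding smooth_on_def smooth_in_chart_def
  by (intro ballI allI Ck_on_mult[OF atlas_chart]) (auto intro: atlas_open)

lemma smooth_on_minus: "open W \<Longrightarrow> smooth_on M W f \<Longrightarrow> smooth_on M W (\<lambda>x. - f x)"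
  using smooth_on_mult[OF _ smooth_on_const[of W "-1"], of f] by simp

lemma smooth_on_diff: "open W \<Longrightarrow> smooth_on M W f \<Longrightarrow> smooth_on M W g \<Longrightarrow> smooth_on M W (\<lambda>x. f x - g x)"
  using smooth_on_add[OF _ _ smooth_on_minus, of W f g] by simp

lemma smooth_on_sum: "open W \<Longrightarrow> (\<And>i. i \<in> S \<Longrightarrow> smooth_on M W (f i)) \<Longrightarrow> smooth_on M W (\<lambda>x. \<Sum>i\<in>S. f i x)"
  by (induction S rule: infinite_finite_induct) (auto intro: smooth_on_const smooth_on_add)

lemma smooth_on_prod: "open W \<Longrightarrow> (\<And>i. i \<in> S \<Longrightarrow> smooth_on M W (f i)) \<Longrightarrow> smooth_on M W (\<lambda>x. \<Prod>i\<in>S. f i x)"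
  by (induction S rule: infinite_finite_induct) (auto intro: smooth_on_const smooth_on_mult)

lemma smooth_on_real_compose:
  assumes "open W" "smooth_on M W f" "real_smooth S h" "f ` W \<subseteq> S"
  shows "smooth_on M W (\<lambda>x. h (f x))"
  unfolding smooth_on_def smooth_in_chart_def
proof (intro ballI allI)
  fix c k assume c: "c \<in> atlas M"
  show "Ck_on (coords M) c (W \<inter> fst c) k (\<lambda>x. h (f x))"
    by (rule Ck_on_real_compose[OF atlas_chart[OF c] _ _ _ assms(3) smooth_on_Ck[OF assms(2) c]])
      (use assms atlas_open[OF c] in auto)
qed

text \<open>The identity map has smooth coordinates with respect to any two charts, so composing with it
  carries regularity from one chart to all others.\<close>
lemma smooth_on_chartI:
  assumes c: "c \<in> atlas M" and W: "open W" "W \<subseteq> fst c" and f: "\<And>k. Ck_on (coords M) c W k f"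
  shows "smooth_on M W f"
  unfolding smooth_on_def smooth_in_chart_def
proof (intro ballI allI)
  fix d k assume d: "d \<in> atlas M"
  have o: "open (W \<inter> fst d)" using W atlas_open[OF d] by auto
  have "Ck_on (coords M) d (W \<inter> fst d) k (\<lambda>x. f (id x))"
  proof (rule Ck_on_compose[OF atlas_chart[OF c] atlas_chart[OF d] W o _ _ _ _ f])
    fix i assume "i \<in> coords M"
    show "Ck_on (coords M) d (W \<inter> fst d) k (\<lambda>x. snd c (id x) $ i)"
      using smooth_on_Ck[OF smooth_on_subset[OF smooth_coord[OF c]] d, of W k] W by simp
  qed auto
  then show "Ck_on (coords M) d (W \<inter> fst d) k f" by simp
qed

lemma smooth_on_partial:
  assumes "smooth_on M W f" "open W" "W \<subseteq> fst c" "c \<in> atlas M" "i \<in> coords M"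
  shows "smooth_on M W (partial c i f)"
proof (rule smooth_on_chartI[OF assms(4,2,3)])
  fix k
  have "W \<inter> fst c = W" using assms(3) by auto
  then show "Ck_on (coords M) c W k (partial c i f)" using smooth_on_Ck[OF assms(1,4), of "Suc k"] assms(5) by simp
qed

lemma smooth_on_curve:
  assumes "smooth_on M W f" "open W" "x \<in> W" "x \<in> fst c" "c \<in> atlas M" "i \<in> coords M"
  shows "((\<lambda>t. f (coord_curve c i x t)) has_real_derivative partial c i f x) (at 0)"
  using Ck_on_partial[OF atlas_chart[OF assms(5)] smooth_on_Ck[OF assms(1,5), of "Suc 0"] _ assms(6)] assms by auto

lemma partial_eq_near:
  assumes "open W" "x \<in> W" "x \<in> fst c" "c \<in> atlas M" "i \<in> coords M" "\<And>y. y \<in> W \<Longrightarrow> f y = g y"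
  shows "partial c i f x = partial c i g x"
  by (rule partial_cong[OF atlas_chart[OF assms(4)], of "W \<inter> fst c"]) (use assms atlas_open[OF assms(4)] in auto)

context
  fixes c x i W
  assumes c: "c \<in> atlas M" and x: "x \<in> fst c" "x \<in> W" and i: "i \<in> coords M" and W: "open W"
begin

lemma partial_const: "partial c i (\<lambda>x. a) x = 0"
  by (simp add: partial_def)

lemma partial_add:
  assumes "smooth_on M W f" "smooth_on M W g"
  shows "partial c i (\<lambda>x. f x + g x) x = partial c i f x + partial c i g x"
  using smooth_on_curve[OF assms(1) W x(2,1) c i] smooth_on_curve[OF assms(2) W x(2,1) c i]
  by (auto intro!: partial_eqI[OF atlas_chart[OF c]] DERIV_add)

lemma partial_mult:
  assumes "smooth_on M W f" "smooth_on M W g"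
  shows "partial c i (\<lambda>x. f x * g x) x = partial c i f x * g x + f x * partial c i g x"
proof (rule partial_eqI[OF atlas_chart[OF c]])
  show "((\<lambda>t. f (coord_curve c i x t) * g (coord_curve c i x t)) has_real_derivative
    partial c i f x * g x + f x * partial c i g x) (at 0)"
    using DERIV_mult[OF smooth_on_curve[OF assms(1) W x(2,1) c i] smooth_on_curve[OF assms(2) W x(2,1) c i]]
      coord_curve_0[OF atlas_chart[OF c] x(1)] by (simp add: algebra_simps)
qed

lemma partial_sum:
  assumes "\<And>j. j \<in> S \<Longrightarrow> smooth_on M W (f j)"
  shows "partial c i (\<lambda>x. \<Sum>j\<in>S. f j x) x = (\<Sum>j\<in>S. partial c i (f j) x)"
  using assms
proof (induction S rule: infinite_finite_induct)
  case (insert j S)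
  then show ?case using partial_add[of "f j" "\<lambda>x. \<Sum>j\<in>S. f j x"] smooth_on_sum[OF W, of S f] by simp
qed (simp_all add: partial_const)

lemma partial_coord: "partial c i (\<lambda>x. snd c x $ j) x = (if i = j then 1 else 0)"
proof (rule partial_eqI[OF atlas_chart[OF c]])
  have ev: "\<forall>\<^sub>F t in nhds 0. snd c (coord_curve c i x t) $ j = snd c x $ j + t * (if i = j then 1 else 0)"
    using eventually_coord_curve_in[OF atlas_chart[OF c] atlas_open[OF c] order_refl x(1) i]
    by eventually_elim (simp add: axis_def)
  moreover have "((\<lambda>t. snd c x $ j + t * (if i = j then 1 else 0)) has_real_derivative (if i = j then 1 else 0)) (at 0)"
    by (auto intro!: derivative_eq_intros)
  ultimately show "((\<lambda>t. snd c (coord_curve c i x t) $ j) has_real_derivative (if i = j then 1 else 0)) (at 0)"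
    using DERIV_cong_ev[OF refl ev refl] by blast
qed

lemma partial_chain:
  assumes "smooth_on M W f" and d: "d \<in> atlas M" "x \<in> fst d"
  shows "partial c i f x = (\<Sum>j\<in>coords M. partial d j f x * partial c i (\<lambda>y. snd d y $ j) x)"
proof (rule partial_eqI[OF atlas_chart[OF c]])
  have z: "coord_curve c i x 0 = x" using coord_curve_0[OF atlas_chart[OF c] x(1)] .
  have "((\<lambda>t. f (coord_curve c i x t)) has_real_derivative
     (\<Sum>j\<in>coords M. partial d j f (coord_curve c i x 0) * partial c i (\<lambda>y. snd d y $ j) x)) (at 0)"
  proof (rule Ck_on_deriv_along[OF atlas_chart[OF d(1)]])
    show "open (W \<inter> fst d)" "W \<inter> fst d \<subseteq> fst d" using W atlas_open[OF d(1)] by auto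
    show "Ck_on (coords M) d (W \<inter> fst d) (Suc 0) f" using smooth_on_Ck[OF assms(1) d(1)] .
    have "open (W \<inter> fst d \<inter> fst c)" using W atlas_open[OF d(1)] atlas_open[OF c] by auto
    from eventually_coord_curve_in[OF atlas_chart[OF c] this _ _ i, of x]
    show "\<forall>\<^sub>F t in nhds 0. coord_curve c i x t \<in> W \<inter> fst d"
      using x d by (auto elim: eventually_mono)
    show "((\<lambda>t. snd d (coord_curve c i x t) $ j) has_real_derivative partial c i (\<lambda>y. snd d y $ j) x) (at 0)" for j
      by (rule smooth_on_curve[OF smooth_coord[OF d(1)] atlas_open[OF d(1)] d(2) x(1) c i])
  qed
  then show "((\<lambda>t. f (coord_curve c i x t)) has_real_derivative
     (\<Sum>j\<in>coords M. partial d j f x * partial c i (\<lambda>y. snd d y $ j) x)) (at 0)" by (simp add: z)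
qed

lemma partial_partial_commute:
  assumes "smooth_on M W f" "j \<in> coords M"
  shows "partial c i (partial c j f) x = partial c j (partial c i f) x"
  by (rule partial_commute[OF atlas_chart[OF c] _ _ smooth_on_Ck[OF assms(1) c, of "Suc (Suc 0)"]])
    (use assms x i W atlas_open[OF c] in auto)

end

end

lemma smooth_on_compose:
  assumes M: "manifold M" and M': "manifold M'" and \<tau>: "smooth_map M' M \<tau>"
    and W: "open W" and f: "smooth_on M W f"
  shows "smooth_on M' (\<tau> -` W) (\<lambda>x. f (\<tau> x))"
proof -
  have cont: "continuous_on S \<tau>" for S by (rule smooth_map_continuous[OF \<tau>])
  then have op: "open (\<tau> -` U)" if "open U" for U using that by (simp add: open_vimage)
  show ?thesis
  proof (rule smooth_on_local[OF M' op[OF W]])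
    fix x assume x: "x \<in> \<tau> -` W"
    obtain c where c: "c \<in> atlas M" "\<tau> x \<in> fst c" using atlas_cover[OF M] by blast
    have "smooth_on M' (\<tau> -` W \<inter> \<tau> -` fst c) (\<lambda>x. f (\<tau> x))"
      unfolding smooth_on_def smooth_in_chart_def
    proof (intro ballI allI)
      fix d k assume d: "d \<in> atlas M'"
      show "Ck_on (coords M') d (\<tau> -` W \<inter> \<tau> -` fst c \<inter> fst d) k (\<lambda>x. f (\<tau> x))"
      proof (rule Ck_on_compose[OF atlas_chart[OF M c(1)] atlas_chart[OF M' d] _ _ _ _ _ _ _ smooth_on_Ck[OF M f c(1)]])
        show "open (\<tau> -` W \<inter> \<tau> -` fst c \<inter> fst d)"
          using op W atlas_open[OF M c(1)] atlas_open[OF M' d] by auto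
        fix i assume "i \<in> coords M"
        then have "smooth_on M' (\<tau> -` fst c) (\<lambda>x. snd c (\<tau> x) $ i)"
          using \<tau> c(1) by (auto simp: smooth_map_def)
        then show "Ck_on (coords M') d (\<tau> -` W \<inter> \<tau> -` fst c \<inter> fst d) k (\<lambda>x. snd c (\<tau> x) $ i)"
          using smooth_on_Ck[OF M' _ d] Ck_on_subset[OF atlas_chart[OF M' d]] by (meson Int_mono inf_le2 order_refl)
      qed (use W atlas_open[OF M c(1)] cont in auto)
    qed
    then show "\<exists>U. open U \<and> x \<in> U \<and> smooth_on M' (\<tau> -` W \<inter> U) (\<lambda>x. f (\<tau> x))"
      using op[OF atlas_open[OF M c(1)]] c(2) by blast
  qed
qed

section \<open>Bump functions\<close>

lemma real_smooth_powr: "real_smooth {0<..} (\<lambda>t. t powr s)"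
proof -
  define H where "H k t = (\<Prod>j<k. s - real j) * t powr (s - real k)" for k :: nat and t :: real
  have "(H k has_real_derivative H (Suc k) t) (at t)" if "t > 0" for k t
    unfolding H_def using that
    by (auto intro!: derivative_eq_intros simp: algebra_simps)
  moreover have "H 0 = (\<lambda>t. t powr s)" by (simp add: H_def fun_eq_iff)
  ultimately show ?thesis unfolding real_smooth_def by (intro exI[of _ H]) auto
qed

definition flat :: "real \<Rightarrow> real" where "flat t = (if t > 0 then exp (- (1 / t)) else 0)"

text \<open>The power \<open>s ^ n\<close> makes the induction over the coefficients of \<open>p\<close> go through.\<close>
lemma poly_exp_tendsto_0: "((\<lambda>s. s ^ n * poly p s * exp (- s)) \<longlongrightarrow> (0::real)) at_top"
proof (induction p arbitrary: n)
  case 0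
  then show ?case by simp
next
  case (pCons a p)
  have "((\<lambda>s. a * (s ^ n / exp s) + s ^ Suc n * poly p s * exp (- s)) \<longlongrightarrow> a * 0 + 0) at_top"
    by (intro tendsto_intros tendsto_power_div_exp_0 pCons.IH)
  then show ?case by (simp add: exp_minus field_simps)
qed

text \<open>All derivatives have the form \<open>P(1/t) exp (-1/t)\<close> for positive \<open>t\<close>, with a polynomial \<open>P\<close> obtained by
  a recursion, and tend to \<open>0\<close> faster than any power of \<open>t\<close>.\<close>
lemma real_smooth_flat: "real_smooth UNIV flat"
proof -
  define p where "p = rec_nat 1 (\<lambda>_ q. [:0, 0, 1:] * (q - pderiv q) :: real poly)"
  have p0: "p 0 = 1" and pS: "p (Suc k) = [:0, 0, 1:] * (p k - pderiv (p k))" for k by (simp_all add: p_def)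
  define H where "H k t = (if t > 0 then poly (p k) (1 / t) * exp (- (1 / t)) else 0)" for k :: nat and t :: real
  have "(H k has_real_derivative H (Suc k) t) (at t)" for k t
  proof (cases t "0::real" rule: linorder_cases)
    case less
    have "((\<lambda>t. 0) has_real_derivative H (Suc k) t) (at t)" using less by (simp add: H_def)
    moreover have "\<forall>\<^sub>F u in nhds t. 0 = H k u"
      by (rule eventually_nhds[THEN iffD2]) (use less in \<open>auto intro!: exI[of _ "{..<0}"] simp: H_def\<close>)
    ultimately show ?thesis using DERIV_cong_ev[OF refl, of "\<lambda>_. 0" "H k" t] by blast
  next
    case greater
    have "((\<lambda>t. poly (p k) (1 / t) * exp (- (1 / t))) has_real_derivative H (Suc k) t) (at t)"
      using greater by (auto intro!: derivative_eq_intros simp: H_def pS field_simps power2_eq_square)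
    moreover have "\<forall>\<^sub>F u in nhds t. poly (p k) (1 / u) * exp (- (1 / u)) = H k u"
      by (rule eventually_nhds[THEN iffD2]) (use greater in \<open>auto intro!: exI[of _ "{0<..}"] simp: H_def\<close>)
    ultimately show ?thesis using DERIV_cong_ev[OF refl, of "\<lambda>t. poly (p k) (1 / t) * exp (- (1 / t))" "H k" t] by blast
  next
    case equal
    have R: "((\<lambda>h. H k h / h) \<longlongrightarrow> 0) (at_right 0)"
    proof -
      have "((\<lambda>h. (inverse h) ^ 1 * poly (p k) (inverse h) * exp (- inverse h)) \<longlongrightarrow> 0) (at_right (0::real))"
        by (rule filterlim_compose[OF poly_exp_tendsto_0 filterlim_inverse_at_top_right])
      moreover have "\<forall>\<^sub>F h in at_right 0. (inverse h) ^ 1 * poly (p k) (inverse h) * exp (- inverse h) = H k h / (h::real)"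
        by (auto simp: eventually_at_filter H_def field_simps)
      ultimately show ?thesis by (rule Lim_transform_eventually)
    qed
    have L: "((\<lambda>h. H k h / h) \<longlongrightarrow> 0) (at_left 0)"
    proof -
      have "\<forall>\<^sub>F h in at_left 0. 0 = H k h / (h::real)" by (auto simp: eventually_at_filter H_def)
      then show ?thesis by (rule Lim_transform_eventually[OF tendsto_const])
    qed
    have "((\<lambda>h. H k h / h) \<longlongrightarrow> 0) (at 0)" using filterlim_split_at[OF L R] .
    then show ?thesis using equal by (simp add: DERIV_def H_def[of k 0] H_def[of "Suc k" 0])
  qed
  moreover have "H 0 = flat" by (simp add: H_def flat_def p0 fun_eq_iff)
  ultimately show ?thesis unfolding real_smooth_def by (intro exI[of _ H]) auto
qed

lemma flat_pos [simp]: "flat t > 0 \<longleftrightarrow> t > 0" and flat_nonneg: "flat t \<ge> 0" and flat_eq_0 [simp]: "flat t = 0 \<longleftrightarrow> t \<le> 0"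
  by (auto simp: flat_def)

context
  fixes M :: "('m::{t2_space, second_countable_topology}, 'n::finite) mfd"
  assumes mfd: "manifold M"
begin

text \<open>Since \<open>f * f\<close> is positive, its power with exponent \<open>-1\<close> is smooth, and \<open>1/f = f / (f * f)\<close>.\<close>
lemma smooth_on_inverse:
  assumes "open W" "smooth_on M W f" "\<And>x. x \<in> W \<Longrightarrow> f x \<noteq> 0"
  shows "smooth_on M W (\<lambda>x. inverse (f x))"
proof -
  have "smooth_on M W (\<lambda>x. f x * f x)" by (intro smooth_on_mult[OF mfd] assms)
  moreover have "(\<lambda>x. f x * f x) ` W \<subseteq> {0<..}" using assms(3) by (auto simp: zero_less_mult_iff) fastforce
  ultimately have "smooth_on M W (\<lambda>x. (f x * f x) powr (-1))"
    using smooth_on_real_compose[OF mfd assms(1) _ real_smooth_powr] by blast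
  then have "smooth_on M W (\<lambda>x. f x * (f x * f x) powr (-1))" by (intro smooth_on_mult[OF mfd] assms)
  then show ?thesis
    by (rule smooth_on_cong[OF mfd _ assms(1)]) (use assms(3) in \<open>simp add: powr_minus\<close>)
qed

text \<open>The extension by zero is smooth on \<open>W\<close> and on the complement of \<open>K\<close>, and these open sets cover the
  manifold.\<close>
lemma smooth_functions_extend:
  assumes "open W" "closed K" "K \<subseteq> W" "smooth_on M W g" "\<And>y. y \<in> W \<Longrightarrow> y \<notin> K \<Longrightarrow> g y = 0"
  shows "(\<lambda>y. if y \<in> W then g y else 0) \<in> smooth_functions M"
  unfolding smooth_functions_def mem_Collect_eq
proof (rule smooth_on_local[OF mfd open_UNIV])
  fix x
  show "\<exists>U. open U \<and> x \<in> U \<and> smooth_on M (UNIV \<inter> U) (\<lambda>y. if y \<in> W then g y else 0)"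
  proof (cases "x \<in> W")
    case True
    have "smooth_on M W (\<lambda>y. if y \<in> W then g y else 0)"
      by (rule smooth_on_cong[OF mfd assms(4,1)]) auto
    then show ?thesis using True assms(1) by auto
  next
    case False
    have "smooth_on M (- K) (\<lambda>y. if y \<in> W then g y else 0)"
      by (rule smooth_on_cong[OF mfd smooth_on_const[OF mfd, of _ 0]]) (use assms in auto)
    then show ?thesis using False assms(2,3) by (intro exI[of _ "- K"]) auto
  qed
qed

text \<open>The function \<open>flat (r\<^sup>2 - d\<^sup>2)\<close>, with \<open>d\<close> the distance from \<open>x\<close> in a chart, is positive
  exactly inside a ball. Its support is compact, hence closed in the manifold since this is Hausdorff.\<close>
lemma bump_function:
  assumes "open U" "x \<in> U"
  obtains \<phi> K where "\<phi> \<in> smooth_functions M" "closed K" "K \<subseteq> U" "\<And>y. \<phi> y \<ge> 0" "\<phi> x > 0"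
    "\<And>y. y \<notin> K \<Longrightarrow> \<phi> y = 0"
proof -
  obtain c where c: "c \<in> atlas M" "x \<in> fst c" using atlas_cover[OF mfd] by blast
  note ch = atlas_chart[OF mfd c(1)]
  define W where "W = U \<inter> fst c"
  have W: "open W" "W \<subseteq> fst c" "x \<in> W" using assms c atlas_open[OF mfd c(1)] by (auto simp: W_def)
  let ?I = "coords M"
  let ?p = "snd c x"
  obtain r where r: "r > 0" "cball ?p r \<subseteq> chart_region ?I c W"
    using open_chart_region[OF ch W(1,2)] chart_region_self[OF ch W(3,2)] open_contains_cball by blast
  define S where "S = cball ?p r \<inter> {y. \<forall>i. i \<notin> ?I \<longrightarrow> y $ i = 0}"
  have "{y::real^'n. \<forall>i. i \<notin> ?I \<longrightarrow> y $ i = 0} = (\<Inter>i\<in>-?I. {y. y $ i = 0})" by auto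
  moreover have "closed (\<Inter>i\<in>-?I. {y::real^'n. y $ i = 0})"
    by (intro closed_INT ballI closed_Collect_eq continuous_intros)
  ultimately have cS: "compact S" unfolding S_def by (simp add: compact_Int_closed)
  have SW: "S \<subseteq> snd c ` W"
  proof
    fix y assume y: "y \<in> S"
    then have e: "coord_proj ?I y = y" by (auto simp: S_def vec_eq_iff)
    have "y \<in> chart_region ?I c W" using y r(2) by (auto simp: S_def)
    then show "y \<in> snd c ` W" using e by (simp add: chart_region_def)
  qed
  define K where "K = inv_into (fst c) (snd c) ` S"
  have "compact K" unfolding K_def
    by (rule compact_continuous_image[OF continuous_on_subset[OF chart_inv_cont[OF ch]] cS]) (use SW W in auto)
  then have clK: "closed K" by (rule compact_imp_closed)
  have KW: "K \<subseteq> W" using SW chart_inj[OF ch] W(2) by (auto simp: K_def subset_iff image_iff)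
  define g where "g y = r\<^sup>2 - (\<Sum>i\<in>UNIV. (snd c y $ i - ?p $ i) * (snd c y $ i - ?p $ i))" for y
  have sg: "smooth_on M (fst c) g" unfolding g_def
    by (intro smooth_on_diff[OF mfd] smooth_on_sum[OF mfd] smooth_on_mult[OF mfd] smooth_on_const[OF mfd]
        smooth_coord[OF mfd c(1)] atlas_open[OF mfd c(1)])
  have sf: "smooth_on M (fst c) (\<lambda>y. flat (g y))"
    by (rule smooth_on_real_compose[OF mfd atlas_open[OF mfd c(1)] sg real_smooth_flat]) auto
  have gK: "g y < 0" if y: "y \<in> fst c" "y \<notin> K" for y
  proof (rule ccontr)
    assume "\<not> g y < 0"
    moreover have "(\<Sum>i\<in>UNIV. (snd c y $ i - ?p $ i) * (snd c y $ i - ?p $ i)) = (dist (snd c y) ?p)\<^sup>2"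
      by (simp add: dist_vec_def L2_set_def dist_real_def sum_nonneg power2_eq_square)
    ultimately have "(dist (snd c y) ?p)\<^sup>2 \<le> r\<^sup>2" by (simp add: g_def)
    then have "dist (snd c y) ?p \<le> r" using r(1) by (simp add: power2_le_iff_abs_le)
    then have "snd c y \<in> S" using chart_zero[OF ch y(1)] by (simp add: S_def dist_commute)
    then have "y \<in> K" unfolding K_def using inv_into_f_f[OF chart_inj[OF ch] y(1)] by (metis imageI)
    then show False using y by simp
  qed
  show thesis
  proof (rule that[of "\<lambda>y. if y \<in> fst c then flat (g y) else 0" K])
    show "(\<lambda>y. if y \<in> fst c then flat (g y) else 0) \<in> smooth_functions M"
      by (rule smooth_functions_extend[OF atlas_open[OF mfd c(1)] clK _ sf]) (use KW W gK in \<open>auto intro: less_imp_le\<close>)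
    show "closed K" by fact
    show "K \<subseteq> U" using KW by (auto simp: W_def)
    show "(if x \<in> fst c then flat (g x) else 0) > 0" using c(2) r by (simp add: g_def)
  qed (use gK in \<open>auto simp: flat_nonneg intro: less_imp_le\<close>)
qed

text \<open>A smooth step function, equal to \<open>0\<close> on the negative half line and to \<open>1\<close> beyond the level \<open>a\<close>, is
  applied to a bump function whose value at \<open>x\<close> exceeds \<open>a\<close>.\<close>
lemma plateau_function:
  assumes "open U" "x \<in> U"
  obtains \<phi> K V where "\<phi> \<in> smooth_functions M" "closed K" "K \<subseteq> U" "open V" "x \<in> V" "V \<subseteq> U"
    "\<And>y. y \<notin> K \<Longrightarrow> \<phi> y = 0" "\<And>y. y \<in> V \<Longrightarrow> \<phi> y = 1"
proof -
  obtain \<phi> K where b: "\<phi> \<in> smooth_functions M" "closed K" "K \<subseteq> U" "\<And>y. \<phi> y \<ge> 0" "\<phi> x > 0"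
    "\<And>y. y \<notin> K \<Longrightarrow> \<phi> y = 0" using bump_function[OF assms] by metis
  define a where "a = \<phi> x / 2"
  have a: "a > 0" "a < \<phi> x" using b(5) by (auto simp: a_def)
  have s: "smooth_on M UNIV \<phi>" using b(1) by (simp add: smooth_functions_def)
  define f where "f y = flat (\<phi> y) * inverse (flat (\<phi> y) + flat (a - \<phi> y))" for y
  have pos: "flat t + flat (a - t) \<noteq> 0" for t
    using flat_nonneg[of t] flat_nonneg[of "a - t"] a(1) flat_pos[of t] flat_pos[of "a - t"] by linarith
  have "smooth_on M UNIV f" unfolding f_def
    by (intro smooth_on_mult[OF mfd] smooth_on_inverse smooth_on_add[OF mfd] pos
        smooth_on_real_compose[OF mfd _ _ real_smooth_flat] smooth_on_diff[OF mfd] smooth_on_const[OF mfd] s) auto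
  then have sf: "f \<in> smooth_functions M" by (simp add: smooth_functions_def)
  have V: "open (\<phi> -` {a<..})" using smooth_on_continuous[OF mfd s open_UNIV] by (simp add: open_vimage)
  show thesis
  proof (rule that[OF sf b(2,3) V])
    show "x \<in> \<phi> -` {a<..}" using a by simp
    show "\<phi> -` {a<..} \<subseteq> U" using a(1) b(3,6) by fastforce
    show "f y = 0" if "y \<notin> K" for y using b(6)[OF that] by (simp add: f_def)
    show "f y = 1" if "y \<in> \<phi> -` {a<..}" for y
    proof -
      have nz: "flat (\<phi> y) \<noteq> 0" and z: "flat (a - \<phi> y) = 0" using that a(1) by auto
      show ?thesis unfolding f_def z using nz by (simp del: flat_eq_0)
    qed
  qed
qed

text \<open>This passes from local coordinates to the global functions on which tangent vectors act.\<close>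
lemma smooth_extension:
  assumes "open U" "x \<in> U" "smooth_on M U g"
  obtains g' V where "g' \<in> smooth_functions M" "open V" "x \<in> V" "V \<subseteq> U" "\<And>y. y \<in> V \<Longrightarrow> g' y = g y"
proof -
  obtain \<phi> K V where p: "\<phi> \<in> smooth_functions M" "closed K" "K \<subseteq> U" "open V" "x \<in> V" "V \<subseteq> U"
    "\<And>y. y \<notin> K \<Longrightarrow> \<phi> y = 0" "\<And>y. y \<in> V \<Longrightarrow> \<phi> y = 1" using plateau_function[OF assms(1,2)] by metis
  have s: "smooth_on M U \<phi>" using p(1) smooth_on_subset[OF mfd] by (auto simp: smooth_functions_def)
  have "(\<lambda>y. if y \<in> U then \<phi> y * g y else 0) \<in> smooth_functions M"
    by (rule smooth_functions_extend[OF assms(1) p(2,3)]) (use p(7) s assms in \<open>auto intro!: smooth_on_mult[OF mfd]\<close>)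
  then show thesis
    by (rule that[OF _ p(4-6)]) (use p(6,8) in auto)
qed

end

section \<open>Vector fields in charts\<close>

definition smooth_vf ::
  "('m::{t2_space, second_countable_topology}, 'n::finite) mfd \<Rightarrow> ('m \<Rightarrow> 'm tangent) \<Rightarrow> bool" where
  "smooth_vf M X \<longleftrightarrow> (\<forall>x. tangent_vector M x (X x)) \<and>
     (\<forall>f\<in>smooth_functions M. (\<lambda>x. X x f) \<in> smooth_functions M)"

lemma smooth_functions_iff: "f \<in> smooth_functions M \<longleftrightarrow> smooth_on M UNIV f"
  by (simp add: smooth_functions_def)

context
  fixes M :: "('m::{t2_space, second_countable_topology}, 'n::finite) mfd"
  assumes mfd: "manifold M"
begin

text \<open>A tangent vector only sees global functions, so its components are read off from global extensions of
  the germs of the coordinates. This yields uniqueness of the components and their smooth dependence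
  on the point.\<close>
lemma has_components_on_coord:
  assumes c: "c \<in> atlas M" "x \<in> fst c" and i: "i \<in> coords M" and h: "has_components M c x T \<xi>"
    and g: "g \<in> smooth_functions M" "open V" "x \<in> V" "\<And>y. y \<in> V \<Longrightarrow> g y = snd c y $ i"
  shows "\<xi> $ i = T g"
proof -
  have "T g = (\<Sum>j\<in>coords M. \<xi> $ j * partial c j g x)" using h g(1) by (simp add: has_components_def)
  also have "\<dots> = (\<Sum>j\<in>coords M. if j = i then \<xi> $ j else 0)"
  proof (rule sum.cong[OF refl])
    fix j assume j: "j \<in> coords M"
    have "partial c j g x = partial c j (\<lambda>y. snd c y $ i) x"
      by (rule partial_eq_near[OF mfd g(2,3) c(2,1) j]) (use g(4) in auto)
    then show "\<xi> $ j * partial c j g x = (if j = i then \<xi> $ j else 0)"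
      using partial_coord[OF mfd c UNIV_I j open_UNIV, of i] by simp
  qed
  also have "\<dots> = \<xi> $ i" using i by (simp add: sum.delta)
  finally show ?thesis by simp
qed

lemma coord_extension:
  assumes c: "c \<in> atlas M" "x \<in> fst c"
  obtains g V where "g \<in> smooth_functions M" "open V" "x \<in> V" "V \<subseteq> fst c" "\<And>y. y \<in> V \<Longrightarrow> g y = snd c y $ i"
  using smooth_extension[OF mfd atlas_open[OF mfd c(1)] c(2) smooth_coord[OF mfd c(1), of i]] by metis

lemma has_components_chart_components:
  assumes c: "c \<in> atlas M" "x \<in> fst c" and T: "tangent_vector M x T"
  shows "has_components M c x T (chart_components M c x T)"
proof -
  obtain \<xi> where \<xi>: "has_components M c x T \<xi>" using T c by (auto simp: tangent_vector_def)
  have "\<eta> = \<xi>" if \<eta>: "has_components M c x T \<eta>" for \<eta>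
  proof -
    have "\<eta> $ i = \<xi> $ i" for i
    proof (cases "i \<in> coords M")
      case True
      obtain g V where g: "g \<in> smooth_functions M" "open V" "x \<in> V" "V \<subseteq> fst c" "\<And>y. y \<in> V \<Longrightarrow> g y = snd c y $ i"
        using coord_extension[OF c] by metis
      show ?thesis using has_components_on_coord[OF c True \<eta> g(1,2,3,5)] has_components_on_coord[OF c True \<xi> g(1,2,3,5)] by simp
    next
      case False then show ?thesis using \<eta> \<xi> by (simp add: has_components_def)
    qed
    then show ?thesis by (simp add: vec_eq_iff)
  qed
  then have "\<exists>!\<xi>. has_components M c x T \<xi>" using \<xi> by blast
  then show ?thesis unfolding chart_components_def by (rule theI')
qed

lemma tangent_vector_apply:
  assumes c: "c \<in> atlas M" "x \<in> fst c" and T: "tangent_vector M x T" and f: "f \<in> smooth_functions M"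
  shows "T f = (\<Sum>i\<in>coords M. chart_components M c x T $ i * partial c i f x)"
  using has_components_chart_components[OF c T] f by (simp add: has_components_def)

lemma chart_components_coord:
  assumes c: "c \<in> atlas M" "x \<in> fst c" and i: "i \<in> coords M" and T: "tangent_vector M x T"
    and g: "g \<in> smooth_functions M" "open V" "x \<in> V" "\<And>y. y \<in> V \<Longrightarrow> g y = snd c y $ i"
  shows "chart_components M c x T $ i = T g"
  by (rule has_components_on_coord[OF c i has_components_chart_components[OF c T] g])

lemma tangent_local:
  assumes T: "tangent_vector M x T" and "f \<in> smooth_functions M" "g \<in> smooth_functions M"
    and "open U" "x \<in> U" "\<And>y. y \<in> U \<Longrightarrow> f y = g y"
  shows "T f = T g"
proof -
  obtain c where c: "c \<in> atlas M" "x \<in> fst c" using atlas_cover[OF mfd] by blast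
  have "partial c i f x = partial c i g x" if "i \<in> coords M" for i
    by (rule partial_eq_near[OF mfd assms(4,5) c(2,1) that assms(6)])
  then show ?thesis using tangent_vector_apply[OF c T assms(2)] tangent_vector_apply[OF c T assms(3)] by simp
qed

lemma tangent_mult:
  assumes T: "tangent_vector M x T" and f: "f \<in> smooth_functions M" and g: "g \<in> smooth_functions M"
  shows "T (\<lambda>y. f y * g y) = f x * T g + g x * T f"
proof -
  obtain c where c: "c \<in> atlas M" "x \<in> fst c" using atlas_cover[OF mfd] by blast
  have fg: "(\<lambda>y. f y * g y) \<in> smooth_functions M"
    using f g smooth_on_mult[OF mfd open_UNIV] by (simp add: smooth_functions_iff)
  have "partial c i (\<lambda>y. f y * g y) x = partial c i f x * g x + f x * partial c i g x" if "i \<in> coords M" for i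
    using partial_mult[OF mfd c UNIV_I that open_UNIV] f g by (simp add: smooth_functions_iff)
  then show ?thesis
    by (simp add: tangent_vector_apply[OF c T] f g fg sum_distrib_left sum.distrib[symmetric] algebra_simps)
qed

lemma tangent_add:
  assumes T: "tangent_vector M x T" and f: "f \<in> smooth_functions M" and g: "g \<in> smooth_functions M"
  shows "T (\<lambda>y. f y + g y) = T f + T g"
proof -
  obtain c where c: "c \<in> atlas M" "x \<in> fst c" using atlas_cover[OF mfd] by blast
  have fg: "(\<lambda>y. f y + g y) \<in> smooth_functions M"
    using f g smooth_on_add[OF mfd open_UNIV] by (simp add: smooth_functions_iff)
  have "partial c i (\<lambda>y. f y + g y) x = partial c i f x + partial c i g x" if "i \<in> coords M" for i
    using partial_add[OF mfd c UNIV_I that open_UNIV] f g by (simp add: smooth_functions_iff)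
  then show ?thesis
    by (simp add: tangent_vector_apply[OF c T] f g fg sum_distrib_left sum.distrib[symmetric] algebra_simps)
qed

lemma tangent_const:
  assumes T: "tangent_vector M x T" shows "T (\<lambda>y. a) = 0"
proof -
  obtain c where c: "c \<in> atlas M" "x \<in> fst c" using atlas_cover[OF mfd] by blast
  have "(\<lambda>y. a) \<in> smooth_functions M" using smooth_on_const[OF mfd] by (simp add: smooth_functions_iff)
  then show ?thesis using tangent_vector_apply[OF c T, of "\<lambda>y. a"] partial_const[OF mfd c UNIV_I _ open_UNIV] by simp
qed

lemma chart_components_change:
  assumes c: "c \<in> atlas M" "x \<in> fst c" and d: "d \<in> atlas M" "x \<in> fst d" and T: "tangent_vector M x T" and j: "j \<in> coords M"
  shows "chart_components M d x T $ j = (\<Sum>i\<in>coords M. chart_components M c x T $ i * partial c i (\<lambda>y. snd d y $ j) x)"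
proof -
  obtain g V where g: "g \<in> smooth_functions M" "open V" "x \<in> V" "V \<subseteq> fst d" "\<And>y. y \<in> V \<Longrightarrow> g y = snd d y $ j"
    using coord_extension[OF d] by metis
  have "partial c i g x = partial c i (\<lambda>y. snd d y $ j) x" if "i \<in> coords M" for i
    by (rule partial_eq_near[OF mfd g(2,3) c(2,1) that]) (use g(5) in auto)
  then show ?thesis using chart_components_coord[OF d j T g(1,2,3,5)] tangent_vector_apply[OF c T g(1)] by simp
qed

lemma chart_components_combine:
  assumes c: "c \<in> atlas M" "x \<in> fst c" and i: "i \<in> coords M"
    and T: "tangent_vector M x T" "tangent_vector M x S" "tangent_vector M x R"
    and lin: "\<And>f. f \<in> smooth_functions M \<Longrightarrow> R f = a * T f + b * S f"
  shows "chart_components M c x R $ i = a * chart_components M c x T $ i + b * chart_components M c x S $ i"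
proof -
  obtain g V where g: "g \<in> smooth_functions M" "open V" "x \<in> V" "V \<subseteq> fst c" "\<And>y. y \<in> V \<Longrightarrow> g y = snd c y $ i"
    using coord_extension[OF c] by metis
  show ?thesis using lin[OF g(1)] chart_components_coord[OF c i _ g(1,2,3,5)] T by simp
qed

lemma smooth_chart_components:
  assumes c: "c \<in> atlas M" and X: "smooth_vf M X" and i: "i \<in> coords M"
  shows "smooth_on M (fst c) (\<lambda>y. chart_components M c y (X y) $ i)"
proof (rule smooth_on_local[OF mfd atlas_open[OF mfd c]])
  fix x assume x: "x \<in> fst c"
  obtain g V where g: "g \<in> smooth_functions M" "open V" "x \<in> V" "V \<subseteq> fst c" "\<And>y. y \<in> V \<Longrightarrow> g y = snd c y $ i"
    using coord_extension[OF c x] by metis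
  have "smooth_on M V (\<lambda>y. X y g)"
    using X g(1) smooth_on_subset[OF mfd _ subset_UNIV] by (auto simp: smooth_vf_def smooth_functions_iff)
  then have "smooth_on M V (\<lambda>y. chart_components M c y (X y) $ i)"
  proof (rule smooth_on_cong[OF mfd _ g(2)])
    fix y assume y: "y \<in> V"
    show "X y g = chart_components M c y (X y) $ i"
      using chart_components_coord[OF c _ i _ g(1,2) y g(5)] X y g(4) by (auto simp: smooth_vf_def)
  qed
  then show "\<exists>U. open U \<and> x \<in> U \<and> smooth_on M (fst c \<inter> U) (\<lambda>y. chart_components M c y (X y) $ i)"
    using g(2-4) by (intro exI[of _ V]) (simp add: Int_absorb1)
qed

section \<open>Jacobians\<close>

lemma coord_jacobian_mult:
  assumes "c \<in> atlas M" "d \<in> atlas M" "e \<in> atlas M" "x \<in> fst c" "x \<in> fst d" "x \<in> fst e"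
  shows "coord_jacobian M d e x ** coord_jacobian M c d x = coord_jacobian M c e x"
proof -
  let ?I = "coords M"
  have *: "partial c j (\<lambda>y. snd e y $ i) x = (\<Sum>k\<in>?I. partial d k (\<lambda>y. snd e y $ i) x * partial c j (\<lambda>y. snd d y $ k) x)"
    if "j \<in> ?I" for i j
    by (rule partial_chain[OF mfd assms(1,4,6) that atlas_open[OF mfd assms(3)] smooth_coord[OF mfd assms(3)] assms(2,5)])
  have "(\<Sum>k\<in>UNIV. coord_jacobian M d e x $ i $ k * coord_jacobian M c d x $ k $ j) = coord_jacobian M c e x $ i $ j" for i j
  proof (cases "i \<in> ?I \<and> j \<in> ?I")
    case True
    have "(\<Sum>k\<in>UNIV. coord_jacobian M d e x $ i $ k * coord_jacobian M c d x $ k $ j)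
      = (\<Sum>k\<in>?I. coord_jacobian M d e x $ i $ k * coord_jacobian M c d x $ k $ j)"
      by (rule sum.mono_neutral_right) (use True in \<open>auto simp: coord_jacobian_def\<close>)
    then show ?thesis using True * by (simp add: coord_jacobian_def)
  next
    case False
    show ?thesis
    proof (cases "i \<in> ?I")
      case True
      then have "j \<notin> ?I" using False by simp
      then have "coord_jacobian M d e x $ i $ k * coord_jacobian M c d x $ k $ j = (if k = j then coord_jacobian M d e x $ i $ j else 0)" for k
        by (simp add: coord_jacobian_def)
      then show ?thesis using \<open>j \<notin> ?I\<close> by (simp add: coord_jacobian_def)
    next
      case False
      then have "coord_jacobian M d e x $ i $ k * coord_jacobian M c d x $ k $ j = (if k = i then coord_jacobian M c d x $ i $ j else 0)" for k
        by (auto simp: coord_jacobian_def)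
      then show ?thesis using False by (simp add: coord_jacobian_def)
    qed
  qed
  then show ?thesis by (simp add: matrix_matrix_mult_def vec_eq_iff)
qed

lemma coord_jacobian_self:
  assumes "c \<in> atlas M" "x \<in> fst c" shows "coord_jacobian M c c x = mat 1"
  using partial_coord[OF mfd assms UNIV_I _ open_UNIV] by (auto simp: coord_jacobian_def mat_def vec_eq_iff)

lemma coord_jacobian_inverse:
  assumes "c \<in> atlas M" "d \<in> atlas M" "x \<in> fst c" "x \<in> fst d"
  shows "coord_jacobian M d c x ** coord_jacobian M c d x = mat 1"
  using coord_jacobian_mult[OF assms(1,2,1,3,4,3)] coord_jacobian_self[OF assms(1,3)] by simp

lemma det_coord_jacobian_nz:
  assumes "c \<in> atlas M" "d \<in> atlas M" "x \<in> fst c" "x \<in> fst d"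
  shows "det (coord_jacobian M c d x) \<noteq> 0"
  using coord_jacobian_inverse[OF assms] det_mul[of "coord_jacobian M d c x" "coord_jacobian M c d x"] by auto

lemma smooth_coord_jacobian:
  assumes "c \<in> atlas M" "d \<in> atlas M"
  shows "smooth_on M (fst c \<inter> fst d) (\<lambda>x. coord_jacobian M c d x $ i $ j)"
proof (cases "i \<in> coords M \<and> j \<in> coords M")
  case True
  have "smooth_on M (fst c \<inter> fst d) (partial c j (\<lambda>y. snd d y $ i))"
    by (rule smooth_on_partial[OF mfd smooth_on_subset[OF mfd smooth_coord[OF mfd assms(2)]]])
      (use True assms atlas_open[OF mfd assms(1)] atlas_open[OF mfd assms(2)] in auto)
  then show ?thesis using True by (simp add: coord_jacobian_def)
next
  case False
  then have "(\<lambda>x. coord_jacobian M c d x $ i $ j) = (\<lambda>x. if i = j then 1 else 0)"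
    by (auto simp: coord_jacobian_def fun_eq_iff)
  then show ?thesis using smooth_on_const[OF mfd] by simp
qed

lemma smooth_det_coord_jacobian:
  assumes "c \<in> atlas M" "d \<in> atlas M"
  shows "smooth_on M (fst c \<inter> fst d) (\<lambda>x. det (coord_jacobian M c d x))"
  unfolding det_def
  by (intro smooth_on_sum[OF mfd] smooth_on_mult[OF mfd] smooth_on_const[OF mfd] smooth_on_prod[OF mfd]
      smooth_coord_jacobian assms open_Int atlas_open[OF mfd])

end

text \<open>The determinant of \<open>B A(t)\<close> is differentiated where that matrix is the
  identity: in the Leibniz formula every non-trivial permutation contributes at least two factors
  that vanish there, so that only the diagonal term has a derivative. This is Jacobi's formula.\<close>
lemma det_has_derivative:
  fixes A :: "real \<Rightarrow> real ^ 'n ^ 'n::finite"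
  assumes A: "\<And>i j. ((\<lambda>t. A t $ i $ j) has_real_derivative A' i j) (at 0)"
    and B: "B ** A 0 = mat 1"
  shows "((\<lambda>t. det (A t)) has_real_derivative det (A 0) * (\<Sum>i\<in>UNIV. \<Sum>k\<in>UNIV. B $ i $ k * A' k i)) (at 0)"
proof -
  define N where "N t = B ** A t" for t
  define N' where "N' i j = (\<Sum>k\<in>UNIV. B $ i $ k * A' k j)" for i j
  have N: "((\<lambda>t. N t $ i $ j) has_real_derivative N' i j) (at 0)" for i j
    unfolding N_def N'_def matrix_matrix_mult_def using A by (auto intro!: derivative_eq_intros simp: mult.commute)
  have N0: "N 0 $ i $ j = (if i = j then 1 else 0)" for i j using B by (simp add: N_def mat_def)
  let ?d = "\<lambda>p. \<Sum>i\<in>UNIV. N' i (p i) * (\<Prod>j\<in>UNIV-{i}. N 0 $ j $ p j)"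
  have "((\<lambda>t. det (N t)) has_real_derivative (\<Sum>p | p permutes (UNIV::'n set). of_int (sign p) * ?d p)) (at 0)"
    unfolding det_def using N by (auto intro!: DERIV_sum DERIV_cmult has_field_derivative_prod)
  moreover have "(\<Sum>p | p permutes (UNIV::'n set). of_int (sign p) * ?d p) = (\<Sum>i\<in>UNIV. N' i i)"
  proof -
    have z: "?d p = 0" if p: "p permutes UNIV" "p \<noteq> id" for p
    proof (rule sum.neutral, intro ballI)
      fix i
      obtain a where a: "p a \<noteq> a" using p(2) by (auto simp: fun_eq_iff)
      have "\<exists>j. j \<noteq> i \<and> p j \<noteq> j"
      proof (cases "a = i")
        case True
        have "p (p i) \<noteq> p i" using a True permutes_inj[OF p(1)] by (auto dest: injD)
        then show ?thesis using a True by metis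
      qed (use a in auto)
      then obtain j where "j \<noteq> i" "p j \<noteq> j" by blast
      then have "(\<Prod>j\<in>UNIV-{i}. N 0 $ j $ p j) = 0"
        by (intro prod_zero) (auto simp: N0 intro!: bexI[of _ j])
      then show "N' i (p i) * (\<Prod>j\<in>UNIV-{i}. N 0 $ j $ p j) = 0" by simp
    qed
    have "(\<Sum>p | p permutes (UNIV::'n set). of_int (sign p) * ?d p) = (\<Sum>p\<in>{id::'n\<Rightarrow>'n}. of_int (sign p) * ?d p)"
      by (rule sum.mono_neutral_right) (use z in \<open>auto simp: permutes_id\<close>)
    also have "\<dots> = (\<Sum>i\<in>UNIV. N' i i)" by (simp add: N0 sign_id)
    finally show ?thesis .
  qed
  ultimately have dN: "((\<lambda>t. det (N t)) has_real_derivative (\<Sum>i\<in>UNIV. N' i i)) (at 0)" by simp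
  have "det B * det (A 0) = 1" using det_mul[of B "A 0"] B by simp
  then have "det (A 0) * det (N t) = det (A t)" for t by (simp add: N_def det_mul algebra_simps)
  then show ?thesis using DERIV_cmult[OF dN, of "det (A 0)"] by (simp only: N'_def)
qed

section \<open>Divergences of vector fields\<close>

definition dir_deriv where
  "dir_deriv M c X f x = (\<Sum>i\<in>coords M. chart_components M c x (X x) $ i * partial c i f x)"

definition chart_div where
  "chart_div M c X x = (\<Sum>i\<in>coords M. partial c i (\<lambda>y. chart_components M c y (X y) $ i) x)"

lemma lie_density_eq: "lie_density M s X \<sigma> c x = dir_deriv M c X (\<sigma> c) x + s * chart_div M c X x * \<sigma> c x"
  by (simp add: lie_density_def dir_deriv_def chart_div_def)

context
  fixes M :: "('m::{t2_space, second_countable_topology}, 'n::finite) mfd"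
  assumes mfd: "manifold M"
begin

lemma dir_deriv_change:
  assumes c: "c \<in> atlas M" "x \<in> fst c" and d: "d \<in> atlas M" "x \<in> fst d" and T: "tangent_vector M x (X x)"
    and f: "open W" "x \<in> W" "smooth_on M W f"
  shows "dir_deriv M c X f x = dir_deriv M d X f x"
proof -
  let ?I = "coords M"
  have "dir_deriv M d X f x = (\<Sum>j\<in>?I. \<Sum>i\<in>?I. chart_components M c x (X x) $ i * partial c i (\<lambda>y. snd d y $ j) x * partial d j f x)"
    unfolding dir_deriv_def by (simp add: chart_components_change[OF mfd c d T] sum_distrib_right)
  also have "\<dots> = (\<Sum>i\<in>?I. \<Sum>j\<in>?I. chart_components M c x (X x) $ i * partial c i (\<lambda>y. snd d y $ j) x * partial d j f x)"
    by (rule sum.swap)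
  also have "\<dots> = dir_deriv M c X f x"
    unfolding dir_deriv_def
    by (rule sum.cong[OF refl], subst partial_chain[OF mfd c f(2) _ f(1,3) d])
      (auto simp: sum_distrib_left mult_ac)
  finally show ?thesis by simp
qed

lemma dir_deriv_smooth:
  assumes "c \<in> atlas M" "x \<in> fst c" "tangent_vector M x (X x)" "f \<in> smooth_functions M"
  shows "dir_deriv M c X f x = X x f"
  unfolding dir_deriv_def using tangent_vector_apply[OF mfd assms] by simp

lemma dir_deriv_mult:
  assumes c: "c \<in> atlas M" "x \<in> fst c" and W: "open W" "x \<in> W" "smooth_on M W f" "smooth_on M W g"
  shows "dir_deriv M c X (\<lambda>y. f y * g y) x = f x * dir_deriv M c X g x + g x * dir_deriv M c X f x"
proof -
  have "partial c i (\<lambda>y. f y * g y) x = partial c i f x * g x + f x * partial c i g x" if "i \<in> coords M" for i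
    by (rule partial_mult[OF mfd c W(2) that W(1,3,4)])
  then show ?thesis unfolding dir_deriv_def by (simp add: sum_distrib_left sum.distrib[symmetric] algebra_simps)
qed

lemma dir_deriv_cong:
  assumes c: "c \<in> atlas M" "x \<in> fst c" and W: "open W" "x \<in> W" "\<And>y. y \<in> W \<Longrightarrow> f y = g y"
  shows "dir_deriv M c X f x = dir_deriv M c X g x"
  unfolding dir_deriv_def using partial_eq_near[OF mfd W(1,2) c(2,1) _ W(3)] by simp

text \<open>The coordinate divergence is not invariant, but changes by the logarithmic derivative of the
  Jacobian determinant, by Jacobi's formula and the symmetry of second derivatives.\<close>
lemma chart_div_change:
  assumes c: "c \<in> atlas M" "x \<in> fst c" and d: "d \<in> atlas M" "x \<in> fst d" and X: "smooth_vf M X"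
  shows "dir_deriv M c X (\<lambda>y. det (coord_jacobian M c d y)) x
    = det (coord_jacobian M c d x) * (chart_div M d X x - chart_div M c X x)"
proof -
  let ?I = "coords M"
  let ?W = "fst c \<inter> fst d"
  define J where "J = coord_jacobian M c d"
  define K where "K = coord_jacobian M d c x"
  define Xc where "Xc i y = chart_components M c y (X y) $ i" for i y
  have W: "open ?W" "x \<in> ?W" using c d by (auto intro!: atlas_open[OF mfd])
  have KJ: "K ** J x = mat 1" using coord_jacobian_inverse[OF mfd c(1) d(1) c(2) d(2)] by (simp add: K_def J_def)
  have sJ: "smooth_on M ?W (\<lambda>y. J y $ i $ j)" for i j
    unfolding J_def by (rule smooth_coord_jacobian[OF mfd c(1) d(1)])
  have sX: "smooth_on M ?W (Xc i)" if "i \<in> ?I" for i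
    unfolding Xc_def[abs_def] by (rule smooth_on_subset[OF mfd smooth_chart_components[OF mfd c(1) X that]]) auto
  have T: "tangent_vector M y (X y)" for y using X by (simp add: smooth_vf_def)
  have Jpart: "J y $ j $ i = partial c i (\<lambda>z. snd d z $ j) y" if "i \<in> ?I" "j \<in> ?I" for i j y
    using that by (simp add: J_def coord_jacobian_def)
  \<comment> \<open>The entries of \<open>J\<close> are first derivatives, so this is the symmetry of second derivatives.\<close>
  have Jsym: "partial c k (\<lambda>y. J y $ j $ i) x = partial c i (\<lambda>y. J y $ j $ k) x"
    if "i \<in> ?I" "j \<in> ?I" "k \<in> ?I" for i j k
  proof -
    have "partial c k (partial c i (\<lambda>z. snd d z $ j)) x = partial c i (partial c k (\<lambda>z. snd d z $ j)) x"
      by (rule partial_partial_commute[OF mfd c _ that(3) atlas_open[OF mfd d(1)] smooth_coord[OF mfd d(1)] that(1)]) (use d in auto)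
    moreover have "(\<lambda>y. J y $ j $ i) = partial c i (\<lambda>z. snd d z $ j)" if "i \<in> ?I" for i
      using Jpart that \<open>j \<in> ?I\<close> by (simp add: fun_eq_iff)
    ultimately show ?thesis using that by simp
  qed
  have Jac: "partial c k (\<lambda>y. det (J y)) x = det (J x) * (\<Sum>i\<in>?I. \<Sum>j\<in>?I. K $ i $ j * partial c k (\<lambda>y. J y $ j $ i) x)"
    if k: "k \<in> ?I" for k
  proof -
    have z: "coord_curve c k x 0 = x" by (rule coord_curve_0[OF atlas_chart[OF mfd c(1)] c(2)])
    have "((\<lambda>t. det (J (coord_curve c k x t))) has_real_derivative
        det (J (coord_curve c k x 0)) * (\<Sum>i\<in>UNIV. \<Sum>j\<in>UNIV. K $ i $ j * partial c k (\<lambda>y. J y $ j $ i) x)) (at 0)"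
      by (rule det_has_derivative[OF smooth_on_curve[OF mfd sJ W c(2,1) k]]) (use KJ z in simp)
    then have "partial c k (\<lambda>y. det (J y)) x = det (J x) * (\<Sum>i\<in>UNIV. \<Sum>j\<in>UNIV. K $ i $ j * partial c k (\<lambda>y. J y $ j $ i) x)"
      using partial_eqI[OF atlas_chart[OF mfd c(1)], where f = "\<lambda>y. det (J y)"] z by simp
    also have "(\<Sum>i\<in>UNIV. \<Sum>j\<in>UNIV. K $ i $ j * partial c k (\<lambda>y. J y $ j $ i) x)
        = (\<Sum>i\<in>?I. \<Sum>j\<in>?I. K $ i $ j * partial c k (\<lambda>y. J y $ j $ i) x)"
    proof -
      have "partial c k (\<lambda>y. J y $ j $ i) x = 0" if "i \<notin> ?I \<or> j \<notin> ?I" for i j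
      proof -
        have "(\<lambda>y. J y $ j $ i) = (\<lambda>y. if j = i then 1 else 0)" using that by (auto simp: J_def coord_jacobian_def fun_eq_iff)
        then show ?thesis using partial_const[OF mfd c UNIV_I k open_UNIV] by simp
      qed
      then show ?thesis by (intro sum.mono_neutral_cong_right) (auto intro!: sum.mono_neutral_right)
    qed
    finally show ?thesis .
  qed
  have KJI: "(\<Sum>j\<in>?I. K $ k $ j * J x $ j $ i) = (if k = i then 1 else 0)" if "i \<in> ?I" "k \<in> ?I" for i k
  proof -
    have "(\<Sum>j\<in>?I. K $ k $ j * J x $ j $ i) = (\<Sum>j\<in>UNIV. K $ k $ j * J x $ j $ i)"
      by (rule sum.mono_neutral_left) (use that in \<open>auto simp: K_def coord_jacobian_def\<close>)
    also have "\<dots> = (K ** J x) $ k $ i" by (simp add: matrix_matrix_mult_def)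
    finally show ?thesis by (simp add: KJ mat_def)
  qed
  have Xd: "chart_components M d y (X y) $ j = (\<Sum>i\<in>?I. Xc i y * J y $ j $ i)" if "y \<in> ?W" "j \<in> ?I" for y j
    using chart_components_change[OF mfd c(1) _ d(1) _ T that(2), of y] that by (simp add: Xc_def Jpart)
  have sXd: "smooth_on M (fst d) (\<lambda>y. chart_components M d y (X y) $ j)" if "j \<in> ?I" for j
    by (rule smooth_chart_components[OF mfd d(1) X that])
  have "chart_div M d X x = (\<Sum>j\<in>?I. \<Sum>k\<in>?I. partial c k (\<lambda>y. chart_components M d y (X y) $ j) x * K $ k $ j)"
    unfolding chart_div_def
    by (rule sum.cong[OF refl], subst partial_chain[OF mfd d d(2) _ atlas_open[OF mfd d(1)] sXd c])
      (auto simp: K_def coord_jacobian_def)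
  also have "\<dots> = (\<Sum>j\<in>?I. \<Sum>k\<in>?I. (\<Sum>i\<in>?I. partial c k (Xc i) x * J x $ j $ i + Xc i x * partial c k (\<lambda>y. J y $ j $ i) x) * K $ k $ j)"
  proof (intro sum.cong refl)
    fix j k assume j: "j \<in> ?I" and k: "k \<in> ?I"
    have "partial c k (\<lambda>y. chart_components M d y (X y) $ j) x = partial c k (\<lambda>y. \<Sum>i\<in>?I. Xc i y * J y $ j $ i) x"
      by (rule partial_eq_near[OF mfd W c(2,1) k]) (rule Xd[OF _ j])
    also have "\<dots> = (\<Sum>i\<in>?I. partial c k (\<lambda>y. Xc i y * J y $ j $ i) x)"
      by (rule partial_sum[OF mfd c W(2) k W(1)]) (intro smooth_on_mult[OF mfd W(1)] sX sJ)
    also have "\<dots> = (\<Sum>i\<in>?I. partial c k (Xc i) x * J x $ j $ i + Xc i x * partial c k (\<lambda>y. J y $ j $ i) x)"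
      by (intro sum.cong refl partial_mult[OF mfd c W(2) k W(1)] sX sJ)
    finally show "partial c k (\<lambda>y. chart_components M d y (X y) $ j) x * K $ k $ j
      = (\<Sum>i\<in>?I. partial c k (Xc i) x * J x $ j $ i + Xc i x * partial c k (\<lambda>y. J y $ j $ i) x) * K $ k $ j" by simp
  qed
  also have "\<dots> = (\<Sum>j\<in>?I. \<Sum>k\<in>?I. \<Sum>i\<in>?I. partial c k (Xc i) x * (K $ k $ j * J x $ j $ i))
      + (\<Sum>j\<in>?I. \<Sum>k\<in>?I. \<Sum>i\<in>?I. Xc i x * (K $ k $ j * partial c k (\<lambda>y. J y $ j $ i) x))"
    unfolding sum_distrib_right distrib_right sum.distrib by (simp add: mult_ac)
  also have "(\<Sum>j\<in>?I. \<Sum>k\<in>?I. \<Sum>i\<in>?I. partial c k (Xc i) x * (K $ k $ j * J x $ j $ i))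
      = (\<Sum>k\<in>?I. \<Sum>i\<in>?I. partial c k (Xc i) x * (\<Sum>j\<in>?I. K $ k $ j * J x $ j $ i))"
    by (subst sum.swap) (rule sum.cong[OF refl], subst sum.swap, simp add: sum_distrib_left)
  also have "\<dots> = (\<Sum>k\<in>?I. \<Sum>i\<in>?I. if k = i then partial c k (Xc i) x else 0)"
    by (intro sum.cong refl) (simp add: KJI)
  also have "\<dots> = chart_div M c X x" unfolding chart_div_def Xc_def[abs_def] by (simp add: sum.delta)
  also have "(\<Sum>j\<in>?I. \<Sum>k\<in>?I. \<Sum>i\<in>?I. Xc i x * (K $ k $ j * partial c k (\<lambda>y. J y $ j $ i) x))
      = (\<Sum>i\<in>?I. Xc i x * (\<Sum>k\<in>?I. \<Sum>j\<in>?I. K $ k $ j * partial c i (\<lambda>y. J y $ j $ k) x))"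
  proof -
    have "(\<Sum>j\<in>?I. \<Sum>k\<in>?I. \<Sum>i\<in>?I. Xc i x * (K $ k $ j * partial c k (\<lambda>y. J y $ j $ i) x))
      = (\<Sum>j\<in>?I. \<Sum>k\<in>?I. \<Sum>i\<in>?I. Xc i x * (K $ k $ j * partial c i (\<lambda>y. J y $ j $ k) x))"
      by (intro sum.cong refl) (simp add: Jsym)
    also have "\<dots> = (\<Sum>k\<in>?I. \<Sum>j\<in>?I. \<Sum>i\<in>?I. Xc i x * (K $ k $ j * partial c i (\<lambda>y. J y $ j $ k) x))"
      by (rule sum.swap)
    also have "\<dots> = (\<Sum>k\<in>?I. \<Sum>i\<in>?I. \<Sum>j\<in>?I. Xc i x * (K $ k $ j * partial c i (\<lambda>y. J y $ j $ k) x))"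
      by (intro sum.cong refl sum.swap)
    also have "\<dots> = (\<Sum>i\<in>?I. \<Sum>k\<in>?I. \<Sum>j\<in>?I. Xc i x * (K $ k $ j * partial c i (\<lambda>y. J y $ j $ k) x))"
      by (rule sum.swap)
    finally show ?thesis by (simp add: sum_distrib_left)
  qed
  finally have e1: "chart_div M d X x = chart_div M c X x
     + (\<Sum>i\<in>?I. Xc i x * (\<Sum>k\<in>?I. \<Sum>j\<in>?I. K $ k $ j * partial c i (\<lambda>y. J y $ j $ k) x))" .
  have "dir_deriv M c X (\<lambda>y. det (J y)) x
     = det (J x) * (\<Sum>i\<in>?I. Xc i x * (\<Sum>k\<in>?I. \<Sum>j\<in>?I. K $ k $ j * partial c i (\<lambda>y. J y $ j $ k) x))"
    unfolding dir_deriv_def by (simp add: Jac Xc_def sum_distrib_left mult_ac)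
  then show ?thesis unfolding e1 by (simp add: J_def)
qed

end

section \<open>The divergence with respect to a density\<close>

definition vf_div where
  "vf_div M \<mu> X = density_ratio M (lie_density M 1 X \<mu>) \<mu>"

context
  fixes M :: "('m::{t2_space, second_countable_topology}, 'n::finite) mfd" and \<mu> :: "('m, 'n) dens"
  assumes mfd: "manifold M" and dens: "is_density M 1 \<mu>" and nv: "nonvanishing M \<mu>"
begin

text \<open>The two coefficients differ by the factor of the absolute Jacobian determinant, whose logarithmic derivative
  compensates the change of the coordinate divergence.\<close>
lemma vf_div_chart_change:
  assumes X: "smooth_vf M X" and c: "c \<in> atlas M" "x \<in> fst c" and d: "d \<in> atlas M" "x \<in> fst d"
  shows "lie_density M 1 X \<mu> c x / \<mu> c x = lie_density M 1 X \<mu> d x / \<mu> d x"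
proof -
  let ?W = "fst c \<inter> fst d"
  define \<Delta> where "\<Delta> y = det (coord_jacobian M c d y)" for y
  have W: "open ?W" "x \<in> ?W" using c d by (auto intro!: atlas_open[OF mfd])
  have s: "smooth_on M ?W (\<mu> c)" "smooth_on M ?W (\<mu> d)"
    using dens c d smooth_on_subset[OF mfd] unfolding is_density_def by (meson inf_le1 inf_le2)+
  have sD: "smooth_on M ?W \<Delta>" unfolding \<Delta>_def[abs_def] by (rule smooth_det_coord_jacobian[OF mfd c(1) d(1)])
  \<comment> \<open>Squaring removes the absolute value of the determinant.\<close>
  have sq: "\<mu> c y * \<mu> c y = (\<Delta> y * \<Delta> y) * (\<mu> d y * \<mu> d y)" if "y \<in> ?W" for y
  proof -
    have "\<mu> c y = \<bar>\<Delta> y\<bar> * \<mu> d y" using dens c(1) d(1) that unfolding is_density_def \<Delta>_def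
      by (metis abs_ge_zero powr_one_gt_zero_iff)
    then have "\<mu> c y * \<mu> c y = (\<bar>\<Delta> y\<bar> * \<bar>\<Delta> y\<bar>) * (\<mu> d y * \<mu> d y)" by simp
    then show ?thesis by simp
  qed
  let ?D = "dir_deriv M c X"
  have T: "tangent_vector M x (X x)" using X by (simp add: smooth_vf_def)
  have "?D (\<lambda>y. \<mu> c y * \<mu> c y) x = ?D (\<lambda>y. (\<Delta> y * \<Delta> y) * (\<mu> d y * \<mu> d y)) x"
    by (rule dir_deriv_cong[OF mfd c W sq])
  also have "\<dots> = (\<Delta> x * \<Delta> x) * ?D (\<lambda>y. \<mu> d y * \<mu> d y) x + (\<mu> d x * \<mu> d x) * ?D (\<lambda>y. \<Delta> y * \<Delta> y) x"
    by (intro dir_deriv_mult[OF mfd c W] smooth_on_mult[OF mfd W(1)] s sD)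
  also have "?D (\<lambda>y. \<mu> d y * \<mu> d y) x = 2 * \<mu> d x * ?D (\<mu> d) x"
    by (subst dir_deriv_mult[OF mfd c W s(2) s(2)]) simp
  also have "?D (\<lambda>y. \<Delta> y * \<Delta> y) x = 2 * \<Delta> x * ?D \<Delta> x"
    by (subst dir_deriv_mult[OF mfd c W sD sD]) simp
  also have "?D (\<lambda>y. \<mu> c y * \<mu> c y) x = 2 * \<mu> c x * ?D (\<mu> c) x"
    by (subst dir_deriv_mult[OF mfd c W s(1) s(1)]) simp
  also have "?D \<Delta> x = \<Delta> x * (chart_div M d X x - chart_div M c X x)"
    unfolding \<Delta>_def[abs_def] by (rule chart_div_change[OF mfd c d X])
  also have "?D (\<mu> d) x = dir_deriv M d X (\<mu> d) x"
    by (rule dir_deriv_change[OF mfd c d _ W s(2)]) (rule T)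
  finally have e0: "2 * \<mu> c x * ?D (\<mu> c) x = \<Delta> x * \<Delta> x * (2 * \<mu> d x * dir_deriv M d X (\<mu> d) x)
      + \<mu> d x * \<mu> d x * (2 * \<Delta> x * (\<Delta> x * (chart_div M d X x - chart_div M c X x)))" .
  have nz: "\<mu> c x \<noteq> 0" "\<mu> d x \<noteq> 0" using nv c d by (auto simp: nonvanishing_def)
  have alg: "m * a = (D * D) * (n * n) * (b / n + q)"
    if "2 * m * a = D * D * (2 * n * b) + n * n * (2 * D * (D * q))" "n \<noteq> 0" for m a D n b q :: real
  proof -
    have "n * n * (b / n + q) = n * b + n * n * q" using that(2) by (simp add: field_simps)
    moreover have "m * a = D * D * (n * b + n * n * q)" using that(1) by (simp add: algebra_simps)
    ultimately show ?thesis by (simp add: mult.assoc)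
  qed
  note e = alg[OF e0 nz(2)]
  from e have "\<mu> c x * ?D (\<mu> c) x = \<mu> c x * \<mu> c x *
      (dir_deriv M d X (\<mu> d) x / \<mu> d x + (chart_div M d X x - chart_div M c X x))"
    using sq[OF W(2)] by simp
  then have "?D (\<mu> c) x = \<mu> c x * (dir_deriv M d X (\<mu> d) x / \<mu> d x + (chart_div M d X x - chart_div M c X x))"
    using nz(1) by (simp add: mult.assoc)
  then have "?D (\<mu> c) x / \<mu> c x + chart_div M c X x = dir_deriv M d X (\<mu> d) x / \<mu> d x + chart_div M d X x"
    using nz(1) by simp
  then show ?thesis using nz by (simp add: lie_density_eq add_divide_distrib)
qed

lemma chosen_chart:
  "(SOME c. c \<in> atlas M \<and> x \<in> fst c) \<in> atlas M \<and> x \<in> fst (SOME c. c \<in> atlas M \<and> x \<in> fst c)"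
proof -
  have "\<exists>c. c \<in> atlas M \<and> x \<in> fst c" using atlas_cover[OF mfd, of x] by metis
  then show ?thesis by (rule someI_ex)
qed

lemma vf_div_chart:
  assumes X: "smooth_vf M X" and c: "c \<in> atlas M" "x \<in> fst c"
  shows "vf_div M \<mu> X x = dir_deriv M c X (\<mu> c) x / \<mu> c x + chart_div M c X x"
proof -
  have nz: "\<mu> c x \<noteq> 0" using nv c by (auto simp: nonvanishing_def)
  have "vf_div M \<mu> X x = lie_density M 1 X \<mu> c x / \<mu> c x"
    using vf_div_chart_change[OF X c, of "SOME c. c \<in> atlas M \<and> x \<in> fst c"] chosen_chart[of x]
    by (simp add: vf_div_def density_ratio_def Let_def)
  then show ?thesis using nz by (simp add: lie_density_eq add_divide_distrib)
qed

lemma smooth_dir_deriv: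
  assumes X: "smooth_vf M X" and c: "c \<in> atlas M" and f: "smooth_on M (fst c) f"
  shows "smooth_on M (fst c) (dir_deriv M c X f)"
  unfolding dir_deriv_def[abs_def]
  by (intro smooth_on_sum[OF mfd] smooth_on_mult[OF mfd] smooth_chart_components[OF mfd c X]
      smooth_on_partial[OF mfd f _ _ c] atlas_open[OF mfd c]) auto

lemma vf_div_smooth:
  assumes X: "smooth_vf M X"
  shows "vf_div M \<mu> X \<in> smooth_functions M"
  unfolding smooth_functions_iff
proof (rule smooth_on_local[OF mfd open_UNIV])
  fix x
  obtain c where c: "c \<in> atlas M" "x \<in> fst c" using atlas_cover[OF mfd] by blast
  note o = atlas_open[OF mfd c(1)]
  have "smooth_on M (fst c) (\<mu> c)" using dens c by (simp add: is_density_def)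
  then have "smooth_on M (fst c) (\<lambda>y. dir_deriv M c X (\<mu> c) y * inverse (\<mu> c y) + chart_div M c X y)"
    unfolding chart_div_def
    by (intro smooth_on_add[OF mfd] smooth_on_mult[OF mfd] smooth_dir_deriv[OF X c(1)] smooth_on_inverse[OF mfd]
      smooth_on_sum[OF mfd] smooth_on_partial[OF mfd smooth_chart_components[OF mfd c(1) X] _ _ c(1)] o)
      (use nv c in \<open>auto simp: nonvanishing_def\<close>)
  then have "smooth_on M (fst c) (vf_div M \<mu> X)"
    by (rule smooth_on_cong[OF mfd _ o]) (simp add: vf_div_chart[OF X c(1)] divide_inverse)
  then show "\<exists>U. open U \<and> x \<in> U \<and> smooth_on M (UNIV \<inter> U) (vf_div M \<mu> X)"
    using o c(2) by auto
qed

text \<open>Constant \<open>g\<close>, \<open>h\<close> give linearity of the divergence, and \<open>h = 0\<close> its Leibniz rule.\<close>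
lemma vf_div_combine:
  assumes X: "smooth_vf M X" and Y: "smooth_vf M Y" and Z: "smooth_vf M Z"
    and g: "g \<in> smooth_functions M" and h: "h \<in> smooth_functions M"
    and lin: "\<And>y f. f \<in> smooth_functions M \<Longrightarrow> Z y f = g y * X y f + h y * Y y f"
  shows "vf_div M \<mu> Z x = g x * vf_div M \<mu> X x + X x g + h x * vf_div M \<mu> Y x + Y x h"
proof -
  obtain c where c: "c \<in> atlas M" "x \<in> fst c" using atlas_cover[OF mfd] by blast
  note o = atlas_open[OF mfd c(1)]
  have T: "tangent_vector M y (X y)" "tangent_vector M y (Y y)" "tangent_vector M y (Z y)" for y
    using X Y Z by (auto simp: smooth_vf_def)
  have comp: "chart_components M c y (Z y) $ i = g y * chart_components M c y (X y) $ i + h y * chart_components M c y (Y y) $ i"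
    if "i \<in> coords M" "y \<in> fst c" for i y
    by (rule chart_components_combine[OF mfd c(1) that(2,1) T lin])
  have sg: "smooth_on M (fst c) g" and sh: "smooth_on M (fst c) h"
    using g h smooth_on_subset[OF mfd _ subset_UNIV] by (auto simp: smooth_functions_iff)
  have part: "partial c i (\<lambda>y. chart_components M c y (Z y) $ i) x =
      partial c i g x * chart_components M c x (X x) $ i + g x * partial c i (\<lambda>y. chart_components M c y (X y) $ i) x
      + (partial c i h x * chart_components M c x (Y x) $ i + h x * partial c i (\<lambda>y. chart_components M c y (Y y) $ i) x)"
    if i: "i \<in> coords M" for i
  proof -
    note sc = smooth_chart_components[OF mfd c(1) X i] smooth_chart_components[OF mfd c(1) Y i]
    have "partial c i (\<lambda>y. chart_components M c y (Z y) $ i) x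
      = partial c i (\<lambda>y. g y * chart_components M c y (X y) $ i + h y * chart_components M c y (Y y) $ i) x"
      by (rule partial_eq_near[OF mfd o c(2) c(2,1) i]) (rule comp[OF i])
    also have "\<dots> = partial c i (\<lambda>y. g y * chart_components M c y (X y) $ i) x + partial c i (\<lambda>y. h y * chart_components M c y (Y y) $ i) x"
      by (intro partial_add[OF mfd c c(2) i o] smooth_on_mult[OF mfd o] sg sh sc)
    also have "partial c i (\<lambda>y. g y * chart_components M c y (X y) $ i) x =
      partial c i g x * chart_components M c x (X x) $ i + g x * partial c i (\<lambda>y. chart_components M c y (X y) $ i) x"
      by (rule partial_mult[OF mfd c c(2) i o sg sc(1)])
    also have "partial c i (\<lambda>y. h y * chart_components M c y (Y y) $ i) x =
      partial c i h x * chart_components M c x (Y x) $ i + h x * partial c i (\<lambda>y. chart_components M c y (Y y) $ i) x"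
      by (rule partial_mult[OF mfd c c(2) i o sh sc(2)])
    finally show ?thesis .
  qed
  have "chart_div M c Z x = dir_deriv M c X g x + g x * chart_div M c X x + (dir_deriv M c Y h x + h x * chart_div M c Y x)"
    unfolding chart_div_def dir_deriv_def
    by (simp add: part sum.distrib sum_distrib_left mult_ac)
  moreover have "dir_deriv M c Z f x = g x * dir_deriv M c X f x + h x * dir_deriv M c Y f x" for f
    unfolding dir_deriv_def by (simp add: comp c(2) sum.distrib sum_distrib_left distrib_left distrib_right mult_ac)
  moreover have "dir_deriv M c X g x = X x g" "dir_deriv M c Y h x = Y x h"
    using dir_deriv_smooth[OF mfd c] T g h by auto
  ultimately show ?thesis
    by (simp add: vf_div_chart[OF X c] vf_div_chart[OF Y c] vf_div_chart[OF Z c] field_simps add_divide_distrib)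
qed

lemma vf_div_local:
  assumes "open U" "x \<in> U" "\<And>y. y \<in> U \<Longrightarrow> X y = Y y"
  shows "vf_div M \<mu> X x = vf_div M \<mu> Y x"
proof -
  define c where "c = (SOME c. c \<in> atlas M \<and> x \<in> fst c)"
  have c: "c \<in> atlas M" "x \<in> fst c" using chosen_chart[of x] by (auto simp: c_def)
  have "partial c i (\<lambda>y. chart_components M c y (X y) $ j) x = partial c i (\<lambda>y. chart_components M c y (Y y) $ j) x"
    if "i \<in> coords M" for i j
    by (rule partial_eq_near[OF mfd assms(1,2) c(2,1) that]) (use assms(3) in auto)
  then have "lie_density M 1 X \<mu> c x = lie_density M 1 Y \<mu> c x"
    using assms(3)[OF assms(2)] by (simp add: lie_density_def)
  then show ?thesis unfolding vf_div_def density_ratio_def by (simp add: Let_def c_def[symmetric])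
qed

end

context
  fixes M :: "('m::{t2_space, second_countable_topology}, 'n::finite) mfd" and \<sigma> :: "('m, 'n) dens"
  assumes mfd: "manifold M" and half: "is_density M (1/2) \<sigma>" and nv: "nonvanishing M \<sigma>"
begin

lemma half_density_square: "is_density M 1 (\<lambda>k y. (\<sigma> k y)\<^sup>2)"
  unfolding is_density_def
proof (intro conjI ballI)
  fix c assume c: "c \<in> atlas M"
  show "smooth_on M (fst c) (\<lambda>y. (\<sigma> c y)\<^sup>2)"
    using smooth_on_mult[OF mfd atlas_open[OF mfd c], of "\<sigma> c" "\<sigma> c"] half c
    by (simp add: is_density_def power2_eq_square)
  fix d x assume d: "d \<in> atlas M" and x: "x \<in> fst c \<inter> fst d"
  have "\<sigma> c x = \<bar>det (coord_jacobian M c d x)\<bar> powr (1/2) * \<sigma> d x"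
    using half c d x unfolding is_density_def by blast
  moreover have "(t powr (1/2))\<^sup>2 = t powr 1" for t :: real
    by (simp add: power2_eq_square powr_add[symmetric])
  ultimately show "(\<sigma> c x)\<^sup>2 = \<bar>det (coord_jacobian M c d x)\<bar> powr 1 * (\<sigma> d x)\<^sup>2"
    by (simp add: power_mult_distrib)
qed

lemma nonvanishing_square: "nonvanishing M (\<lambda>k y. (\<sigma> k y)\<^sup>2)"
  using nv by (auto simp: nonvanishing_def)

text \<open>Half of the logarithmic derivative of the square is the logarithmic derivative.\<close>
lemma lie_half_density:
  assumes X: "smooth_vf M X" and c: "c \<in> atlas M" "x \<in> fst c"
  shows "lie_density M (1/2) X \<sigma> c x = 1/2 * vf_div M (\<lambda>k y. (\<sigma> k y)\<^sup>2) X x * \<sigma> c x"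
proof -
  have s: "smooth_on M (fst c) (\<sigma> c)" using half c by (simp add: is_density_def)
  have nz: "\<sigma> c x \<noteq> 0" using nv c by (auto simp: nonvanishing_def)
  have D2: "dir_deriv M c X (\<lambda>y. (\<sigma> c y)\<^sup>2) x = 2 * \<sigma> c x * dir_deriv M c X (\<sigma> c) x"
    unfolding power2_eq_square by (subst dir_deriv_mult[OF mfd c atlas_open[OF mfd c(1)] c(2) s s]) simp
  show ?thesis
    unfolding vf_div_chart[OF mfd half_density_square nonvanishing_square X c] lie_density_eq D2
    using nz by (simp add: field_simps power2_eq_square)
qed

text \<open>Apply the previous formula twice: with \<open>L\<^sub>X \<sigma> = 1/2 (D X) \<sigma>\<close> the second Lie derivative is the derivative of
  a product.\<close>
lemma lie_half_density_twice:
  assumes X: "smooth_vf M X" and Y: "smooth_vf M Y" and c: "c \<in> atlas M" "x \<in> fst c"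
  defines "D \<equiv> vf_div M (\<lambda>k y. (\<sigma> k y)\<^sup>2)"
  shows "4 * lie_density M (1/2) Y (lie_density M (1/2) X \<sigma>) c x
    = (D Y x * D X x + 2 * Y x (D X)) * \<sigma> c x"
proof -
  note o = atlas_open[OF mfd c(1)]
  have s: "smooth_on M (fst c) (\<sigma> c)" using half c by (simp add: is_density_def)
  have DX: "D X \<in> smooth_functions M"
    unfolding D_def by (rule vf_div_smooth[OF mfd half_density_square nonvanishing_square X])
  have sD: "smooth_on M (fst c) (\<lambda>y. 1/2 * D X y)"
    using DX smooth_on_subset[OF mfd _ subset_UNIV] by (intro smooth_on_mult[OF mfd o] smooth_on_const[OF mfd]) (auto simp: smooth_functions_iff)
  have TY: "tangent_vector M x (Y x)" using Y by (simp add: smooth_vf_def)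
  have "dir_deriv M c Y (lie_density M (1/2) X \<sigma> c) x = dir_deriv M c Y (\<lambda>y. (1/2 * D X y) * \<sigma> c y) x"
    by (rule dir_deriv_cong[OF mfd c o c(2)]) (use lie_half_density[OF X c(1)] in \<open>auto simp: D_def\<close>)
  also have "\<dots> = 1/2 * D X x * dir_deriv M c Y (\<sigma> c) x + \<sigma> c x * dir_deriv M c Y (\<lambda>y. 1/2 * D X y) x"
    by (rule dir_deriv_mult[OF mfd c o c(2) sD s])
  also have "dir_deriv M c Y (\<lambda>y. 1/2 * D X y) x = 1/2 * dir_deriv M c Y (D X) x"
  proof -
    have sDX: "smooth_on M (fst c) (D X)"
      using DX smooth_on_subset[OF mfd _ subset_UNIV] by (auto simp: smooth_functions_iff)
    have z: "dir_deriv M c Y (\<lambda>y. 1/2) x = 0"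
      unfolding dir_deriv_def using partial_const[OF mfd c UNIV_I _ open_UNIV] by simp
    show ?thesis
      using dir_deriv_mult[OF mfd c o c(2) smooth_on_const[OF mfd] sDX, where X=Y, of "1/2"] z by simp
  qed
  also have "dir_deriv M c Y (D X) x = Y x (D X)" by (rule dir_deriv_smooth[OF mfd c _ DX]) (rule TY)
  finally have d: "dir_deriv M c Y (lie_density M (1/2) X \<sigma> c) x
     = 1/2 * D X x * dir_deriv M c Y (\<sigma> c) x + \<sigma> c x * (1/2 * Y x (D X))" .
  have "lie_density M (1/2) Y (lie_density M (1/2) X \<sigma>) c x =
     1/2 * D X x * lie_density M (1/2) Y \<sigma> c x + \<sigma> c x * (1/2 * Y x (D X))"
    unfolding lie_density_eq[of M "1/2" Y] d
    using lie_half_density[OF X c] by (simp add: D_def field_simps)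
  then show ?thesis unfolding lie_half_density[OF Y c] by (simp add: D_def field_simps)
qed

end

section \<open>Existence of half-densities\<close>

context
  fixes M :: "('m::{t2_space, second_countable_topology}, 'n::finite) mfd"
  assumes mfd: "manifold M"
begin

text \<open>By the Lindelof property countably many bump functions \<open>f n\<close> are somewhere positive. Cutting \<open>f n\<close> off
  where some earlier \<open>f k\<close> exceeds \<open>1/(n+1)\<close> makes the family locally finite: where \<open>f k > a\<close>, all
  members with \<open>n > k\<close> and \<open>1/(n+1) < a\<close> vanish. It still covers, because nothing is cut off at a point
  from the first \<open>f n\<close> that is positive there.\<close>
lemma locally_finite_bumps:
  obtains c :: "nat \<Rightarrow> ('m, 'n) chart" and \<psi> :: "nat \<Rightarrow> 'm \<Rightarrow> real" and K :: "nat \<Rightarrow> 'm set"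
  where "\<And>n. c n \<in> atlas M" "\<And>n. \<psi> n \<in> smooth_functions M" "\<And>n. closed (K n)" "\<And>n. K n \<subseteq> fst (c n)"
    "\<And>n x. x \<notin> K n \<Longrightarrow> \<psi> n x = 0" "\<And>n x. \<psi> n x \<ge> 0" "\<And>x. \<exists>n. \<psi> n x > 0"
    "\<And>x. \<exists>U N. open U \<and> x \<in> U \<and> (\<forall>n\<ge>N. \<forall>y\<in>U. \<psi> n y = 0)"
proof -
  have "\<exists>t. fst t \<in> atlas M \<and> fst (snd t) \<in> smooth_functions M \<and> closed (snd (snd t)) \<and> snd (snd t) \<subseteq> fst (fst t) \<and>
      (\<forall>y. fst (snd t) y \<ge> 0) \<and> fst (snd t) x > 0 \<and> (\<forall>y. y \<notin> snd (snd t) \<longrightarrow> fst (snd t) y = 0)" for x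
  proof -
    obtain c where c: "c \<in> atlas M" "x \<in> fst c" using atlas_cover[OF mfd] by blast
    obtain f K where "f \<in> smooth_functions M" "closed K" "K \<subseteq> fst c" "\<And>y. f y \<ge> 0" "f x > 0"
      "\<And>y. y \<notin> K \<Longrightarrow> f y = 0" using bump_function[OF mfd atlas_open[OF mfd c(1)] c(2)] by metis
    then show ?thesis using c by (intro exI[of _ "(c, f, K)"]) auto
  qed
  then obtain t where t: "\<And>x. fst (t x) \<in> atlas M" "\<And>x. fst (snd (t x)) \<in> smooth_functions M"
      "\<And>x. closed (snd (snd (t x)))" "\<And>x. snd (snd (t x)) \<subseteq> fst (fst (t x))"
      "\<And>x y. fst (snd (t x)) y \<ge> 0" "\<And>x. fst (snd (t x)) x > 0"
      "\<And>x y. y \<notin> snd (snd (t x)) \<Longrightarrow> fst (snd (t x)) y = 0"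
    by metis
  define P where "P x = fst (snd (t x)) -` {0<..}" for x
  have opn: "open (f -` {a<..})" if "f \<in> smooth_functions M" for f :: "'m \<Rightarrow> real" and a
    using smooth_on_continuous[OF mfd _ open_UNIV] that by (simp add: open_vimage smooth_functions_iff)
  obtain F' where F': "F' \<subseteq> range P" "countable F'" "\<Union>F' = \<Union>(range P)"
    using Lindelof[of "range P"] opn[OF t(2)] unfolding P_def by (metis (no_types, lifting) imageE)
  have cov: "\<Union>F' = UNIV" using F'(3) t(6) by (auto simp: P_def)
  then have "F' \<noteq> {}" by auto
  obtain s where s: "F' = P ` s" "countable s" using F' by (meson countable_subset_image)
  then have "s \<noteq> {}" using \<open>F' \<noteq> {}\<close> by auto
  define q where "q = from_nat_into s"
  have q: "range q = s" unfolding q_def using s \<open>s \<noteq> {}\<close> by (simp add: range_from_nat_into)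
  define f where "f n = fst (snd (t (q n)))" for n
  have f: "f n \<in> smooth_functions M" "f n y \<ge> 0" for n y by (simp_all add: f_def t)
  have pos: "\<exists>n. f n x > 0" for x
  proof -
    have "x \<in> \<Union>(P ` range q)" using cov s q by auto
    then show ?thesis by (auto simp: P_def f_def)
  qed
  define \<psi> where "\<psi> n x = f n x * (\<Prod>k<n. flat (1 / real (Suc n) - f k x))" for n x
  show thesis
  proof (rule that[of "\<lambda>n. fst (t (q n))" \<psi> "\<lambda>n. snd (snd (t (q n)))"])
    show "\<psi> n \<in> smooth_functions M" for n
      unfolding \<psi>_def[abs_def] smooth_functions_iff
      by (intro smooth_on_mult[OF mfd] smooth_on_prod[OF mfd] smooth_on_real_compose[OF mfd _ _ real_smooth_flat]
          smooth_on_diff[OF mfd] smooth_on_const[OF mfd] f(1)[unfolded smooth_functions_iff]) auto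
    show "x \<notin> snd (snd (t (q n))) \<Longrightarrow> \<psi> n x = 0" for n x using t(7) by (simp add: \<psi>_def f_def)
    show "\<psi> n x \<ge> 0" for n x unfolding \<psi>_def by (intro mult_nonneg_nonneg prod_nonneg f flat_nonneg)
    show "\<exists>n. \<psi> n x > 0" for x
    proof -
      define n where "n = (LEAST n. f n x > 0)"
      have n: "f n x > 0" unfolding n_def using pos by (rule LeastI_ex)
      have "f k x = 0" if "k < n" for k
        using not_less_Least[of k "\<lambda>n. f n x > 0"] that f(2)[of k x] by (simp add: n_def)
      then have "(\<Prod>k<n. flat (1 / real (Suc n) - f k x)) > 0" by (intro prod_pos) auto
      then show ?thesis using n by (auto simp: \<psi>_def intro!: exI[of _ n])
    qed
    show "\<exists>U N. open U \<and> x \<in> U \<and> (\<forall>n\<ge>N. \<forall>y\<in>U. \<psi> n y = 0)" for x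
    proof -
      obtain k where k: "f k x > 0" using pos by blast
      define a where "a = f k x / 2"
      have a: "a > 0" "a < f k x" using k by (auto simp: a_def)
      obtain N where N: "1 / real (Suc N) < a" using reals_Archimedean[OF a(1)] by (auto simp: inverse_eq_divide)
      show ?thesis
      proof (intro exI conjI allI impI ballI)
        show "open (f k -` {a<..})" by (rule opn[OF f(1)])
        show "x \<in> f k -` {a<..}" using a by simp
        fix n y assume n: "n \<ge> max N (Suc k)" and y: "y \<in> f k -` {a<..}"
        have "1 / real (Suc n) \<le> 1 / real (Suc N)" using n by (simp add: frac_le)
        then have "flat (1 / real (Suc n) - f k y) = 0" using N y by simp
        then have "(\<Prod>k<n. flat (1 / real (Suc n) - f k y)) = 0" using n by (intro prod_zero) (auto intro!: bexI[of _ k])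
        then show "\<psi> n y = 0" by (simp add: \<psi>_def)
      qed
    qed
  qed (use t in auto)
qed

text \<open>The coordinate half-densities of the charts around the bump functions are added with these positive
  weights. Their coefficients in any other chart are positive, so the sum does not vanish.\<close>
lemma nonvanishing_half_density_exists: "\<exists>\<sigma>. is_density M (1/2) \<sigma> \<and> nonvanishing M \<sigma>"
proof -
  obtain c :: "nat \<Rightarrow> ('m, 'n) chart" and \<psi> :: "nat \<Rightarrow> 'm \<Rightarrow> real" and K :: "nat \<Rightarrow> 'm set" where b: "\<And>n. c n \<in> atlas M" "\<And>n. \<psi> n \<in> smooth_functions M" "\<And>n. closed (K n)" "\<And>n. K n \<subseteq> fst (c n)"
    "\<And>n x. x \<notin> K n \<Longrightarrow> \<psi> n x = 0" "\<And>n x. \<psi> n x \<ge> 0" "\<And>x. \<exists>n. \<psi> n x > 0"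
    "\<And>x. \<exists>U N. open U \<and> x \<in> U \<and> (\<forall>n\<ge>N. \<forall>y\<in>U. \<psi> n y = 0)"
    by (rule locally_finite_bumps, rule that, assumption+)
  define w where "w n d y = \<bar>det (coord_jacobian M d (c n) y)\<bar> powr (1/2)" for n d y
  define \<sigma> where "\<sigma> d y = (\<Sum>n | \<psi> n y \<noteq> 0. \<psi> n y * w n d y)" for d y
  have inK: "x \<in> fst (c n)" if "\<psi> n x \<noteq> 0" for n x using b(4,5) that by blast
  have fin: "finite {n. \<psi> n x \<noteq> 0}" for x
  proof -
    obtain U N where "x \<in> U" "\<forall>n\<ge>N. \<forall>y\<in>U. \<psi> n y = 0" using b(8) by blast
    then have "{n. \<psi> n x \<noteq> 0} \<subseteq> {..<N}" by (auto simp: not_le[symmetric])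
    then show ?thesis by (rule finite_subset) simp
  qed
  have smooth_term: "smooth_on M (fst d) (\<lambda>y. \<psi> n y * w n d y)" if d: "d \<in> atlas M" for n d
  proof (rule smooth_on_local[OF mfd atlas_open[OF mfd d]])
    fix x assume x: "x \<in> fst d"
    show "\<exists>U. open U \<and> x \<in> U \<and> smooth_on M (fst d \<inter> U) (\<lambda>y. \<psi> n y * w n d y)"
    proof (cases "x \<in> K n")
      case True
      let ?W = "fst d \<inter> fst (c n)"
      have o: "open ?W" by (intro open_Int atlas_open[OF mfd] d b)
      have sD: "smooth_on M ?W (\<lambda>y. det (coord_jacobian M d (c n) y))" by (rule smooth_det_coord_jacobian[OF mfd d b(1)])
      have "smooth_on M ?W (\<lambda>y. (det (coord_jacobian M d (c n) y) * det (coord_jacobian M d (c n) y)) powr (1/4))"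
      proof (rule smooth_on_real_compose[OF mfd o smooth_on_mult[OF mfd o sD sD] real_smooth_powr])
        show "(\<lambda>y. det (coord_jacobian M d (c n) y) * det (coord_jacobian M d (c n) y)) ` ?W \<subseteq> {0<..}"
          using det_coord_jacobian_nz[OF mfd d b(1)] not_real_square_gt_zero by (fastforce simp: image_subset_iff)
      qed
      moreover have "(t * t) powr (1/4) = \<bar>t\<bar> powr (1/2)" for t :: real
      proof -
        have "(t * t) powr (1/4) = (\<bar>t\<bar> * \<bar>t\<bar>) powr (1/4)" by simp
        also have "\<dots> = \<bar>t\<bar> powr (1/4) * \<bar>t\<bar> powr (1/4)" by (rule powr_mult)
        also have "\<dots> = \<bar>t\<bar> powr (1/2)" by (simp add: powr_add[symmetric])
        finally show ?thesis .
      qed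
      ultimately have "smooth_on M ?W (w n d)" by (simp add: w_def[abs_def])
      moreover have "smooth_on M ?W (\<psi> n)" using b(2) smooth_on_subset[OF mfd _ subset_UNIV] by (auto simp: smooth_functions_iff)
      ultimately have "smooth_on M ?W (\<lambda>y. \<psi> n y * w n d y)" by (intro smooth_on_mult[OF mfd o])
      then show ?thesis using True b(4) atlas_open[OF mfd b(1)] by blast
    next
      case False
      have "smooth_on M (fst d \<inter> - K n) (\<lambda>y. \<psi> n y * w n d y)"
        by (rule smooth_on_cong[OF mfd smooth_on_const[OF mfd, of _ 0]])
          (use b(3,5) atlas_open[OF mfd d] in auto)
      then show ?thesis using False b(3) by (intro exI[of _ "- K n"]) auto
    qed
  qed
  have "is_density M (1/2) \<sigma>"
    unfolding is_density_def
  proof (intro conjI ballI)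
    fix d assume d: "d \<in> atlas M"
    show "smooth_on M (fst d) (\<sigma> d)"
    proof (rule smooth_on_local[OF mfd atlas_open[OF mfd d]])
      fix x assume x: "x \<in> fst d"
      obtain U N where U: "open U" "x \<in> U" "\<forall>n\<ge>N. \<forall>y\<in>U. \<psi> n y = 0" using b(8) by blast
      have o: "open (fst d \<inter> U)" by (intro open_Int atlas_open[OF mfd] d U)
      have "smooth_on M (fst d \<inter> U) (\<lambda>y. \<Sum>n<N. \<psi> n y * w n d y)"
        by (rule smooth_on_sum[OF mfd o]) (rule smooth_on_subset[OF mfd smooth_term[OF d]], auto)
      then have "smooth_on M (fst d \<inter> U) (\<sigma> d)"
      proof (rule smooth_on_cong[OF mfd _ o])
        fix y assume "y \<in> fst d \<inter> U"
        then show "(\<Sum>n<N. \<psi> n y * w n d y) = \<sigma> d y" unfolding \<sigma>_def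
          using U(3) by (intro sum.mono_neutral_right) (auto simp: not_le[symmetric])
      qed
      then show "\<exists>U. open U \<and> x \<in> U \<and> smooth_on M (fst d \<inter> U) (\<sigma> d)" using U by blast
    qed
    fix e x assume e: "e \<in> atlas M" and x: "x \<in> fst d \<inter> fst e"
    have "w n d x = \<bar>det (coord_jacobian M d e x)\<bar> powr (1/2) * w n e x" if "\<psi> n x \<noteq> 0" for n
    proof -
      have "coord_jacobian M e (c n) x ** coord_jacobian M d e x = coord_jacobian M d (c n) x"
        by (rule coord_jacobian_mult[OF mfd d e b(1)]) (use x inK[OF that] in auto)
      then show ?thesis unfolding w_def by (simp add: det_mul abs_mult powr_mult flip: \<open>_ = coord_jacobian M d (c n) x\<close>)
    qed
    then show "\<sigma> d x = \<bar>det (coord_jacobian M d e x)\<bar> powr (1/2) * \<sigma> e x"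
      unfolding \<sigma>_def sum_distrib_left by (intro sum.cong refl) (simp add: mult_ac)
  qed
  moreover have "nonvanishing M \<sigma>"
    unfolding nonvanishing_def
  proof (intro ballI)
    fix d x assume d: "d \<in> atlas M" and x: "x \<in> fst d"
    obtain n where n: "\<psi> n x > 0" using b(7) by blast
    have "det (coord_jacobian M d (c n) x) \<noteq> 0"
      by (rule det_coord_jacobian_nz[OF mfd d b(1) x inK]) (use n in simp)
    then have "\<psi> n x * w n d x > 0" using n by (simp add: w_def)
    then have "\<sigma> d x > 0" unfolding \<sigma>_def
      by (intro sum_pos2[OF fin, of n]) (use n b(6) in \<open>auto simp: w_def\<close>)
    then show "\<sigma> d x \<noteq> 0" by simp
  qed
  ultimately show ?thesis by blast
qed

end

section \<open>Bases of subspaces\<close>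

lemma basis_family_coeff_0:
  assumes "basis_family W J b" "finite J" "(\<Sum>j\<in>J. g j *\<^sub>R b j) = 0" "j \<in> J"
  shows "g j = 0"
proof -
  have inj: "inj_on b J" and ind: "independent (b ` J)" using assms(1) by (auto simp: basis_family_def)
  have "(\<Sum>v\<in>b ` J. g (inv_into J b v) *\<^sub>R v) = (\<Sum>j\<in>J. g j *\<^sub>R b j)"
    by (subst sum.reindex[OF inj]) (simp add: inj)
  then have "g (inv_into J b (b j)) = 0"
    using independentD[OF ind, of "b ` J" "\<lambda>v. g (inv_into J b v)" "b j"] assms by simp
  then show ?thesis using inj assms(4) by simp
qed

lemma basis_family_coeff_unique:
  assumes "basis_family W J b" "finite J" "(\<Sum>j\<in>J. g j *\<^sub>R b j) = (\<Sum>j\<in>J. h j *\<^sub>R b j)" "j \<in> J"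
  shows "g j = h j"
  using basis_family_coeff_0[OF assms(1,2), of "\<lambda>j. g j - h j" j] assms(3,4)
  by (simp add: scaleR_left_diff_distrib sum_subtractf)

lemma basis_family_expand:
  assumes "basis_family W J b" "finite J" "v \<in> W"
  obtains g where "v = (\<Sum>j\<in>J. g j *\<^sub>R b j)"
proof -
  have inj: "inj_on b J" and sp: "span (b ` J) = W" using assms(1) by (auto simp: basis_family_def)
  have "v \<in> span (b ` J)" using assms sp by simp
  then obtain u where "v = (\<Sum>w\<in>b ` J. u w *\<^sub>R w)" using span_finite[of "b ` J"] assms(2) by auto
  then have "v = (\<Sum>j\<in>J. u (b j) *\<^sub>R b j)" by (simp add: sum.reindex[OF inj])
  then show thesis by (rule that)
qed

lemma basis_family_mem: "basis_family W J b \<Longrightarrow> j \<in> J \<Longrightarrow> b j \<in> W"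
  by (auto simp: basis_family_def intro: span_base)

lemma basis_familyI:
  assumes "finite J" "\<And>g j. (\<Sum>j\<in>J. g j *\<^sub>R b j) = 0 \<Longrightarrow> j \<in> J \<Longrightarrow> g j = 0"
  shows "basis_family (span (b ` J)) J b"
proof -
  have inj: "inj_on b J"
  proof (rule inj_onI, rule ccontr)
    fix i j assume ij: "i \<in> J" "j \<in> J" "b i = b j" "i \<noteq> j"
    have "(\<Sum>k\<in>J. (if k = i then 1 else if k = j then -1 else 0) *\<^sub>R b k)
      = (\<Sum>k\<in>J. (if k = i then b i else 0) + (if k = j then - b j else 0))"
      using ij(4) by (intro sum.cong refl) auto
    also have "\<dots> = 0" using assms(1) ij by (simp add: sum.distrib)
    finally have "(\<lambda>k. if k = i then 1 else if k = j then -1 else (0::real)) i = 0"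
      by (rule assms(2)) (rule ij(1))
    then show False by simp
  qed
  have "independent (b ` J)"
  proof (rule independent_if_scalars_zero[OF finite_imageI[OF assms(1)]])
    fix f v assume "(\<Sum>x\<in>b ` J. f x *\<^sub>R x) = 0" "v \<in> b ` J"
    then obtain j where j: "j \<in> J" "v = b j" by auto
    have "(\<Sum>j\<in>J. f (b j) *\<^sub>R b j) = 0" using \<open>(\<Sum>x\<in>b ` J. f x *\<^sub>R x) = 0\<close> by (simp add: sum.reindex[OF inj])
    then show "f v = 0" using assms(2)[of "\<lambda>j. f (b j)" j] j by simp
  qed
  then show ?thesis using inj by (simp add: basis_family_def)
qed

lemma basis_family_card_le:
  assumes W: "basis_family W J b" "finite J" and J': "basis_family W' J' b'" "finite J'" "W' \<subseteq> W"
  shows "card J' \<le> card J"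
proof -
  have "b' ` J' \<subseteq> span (b ` J)" using assms by (auto simp: basis_family_def intro: span_base)
  moreover have "independent (b' ` J')" using J'(1) by (simp add: basis_family_def)
  ultimately have "card (b' ` J') \<le> card (b ` J)"
    using independent_span_bound[OF finite_imageI[OF W(2)]] by blast
  then show ?thesis using W(1) J'(1) by (simp add: basis_family_def card_image)
qed

lemma basis_family_eq:
  assumes W: "basis_family W J b" "finite J" and J': "basis_family W' J' b'" "finite J'" "W' \<subseteq> W" and c: "card J = card J'"
  shows "W' = W"
proof (rule ccontr)
  assume "W' \<noteq> W"
  then obtain v where v: "v \<in> W" "v \<notin> W'" using J'(3) by auto
  have ind: "independent (b' ` J')" "span (b' ` J') = W'" "inj_on b' J'" using J'(1) by (auto simp: basis_family_def)
  have i2: "independent (insert v (b' ` J'))" using ind v by (simp add: independent_insertI)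
  have "v \<notin> b' ` J'" using v ind by (auto intro: span_base)
  then have "card (insert v (b' ` J')) = Suc (card J')" using J'(2) ind by (simp add: card_image)
  moreover have "insert v (b' ` J') \<subseteq> span (b ` J)" using v W J' ind by (auto simp: basis_family_def intro: span_base)
  ultimately have "Suc (card J') \<le> card (b ` J)"
    using independent_span_bound[OF finite_imageI[OF W(2)] i2] by metis
  also have "\<dots> \<le> card J" using W(2) by (rule card_image_le)
  finally show False using c by simp
qed

section \<open>Sections\<close>

context
  fixes M :: "('m::{t2_space, second_countable_topology}, 'n::finite) mfd"
    and E :: "('m, 'v::real_vector, 'z) vbundle_scheme"
  assumes mfd: "manifold M" and vb: "vector_bundle M E"
begin

lemma fibre_subspace: "subspace (fibre E x)"
  using vb by (simp add: vector_bundle_def)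

lemma triv_cover: obtains U s where "(U, s) \<in> trivs E" "x \<in> U"
proof -
  have "x \<in> (\<Union>t\<in>trivs E. fst t)" using vb by (simp add: vector_bundle_def)
  then show thesis using that by (metis UN_E prod.collapse)
qed

lemma triv_open: "(U, s) \<in> trivs E \<Longrightarrow> open U"
  and triv_basis: "(U, s) \<in> trivs E \<Longrightarrow> x \<in> U \<Longrightarrow> basis_family (fibre E x) {..<fibre_dim E} (\<lambda>i. s i x)"
  using vb unfolding vector_bundle_def by fastforce+

lemma section_fibre: "u \<in> sections M E \<Longrightarrow> u x \<in> fibre E x"
  by (simp add: sections_def smooth_section_on_def)

lemma smooth_section_on_coeff:
  assumes "smooth_section_on M E W u" "(U, s) \<in> trivs E"
  obtains g where "\<And>i. i < fibre_dim E \<Longrightarrow> smooth_on M (U \<inter> W) (g i)"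
    "\<And>x. x \<in> U \<inter> W \<Longrightarrow> u x = (\<Sum>i<fibre_dim E. g i x *\<^sub>R s i x)"
proof -
  have "\<exists>g. (\<forall>i<fibre_dim E. smooth_on M (U \<inter> W) (g i)) \<and>
        (\<forall>x\<in>U \<inter> W. u x = (\<Sum>i<fibre_dim E. g i x *\<^sub>R s i x))"
    using assms unfolding smooth_section_on_def by blast
  then show thesis using that by blast
qed

lemma triv_smooth_section:
  assumes "(U, s) \<in> trivs E" "j < fibre_dim E"
  shows "smooth_section_on M E U (s j)"
  unfolding smooth_section_on_def
proof (intro conjI ballI)
  fix x assume "x \<in> U"
  then show "s j x \<in> fibre E x" using basis_family_mem[OF triv_basis[OF assms(1)]] assms(2) by auto
next
  fix t assume t: "t \<in> trivs E"
  obtain U' s' where [simp]: "t = (U', s')" by (cases t)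
  have A: "\<forall>(U, s)\<in>trivs E. \<forall>(U', s')\<in>trivs E. \<forall>j<fibre_dim E. \<exists>g.
        (\<forall>i<fibre_dim E. smooth_on M (U \<inter> U') (g i)) \<and>
        (\<forall>x\<in>U \<inter> U'. s' j x = (\<Sum>i<fibre_dim E. g i x *\<^sub>R s i x))"
    using vb by (simp add: vector_bundle_def)
  from bspec[OF A t] have B: "\<forall>(Ua, sa)\<in>trivs E. \<forall>j<fibre_dim E. \<exists>g.
        (\<forall>i<fibre_dim E. smooth_on M (U' \<inter> Ua) (g i)) \<and>
        (\<forall>x\<in>U' \<inter> Ua. sa j x = (\<Sum>i<fibre_dim E. g i x *\<^sub>R s' i x))" by simp
  from bspec[OF B assms(1)] assms(2)
  show "case t of (Ua, sa) \<Rightarrow> \<exists>g. (\<forall>i<fibre_dim E. smooth_on M (Ua \<inter> U) (g i)) \<and>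
        (\<forall>x\<in>Ua \<inter> U. s j x = (\<Sum>i<fibre_dim E. g i x *\<^sub>R sa i x))" by simp
qed

lemma smooth_section_subset:
  assumes "smooth_section_on M E W u" "W' \<subseteq> W"
  shows "smooth_section_on M E W' u"
  unfolding smooth_section_on_def
proof (intro conjI ballI)
  show "u x \<in> fibre E x" if "x \<in> W'" for x using assms that by (auto simp: smooth_section_on_def)
  fix t assume t: "t \<in> trivs E"
  obtain U s where [simp]: "t = (U, s)" by (cases t)
  obtain g where g: "\<And>i. i < fibre_dim E \<Longrightarrow> smooth_on M (U \<inter> W) (g i)"
    "\<And>x. x \<in> U \<inter> W \<Longrightarrow> u x = (\<Sum>i<fibre_dim E. g i x *\<^sub>R s i x)"
    using smooth_section_on_coeff[OF assms(1)] t by auto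
  have sub: "U \<inter> W' \<subseteq> U \<inter> W" using assms(2) by auto
  have "\<exists>g. (\<forall>i<fibre_dim E. smooth_on M (U \<inter> W') (g i)) \<and> (\<forall>x\<in>U \<inter> W'. u x = (\<Sum>i<fibre_dim E. g i x *\<^sub>R s i x))"
    by (rule exI[of _ g]) (use g sub smooth_on_subset[OF mfd _ sub] in auto)
  then show "case t of (U, s) \<Rightarrow> \<exists>g. (\<forall>i<fibre_dim E. smooth_on M (U \<inter> W') (g i)) \<and>
        (\<forall>x\<in>U \<inter> W'. u x = (\<Sum>i<fibre_dim E. g i x *\<^sub>R s i x))" by simp
qed

lemma smooth_section_combine:
  assumes W: "open W" and u: "smooth_section_on M E W u" and v: "smooth_section_on M E W v"
    and f: "smooth_on M W f" and h: "smooth_on M W h"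
    and eq: "\<And>x. x \<in> W \<Longrightarrow> w x = f x *\<^sub>R u x + h x *\<^sub>R v x"
  shows "smooth_section_on M E W w"
  unfolding smooth_section_on_def
proof (intro conjI ballI)
  show "w x \<in> fibre E x" if "x \<in> W" for x
    unfolding eq[OF that] using u v that fibre_subspace
    by (auto simp: smooth_section_on_def intro!: subspace_add subspace_scale)
  fix t assume t: "t \<in> trivs E"
  obtain U s where [simp]: "t = (U, s)" by (cases t)
  have Us: "(U, s) \<in> trivs E" using t by simp
  obtain g where g: "\<And>i. i < fibre_dim E \<Longrightarrow> smooth_on M (U \<inter> W) (g i)"
    "\<And>x. x \<in> U \<inter> W \<Longrightarrow> u x = (\<Sum>i<fibre_dim E. g i x *\<^sub>R s i x)"
    using smooth_section_on_coeff[OF u Us] by metis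
  obtain k where k: "\<And>i. i < fibre_dim E \<Longrightarrow> smooth_on M (U \<inter> W) (k i)"
    "\<And>x. x \<in> U \<inter> W \<Longrightarrow> v x = (\<Sum>i<fibre_dim E. k i x *\<^sub>R s i x)"
    using smooth_section_on_coeff[OF v Us] by metis
  have o: "open (U \<inter> W)" using triv_open[OF Us] W by auto
  have sf: "smooth_on M (U \<inter> W) f" "smooth_on M (U \<inter> W) h"
    using smooth_on_subset[OF mfd f] smooth_on_subset[OF mfd h] by auto
  have "\<exists>g. (\<forall>i<fibre_dim E. smooth_on M (U \<inter> W) (g i)) \<and> (\<forall>x\<in>U \<inter> W. w x = (\<Sum>i<fibre_dim E. g i x *\<^sub>R s i x))"
  proof (intro exI[of _ "\<lambda>i x. f x * g i x + h x * k i x"] conjI allI impI ballI)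
    show "smooth_on M (U \<inter> W) (\<lambda>x. f x * g i x + h x * k i x)" if "i < fibre_dim E" for i
      using that g k by (intro smooth_on_add[OF mfd o] smooth_on_mult[OF mfd o] sf) auto
    show "w x = (\<Sum>i<fibre_dim E. (f x * g i x + h x * k i x) *\<^sub>R s i x)" if "x \<in> U \<inter> W" for x
      using that by (simp add: eq g(2) k(2) scaleR_sum_right scaleR_left_distrib sum.distrib)
  qed
  then show "case t of (U, s) \<Rightarrow> \<exists>g. (\<forall>i<fibre_dim E. smooth_on M (U \<inter> W) (g i)) \<and>
        (\<forall>x\<in>U \<inter> W. w x = (\<Sum>i<fibre_dim E. g i x *\<^sub>R s i x))" by simp
qed

lemma smooth_section_zero: "smooth_section_on M E W (\<lambda>x. 0)"
  unfolding smooth_section_on_def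
  by (auto intro!: exI[of _ "\<lambda>i x. 0"] smooth_on_const[OF mfd] subspace_0[OF fibre_subspace])

lemma smooth_section_sum:
  assumes W: "open W" and "\<And>i. i \<in> S \<Longrightarrow> smooth_section_on M E W (u i)" "\<And>i. i \<in> S \<Longrightarrow> smooth_on M W (f i)"
  shows "smooth_section_on M E W (\<lambda>x. \<Sum>i\<in>S. f i x *\<^sub>R u i x)"
  using assms(2,3)
proof (induction S rule: infinite_finite_induct)
  case (insert i S)
  show ?case
    by (rule smooth_section_combine[OF W, of "u i" "\<lambda>x. \<Sum>i\<in>S. f i x *\<^sub>R u i x" "f i" "\<lambda>x. 1"])
      (use insert in \<open>auto intro: smooth_on_const[OF mfd]\<close>)
qed (auto intro: smooth_section_zero)

text \<open>The coefficients with respect to a local trivialization are unique, so those found on small open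
  sets agree on overlaps.\<close>
lemma smooth_section_local:
  assumes W: "open W" and loc: "\<And>x. x \<in> W \<Longrightarrow> \<exists>U. open U \<and> x \<in> U \<and> smooth_section_on M E (W \<inter> U) u"
  shows "smooth_section_on M E W u"
  unfolding smooth_section_on_def
proof (intro conjI ballI)
  show fib: "u x \<in> fibre E x" if "x \<in> W" for x using loc[OF that] that unfolding smooth_section_on_def by blast
  fix t assume t: "t \<in> trivs E"
  obtain U s where [simp]: "t = (U, s)" by (cases t)
  have Us: "(U, s) \<in> trivs E" using t by simp
  have o: "open (U \<inter> W)" using triv_open[OF Us] W by auto
  have "\<exists>g. u x = (\<Sum>i<fibre_dim E. g i *\<^sub>R s i x)" if "x \<in> U \<inter> W" for x
    using basis_family_expand[OF triv_basis[OF Us] _ fib] that by (metis IntD1 IntD2 finite_lessThan)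
  then obtain g where g: "\<And>x. x \<in> U \<inter> W \<Longrightarrow> u x = (\<Sum>i<fibre_dim E. g x i *\<^sub>R s i x)" by metis
  have "smooth_on M (U \<inter> W) (\<lambda>x. g x i)" if i: "i < fibre_dim E" for i
  proof (rule smooth_on_local[OF mfd o])
    fix x assume x: "x \<in> U \<inter> W"
    then obtain O' where O': "open O'" "x \<in> O'" "smooth_section_on M E (W \<inter> O') u" using loc by blast
    obtain h where h: "\<And>i. i < fibre_dim E \<Longrightarrow> smooth_on M (U \<inter> (W \<inter> O')) (h i)"
      "\<And>x. x \<in> U \<inter> (W \<inter> O') \<Longrightarrow> u x = (\<Sum>i<fibre_dim E. h i x *\<^sub>R s i x)"
      using smooth_section_on_coeff[OF O'(3) Us] by metis
    have "smooth_on M (U \<inter> W \<inter> O') (\<lambda>x. g x i)"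
    proof (rule smooth_on_cong[OF mfd])
      show "smooth_on M (U \<inter> W \<inter> O') (h i)" using h(1)[OF i] by (simp add: Int_assoc)
      show "open (U \<inter> W \<inter> O')" using o O' by auto
      fix y assume y: "y \<in> U \<inter> W \<inter> O'"
      have "(\<Sum>i<fibre_dim E. h i y *\<^sub>R s i y) = (\<Sum>i<fibre_dim E. g y i *\<^sub>R s i y)"
        using h(2)[of y] g[of y] y by auto
      then show "h i y = g y i"
        using basis_family_coeff_unique[OF triv_basis[OF Us], of y] y i by auto
    qed
    then show "\<exists>Ua. open Ua \<and> x \<in> Ua \<and> smooth_on M (U \<inter> W \<inter> Ua) (\<lambda>x. g x i)" using O' by auto
  qed
  then have "\<exists>g. (\<forall>i<fibre_dim E. smooth_on M (U \<inter> W) (g i)) \<and> (\<forall>x\<in>U \<inter> W. u x = (\<Sum>i<fibre_dim E. g i x *\<^sub>R s i x))"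
    using g by (intro exI[of _ "\<lambda>i x. g x i"]) auto
  then show "case t of (U, s) \<Rightarrow> \<exists>g. (\<forall>i<fibre_dim E. smooth_on M (U \<inter> W) (g i)) \<and>
        (\<forall>x\<in>U \<inter> W. u x = (\<Sum>i<fibre_dim E. g i x *\<^sub>R s i x))" by simp
qed

lemma smooth_section_cong:
  assumes "open W" "smooth_section_on M E W u" "\<And>x. x \<in> W \<Longrightarrow> u x = v x"
  shows "smooth_section_on M E W v"
  by (rule smooth_section_combine[OF assms(1,2,2) smooth_on_const[OF mfd, of _ 1] smooth_on_const[OF mfd, of _ 0]])
    (use assms in auto)

lemma sections_combine:
  assumes "u \<in> sections M E" "v \<in> sections M E" "f \<in> smooth_functions M" "h \<in> smooth_functions M"
  shows "(\<lambda>x. f x *\<^sub>R u x + h x *\<^sub>R v x) \<in> sections M E"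
  unfolding sections_def mem_Collect_eq
  by (rule smooth_section_combine[OF open_UNIV, of u v f h])
    (use assms in \<open>auto simp: sections_def smooth_functions_iff\<close>)

lemma const_smooth: "(\<lambda>x. a) \<in> smooth_functions M"
  using smooth_on_const[OF mfd] by (simp add: smooth_functions_iff)

lemma sections_scale:
  assumes "u \<in> sections M E" "f \<in> smooth_functions M"
  shows "(\<lambda>x. f x *\<^sub>R u x) \<in> sections M E"
  using sections_combine[OF assms(1,1,2) const_smooth[of 0]] by simp

lemma sections_sum:
  assumes "\<And>i. i \<in> S \<Longrightarrow> u i \<in> sections M E" "\<And>i. i \<in> S \<Longrightarrow> f i \<in> smooth_functions M"
  shows "(\<lambda>x. \<Sum>i\<in>S. f i x *\<^sub>R u i x) \<in> sections M E"
  using smooth_section_sum[OF open_UNIV, of S u f] assms by (simp add: sections_def smooth_functions_iff)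

lemma sections_zero: "(\<lambda>x. 0) \<in> sections M E"
  using smooth_section_zero by (simp add: sections_def)

text \<open>Multiply by a plateau function. Frames and brackets can thereby be treated with global sections.\<close>
lemma section_extension:
  assumes U: "open U" "x \<in> U" and u: "smooth_section_on M E U u"
  obtains u' V where "u' \<in> sections M E" "open V" "x \<in> V" "V \<subseteq> U" "\<And>y. y \<in> V \<Longrightarrow> u' y = u y"
proof -
  obtain f K V where p: "f \<in> smooth_functions M" "closed K" "K \<subseteq> U" "open V" "x \<in> V" "V \<subseteq> U"
    "\<And>y. y \<notin> K \<Longrightarrow> f y = 0" "\<And>y. y \<in> V \<Longrightarrow> f y = 1" using plateau_function[OF mfd U] by metis
  have sf: "smooth_on M U f" using p(1) smooth_on_subset[OF mfd _ subset_UNIV] by (auto simp: smooth_functions_iff)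
  let ?u = "\<lambda>y. if y \<in> U then f y *\<^sub>R u y else 0"
  have "smooth_section_on M E UNIV ?u"
  proof (rule smooth_section_local[OF open_UNIV])
    fix y
    show "\<exists>O'. open O' \<and> y \<in> O' \<and> smooth_section_on M E (UNIV \<inter> O') ?u"
    proof (cases "y \<in> U")
      case True
      have "smooth_section_on M E U ?u"
        by (rule smooth_section_combine[OF U(1) u u sf smooth_on_const[OF mfd, of _ 0]]) auto
      then show ?thesis using True U by auto
    next
      case False
      have "smooth_section_on M E (- K) ?u"
        by (rule smooth_section_cong[OF _ smooth_section_zero]) (use p in auto)
      then show ?thesis using False p by (intro exI[of _ "- K"]) auto
    qed
  qed
  then show thesis using p
    by (intro that[of ?u V]) (auto simp: sections_def)
qed

lemma section_through:
  assumes "v \<in> fibre E x" obtains u where "u \<in> sections M E" "u x = v"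
proof -
  obtain U s where Us: "(U, s) \<in> trivs E" "x \<in> U" by (rule triv_cover)
  obtain g where g: "v = (\<Sum>i<fibre_dim E. g i *\<^sub>R s i x)"
    using basis_family_expand[OF triv_basis[OF Us] finite_lessThan assms] by metis
  have sm: "smooth_section_on M E U (\<lambda>y. \<Sum>i<fibre_dim E. g i *\<^sub>R s i y)"
    using smooth_section_sum[OF triv_open[OF Us(1)], of "{..<fibre_dim E}" s "\<lambda>i x. g i"]
      triv_smooth_section[OF Us(1)] smooth_on_const[OF mfd] by simp
  obtain u' V where "u' \<in> sections M E" "open V" "x \<in> V" "V \<subseteq> U"
    "\<And>y. y \<in> V \<Longrightarrow> u' y = (\<Sum>i<fibre_dim E. g i *\<^sub>R s i y)"
    by (rule section_extension[OF triv_open[OF Us(1)] Us(2) sm], rule that, assumption+)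
  then show thesis using that[of u'] g by simp
qed

end

section \<open>Fibre metric and orthonormal frames\<close>

text \<open>The square of the \<open>k\<close>-th vector of a pseudo-orthonormal frame whose first \<open>p\<close> vectors span
  the positive subspace.\<close>

definition frame_sign :: "nat \<Rightarrow> nat \<Rightarrow> real" where
  "frame_sign p k = (if k < p then 1 else -1)"

lemma frame_sign_sq [simp]: "frame_sign p k * frame_sign p k = 1"
  by (simp add: frame_sign_def)

lemma frame_sign_nz [simp]: "frame_sign p k \<noteq> 0"
  by (simp add: frame_sign_def)

definition orthonormal_on where
  "orthonormal_on E V p w U \<longleftrightarrow> (\<forall>y\<in>U.
     basis_family (V y) {..<p} (\<lambda>a. w a y) \<and> basis_family (perp E V y) {p..<fibre_dim E} (\<lambda>a. w a y) \<and>
     (\<forall>j<fibre_dim E. \<forall>k<fibre_dim E. inner_sec E (w j) (w k) y = (if j = k then frame_sign p k else 0)))"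

definition orthonormal_frame where
  "orthonormal_frame M E V x p w \<longleftrightarrow> p \<le> fibre_dim E \<and> (\<forall>k<fibre_dim E. w k \<in> sections M E) \<and>
     (\<exists>U. open U \<and> x \<in> U \<and> orthonormal_on E V p w U)"

lemma span_insert_scale_diff:
  fixes v s :: "'v::real_vector"
  assumes "a \<noteq> 0" "s \<in> span S" "span S = span T"
  shows "span (insert (a *\<^sub>R (v - s)) S) = span (insert v T)"
proof (rule antisym)
  have ST: "span S \<subseteq> span (insert v T)" unfolding assms(3) by (rule span_mono) auto
  have "a *\<^sub>R (v - s) \<in> span (insert v T)"
    using ST assms(2) by (intro span_scale span_diff) (auto intro: span_base)
  moreover have "S \<subseteq> span (insert v T)" using ST span_superset by blast
  ultimately show "span (insert (a *\<^sub>R (v - s)) S) \<subseteq> span (insert v T)"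
    by (intro span_minimal) auto
  let ?R = "span (insert (a *\<^sub>R (v - s)) S)"
  have SR: "span S \<subseteq> ?R" by (rule span_mono) auto
  have "a *\<^sub>R (v - s) \<in> ?R" by (simp add: span_base)
  then have "(1 / a) *\<^sub>R (a *\<^sub>R (v - s)) + s \<in> ?R"
    using SR assms(2) by (intro span_add span_scale[of "a *\<^sub>R (v - s)"]) auto
  then have "v \<in> ?R" using assms(1) by simp
  moreover have "T \<subseteq> ?R" using SR unfolding assms(3) using span_superset by blast
  ultimately show "span (insert v T) \<subseteq> ?R" by (intro span_minimal) auto
qed

text \<open>As long as there are fewer than \<open>r\<close> vectors they cannot span an \<open>r\<close>-dimensional space, so another one
  can be chosen outside their span.\<close>
lemma extend_independent_family:
  fixes b :: "nat \<Rightarrow> 'v::real_vector"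
  assumes B: "basis_family W {..<r} b" and v: "\<And>k. k < p \<Longrightarrow> v k \<in> W"
    "\<And>k. k < p \<Longrightarrow> v k \<notin> span (v ` {..<k})" and m: "p \<le> m" "m \<le> r"
  shows "\<exists>v'. (\<forall>k<p. v' k = v k) \<and> (\<forall>k<m. v' k \<in> W) \<and> (\<forall>k<m. v' k \<notin> span (v' ` {..<k}))"
  using m
proof (induction m rule: dec_induct)
  case base
  then show ?case using v by (intro exI[of _ v]) auto
next
  case (step m)
  then obtain v' where v': "\<forall>k<p. v' k = v k" "\<forall>k<m. v' k \<in> W" "\<forall>k<m. v' k \<notin> span (v' ` {..<k})" by auto
  have "\<not> W \<subseteq> span (v' ` {..<m})"
  proof
    assume "W \<subseteq> span (v' ` {..<m})"
    then have "b ` {..<r} \<subseteq> span (v' ` {..<m})" using B by (auto simp: basis_family_def intro: span_base)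
    moreover have "independent (b ` {..<r})" using B by (simp add: basis_family_def)
    ultimately have "card (b ` {..<r}) \<le> card (v' ` {..<m})"
      using independent_span_bound[of "v' ` {..<m}" "b ` {..<r}"] by simp
    also have "\<dots> \<le> m" using card_image_le[of "{..<m}" v'] by simp
    finally show False using B step by (simp add: basis_family_def card_image)
  qed
  then obtain z where z: "z \<in> W" "z \<notin> span (v' ` {..<m})" by auto
  have im: "(v'(m := z)) ` {..<k} = v' ` {..<k}" if "k \<le> m" for k using that by auto
  show ?case
  proof (intro exI[of _ "v'(m := z)"] conjI allI impI)
    show "(v'(m := z)) k = v k" if "k < p" for k using that v'(1) step by simp
    show "(v'(m := z)) k \<in> W" if "k < Suc m" for k using that v'(2) z by (auto simp: less_Suc_eq)
    show "(v'(m := z)) k \<notin> span ((v'(m := z)) ` {..<k})" if "k < Suc m" for k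
      using that v'(3) z im[of k] by (auto simp: less_Suc_eq simp del: fun_upd_apply) (simp_all)
  qed
qed

lemma basis_family_not_in_span:
  assumes "basis_family W {..<p} b" "k < p" shows "b k \<notin> span (b ` {..<k})"
proof
  assume "b k \<in> span (b ` {..<k})"
  moreover have "b ` {..<k} \<subseteq> b ` {..<p} - {b k}"
    using assms by (auto simp: basis_family_def inj_on_def)
  ultimately have "b k \<in> span (b ` {..<p} - {b k})" using span_mono by blast
  moreover have "independent (b ` {..<p})" using assms by (simp add: basis_family_def)
  ultimately show False using assms(2) by (auto simp: dependent_def)
qed

context
  fixes M :: "('m::{t2_space, second_countable_topology}, 'n::finite) mfd"
    and E :: "('m, 'v::real_vector) calg"
  assumes mfd: "manifold M" and ca: "courant_algebroid M E"
begin

lemma ca_vb: "vector_bundle M E" using ca by (simp add: courant_algebroid_def)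

lemma ca_fibre_subspace: "subspace (fibre E x)" by (rule fibre_subspace[OF mfd ca_vb])

lemma ca_section_fibre: "u \<in> sections M E \<Longrightarrow> u x \<in> fibre E x" by (rule section_fibre[OF mfd ca_vb])

lemma pairing_combine:
  "u \<in> fibre E x \<Longrightarrow> v \<in> fibre E x \<Longrightarrow> w \<in> fibre E x \<Longrightarrow>
    pairing E x (a *\<^sub>R u + b *\<^sub>R v) w = a * pairing E x u w + b * pairing E x v w"
  using ca by (simp add: courant_algebroid_def fibre_metric_def)

lemma pairing_sym: "u \<in> fibre E x \<Longrightarrow> v \<in> fibre E x \<Longrightarrow> pairing E x u v = pairing E x v u"
  using ca unfolding courant_algebroid_def fibre_metric_def by blast

lemma pairing_nondegenerate:
  "v \<in> fibre E x \<Longrightarrow> (\<And>w. w \<in> fibre E x \<Longrightarrow> pairing E x v w = 0) \<Longrightarrow> v = 0"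
  using ca unfolding courant_algebroid_def fibre_metric_def nondegenerate_on_def by blast

lemma pairing_zero: "w \<in> fibre E x \<Longrightarrow> pairing E x 0 w = 0"
  using pairing_combine[of w x w w 0 0] by simp

lemma pairing_scale: "u \<in> fibre E x \<Longrightarrow> w \<in> fibre E x \<Longrightarrow> pairing E x (a *\<^sub>R u) w = a * pairing E x u w"
  using pairing_combine[of u x u w a 0] by simp

lemma pairing_add: "u \<in> fibre E x \<Longrightarrow> v \<in> fibre E x \<Longrightarrow> w \<in> fibre E x \<Longrightarrow>
    pairing E x (u + v) w = pairing E x u w + pairing E x v w"
  using pairing_combine[of u x v w 1 1] by simp

lemma pairing_diff: "u \<in> fibre E x \<Longrightarrow> v \<in> fibre E x \<Longrightarrow> w \<in> fibre E x \<Longrightarrow>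
    pairing E x (u - v) w = pairing E x u w - pairing E x v w"
  using pairing_combine[of u x v w 1 "-1"] by simp

lemma pairing_sum:
  assumes "\<And>i. i \<in> S \<Longrightarrow> u i \<in> fibre E x" "w \<in> fibre E x"
  shows "pairing E x (\<Sum>i\<in>S. c i *\<^sub>R u i) w = (\<Sum>i\<in>S. c i * pairing E x (u i) w)"
  using assms(1)
proof (induction S rule: infinite_finite_induct)
  case (insert i S)
  have "(\<Sum>i\<in>S. c i *\<^sub>R u i) \<in> fibre E x"
    using insert.prems by (intro subspace_sum subspace_scale ca_fibre_subspace) auto
  then show ?case using insert pairing_combine[of "u i" x "\<Sum>i\<in>S. c i *\<^sub>R u i" w "c i" 1] assms(2) by simp
qed (simp_all add: pairing_zero assms(2))

lemma pairing_sum_right: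
  assumes "\<And>i. i \<in> S \<Longrightarrow> u i \<in> fibre E x" "w \<in> fibre E x"
  shows "pairing E x w (\<Sum>i\<in>S. c i *\<^sub>R u i) = (\<Sum>i\<in>S. c i * pairing E x w (u i))"
proof -
  have "(\<Sum>i\<in>S. c i *\<^sub>R u i) \<in> fibre E x"
    using assms by (intro subspace_sum subspace_scale ca_fibre_subspace) auto
  then have "pairing E x w (\<Sum>i\<in>S. c i *\<^sub>R u i) = pairing E x (\<Sum>i\<in>S. c i *\<^sub>R u i) w"
    by (rule pairing_sym[OF assms(2)])
  also have "\<dots> = (\<Sum>i\<in>S. c i * pairing E x w (u i))"
    using pairing_sum[OF assms, of S] assms pairing_sym[OF assms(2)] by (simp cong: sum.cong)
  finally show ?thesis .
qed

lemma inner_smooth: "u \<in> sections M E \<Longrightarrow> v \<in> sections M E \<Longrightarrow> inner_sec E u v \<in> smooth_functions M"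
  using ca by (simp add: courant_algebroid_def fibre_metric_def)

lemma inner_sym: "u \<in> sections M E \<Longrightarrow> v \<in> sections M E \<Longrightarrow> inner_sec E u v = inner_sec E v u"
  by (auto simp: inner_sec_def fun_eq_iff intro: pairing_sym ca_section_fibre)

text \<open>Pair the combination with \<open>b j\<close>, and use that the sign is its own inverse.\<close>
lemma ortho_coeff:
  assumes b: "\<And>j. j \<in> J \<Longrightarrow> b j \<in> fibre E x" and fin: "finite J"
    and o: "\<And>i j. i \<in> J \<Longrightarrow> j \<in> J \<Longrightarrow> pairing E x (b i) (b j) = (if i = j then frame_sign p j else 0)"
    and v: "v = (\<Sum>j\<in>J. g j *\<^sub>R b j)" and j: "j \<in> J"
  shows "g j = frame_sign p j * pairing E x v (b j)"
proof -
  have "pairing E x v (b j) = (\<Sum>i\<in>J. g i * pairing E x (b i) (b j))"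
    unfolding v by (rule pairing_sum) (use b j in auto)
  also have "\<dots> = (\<Sum>i\<in>J. if i = j then g j * frame_sign p j else 0)"
    by (intro sum.cong refl) (simp add: o j)
  also have "\<dots> = g j * frame_sign p j" using fin j by (simp add: sum.delta)
  finally show ?thesis by (simp add: mult.left_commute[of "frame_sign p j"])
qed

lemma ortho_basis_family:
  assumes b: "\<And>j. j \<in> J \<Longrightarrow> b j \<in> fibre E x" and fin: "finite J"
    and o: "\<And>i j. i \<in> J \<Longrightarrow> j \<in> J \<Longrightarrow> pairing E x (b i) (b j) = (if i = j then frame_sign p j else 0)"
  shows "basis_family (span (b ` J)) J b"
proof (rule basis_familyI[OF fin])
  fix g j assume z: "(\<Sum>j\<in>J. g j *\<^sub>R b j) = 0" and j: "j \<in> J"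
  have "g j = frame_sign p j * pairing E x 0 (b j)"
    by (rule ortho_coeff[OF b fin o z[symmetric] j])
  then show "g j = 0" using pairing_zero[OF b[OF j]] by simp
qed

context
  fixes V :: "'m \<Rightarrow> 'v set"
  assumes gm: "generalized_metric M E V"
begin

lemma V_subspace: "subspace (V x)" and V_fibre: "V x \<subseteq> fibre E x"
  using gm by (auto simp: generalized_metric_def generalized_pseudometric_def subbundle_def)

lemma V_pos: "v \<in> V x \<Longrightarrow> v \<noteq> 0 \<Longrightarrow> pairing E x v v > 0"
  using gm unfolding generalized_metric_def by blast

lemma perp_neg: "v \<in> perp E V x \<Longrightarrow> v \<noteq> 0 \<Longrightarrow> pairing E x v v < 0"
  using gm unfolding generalized_metric_def by blast

text \<open>Gram-Schmidt orthonormalization of global sections near a point. The sign of the square of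
  the new vector is known at the point, since there it lies in \<open>V\<close> or in its orthogonal
  complement, and persists in a neighbourhood.\<close>
lemma gram_schmidt:
  assumes "\<And>k. k < m \<Longrightarrow> v k \<in> sections M E" and U0: "open U0" "x \<in> U0"
    and vV: "\<And>k y. k < m \<Longrightarrow> k < p \<Longrightarrow> y \<in> U0 \<Longrightarrow> v k y \<in> V y"
    and Vs: "V x \<subseteq> span ((\<lambda>j. v j x) ` {..<p})"
    and ind: "\<And>k. k < m \<Longrightarrow> v k x \<notin> span ((\<lambda>j. v j x) ` {..<k})"
  shows "\<exists>w U. open U \<and> x \<in> U \<and> (\<forall>k<m. w k \<in> sections M E) \<and>
    (\<forall>y\<in>U. \<forall>j<m. \<forall>k<m. inner_sec E (w j) (w k) y = (if j = k then frame_sign p k else 0)) \<and>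
    (\<forall>y\<in>U. \<forall>k<m. k < p \<longrightarrow> w k y \<in> V y) \<and>
    (\<forall>k\<le>m. span ((\<lambda>j. w j x) ` {..<k}) = span ((\<lambda>j. v j x) ` {..<k}))"
  using assms(1) vV ind
proof (induction m)
  case 0
  show ?case by (intro exI[of _ v] exI[of _ UNIV]) auto
next
  case (Suc m)
  have "\<exists>w U. open U \<and> x \<in> U \<and> (\<forall>k<m. w k \<in> sections M E) \<and>
    (\<forall>y\<in>U. \<forall>j<m. \<forall>k<m. inner_sec E (w j) (w k) y = (if j = k then frame_sign p k else 0)) \<and>
    (\<forall>y\<in>U. \<forall>k<m. k < p \<longrightarrow> w k y \<in> V y) \<and>
    (\<forall>k\<le>m. span ((\<lambda>j. w j x) ` {..<k}) = span ((\<lambda>j. v j x) ` {..<k}))"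
    by (rule Suc.IH) (use Suc.prems in auto)
  then obtain w U where W: "open U" "x \<in> U" "\<forall>k<m. w k \<in> sections M E"
    "\<forall>y\<in>U. \<forall>j<m. \<forall>k<m. inner_sec E (w j) (w k) y = (if j = k then frame_sign p k else 0)"
    "\<forall>y\<in>U. \<forall>k<m. k < p \<longrightarrow> w k y \<in> V y"
    "\<forall>k\<le>m. span ((\<lambda>j. w j x) ` {..<k}) = span ((\<lambda>j. v j x) ` {..<k})"
    by - (elim exE conjE, rule that, assumption+)
  note w = W(1,2) W(3)[rule_format] W(4)[rule_format] W(5)[rule_format] W(6)[rule_format]
  have vm: "v m \<in> sections M E" using Suc.prems(1) by simp
  define c where "c j y = frame_sign p j * inner_sec E (v m) (w j) y" for j y
  define S where "S y = (\<Sum>j<m. c j y *\<^sub>R w j y)" for y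
  define w' where "w' y = v m y - S y" for y
  have cs: "c j \<in> smooth_functions M" if "j < m" for j
    unfolding c_def[abs_def] smooth_functions_iff
    using inner_smooth[OF vm w(3)[OF that]]
    by (intro smooth_on_mult[OF mfd] smooth_on_const[OF mfd]) (auto simp: smooth_functions_iff)
  have Ssec: "S \<in> sections M E" unfolding S_def[abs_def]
    by (rule sections_sum[OF mfd ca_vb]) (use w cs in auto)
  have w's: "w' \<in> sections M E"
    using sections_combine[OF mfd ca_vb vm Ssec const_smooth[OF mfd ca_vb, of 1] const_smooth[OF mfd ca_vb, of "-1"]]
    by (simp add: w'_def[abs_def])
  have orth: "inner_sec E w' (w k) y = 0" if "y \<in> U" "k < m" for y k
  proof -
    have fib: "v m y \<in> fibre E y" "S y \<in> fibre E y" "w k y \<in> fibre E y"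
      using ca_section_fibre vm Ssec w(3)[OF that(2)] by auto
    have "inner_sec E w' (w k) y = pairing E y (v m y) (w k y) - pairing E y (S y) (w k y)"
      unfolding inner_sec_def w'_def by (rule pairing_diff[OF fib])
    also have "pairing E y (S y) (w k y) = (\<Sum>j<m. c j y * pairing E y (w j y) (w k y))"
      unfolding S_def by (rule pairing_sum) (use ca_section_fibre w(3) that in auto)
    also have "\<dots> = (\<Sum>j<m. if j = k then c k y * frame_sign p k else 0)"
      by (intro sum.cong refl) (use w(4)[OF that(1) _ that(2)] in \<open>auto simp: inner_sec_def\<close>)
    also have "\<dots> = pairing E y (v m y) (w k y)"
      using that by (simp add: sum.delta c_def inner_sec_def mult.left_commute[of _ "pairing E y (v m y) (w k y)"] mult_ac)
    finally show ?thesis by simp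
  qed
  have Sspan: "S x \<in> span ((\<lambda>j. w j x) ` {..<m})"
    unfolding S_def by (intro span_sum span_scale span_base) auto
  have w'nz: "w' x \<noteq> 0"
    using Sspan Suc.prems(3)[of m] w(6)[of m] by (auto simp: w'_def)
  have w'fib: "w' x \<in> fibre E x" using ca_section_fibre w's by blast
  define s where "s y = frame_sign p m * inner_sec E w' w' y" for y
  have sx: "s x > 0"
  proof (cases "m < p")
    case True
    have "S x \<in> V x" unfolding S_def using w(5)[OF w(2)] True
      by (intro subspace_sum subspace_scale V_subspace) auto
    then have "w' x \<in> V x" unfolding w'_def using Suc.prems(2)[of m x] True U0 by (intro subspace_diff V_subspace) auto
    then show ?thesis using V_pos w'nz True by (simp add: s_def frame_sign_def inner_sec_def)
  next
    case False
    have "z \<in> {z \<in> fibre E x. pairing E x z (w' x) = 0}" if z: "z \<in> V x" for z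
    proof -
      have sub: "subspace {z \<in> fibre E x. pairing E x z (w' x) = 0}"
        using ca_fibre_subspace w'fib
        by (auto simp: subspace_def pairing_zero pairing_add pairing_scale)
      have "z \<in> span ((\<lambda>j. w j x) ` {..<p})" using z Vs w(6)[of p] False by auto
      moreover have "(\<lambda>j. w j x) ` {..<p} \<subseteq> {z \<in> fibre E x. pairing E x z (w' x) = 0}"
      proof clarify
        fix j assume "j < p"
        then have j: "j < m" using False by simp
        have "w j x \<in> fibre E x" using ca_section_fibre w(3)[OF j] by blast
        then show "w j x \<in> fibre E x \<and> pairing E x (w j x) (w' x) = 0"
          using orth[OF w(2) j] pairing_sym[OF w'fib] by (simp add: inner_sec_def)
      qed
      ultimately show ?thesis using span_minimal[OF _ sub] by blast
    qed
    then have "w' x \<in> perp E V x" using w'fib pairing_sym[OF w'fib] V_fibre by (auto simp: perp_def)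
    then show ?thesis using perp_neg w'nz False by (simp add: s_def frame_sign_def inner_sec_def)
  qed
  have ssm: "smooth_on M UNIV s" unfolding s_def[abs_def]
    using inner_smooth[OF w's w's] by (intro smooth_on_mult[OF mfd] smooth_on_const[OF mfd]) (auto simp: smooth_functions_iff)
  let ?U = "U \<inter> s -` {0<..}"
  have oU: "open ?U" using smooth_on_continuous[OF mfd ssm open_UNIV] w(1) by (intro open_Int) (auto simp: open_vimage)
  \<comment> \<open>The normalizing factor is only defined near \<open>x\<close>; a global function with the same germ replaces it.\<close>
  have phi: "smooth_on M ?U (\<lambda>y. s y powr (-1/2))"
    by (rule smooth_on_real_compose[OF mfd oU smooth_on_subset[OF mfd ssm] real_smooth_powr]) auto
  have xU: "x \<in> ?U" using w(2) sx by simp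
  obtain f U' where f: "f \<in> smooth_functions M" "open U'" "x \<in> U'" "U' \<subseteq> ?U" "\<And>y. y \<in> U' \<Longrightarrow> f y = s y powr (-1/2)"
    by (rule smooth_extension[OF mfd oU xU phi], rule that, assumption+)
  define w2 where "w2 = w(m := (\<lambda>y. f y *\<^sub>R w' y))"
  have w2m: "w2 m y = f y *\<^sub>R w' y" and w2: "k < m \<Longrightarrow> w2 k = w k" for k y by (auto simp: w2_def)
  have sec2: "w2 m \<in> sections M E" using sections_scale[OF mfd ca_vb w's f(1)] by (simp add: w2_def)
  have fib': "w' y \<in> fibre E y" for y using ca_section_fibre w's by blast
  have norm2: "inner_sec E (w2 m) (w2 m) y = frame_sign p m" if y: "y \<in> U'" for y
  proof -
    have sy: "s y > 0" using y f(4) by auto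
    have ff: "f y * f y = inverse (s y)"
    proof -
      have "f y * f y = s y powr (-1/2 + -1/2)" unfolding f(5)[OF y] by (simp only: powr_add)
      then show ?thesis using sy by (simp add: powr_minus)
    qed
    have sc: "f y *\<^sub>R w' y \<in> fibre E y" using fib' ca_fibre_subspace by (simp add: subspace_scale)
    have "inner_sec E (w2 m) (w2 m) y = f y * f y * inner_sec E w' w' y"
      using pairing_scale[OF fib' sc, where a = "f y"] pairing_scale[OF fib'[of y] fib'[of y], where a = "f y"] pairing_sym[OF fib' sc]
      by (simp add: inner_sec_def w2m)
    also have "inner_sec E w' w' y = frame_sign p m * s y" by (simp add: s_def mult.assoc[symmetric])
    finally show ?thesis using sy unfolding ff by simp
  qed
  have orth2: "inner_sec E (w2 m) (w2 k) y = 0" if "y \<in> U'" "k < m" for y k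
    using orth[of y k] that f(4) pairing_scale[OF fib'[of y], where w = "w k y" and a = "f y"] ca_section_fibre[OF w(3)[OF that(2)]] w2[OF that(2)]
    by (auto simp: inner_sec_def w2m)
  show ?case
  proof (intro exI[of _ w2] exI[of _ "U' \<inter> U0"] conjI allI impI ballI)
    show "open (U' \<inter> U0)" "x \<in> U' \<inter> U0" using f U0 by auto
    show s2: "w2 k \<in> sections M E" if "k < Suc m" for k using that sec2 w(3) w2 by (auto simp: less_Suc_eq)
    show "inner_sec E (w2 j) (w2 k) y = (if j = k then frame_sign p k else 0)"
      if "y \<in> U' \<inter> U0" "j < Suc m" "k < Suc m" for y j k
    proof -
      have y: "y \<in> U'" "y \<in> U" using that f(4) by auto
      consider "j < m" "k < m" | "j = m" "k < m" | "j < m" "k = m" | "j = m" "k = m"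
        using \<open>j < Suc m\<close> \<open>k < Suc m\<close> by linarith
      then show ?thesis
      proof cases
        case 3
        then show ?thesis using orth2[OF y(1) 3(1)] inner_sym[OF s2[of j] s2[of m]] by auto
      qed (use w(4)[OF y(2)] w2 orth2[OF y(1)] norm2[OF y(1)] in auto)
    qed
    show "w2 k y \<in> V y" if "y \<in> U' \<inter> U0" "k < Suc m" "k < p" for y k
    proof (cases "k < m")
      case True then show ?thesis using w(5)[of y k] w2 that f(4) by auto
    next
      case False
      then have k: "k = m" using that by simp
      have "S y \<in> V y" unfolding S_def using w(5)[of y] that f(4) k
        by (intro subspace_sum subspace_scale V_subspace) auto
      then have "w' y \<in> V y" unfolding w'_def using Suc.prems(2)[of m y] that k by (intro subspace_diff V_subspace) auto
      then show ?thesis using V_subspace by (simp add: k w2m subspace_scale)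
    qed
    show "span ((\<lambda>j. w2 j x) ` {..<k}) = span ((\<lambda>j. v j x) ` {..<k})" if "k \<le> Suc m" for k
    proof (cases "k \<le> m")
      case True
      then have "(\<lambda>j. w2 j x) ` {..<k} = (\<lambda>j. w j x) ` {..<k}" using w2 by (intro image_cong) auto
      then show ?thesis using w(6)[OF True] by simp
    next
      case False
      then have k: "k = Suc m" using that by simp
      have "(\<lambda>j. w2 j x) ` {..<m} = (\<lambda>j. w j x) ` {..<m}" using w2 by (intro image_cong) auto
      then have "(\<lambda>j. w2 j x) ` {..<k} = insert (f x *\<^sub>R (v m x - S x)) ((\<lambda>j. w j x) ` {..<m})"
        by (simp add: k lessThan_Suc w2m w'_def)
      moreover have "f x \<noteq> 0" using f(5)[OF f(3)] sx by simp
      ultimately show ?thesis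
        using span_insert_scale_diff[OF _ Sspan w(6)[OF order_refl], of "f x" "v m x"] by (simp add: k lessThan_Suc)
    qed
  qed
qed

text \<open>Extend a local frame of \<open>V\<close> by sections through vectors that complete its value at \<open>x\<close> to a basis, and
  orthonormalize. The vectors after the first \<open>p\<close> are then orthogonal to \<open>V\<close>, and they span the complement
  because the whole family spans the fibre.\<close>
lemma orthonormal_frame_exists: "\<exists>p w. orthonormal_frame M E V x p w"
proof -
  let ?r = "fibre_dim E"
  have "subbundle M E V" using gm by (simp add: generalized_metric_def generalized_pseudometric_def)
  then obtain p where p: "\<forall>x. \<exists>U e. open U \<and> x \<in> U \<and> (\<forall>a<p. smooth_section_on M E U (e a)) \<and>
        (\<forall>y\<in>U. basis_family (V y) {..<p} (\<lambda>a. e a y))" unfolding subbundle_def by blast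
  from p[rule_format, of x] obtain U e where U: "open U" "x \<in> U" "\<And>a. a < p \<Longrightarrow> smooth_section_on M E U (e a)"
    "\<And>y. y \<in> U \<Longrightarrow> basis_family (V y) {..<p} (\<lambda>a. e a y)" by blast
  have "\<exists>u O'. u \<in> sections M E \<and> open O' \<and> x \<in> O' \<and> (\<forall>y\<in>O'. u y = e a y)" if a: "a < p" for a
  proof -
    obtain u' O' where "u' \<in> sections M E" "open O'" "x \<in> O'" "O' \<subseteq> U" "\<And>y. y \<in> O' \<Longrightarrow> u' y = e a y"
      by (rule section_extension[OF mfd ca_vb U(1,2) U(3)[OF a]], rule that, assumption+)
    then show ?thesis by blast
  qed
  then obtain u O' where u: "\<And>a. a < p \<Longrightarrow> u a \<in> sections M E" "\<And>a. a < p \<Longrightarrow> open (O' a)" "\<And>a. a < p \<Longrightarrow> x \<in> O' a"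
    "\<And>a y. a < p \<Longrightarrow> y \<in> O' a \<Longrightarrow> u a y = e a y" by metis
  define U0 where "U0 = U \<inter> (\<Inter>a<p. O' a)"
  have U0: "open U0" "x \<in> U0" using U(1,2) u(2,3) by (auto simp: U0_def intro!: open_Int open_INT)
  have ue: "u a y = e a y" if "y \<in> U0" "a < p" for a y using u(4)[OF that(2)] that by (auto simp: U0_def)
  have Vb: "basis_family (V y) {..<p} (\<lambda>a. u a y)" if "y \<in> U0" for y
  proof -
    have "(\<lambda>a. u a y) ` {..<p} = (\<lambda>a. e a y) ` {..<p}" using ue[OF that] by (intro image_cong) auto
    moreover have "inj_on (\<lambda>a. u a y) {..<p} = inj_on (\<lambda>a. e a y) {..<p}" using ue[OF that] by (intro inj_on_cong) auto
    ultimately show ?thesis using U(4)[of y] that by (simp add: basis_family_def U0_def)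
  qed
  obtain T s where Ts: "(T, s) \<in> trivs E" "x \<in> T" by (rule triv_cover[OF mfd ca_vb])
  have fb: "basis_family (fibre E y) {..<?r} (\<lambda>i. s i y)" if "y \<in> T" for y by (rule triv_basis[OF mfd ca_vb Ts(1) that])
  have pr: "p \<le> ?r" using basis_family_card_le[OF fb[OF Ts(2)] _ Vb[OF U0(2)] _ V_fibre] by simp
  have "\<exists>v'. (\<forall>k<p. v' k = u k x) \<and> (\<forall>k< ?r. v' k \<in> fibre E x) \<and> (\<forall>k< ?r. v' k \<notin> span (v' ` {..<k}))"
    by (rule extend_independent_family[OF fb[OF Ts(2)] _ _ pr order_refl])
      (use basis_family_not_in_span[OF Vb[OF U0(2)]] ca_section_fibre[OF u(1)] in auto)
  then obtain v' where v': "\<And>k. k < p \<Longrightarrow> v' k = u k x" "\<And>k. k < ?r \<Longrightarrow> v' k \<in> fibre E x"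
    "\<And>k. k < ?r \<Longrightarrow> v' k \<notin> span (v' ` {..<k})" by blast
  have "\<exists>t. t \<in> sections M E \<and> t x = v' k" if "k < ?r" for k
    by (rule section_through[OF mfd ca_vb v'(2)[OF that]]) blast
  then obtain t where t: "\<And>k. k < ?r \<Longrightarrow> t k \<in> sections M E" "\<And>k. k < ?r \<Longrightarrow> t k x = v' k" by metis
  define v where "v k = (if k < p then u k else t k)" for k
  have vx: "v k x = v' k" if "k < ?r" for k using that v'(1) t(2) by (simp add: v_def)
  have im: "(\<lambda>j. v j x) ` {..<k} = v' ` {..<k}" if "k \<le> ?r" for k using vx that by (intro image_cong) auto
  have "\<exists>w U. open U \<and> x \<in> U \<and> (\<forall>k<?r. w k \<in> sections M E) \<and>
    (\<forall>y\<in>U. \<forall>j<?r. \<forall>k<?r. inner_sec E (w j) (w k) y = (if j = k then frame_sign p k else 0)) \<and>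
    (\<forall>y\<in>U. \<forall>k<?r. k < p \<longrightarrow> w k y \<in> V y) \<and>
    (\<forall>k\<le>?r. span ((\<lambda>j. w j x) ` {..<k}) = span ((\<lambda>j. v j x) ` {..<k}))"
  proof (rule gram_schmidt[OF _ U0])
    show "v k \<in> sections M E" if "k < ?r" for k using that u(1) t(1) by (simp add: v_def)
    show "v k y \<in> V y" if "k < p" "y \<in> U0" for k y
      using basis_family_mem[OF Vb[OF that(2)], of k] that by (simp add: v_def)
    have "V x = span ((\<lambda>j. u j x) ` {..<p})" using Vb[OF U0(2)] by (simp add: basis_family_def)
    moreover have "(\<lambda>j. u j x) ` {..<p} = (\<lambda>j. v j x) ` {..<p}" by (intro image_cong) (auto simp: v_def)
    ultimately show "V x \<subseteq> span ((\<lambda>j. v j x) ` {..<p})" by simp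
    show "v k x \<notin> span ((\<lambda>j. v j x) ` {..<k})" if "k < ?r" for k using v'(3)[OF that] vx[OF that] im[of k] that by simp
  qed
  then obtain w U1 where W: "open U1" "x \<in> U1" "\<forall>k<?r. w k \<in> sections M E"
    "\<forall>y\<in>U1. \<forall>j<?r. \<forall>k<?r. inner_sec E (w j) (w k) y = (if j = k then frame_sign p k else 0)"
    "\<forall>y\<in>U1. \<forall>k<?r. k < p \<longrightarrow> w k y \<in> V y"
    by - (elim exE conjE, rule that, assumption+)
  note w = W(1,2) W(3)[rule_format] W(4)[rule_format] W(5)[rule_format]
  define U2 where "U2 = U1 \<inter> U0 \<inter> T"
  have "orthonormal_on E V p w U2"
    unfolding orthonormal_on_def
  proof (intro ballI conjI allI impI)
    fix y assume "y \<in> U2"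
    then have y: "y \<in> U1" "y \<in> U0" "y \<in> T" by (auto simp: U2_def)
    have wf: "w k y \<in> fibre E y" if "k < ?r" for k using ca_section_fibre w(3)[OF that] by blast
    have o: "pairing E y (w j y) (w k y) = (if j = k then frame_sign p k else 0)" if "j < ?r" "k < ?r" for j k
      using w(4)[OF y(1) that] by (simp add: inner_sec_def)
    have bf: "basis_family (span ((\<lambda>k. w k y) ` J)) J (\<lambda>k. w k y)" if J: "J \<subseteq> {..<?r}" for J
    proof (rule ortho_basis_family)
      show "w j y \<in> fibre E y" if "j \<in> J" for j using wf J that by auto
      show "finite J" using J by (rule finite_subset) simp
      show "pairing E y (w i y) (w j y) = (if i = j then frame_sign p j else 0)" if "i \<in> J" "j \<in> J" for i j
        by (rule o) (use that J in auto)
    qed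
    have "span ((\<lambda>k. w k y) ` {..<p}) \<subseteq> V y"
      using w(5)[OF y(1)] pr by (intro span_minimal V_subspace) auto
    then have "span ((\<lambda>k. w k y) ` {..<p}) = V y"
      using basis_family_eq[OF Vb[OF y(2)] _ bf[of "{..<p}"]] pr by auto
    with bf[of "{..<p}"] pr show bV: "basis_family (V y) {..<p} (\<lambda>a. w a y)" by auto
    have "span ((\<lambda>k. w k y) ` {..<?r}) \<subseteq> fibre E y"
      using wf by (intro span_minimal ca_fibre_subspace) auto
    then have "span ((\<lambda>k. w k y) ` {..<?r}) = fibre E y"
      using basis_family_eq[OF fb[OF y(3)] _ bf[of "{..<?r}"]] by auto
    then have bF: "basis_family (fibre E y) {..<?r} (\<lambda>a. w a y)" using bf[of "{..<?r}"] by auto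
    have "perp E V y = span ((\<lambda>k. w k y) ` {p..<?r})"
    proof (rule antisym)
      show "perp E V y \<subseteq> span ((\<lambda>k. w k y) ` {p..<?r})"
      proof
        fix z assume z: "z \<in> perp E V y"
        then have zf: "z \<in> fibre E y" by (simp add: perp_def)
        obtain g where g: "z = (\<Sum>k<?r. g k *\<^sub>R w k y)" by (rule basis_family_expand[OF bF finite_lessThan zf])
        have "g k = 0" if "k < p" for k
        proof -
          have "g k = frame_sign p k * pairing E y z (w k y)"
            by (rule ortho_coeff[OF _ _ _ g]) (use wf o that pr in auto)
          then show ?thesis using z w(5)[OF y(1)] that pr by (simp add: perp_def)
        qed
        then have "z = (\<Sum>k\<in>{p..<?r}. g k *\<^sub>R w k y)"
          unfolding g by (intro sum.mono_neutral_right) auto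
        then show "z \<in> span ((\<lambda>k. w k y) ` {p..<?r})"
          by (simp only:) (intro span_sum span_scale span_base imageI)
      qed
      have psub: "subspace (perp E V y)"
        using ca_fibre_subspace V_fibre by (auto simp: perp_def subspace_def pairing_zero pairing_add pairing_scale subset_iff)
      show "span ((\<lambda>k. w k y) ` {p..<?r}) \<subseteq> perp E V y"
      proof (intro span_minimal psub image_subsetI)
        fix k assume k: "k \<in> {p..<?r}"
        have "pairing E y (w k y) z = 0" if z: "z \<in> V y" for z
        proof -
          obtain g where g: "z = (\<Sum>j<p. g j *\<^sub>R w j y)" by (rule basis_family_expand[OF bV finite_lessThan z])
          have "pairing E y (w k y) z = (\<Sum>j<p. g j * pairing E y (w k y) (w j y))"
            unfolding g by (rule pairing_sum_right) (use wf k pr in auto)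
          also have "\<dots> = 0" by (rule sum.neutral) (use o k pr in auto)
          finally show ?thesis .
        qed
        then show "w k y \<in> perp E V y" using wf k by (simp add: perp_def)
      qed
    qed
    moreover have "{p..<?r} \<subseteq> {..<?r}" by auto
    ultimately show "basis_family (perp E V y) {p..<?r} (\<lambda>a. w a y)" using bf[of "{p..<?r}"] by simp
    show "inner_sec E (w j) (w k) y = (if j = k then frame_sign p k else 0)" if "j < ?r" "k < ?r" for j k
      using w(4)[OF y(1) that] .
  qed
  moreover have "open U2" "x \<in> U2" using w U0 Ts triv_open[OF mfd ca_vb Ts(1)] by (auto simp: U2_def)
  ultimately show ?thesis using pr w(3) unfolding orthonormal_frame_def by blast
qed

end

end

section \<open>Calculus in a Courant algebroid\<close>

context
  fixes M :: "('m::{t2_space, second_countable_topology}, 'n::finite) mfd"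
    and E :: "('m, 'v::real_vector) calg" and V :: "'m \<Rightarrow> 'v set"
  assumes mfd: "manifold M" and ca: "courant_algebroid M E" and gm: "generalized_metric M E V"
begin

lemma br_sec: "u \<in> sections M E \<Longrightarrow> v \<in> sections M E \<Longrightarrow> bracket E u v \<in> sections M E"
  using ca unfolding courant_algebroid_def courant_bracket_def by blast

lemma br_combine_right:
  assumes "u \<in> sections M E" "v \<in> sections M E" "w \<in> sections M E"
  shows "bracket E w (\<lambda>x. a *\<^sub>R u x + b *\<^sub>R v x) x = a *\<^sub>R bracket E w u x + b *\<^sub>R bracket E w v x"
proof -
  have "bracket E w (\<lambda>x. a *\<^sub>R u x + b *\<^sub>R v x) = (\<lambda>x. a *\<^sub>R bracket E w u x + b *\<^sub>R bracket E w v x)"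
    using ca assms unfolding courant_algebroid_def courant_bracket_def by blast
  then show ?thesis by simp
qed

lemma br_jacobi:
  assumes "u \<in> sections M E" "v \<in> sections M E" "w \<in> sections M E"
  shows "bracket E u (bracket E v w) x = bracket E (bracket E u v) w x + bracket E v (bracket E u w) x"
proof -
  have "bracket E u (bracket E v w) = (\<lambda>x. bracket E (bracket E u v) w x + bracket E v (bracket E u w) x)"
    using ca assms unfolding courant_algebroid_def courant_bracket_def by blast
  then show ?thesis by simp
qed

lemma br_leibniz:
  assumes "u \<in> sections M E" "v \<in> sections M E" "f \<in> smooth_functions M"
  shows "bracket E u (\<lambda>x. f x *\<^sub>R v x) = (\<lambda>x. f x *\<^sub>R bracket E u v x + act E u f x *\<^sub>R v x)"
  using ca assms unfolding courant_algebroid_def courant_bracket_def by blast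

lemma br_invariance:
  assumes "u \<in> sections M E" "v \<in> sections M E" "w \<in> sections M E"
  shows "act E u (inner_sec E v w) x = inner_sec E (bracket E u v) w x + inner_sec E v (bracket E u w) x"
proof -
  have "act E u (inner_sec E v w) = (\<lambda>x. inner_sec E (bracket E u v) w x + inner_sec E v (bracket E u w) x)"
    using ca assms unfolding courant_algebroid_def courant_bracket_def by blast
  then show ?thesis by simp
qed

lemma br_symmetric_part:
  assumes "u \<in> sections M E" "v \<in> sections M E"
  shows "bracket E u v x + bracket E v u x = dE E (inner_sec E u v) x"
proof -
  have "(\<lambda>x. bracket E u v x + bracket E v u x) = dE E (inner_sec E u v)"
    using ca assms unfolding courant_algebroid_def courant_bracket_def by blast
  then show ?thesis by (rule fun_cong)
qed

lemma anchor_tangent: "v \<in> fibre E x \<Longrightarrow> tangent_vector M x (anchor E x v)"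
  using ca by (simp add: courant_algebroid_def anchor_map_def)

lemma anchor_combine:
  assumes "v \<in> fibre E x" "w \<in> fibre E x" "f \<in> smooth_functions M"
  shows "anchor E x (a *\<^sub>R v + b *\<^sub>R w) f = a * anchor E x v f + b * anchor E x w f"
  using ca assms unfolding courant_algebroid_def anchor_map_def by blast

lemma act_smooth: "u \<in> sections M E \<Longrightarrow> f \<in> smooth_functions M \<Longrightarrow> act E u f \<in> smooth_functions M"
  using ca by (simp add: courant_algebroid_def anchor_map_def)

lemma anchor_zero: "f \<in> smooth_functions M \<Longrightarrow> anchor E x 0 f = 0"
  using anchor_combine[of 0 x 0 f 0 0] ca_fibre_subspace[OF mfd ca] by (simp add: subspace_0)

lemma anchor_sum:
  assumes "\<And>i. i \<in> S \<Longrightarrow> v i \<in> fibre E x" "f \<in> smooth_functions M"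
  shows "anchor E x (\<Sum>i\<in>S. c i *\<^sub>R v i) f = (\<Sum>i\<in>S. c i * anchor E x (v i) f)"
  using assms(1)
proof (induction S rule: infinite_finite_induct)
  case (insert i S)
  have "(\<Sum>i\<in>S. c i *\<^sub>R v i) \<in> fibre E x"
    using insert.prems by (intro subspace_sum subspace_scale ca_fibre_subspace[OF mfd ca]) auto
  then show ?case using insert anchor_combine[of "v i" x "\<Sum>i\<in>S. c i *\<^sub>R v i" f "c i" 1] assms(2) by simp
qed (simp_all add: anchor_zero assms(2))

lemma section_in_fibre: "u \<in> sections M E \<Longrightarrow> u x \<in> fibre E x"
  by (rule ca_section_fibre[OF mfd ca])

lemma act_tangent: "u \<in> sections M E \<Longrightarrow> tangent_vector M x (rho E u x)"
  unfolding rho_def by (rule anchor_tangent[OF section_in_fibre])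

lemma rho_smooth_vf: "u \<in> sections M E \<Longrightarrow> smooth_vf M (rho E u)"
  unfolding smooth_vf_def using act_tangent act_smooth by (auto simp: act_def[abs_def])

lemma act_mult:
  assumes "u \<in> sections M E" "f \<in> smooth_functions M" "g \<in> smooth_functions M"
  shows "act E u (\<lambda>y. f y * g y) x = f x * act E u g x + g x * act E u f x"
  unfolding act_def by (rule tangent_mult[OF mfd act_tangent[OF assms(1)] assms(2,3)])

lemma act_add:
  assumes "u \<in> sections M E" "f \<in> smooth_functions M" "g \<in> smooth_functions M"
  shows "act E u (\<lambda>y. f y + g y) x = act E u f x + act E u g x"
  unfolding act_def by (rule tangent_add[OF mfd act_tangent[OF assms(1)] assms(2,3)])

lemma act_const: "u \<in> sections M E \<Longrightarrow> act E u (\<lambda>y. a) x = 0"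
  unfolding act_def by (rule tangent_const[OF mfd act_tangent])

lemma act_local:
  assumes "u \<in> sections M E" "f \<in> smooth_functions M" "g \<in> smooth_functions M"
    and "open U" "x \<in> U" "\<And>y. y \<in> U \<Longrightarrow> f y = g y"
  shows "act E u f x = act E u g x"
  unfolding act_def by (rule tangent_local[OF mfd act_tangent[OF assms(1)] assms(2-6)])

lemma smooth_fun_add: "f \<in> smooth_functions M \<Longrightarrow> g \<in> smooth_functions M \<Longrightarrow> (\<lambda>x. f x + g x) \<in> smooth_functions M"
  using smooth_on_add[OF mfd open_UNIV] by (simp add: smooth_functions_iff)

lemma smooth_fun_mult: "f \<in> smooth_functions M \<Longrightarrow> g \<in> smooth_functions M \<Longrightarrow> (\<lambda>x. f x * g x) \<in> smooth_functions M"
  using smooth_on_mult[OF mfd open_UNIV] by (simp add: smooth_functions_iff)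

lemma smooth_fun_sum: "(\<And>i. i \<in> S \<Longrightarrow> f i \<in> smooth_functions M) \<Longrightarrow> (\<lambda>x. \<Sum>i\<in>S. f i x) \<in> smooth_functions M"
  using smooth_on_sum[OF mfd open_UNIV, of S f] by (simp add: smooth_functions_iff)

lemma smooth_fun_const: "(\<lambda>x. a) \<in> smooth_functions M"
  using smooth_on_const[OF mfd] by (simp add: smooth_functions_iff)

lemma act_sum:
  assumes "u \<in> sections M E" "\<And>i. i \<in> S \<Longrightarrow> f i \<in> smooth_functions M"
  shows "act E u (\<lambda>y. \<Sum>i\<in>S. f i y) x = (\<Sum>i\<in>S. act E u (f i) x)"
  using assms(2)
proof (induction S rule: infinite_finite_induct)
  case (insert i S)
  then show ?case using act_add[OF assms(1), of "f i" "\<lambda>y. \<Sum>i\<in>S. f i y"] smooth_fun_sum[of S f] by simp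
qed (simp_all add: act_const[OF assms(1)])

text \<open>The difference \<open>z\<close> of the two sections vanishes near \<open>x\<close>, so it is annihilated by a bump function
  \<open>f\<close> supported there, while the Leibniz rule gives \<open>P (f z) = f(x) P z\<close>. This covers divergences, and
  brackets as functions of the second argument.\<close>
lemma local_operator:
  fixes P :: "('m \<Rightarrow> 'v) \<Rightarrow> 'w::real_vector" and Q :: "('m \<Rightarrow> real) \<Rightarrow> 'v \<Rightarrow> 'w"
  assumes u: "u \<in> sections M E" "v \<in> sections M E" and U: "open U" "x \<in> U" "\<And>y. y \<in> U \<Longrightarrow> u y = v y"
    and lin: "\<And>u v a b. u \<in> sections M E \<Longrightarrow> v \<in> sections M E \<Longrightarrow> P (\<lambda>y. a *\<^sub>R u y + b *\<^sub>R v y) = a *\<^sub>R P u + b *\<^sub>R P v"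
    and leib: "\<And>u f. u \<in> sections M E \<Longrightarrow> f \<in> smooth_functions M \<Longrightarrow> u x = 0 \<Longrightarrow> P (\<lambda>y. f y *\<^sub>R u y) = f x *\<^sub>R P u"
  shows "P u = P v"
proof -
  obtain f K where f: "f \<in> smooth_functions M" "closed K" "K \<subseteq> U" "\<And>y. f y \<ge> 0" "f x > 0" "\<And>y. y \<notin> K \<Longrightarrow> f y = 0"
    by (rule bump_function[OF mfd U(1,2)], rule that, assumption+)
  define z where "z y = 1 *\<^sub>R u y + (-1) *\<^sub>R v y" for y
  have zs: "z \<in> sections M E" unfolding z_def[abs_def]
    by (rule sections_combine[OF mfd ca_vb[OF mfd ca] u smooth_fun_const smooth_fun_const])
  have zU: "z y = 0" if "y \<in> U" for y using U(3)[OF that] by (simp add: z_def)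
  have "(\<lambda>y. f y *\<^sub>R z y) = (\<lambda>y. 0 *\<^sub>R u y + 0 *\<^sub>R v y)"
  proof
    fix y show "f y *\<^sub>R z y = 0 *\<^sub>R u y + 0 *\<^sub>R v y" using zU[of y] f(3) f(6)[of y] by auto
  qed
  then have "f x *\<^sub>R P z = 0" using leib[OF zs f(1) zU[OF U(2)]] lin[OF u, of 0 0] by simp
  then have "P z = 0" using f(5) by simp
  then show ?thesis using lin[OF u, of 1 "-1"] by (simp add: z_def[abs_def])
qed

lemma br_local_right:
  assumes "w \<in> sections M E" "u \<in> sections M E" "v \<in> sections M E" "open U" "x \<in> U" "\<And>y. y \<in> U \<Longrightarrow> u y = v y"
  shows "bracket E w u x = bracket E w v x"
  by (rule local_operator[where P = "\<lambda>u. bracket E w u x", OF assms(2-6)])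
    (simp_all add: br_combine_right assms(1) br_leibniz)

text \<open>The difference of the two sides is orthogonal to the whole frame, hence to \<open>V\<close>; so it lies in the
  orthogonal complement, where its coefficients vanish as well.\<close>
lemma frame_expand:
  assumes on: "orthonormal_on E V p w U" and y: "y \<in> U" and v: "v \<in> fibre E y"
    and w: "\<And>k. k < fibre_dim E \<Longrightarrow> w k \<in> sections M E" and p: "p \<le> fibre_dim E"
  shows "v = (\<Sum>k<fibre_dim E. (frame_sign p k * pairing E y v (w k y)) *\<^sub>R w k y)"
proof -
  let ?r = "fibre_dim E"
  have bV: "basis_family (V y) {..<p} (\<lambda>a. w a y)" and bP: "basis_family (perp E V y) {p..<?r} (\<lambda>a. w a y)"
    and o: "\<And>j k. j < ?r \<Longrightarrow> k < ?r \<Longrightarrow> pairing E y (w j y) (w k y) = (if j = k then frame_sign p k else 0)"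
    using on y by (auto simp: orthonormal_on_def inner_sec_def)
  have wf: "w k y \<in> fibre E y" if "k < ?r" for k using section_in_fibre w that by blast
  let ?s = "\<Sum>k<?r. (frame_sign p k * pairing E y v (w k y)) *\<^sub>R w k y"
  have sf: "?s \<in> fibre E y" using wf by (intro subspace_sum subspace_scale ca_fibre_subspace[OF mfd ca]) auto
  have ps: "pairing E y ?s (w j y) = pairing E y v (w j y)" if j: "j < ?r" for j
  proof -
    have "pairing E y ?s (w j y) = (\<Sum>k<?r. (frame_sign p k * pairing E y v (w k y)) * pairing E y (w k y) (w j y))"
      by (rule pairing_sum[OF mfd ca]) (use wf j in auto)
    also have "\<dots> = (\<Sum>k<?r. if k = j then frame_sign p j * frame_sign p j * pairing E y v (w j y) else 0)"
      by (intro sum.cong refl) (simp add: o j)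
    finally show ?thesis using j by (simp add: sum.delta)
  qed
  define z where "z = v - ?s"
  have zf: "z \<in> fibre E y" unfolding z_def using v sf by (intro subspace_diff ca_fibre_subspace[OF mfd ca])
  have zo: "pairing E y z (w j y) = 0" if "j < ?r" for j
    unfolding z_def using pairing_diff[OF mfd ca v sf wf[OF that]] ps[OF that] by simp
  have "z \<in> perp E V y"
  proof -
    have "pairing E y z t = 0" if t: "t \<in> V y" for t
    proof -
      obtain g where g: "t = (\<Sum>j<p. g j *\<^sub>R w j y)" by (rule basis_family_expand[OF bV finite_lessThan t])
      have "pairing E y z t = (\<Sum>j<p. g j * pairing E y z (w j y))"
        unfolding g by (rule pairing_sum_right[OF mfd ca]) (use wf zf p in auto)
      then show ?thesis using zo p by simp
    qed
    then show ?thesis using zf by (simp add: perp_def)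
  qed
  then obtain g where g: "z = (\<Sum>j\<in>{p..<?r}. g j *\<^sub>R w j y)" by (rule basis_family_expand[OF bP finite_atLeastLessThan])
  have "g j = 0" if j: "j \<in> {p..<?r}" for j
  proof -
    have "g j = frame_sign p j * pairing E y z (w j y)"
      by (rule ortho_coeff[OF mfd ca _ _ _ g j]) (use wf o in auto)
    then show ?thesis using zo j by simp
  qed
  then have "z = 0" using g by simp
  then show ?thesis by (simp add: z_def)
qed

text \<open>The definite description in \<open>dE\<close> is justified by the vector whose coefficients in a pseudo-orthonormal
  frame are the derivatives along the frame.\<close>
lemma dE_property:
  assumes f: "f \<in> smooth_functions M"
  shows "dE E f x \<in> fibre E x \<and> (\<forall>v\<in>fibre E x. pairing E x v (dE E f x) = anchor E x v f)"
proof -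
  let ?r = "fibre_dim E"
  obtain p w where "orthonormal_frame M E V x p w" using orthonormal_frame_exists[OF mfd ca gm] by blast
  then obtain U where w: "p \<le> ?r" "\<And>k. k < ?r \<Longrightarrow> w k \<in> sections M E" and U: "x \<in> U" "orthonormal_on E V p w U"
    unfolding orthonormal_frame_def by blast
  have wf: "w k x \<in> fibre E x" if "k < ?r" for k using section_in_fibre w that by blast
  define t where "t = (\<Sum>k<?r. (frame_sign p k * anchor E x (w k x) f) *\<^sub>R w k x)"
  have tf: "t \<in> fibre E x" unfolding t_def using wf by (intro subspace_sum subspace_scale ca_fibre_subspace[OF mfd ca]) auto
  have t: "pairing E x v t = anchor E x v f" if v: "v \<in> fibre E x" for v
  proof -
    have "pairing E x v t = (\<Sum>k<?r. (frame_sign p k * anchor E x (w k x) f) * pairing E x v (w k x))"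
      unfolding t_def by (rule pairing_sum_right[OF mfd ca]) (use wf v in auto)
    also have "\<dots> = anchor E x (\<Sum>k<?r. (frame_sign p k * pairing E x v (w k x)) *\<^sub>R w k x) f"
      by (subst anchor_sum) (use wf f in \<open>auto simp: mult_ac\<close>)
    also have "(\<Sum>k<?r. (frame_sign p k * pairing E x v (w k x)) *\<^sub>R w k x) = v"
      using frame_expand[OF U(2,1) v w(2,1)] by simp
    finally show ?thesis .
  qed
  have "\<exists>!w. w \<in> fibre E x \<and> (\<forall>v\<in>fibre E x. pairing E x v w = anchor E x v f)"
  proof (rule ex1I[of _ t])
    show "t \<in> fibre E x \<and> (\<forall>v\<in>fibre E x. pairing E x v t = anchor E x v f)" using tf t by blast
    fix s assume s: "s \<in> fibre E x \<and> (\<forall>v\<in>fibre E x. pairing E x v s = anchor E x v f)"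
    have "s - t = 0"
    proof (rule pairing_nondegenerate[OF mfd ca])
      show st: "s - t \<in> fibre E x" using s tf by (intro subspace_diff ca_fibre_subspace[OF mfd ca]) auto
      fix v assume v: "v \<in> fibre E x"
      show "pairing E x (s - t) v = 0"
        using pairing_diff[OF mfd ca _ tf v, of s] s t[OF v] v
          pairing_sym[OF mfd ca tf v] pairing_sym[OF mfd ca _ v, of s] by auto
    qed
    then show "s = t" by simp
  qed
  then show ?thesis unfolding dE_def by (rule theI')
qed

lemma dE_fibre: "f \<in> smooth_functions M \<Longrightarrow> dE E f x \<in> fibre E x"
  and pairing_dE: "f \<in> smooth_functions M \<Longrightarrow> v \<in> fibre E x \<Longrightarrow> pairing E x v (dE E f x) = anchor E x v f"
  using dE_property by blast+

text \<open>Brackets of sections with locally constant pairing are antisymmetric at the point by this.\<close>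
lemma dE_local_const:
  assumes f: "f \<in> smooth_functions M" and U: "open U" "x \<in> U" "\<And>y. y \<in> U \<Longrightarrow> f y = a"
  shows "dE E f x = 0"
proof (rule pairing_nondegenerate[OF mfd ca dE_fibre[OF f]])
  fix v assume v: "v \<in> fibre E x"
  have "anchor E x v f = anchor E x v (\<lambda>y. a)"
    by (rule tangent_local[OF mfd anchor_tangent[OF v] f smooth_fun_const U])
  also have "\<dots> = 0" by (rule tangent_const[OF mfd anchor_tangent[OF v]])
  finally show "pairing E x (dE E f x) v = 0"
    using pairing_dE[OF f v] pairing_sym[OF mfd ca v dE_fibre[OF f]] by simp
qed

lemma br_sum_right:
  assumes u: "u \<in> sections M E" and "\<And>i. i \<in> S \<Longrightarrow> v i \<in> sections M E" "\<And>i. i \<in> S \<Longrightarrow> f i \<in> smooth_functions M"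
  shows "bracket E u (\<lambda>y. \<Sum>i\<in>S. f i y *\<^sub>R v i y) x
    = (\<Sum>i\<in>S. f i x *\<^sub>R bracket E u (v i) x + act E u (f i) x *\<^sub>R v i x)"
proof -
  have z: "bracket E u (\<lambda>y. 0) x = 0"
    using br_combine_right[OF u u u, of 0 0 x] by simp
  show ?thesis using assms(2,3)
  proof (induction S rule: infinite_finite_induct)
    case (insert i S)
    have s1: "(\<lambda>y. f i y *\<^sub>R v i y) \<in> sections M E" using insert.prems by (intro sections_scale[OF mfd ca_vb[OF mfd ca]]) auto
    have s2: "(\<lambda>y. \<Sum>i\<in>S. f i y *\<^sub>R v i y) \<in> sections M E" using insert.prems by (intro sections_sum[OF mfd ca_vb[OF mfd ca]]) auto
    have "bracket E u (\<lambda>y. 1 *\<^sub>R (f i y *\<^sub>R v i y) + 1 *\<^sub>R (\<Sum>i\<in>S. f i y *\<^sub>R v i y)) x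
      = 1 *\<^sub>R bracket E u (\<lambda>y. f i y *\<^sub>R v i y) x + 1 *\<^sub>R bracket E u (\<lambda>y. \<Sum>i\<in>S. f i y *\<^sub>R v i y) x"
      by (rule br_combine_right[OF s1 s2 u])
    then show ?case using insert br_leibniz[OF u, of "v i" "f i"] by simp
  qed (simp_all add: z)
qed

text \<open>The anchor is a homomorphism of brackets: expand the Jacobi identity for \<open>f w\<close>.\<close>
lemma act_bracket:
  assumes u: "u \<in> sections M E" and v: "v \<in> sections M E" and f: "f \<in> smooth_functions M"
  shows "act E (bracket E u v) f x = act E u (act E v f) x - act E v (act E u f) x"
proof (cases "fibre E x = {0}")
  case True
  have "act E s g x = 0" if "s \<in> sections M E" "g \<in> smooth_functions M" for s g
    using section_in_fibre[OF that(1), of x] True anchor_zero[OF that(2)] by (simp add: act_def rho_def)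
  then show ?thesis using u v f br_sec act_smooth by simp
next
  case False
  then obtain w0 where w0: "w0 \<in> fibre E x" "w0 \<noteq> 0"
    using subspace_0[OF ca_fibre_subspace[OF mfd ca, of x]] by blast
  obtain w where w: "w \<in> sections M E" "w x = w0" by (rule section_through[OF mfd ca_vb[OF mfd ca] w0(1)])
  have uvf: "act E u f \<in> smooth_functions M" "act E v f \<in> smooth_functions M" using act_smooth u v f by auto
  have s: "bracket E u v \<in> sections M E" "bracket E u w \<in> sections M E" "bracket E v w \<in> sections M E"
    using br_sec u v w by auto
  have fw: "(\<lambda>y. f y *\<^sub>R w y) \<in> sections M E" by (rule sections_scale[OF mfd ca_vb[OF mfd ca] w(1) f])
  have two: "bracket E a (\<lambda>y. g y *\<^sub>R b y + h y *\<^sub>R c y) x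
      = g x *\<^sub>R bracket E a b x + act E a g x *\<^sub>R b x + (h x *\<^sub>R bracket E a c x + act E a h x *\<^sub>R c x)"
    if "a \<in> sections M E" "b \<in> sections M E" "c \<in> sections M E" "g \<in> smooth_functions M" "h \<in> smooth_functions M" for a b c g h
  proof -
    have "bracket E a (\<lambda>y. 1 *\<^sub>R (g y *\<^sub>R b y) + 1 *\<^sub>R (h y *\<^sub>R c y)) x
      = 1 *\<^sub>R bracket E a (\<lambda>y. g y *\<^sub>R b y) x + 1 *\<^sub>R bracket E a (\<lambda>y. h y *\<^sub>R c y) x"
      by (intro br_combine_right sections_scale[OF mfd ca_vb[OF mfd ca]] that)
    then show ?thesis using that by (simp add: br_leibniz)
  qed
  \<comment> \<open>Both sides of the Jacobi identity contain a derivative of \<open>f\<close> times \<open>w\<close>; the other terms match.\<close>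
  have "bracket E u (bracket E v (\<lambda>y. f y *\<^sub>R w y)) x =
     bracket E (bracket E u v) (\<lambda>y. f y *\<^sub>R w y) x + bracket E v (bracket E u (\<lambda>y. f y *\<^sub>R w y)) x"
    by (rule br_jacobi[OF u v fw])
  then have e: "bracket E u (\<lambda>y. f y *\<^sub>R bracket E v w y + act E v f y *\<^sub>R w y) x =
     bracket E (bracket E u v) (\<lambda>y. f y *\<^sub>R w y) x + bracket E v (\<lambda>y. f y *\<^sub>R bracket E u w y + act E u f y *\<^sub>R w y) x"
    by (simp add: br_leibniz u v w f)
  have "(act E u (act E v f) x - act E v (act E u f) x - act E (bracket E u v) f x) *\<^sub>R w x = 0"
    using e unfolding two[OF u s(3) w(1) f uvf(2)] two[OF v s(2) w(1) f uvf(1)] br_leibniz[OF s(1) w(1) f]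
      br_jacobi[OF u v w(1)]
    by (simp add: algebra_simps)
  then show ?thesis using w w0 by simp
qed

text \<open>The anchor maps \<open>[u,v]\<close> to a commutator, which is antisymmetric, so it kills the symmetric
  part \<open>d\<^sub>E \<langle>u,v\<rangle>\<close>.\<close>
lemma anchor_dE_inner:
  assumes u: "u \<in> sections M E" and v: "v \<in> sections M E" and f: "f \<in> smooth_functions M"
  shows "anchor E x (dE E (inner_sec E u v) x) f = 0"
proof -
  have "anchor E x (1 *\<^sub>R bracket E u v x + 1 *\<^sub>R bracket E v u x) f
    = 1 * anchor E x (bracket E u v x) f + 1 * anchor E x (bracket E v u x) f"
    by (rule anchor_combine) (use section_in_fibre br_sec u v f in auto)
  also have "\<dots> = act E (bracket E u v) f x + act E (bracket E v u) f x" by (simp add: act_def rho_def)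
  also have "\<dots> = 0" by (simp add: act_bracket u v f)
  finally show ?thesis using br_symmetric_part[OF u v, of x] by simp
qed

section \<open>Local form of divergences\<close>

context
  fixes D :: "('m \<Rightarrow> 'v) \<Rightarrow> 'm \<Rightarrow> real"
  assumes D: "divergence M E D"
begin

lemma div_smooth: "u \<in> sections M E \<Longrightarrow> D u \<in> smooth_functions M"
  using D by (simp add: divergence_def)

lemma div_combine:
  assumes "u \<in> sections M E" "v \<in> sections M E"
  shows "D (\<lambda>x. a *\<^sub>R u x + b *\<^sub>R v x) x = a * D u x + b * D v x"
proof -
  have "D (\<lambda>x. a *\<^sub>R u x + b *\<^sub>R v x) = (\<lambda>x. a * D u x + b * D v x)"
    using D assms unfolding divergence_def by blast
  then show ?thesis by simp
qed

lemma div_leibniz: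
  assumes "u \<in> sections M E" "f \<in> smooth_functions M"
  shows "D (\<lambda>x. f x *\<^sub>R u x) x = f x * D u x + act E u f x"
proof -
  have "D (\<lambda>x. f x *\<^sub>R u x) = (\<lambda>x. f x * D u x + act E u f x)"
    using D assms unfolding divergence_def by blast
  then show ?thesis by simp
qed

lemma act_vanishing: "u x = 0 \<Longrightarrow> f \<in> smooth_functions M \<Longrightarrow> act E u f x = 0"
  by (simp add: act_def rho_def anchor_zero)

lemma div_local:
  assumes "u \<in> sections M E" "v \<in> sections M E" "open U" "x \<in> U" "\<And>y. y \<in> U \<Longrightarrow> u y = v y"
  shows "D u x = D v x"
  by (rule local_operator[where P = "\<lambda>u. D u x", OF assms])
    (simp_all add: div_combine div_leibniz act_vanishing)

lemma div_sum:
  assumes "\<And>i. i \<in> S \<Longrightarrow> v i \<in> sections M E" "\<And>i. i \<in> S \<Longrightarrow> f i \<in> smooth_functions M"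
  shows "D (\<lambda>y. \<Sum>i\<in>S. f i y *\<^sub>R v i y) x = (\<Sum>i\<in>S. f i x * D (v i) x + act E (v i) (f i) x)"
proof -
  have z: "D (\<lambda>y. 0) x = 0"
    using div_combine[OF sections_zero[OF mfd ca_vb[OF mfd ca]] sections_zero[OF mfd ca_vb[OF mfd ca]], of 0 0 x] by simp
  show ?thesis using assms
  proof (induction S rule: infinite_finite_induct)
    case (insert i S)
    have s1: "(\<lambda>y. f i y *\<^sub>R v i y) \<in> sections M E" using insert.prems by (intro sections_scale[OF mfd ca_vb[OF mfd ca]]) auto
    have s2: "(\<lambda>y. \<Sum>i\<in>S. f i y *\<^sub>R v i y) \<in> sections M E" using insert.prems by (intro sections_sum[OF mfd ca_vb[OF mfd ca]]) auto
    have "D (\<lambda>y. 1 *\<^sub>R (f i y *\<^sub>R v i y) + 1 *\<^sub>R (\<Sum>i\<in>S. f i y *\<^sub>R v i y)) x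
      = 1 * D (\<lambda>y. f i y *\<^sub>R v i y) x + 1 * D (\<lambda>y. \<Sum>i\<in>S. f i y *\<^sub>R v i y) x"
      by (rule div_combine[OF s1 s2])
    then show ?case using insert div_leibniz[of "v i" "f i"] by simp
  qed (simp_all add: z)
qed

end

end

section \<open>Independence of the orthonormal frame\<close>

lemma sum3_cong:
  fixes f g :: "nat \<Rightarrow> nat \<Rightarrow> nat \<Rightarrow> real"
  assumes "\<And>a b c. a < p \<Longrightarrow> b < p \<Longrightarrow> c < p \<Longrightarrow> f a b c = g a b c"
  shows "(\<Sum>a<p. \<Sum>b<p. \<Sum>c<p. f a b c) = (\<Sum>a<p. \<Sum>b<p. \<Sum>c<p. g a b c)"
  using assms by (intro sum.cong refl) auto

lemma sum3_swap12:
  fixes f :: "nat \<Rightarrow> nat \<Rightarrow> nat \<Rightarrow> real"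
  shows "(\<Sum>a<p. \<Sum>b<p. \<Sum>c<p. f b a c) = (\<Sum>a<p. \<Sum>b<p. \<Sum>c<p. f a b c)"
  by (rule sum.swap)

lemma sum3_cyclic:
  fixes f :: "nat \<Rightarrow> nat \<Rightarrow> nat \<Rightarrow> real"
  shows "(\<Sum>a<p. \<Sum>b<p. \<Sum>c<p. f b c a) = (\<Sum>a<p. \<Sum>b<p. \<Sum>c<p. f a b c)"
proof -
  have "(\<Sum>a<p. \<Sum>b<p. \<Sum>c<p. f b c a) = (\<Sum>b<p. \<Sum>a<p. \<Sum>c<p. f b c a)" by (rule sum.swap)
  also have "\<dots> = (\<Sum>b<p. \<Sum>c<p. \<Sum>a<p. f b c a)" by (intro sum.cong refl sum.swap)
  finally show ?thesis .
qed

text \<open>The bookkeeping behind the invariance. Here \<open>\<theta> c a b\<close> is the derivative along the \<open>c\<close>-th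
  frame vector of the orthogonal matrix relating two frames, \<open>n\<close> are the structure functions, and
  \<open>h a b\<close>, \<open>h2 a b\<close> are second derivatives of that matrix, constrained by differentiating
  orthogonality twice and by the commutator of two derivatives. All contributions reduce to
  \<open>\<Sum>\<theta>\<^sub>a\<^sub>b\<^sub>c\<^sup>2\<close>, \<open>\<Sum>\<theta>\<^sub>a\<^sub>b\<^sub>c\<theta>\<^sub>b\<^sub>c\<^sub>a\<close>, \<open>\<Sum>n\<^sub>a\<^sub>b\<^sub>c\<theta>\<^sub>a\<^sub>b\<^sub>c\<close> and \<open>\<Sum>B\<^sub>a\<^sub>b\<close>, which cancel.\<close>
lemma frame_change_algebra:
  fixes \<theta> n :: "nat \<Rightarrow> nat \<Rightarrow> nat \<Rightarrow> real" and h h2 B bb :: "nat \<Rightarrow> nat \<Rightarrow> real" and d hd' :: "nat \<Rightarrow> real"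
  assumes th: "\<And>a b c. a < p \<Longrightarrow> b < p \<Longrightarrow> c < p \<Longrightarrow> \<theta> a b c = - \<theta> a c b"
    and n1: "\<And>a b c. a < p \<Longrightarrow> b < p \<Longrightarrow> c < p \<Longrightarrow> n a b c = - n b a c"
    and n2: "\<And>a b c. a < p \<Longrightarrow> b < p \<Longrightarrow> c < p \<Longrightarrow> n a b c = - n a c b"
    and H1: "\<And>a b. a < p \<Longrightarrow> b < p \<Longrightarrow> h a b + h2 a b + (\<Sum>c<p. \<theta> b a c * \<theta> a b c + \<theta> a a c * \<theta> b b c) = 0"
    and H2: "\<And>a b. a < p \<Longrightarrow> b < p \<Longrightarrow> h a b - h2 b a = B a b"
  defines "T \<equiv> \<lambda>a b c. \<theta> a b c - \<theta> b a c"
  shows "(\<Sum>a<p. (d a + (\<Sum>b<p. \<theta> b a b))\<^sup>2 + 2 * (hd' a + (\<Sum>b<p. \<theta> a a b * d b + h a b)))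
     - 1/2 * (\<Sum>a<p. \<Sum>b<p. bb a b + (\<Sum>c<p. T a b c * T a b c) + 2 * (\<Sum>c<p. T a b c * n a b c) + 2 * B a b
          + 2 * (\<Sum>c<p. T a b c * \<theta> c a b))
     + 1/3 * (\<Sum>a<p. \<Sum>b<p. \<Sum>c<p. (n a b c + T a b c + \<theta> c a b)\<^sup>2)
   = (\<Sum>a<p. (d a)\<^sup>2 + 2 * hd' a) - 1/2 * (\<Sum>a<p. \<Sum>b<p. bb a b) + 1/3 * (\<Sum>a<p. \<Sum>b<p. \<Sum>c<p. (n a b c)\<^sup>2)"
proof -
  define R where "R f = (\<Sum>a<p. \<Sum>b<p. \<Sum>c<p. f a b c)" for f :: "nat \<Rightarrow> nat \<Rightarrow> nat \<Rightarrow> real"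
  define P where "P = R (\<lambda>a b c. \<theta> a b c * \<theta> a b c)"
  define Q where "Q = R (\<lambda>a b c. \<theta> a b c * \<theta> b c a)"
  define N where "N = R (\<lambda>a b c. \<theta> a b c * n a b c)"
  have Radd: "R (\<lambda>a b c. f a b c + g a b c) = R f + R g" for f g by (simp add: R_def sum.distrib)
  have Rdiff: "R (\<lambda>a b c. f a b c - g a b c) = R f - R g" for f g by (simp add: R_def sum_subtractf)
  have Rmul: "R (\<lambda>a b c. k * f a b c) = k * R f" for f k by (simp add: R_def sum_distrib_left)
  have Rmin: "R (\<lambda>a b c. - f a b c) = - R f" for f by (simp add: R_def sum_negf)
  have Rcong: "R f = R g" if "\<And>a b c. a < p \<Longrightarrow> b < p \<Longrightarrow> c < p \<Longrightarrow> f a b c = g a b c" for f g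
    unfolding R_def by (rule sum3_cong[OF that])
  have Rsw: "R (\<lambda>a b c. f b a c) = R f" for f unfolding R_def by (rule sum3_swap12)
  have Rcy: "R (\<lambda>a b c. f b c a) = R f" for f unfolding R_def by (rule sum3_cyclic)
  have Rcy2: "R (\<lambda>a b c. f c a b) = R f" for f
    using Rcy[of "\<lambda>a b c. f b c a"] Rcy[of f] by simp
  have ncy: "n c a b = n a b c" if "a < p" "b < p" "c < p" for a b c
    using n1[of c a b] n2[of a c b] that by simp
  have q1: "R (\<lambda>a b c. \<theta> b a c * \<theta> a b c) = - Q"
  proof -
    have "R (\<lambda>a b c. \<theta> b a c * \<theta> a b c) = R (\<lambda>a b c. - (\<theta> a b c * \<theta> b c a))"
    proof (rule Rcong)
      fix a b c assume "a < p" "b < p" "c < p"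
      then show "\<theta> b a c * \<theta> a b c = - (\<theta> a b c * \<theta> b c a)" using th[of b a c] by simp
    qed
    then show ?thesis by (simp add: Rmin Q_def)
  qed
  have q2: "R (\<lambda>a b c. \<theta> a b c * \<theta> c a b) = Q"
    using Rcy2[of "\<lambda>a b c. \<theta> a b c * \<theta> b c a"] by (simp add: Q_def mult.commute)
  have q3: "R (\<lambda>a b c. \<theta> b a c * \<theta> c a b) = - Q"
  proof -
    have "R (\<lambda>a b c. \<theta> b a c * \<theta> c a b) = R (\<lambda>a b c. - (\<theta> b c a * \<theta> c a b))"
    proof (rule Rcong)
      fix a b c assume "a < p" "b < p" "c < p"
      then show "\<theta> b a c * \<theta> c a b = - (\<theta> b c a * \<theta> c a b)" using th[of b a c] by simp
    qed
    then show ?thesis using Rcy[of "\<lambda>a b c. \<theta> a b c * \<theta> b c a"] by (simp add: Rmin Q_def)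
  qed
  have p1: "R (\<lambda>a b c. \<theta> b a c * \<theta> b a c) = P" and p2: "R (\<lambda>a b c. \<theta> c a b * \<theta> c a b) = P"
    using Rsw[of "\<lambda>a b c. \<theta> a b c * \<theta> a b c"] Rcy2[of "\<lambda>a b c. \<theta> a b c * \<theta> a b c"] by (simp_all add: P_def)
  have n3: "R (\<lambda>a b c. \<theta> b a c * n a b c) = - N"
  proof -
    have "R (\<lambda>a b c. \<theta> b a c * n a b c) = R (\<lambda>a b c. - (\<theta> b a c * n b a c))"
    proof (rule Rcong)
      fix a b c assume "a < p" "b < p" "c < p"
      then show "\<theta> b a c * n a b c = - (\<theta> b a c * n b a c)" using n1[of a b c] by simp
    qed
    then show ?thesis using Rsw[of "\<lambda>a b c. \<theta> a b c * n a b c"] by (simp add: Rmin N_def)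
  qed
  have n4: "R (\<lambda>a b c. \<theta> c a b * n a b c) = N"
  proof -
    have "R (\<lambda>a b c. \<theta> c a b * n a b c) = R (\<lambda>a b c. \<theta> c a b * n c a b)"
      by (rule Rcong) (simp add: ncy)
    then show ?thesis using Rcy2[of "\<lambda>a b c. \<theta> a b c * n a b c"] by (simp add: N_def)
  qed
  have TT: "R (\<lambda>a b c. T a b c * T a b c) = 2 * P + 2 * Q"
  proof -
    have "(\<lambda>a b c. T a b c * T a b c) = (\<lambda>a b c. (\<theta> a b c * \<theta> a b c + \<theta> b a c * \<theta> b a c) - 2 * (\<theta> b a c * \<theta> a b c))"
      by (intro ext) (simp add: T_def algebra_simps)
    then show ?thesis by (simp add: Rdiff Radd Rmul p1 q1 P_def[symmetric])
  qed
  have Tn: "R (\<lambda>a b c. T a b c * n a b c) = 2 * N"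
    unfolding T_def left_diff_distrib by (simp add: Rdiff n3 N_def[symmetric])
  have Tth: "R (\<lambda>a b c. T a b c * \<theta> c a b) = 2 * Q"
    unfolding T_def left_diff_distrib by (simp add: Rdiff q2 q3)
  have full: "R (\<lambda>a b c. (n a b c + T a b c + \<theta> c a b)\<^sup>2) = R (\<lambda>a b c. (n a b c)\<^sup>2) + 6 * N + 3 * P + 6 * Q"
  proof -
    have "(\<lambda>a b c. (n a b c + T a b c + \<theta> c a b)\<^sup>2) = (\<lambda>a b c. (n a b c)\<^sup>2 + (2 * (T a b c * n a b c)
      + (2 * (\<theta> c a b * n a b c) + (T a b c * T a b c + (2 * (T a b c * \<theta> c a b) + \<theta> c a b * \<theta> c a b)))))"
      by (intro ext) (simp add: power2_eq_square algebra_simps)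
    then show ?thesis by (simp add: Radd Rmul Tn n4 TT Tth p2)
  qed
  have mid: "(\<Sum>a<p. \<Sum>b<p. bb a b + (\<Sum>c<p. T a b c * T a b c) + 2 * (\<Sum>c<p. T a b c * n a b c) + 2 * B a b
          + 2 * (\<Sum>c<p. T a b c * \<theta> c a b))
     = (\<Sum>a<p. \<Sum>b<p. bb a b) + (2 * P + 2 * Q) + 2 * (2 * N) + 2 * (\<Sum>a<p. \<Sum>b<p. B a b) + 2 * (2 * Q)"
    unfolding sum.distrib sum_distrib_left[symmetric] TT[unfolded R_def] Tn[unfolded R_def] Tth[unfolded R_def] ..
  define s where "s a = (\<Sum>b<p. \<theta> b a b)" for a
  have s2: "s a = - (\<Sum>b<p. \<theta> b b a)" if "a < p" for a
  proof -
    have "s a = (\<Sum>b<p. - \<theta> b b a)"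
      unfolding s_def by (intro sum.cong refl, rule th) (use that in auto)
    then show ?thesis by (simp add: sum_negf)
  qed
  have X: "R (\<lambda>a b c. \<theta> a a c * \<theta> b b c) = (\<Sum>a<p. (s a)\<^sup>2)"
  proof -
    have "R (\<lambda>a b c. \<theta> a a c * \<theta> b b c) = R (\<lambda>c a b. \<theta> a a c * \<theta> b b c)"
      using Rcy2[of "\<lambda>c a b. \<theta> a a c * \<theta> b b c"] by simp
    also have "\<dots> = (\<Sum>c<p. (\<Sum>a<p. \<theta> a a c) * (\<Sum>b<p. \<theta> b b c))" unfolding R_def by (simp add: sum_product)
    also have "\<dots> = (\<Sum>a<p. (s a)\<^sup>2)" by (intro sum.cong refl) (simp add: s2 power2_eq_square)
    finally show ?thesis .
  qed
  have ds: "(\<Sum>a<p. d a * s a) + (\<Sum>a<p. \<Sum>b<p. \<theta> a a b * d b) = 0"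
  proof -
    have "(\<Sum>a<p. \<Sum>b<p. \<theta> a a b * d b) = (\<Sum>b<p. \<Sum>a<p. \<theta> a a b * d b)" by (rule sum.swap)
    also have "\<dots> = (\<Sum>b<p. - (d b * s b))"
      by (intro sum.cong refl) (simp add: s2 sum_distrib_left mult.commute)
    finally show ?thesis by (simp add: sum_negf)
  qed
  have h1: "(\<Sum>a<p. \<Sum>b<p. h a b) + (\<Sum>a<p. \<Sum>b<p. h2 a b) + (- Q) + (\<Sum>a<p. (s a)\<^sup>2) = 0"
  proof -
    have "(\<Sum>a<p. \<Sum>b<p. h a b + h2 a b + (\<Sum>c<p. \<theta> b a c * \<theta> a b c + \<theta> a a c * \<theta> b b c)) = 0"
      using H1 by (intro sum.neutral ballI) auto
    then show ?thesis unfolding q1[symmetric] X[symmetric] R_def by (simp add: sum.distrib)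
  qed
  have hB: "(\<Sum>a<p. \<Sum>b<p. h a b) - (\<Sum>a<p. \<Sum>b<p. h2 a b) = (\<Sum>a<p. \<Sum>b<p. B a b)"
  proof -
    have "(\<Sum>a<p. \<Sum>b<p. h a b - h2 b a) = (\<Sum>a<p. \<Sum>b<p. B a b)" using H2 by (intro sum.cong refl) auto
    then show ?thesis using sum.swap[of "\<lambda>a b. h2 a b" "{..<p}" "{..<p}"] by (simp add: sum_subtractf)
  qed
  have fst: "(\<Sum>a<p. (d a + (\<Sum>b<p. \<theta> b a b))\<^sup>2 + 2 * (hd' a + (\<Sum>b<p. \<theta> a a b * d b + h a b)))
    = (\<Sum>a<p. (d a)\<^sup>2 + 2 * hd' a) + 2 * (\<Sum>a<p. d a * s a) + (\<Sum>a<p. (s a)\<^sup>2)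
      + 2 * (\<Sum>a<p. \<Sum>b<p. \<theta> a a b * d b) + 2 * (\<Sum>a<p. \<Sum>b<p. h a b)"
    unfolding s_def[symmetric] by (simp add: power2_sum sum.distrib sum_distrib_left algebra_simps)
  show ?thesis
    unfolding fst mid full[unfolded R_def] using ds h1 hB by (simp add: algebra_simps)
qed

text \<open>The scalar curvature at \<open>x\<close> in terms of an orthonormal frame of \<open>V\<close>. Compared with the usual
  expression, the structure functions \<open>c\<^sub>a\<^sub>b\<^sub>\<alpha>\<close> with \<open>\<alpha>\<close> running through the complement have been
  absorbed into the squares of the brackets, so that only the frame of \<open>V\<close> appears.\<close>
definition frame_curvature where
  "frame_curvature E D p e x =
     (\<Sum>a<p. (D (e a) x)\<^sup>2 + 2 * act E (e a) (D (e a)) x)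
     - 1/2 * (\<Sum>a<p. \<Sum>b<p. inner_sec E (bracket E (e a) (e b)) (bracket E (e a) (e b)) x)
     + 1/3 * (\<Sum>a<p. \<Sum>b<p. \<Sum>c<p. (inner_sec E (e c) (bracket E (e a) (e b)) x)\<^sup>2)"

context
  fixes M :: "('m::{t2_space, second_countable_topology}, 'n::finite) mfd"
    and E :: "('m, 'v::real_vector) calg" and V :: "'m \<Rightarrow> 'v set"
  assumes mfd: "manifold M" and ca: "courant_algebroid M E" and gm: "generalized_metric M E V"
begin

text \<open>In the application \<open>B\<close> is a bracket of one frame, \<open>K\<close> the corresponding bracket of the other, and \<open>G\<close> the
  vector \<open>d\<^sub>E A\<^sub>a\<^sub>b\<close>.\<close>
lemma pairing_square_expand:
  fixes o' :: "nat \<Rightarrow> 'v" and T :: "nat \<Rightarrow> real"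
  assumes B: "B \<in> fibre E x" and G: "G \<in> fibre E x" and o: "\<And>c. c < p \<Longrightarrow> o' c \<in> fibre E x"
    and on: "\<And>b c. b < p \<Longrightarrow> c < p \<Longrightarrow> pairing E x (o' b) (o' c) = (if b = c then 1 else 0)"
    and K: "K = B + (\<Sum>c<p. T c *\<^sub>R o' c) + G"
  shows "pairing E x K K = pairing E x B B + (\<Sum>c<p. T c * T c) + 2 * (\<Sum>c<p. T c * pairing E x (o' c) B)
      + 2 * pairing E x B G + 2 * (\<Sum>c<p. T c * pairing E x (o' c) G) + pairing E x G G"
    and "c < p \<Longrightarrow> pairing E x (o' c) K = pairing E x (o' c) B + T c + pairing E x (o' c) G"
proof -
  note lin = pairing_add[OF mfd ca] and sym = pairing_sym[OF mfd ca]
  let ?S = "\<Sum>c<p. T c *\<^sub>R o' c"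
  have S: "?S \<in> fibre E x" using o by (intro subspace_sum subspace_scale ca_fibre_subspace[OF mfd ca]) auto
  have oS: "pairing E x (o' c) ?S = T c" if c: "c < p" for c
  proof -
    have "pairing E x (o' c) ?S = (\<Sum>b<p. T b * pairing E x (o' c) (o' b))"
      by (rule pairing_sum_right[OF mfd ca]) (use o c in auto)
    also have "\<dots> = (\<Sum>b<p. if b = c then T c else 0)" by (intro sum.cong refl) (use on c in auto)
    finally show ?thesis using c by (simp add: sum.delta)
  qed
  have Sv: "pairing E x ?S v = (\<Sum>c<p. T c * pairing E x (o' c) v)" if "v \<in> fibre E x" for v
    by (rule pairing_sum[OF mfd ca]) (use o that in auto)
  have BS: "B + ?S \<in> fibre E x" and KK: "K \<in> fibre E x"
    using B S G unfolding K by (auto intro!: subspace_add ca_fibre_subspace[OF mfd ca])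
  have K1: "pairing E x K v = pairing E x B v + pairing E x ?S v + pairing E x G v" if v: "v \<in> fibre E x" for v
    unfolding K using lin[OF BS G v] lin[OF B S v] by simp
  have K2: "pairing E x v K = pairing E x v B + pairing E x v ?S + pairing E x v G" if v: "v \<in> fibre E x" for v
    using K1[OF v] sym[OF v KK] sym[OF v B] sym[OF v S] sym[OF v G] by simp
  show "c < p \<Longrightarrow> pairing E x (o' c) K = pairing E x (o' c) B + T c + pairing E x (o' c) G"
    using K2[OF o] oS by simp
  show "pairing E x K K = pairing E x B B + (\<Sum>c<p. T c * T c) + 2 * (\<Sum>c<p. T c * pairing E x (o' c) B)
      + 2 * pairing E x B G + 2 * (\<Sum>c<p. T c * pairing E x (o' c) G) + pairing E x G G"
    using K1[OF KK] K2[OF B] K2[OF S] K2[OF G] sym[OF B S] sym[OF G B] sym[OF G S] Sv[OF B] Sv[OF S] Sv[OF G]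
    by (simp add: oS)
qed

text \<open>The frame \<open>e\<close> is \<open>A o'\<close> with an orthogonal matrix \<open>A\<close> of smooth functions that is the identity
  at \<open>x\<close>. Since its entries are the pairings of \<open>e\<close> with \<open>o'\<close>, they are global functions, and the squares of
  their \<open>d\<^sub>E\<close> vanish.\<close>
lemma frame_curvature_invariant_pointed:
  fixes p :: nat
  assumes D: "divergence M E D"
    and os: "\<And>a. a < p \<Longrightarrow> o' a \<in> sections M E" and es: "\<And>a. a < p \<Longrightarrow> e a \<in> sections M E"
    and U: "open U" "x \<in> U"
    and oo: "\<And>y a b. y \<in> U \<Longrightarrow> a < p \<Longrightarrow> b < p \<Longrightarrow> inner_sec E (o' a) (o' b) y = (if a = b then 1 else 0)"
    and ee: "\<And>y a b. y \<in> U \<Longrightarrow> a < p \<Longrightarrow> b < p \<Longrightarrow> inner_sec E (e a) (e b) y = (if a = b then 1 else 0)"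
    and eo: "\<And>y a. y \<in> U \<Longrightarrow> a < p \<Longrightarrow> e a y = (\<Sum>b<p. inner_sec E (e a) (o' b) y *\<^sub>R o' b y)"
    and ex: "\<And>a. a < p \<Longrightarrow> e a x = o' a x"
  shows "frame_curvature E D p e x = frame_curvature E D p o' x"
proof -
  note vb = ca_vb[OF mfd ca]
  note sf = section_in_fibre[OF mfd ca gm]
  note smul = smooth_fun_mult[OF mfd ca gm] and ssum = smooth_fun_sum[OF mfd ca gm] and sadd = smooth_fun_add[OF mfd ca gm]
  define A where "A a b = inner_sec E (e a) (o' b)" for a b
  define \<theta> where "\<theta> c a b = act E (o' c) (A a b) x" for c a b
  define H where "H i j a b = act E (o' i) (act E (o' j) (A a b)) x" for i j a b
  have As: "A a b \<in> smooth_functions M" if "a < p" "b < p" for a b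
    unfolding A_def by (rule inner_smooth[OF mfd ca es[OF that(1)] os[OF that(2)]])
  have aAs: "act E (o' c) (A a b) \<in> smooth_functions M" if "c < p" "a < p" "b < p" for a b c
    by (rule act_smooth[OF mfd ca gm os[OF that(1)] As[OF that(2,3)]])
  have Ax: "A a b x = (if a = b then 1 else 0)" if "a < p" "b < p" for a b
    using oo[OF U(2) that] ex[OF that(1)] by (simp add: A_def inner_sec_def)
  have ap: "act E (e a) f x = act E (o' a) f x" if "a < p" for a f
    by (simp add: act_def rho_def ex that)
  have AAT: "(\<Sum>c<p. A a c y * A b c y) = (if a = b then 1 else 0)" if "y \<in> U" "a < p" "b < p" for y a b
  proof -
    have "inner_sec E (e b) (e a) y = pairing E y (e b y) (\<Sum>c<p. A a c y *\<^sub>R o' c y)"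
      using eo[OF that(1,2)] by (simp add: inner_sec_def A_def)
    also have "\<dots> = (\<Sum>c<p. A a c y * pairing E y (e b y) (o' c y))"
      by (rule pairing_sum_right[OF mfd ca]) (use sf os es that in auto)
    finally show ?thesis using ee[OF that(1,3,2)] by (simp add: A_def inner_sec_def eq_commute)
  qed
  have d1: "act E (o' j) (\<lambda>y. \<Sum>c<p. A a c y * A b c y) = (\<lambda>y. \<Sum>c<p. A a c y * act E (o' j) (A b c) y + A b c y * act E (o' j) (A a c) y)"
    if "j < p" "a < p" "b < p" for j a b
  proof
    fix y
    have "act E (o' j) (\<lambda>y. \<Sum>c<p. A a c y * A b c y) y = (\<Sum>c<p. act E (o' j) (\<lambda>y. A a c y * A b c y) y)"
      by (rule act_sum[OF mfd ca gm os[OF that(1)]]) (use As that in \<open>auto intro!: smul\<close>)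
    also have "\<dots> = (\<Sum>c<p. A a c y * act E (o' j) (A b c) y + A b c y * act E (o' j) (A a c) y)"
      by (intro sum.cong refl act_mult[OF mfd ca gm os[OF that(1)]]) (use As that in auto)
    finally show "act E (o' j) (\<lambda>y. \<Sum>c<p. A a c y * A b c y) y = \<dots>" .
  qed
  have AATs: "(\<lambda>y. \<Sum>c<p. A a c y * A b c y) \<in> smooth_functions M" if "a < p" "b < p" for a b
    using As that by (intro ssum smul) auto
  have d0: "(\<Sum>c<p. A a c y * act E (o' j) (A b c) y + A b c y * act E (o' j) (A a c) y) = 0"
    if "y \<in> U" "j < p" "a < p" "b < p" for y j a b
  proof -
    have "act E (o' j) (\<lambda>y. \<Sum>c<p. A a c y * A b c y) y = act E (o' j) (\<lambda>y. if a = b then 1 else 0) y"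
      by (rule act_local[OF mfd ca gm os[OF that(2)] AATs[OF that(3,4)] smooth_fun_const[OF mfd ca gm] U(1) that(1)])
        (use AAT that in auto)
    then show ?thesis unfolding d1[OF that(2-4)] using act_const[OF mfd ca gm os[OF that(2)]] by simp
  qed
  have delta: "(\<Sum>c<p. A a c x * f c) = f a" if "a < p" for a and f :: "nat \<Rightarrow> real"
  proof -
    have "(\<Sum>c<p. A a c x * f c) = (\<Sum>c<p. if c = a then f a else 0)"
      by (intro sum.cong refl) (use Ax that in auto)
    then show ?thesis using that by (simp add: sum.delta)
  qed
  \<comment> \<open>First and second derivatives of \<open>A A\<^sup>T = 1\<close> at \<open>x\<close>.\<close>
  have th: "\<theta> j a b = - \<theta> j b a" if "j < p" "a < p" "b < p" for j a b
    using d0[OF U(2) that] delta[OF that(2)] delta[OF that(3)] by (simp add: sum.distrib \<theta>_def)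
  have second: "H i j a b + H i j b a + (\<Sum>c<p. \<theta> j a c * \<theta> i b c + \<theta> i a c * \<theta> j b c) = 0"
    if ij: "i < p" "j < p" and ab: "a < p" "b < p" for i j a b
  proof -
    let ?g = "\<lambda>y. \<Sum>c<p. A a c y * act E (o' j) (A b c) y + A b c y * act E (o' j) (A a c) y"
    have gs: "?g \<in> smooth_functions M" using As aAs ij ab by (intro ssum sadd smul) auto
    have "act E (o' i) ?g x = act E (o' i) (\<lambda>y. 0) x"
      by (rule act_local[OF mfd ca gm os[OF ij(1)] gs smooth_fun_const[OF mfd ca gm] U]) (rule d0[OF _ ij(2) ab])
    also have "\<dots> = 0" by (rule act_const[OF mfd ca gm os[OF ij(1)]])
    also have "act E (o' i) ?g x = (\<Sum>c<p. act E (o' i) (\<lambda>y. A a c y * act E (o' j) (A b c) y + A b c y * act E (o' j) (A a c) y) x)"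
      by (rule act_sum[OF mfd ca gm os[OF ij(1)]]) (use As aAs ij ab in \<open>auto intro!: sadd smul\<close>)
    also have "\<dots> = (\<Sum>c<p. (A a c x * H i j b c + \<theta> j b c * \<theta> i a c) + (A b c x * H i j a c + \<theta> j a c * \<theta> i b c))"
    proof (intro sum.cong refl)
      fix c assume "c \<in> {..<p}"
      then have c: "c < p" by simp
      have "act E (o' i) (\<lambda>y. A a c y * act E (o' j) (A b c) y + A b c y * act E (o' j) (A a c) y) x
        = act E (o' i) (\<lambda>y. A a c y * act E (o' j) (A b c) y) x + act E (o' i) (\<lambda>y. A b c y * act E (o' j) (A a c) y) x"
        by (rule act_add[OF mfd ca gm os[OF ij(1)]]) (use As aAs ij ab c in \<open>auto intro!: smul\<close>)
      also have "act E (o' i) (\<lambda>y. A a c y * act E (o' j) (A b c) y) x = A a c x * H i j b c + \<theta> j b c * \<theta> i a c"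
        unfolding H_def \<theta>_def by (rule act_mult[OF mfd ca gm os[OF ij(1)]]) (use As aAs ij ab c in auto)
      also have "act E (o' i) (\<lambda>y. A b c y * act E (o' j) (A a c) y) x = A b c x * H i j a c + \<theta> j a c * \<theta> i b c"
        unfolding H_def \<theta>_def by (rule act_mult[OF mfd ca gm os[OF ij(1)]]) (use As aAs ij ab c in auto)
      finally show "act E (o' i) (\<lambda>y. A a c y * act E (o' j) (A b c) y + A b c y * act E (o' j) (A a c) y) x
        = (A a c x * H i j b c + \<theta> j b c * \<theta> i a c) + (A b c x * H i j a c + \<theta> j a c * \<theta> i b c)" .
    qed
    also have "\<dots> = H i j b a + H i j a b + (\<Sum>c<p. \<theta> j a c * \<theta> i b c + \<theta> i a c * \<theta> j b c)"
      using delta[OF ab(1), of "H i j b"] delta[OF ab(2), of "H i j a"] by (simp add: sum.distrib mult.commute)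
    finally show ?thesis by simp
  qed
  define Bk where "Bk a b = bracket E (o' a) (o' b) x" for a b
  define G where "G a b = dE E (A a b) x" for a b
  define Bv where "Bv a b = act E (bracket E (o' a) (o' b)) (A a b) x" for a b
  \<comment> \<open>The failure of second derivatives to commute is the derivative along the bracket.\<close>
  have comm: "H a b a b - H b a a b = Bv a b" if "a < p" "b < p" for a b
    unfolding H_def Bv_def using act_bracket[OF mfd ca gm os[OF that(1)] os[OF that(2)] As[OF that]] by simp
  define e' where "e' a y = (\<Sum>b<p. A a b y *\<^sub>R o' b y)" for a y
  have e's: "e' a \<in> sections M E" if "a < p" for a
    unfolding e'_def[abs_def] by (rule sections_sum[OF mfd vb]) (use os As that in auto)
  have ee': "e a y = e' a y" if "y \<in> U" "a < p" for a y using eo[OF that] by (simp add: e'_def A_def)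
  define Dg where "Dg a y = (\<Sum>b<p. A a b y * D (o' b) y + act E (o' b) (A a b) y)" for a y
  have Ds: "D (o' b) \<in> smooth_functions M" if "b < p" for b by (rule div_smooth[OF mfd ca gm D os[OF that]])
  have De: "D (e a) y = Dg a y" if "y \<in> U" "a < p" for a y
  proof -
    have "D (e a) y = D (e' a) y"
      by (rule div_local[OF mfd ca gm D es[OF that(2)] e's[OF that(2)] U(1) that(1)]) (use ee' that in auto)
    also have "\<dots> = Dg a y" unfolding e'_def[abs_def] Dg_def
      by (rule div_sum[OF mfd ca gm D]) (use os As that in auto)
    finally show ?thesis .
  qed
  have T1: "D (e a) x = D (o' a) x + (\<Sum>b<p. \<theta> b a b)" if "a < p" for a
    using De[OF U(2) that] delta[OF that, of "\<lambda>b. D (o' b) x"] by (simp add: Dg_def sum.distrib \<theta>_def)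
  have Dgs: "Dg a \<in> smooth_functions M" if "a < p" for a
    unfolding Dg_def[abs_def] using As aAs Ds that by (intro ssum sadd smul) auto
  have T2: "act E (e a) (D (e a)) x = act E (o' a) (D (o' a)) x + (\<Sum>b<p. \<theta> a a b * D (o' b) x + H a b a b)"
    if a: "a < p" for a
  proof -
    have "act E (e a) (D (e a)) x = act E (o' a) (D (e a)) x" by (rule ap[OF a])
    also have "\<dots> = act E (o' a) (Dg a) x"
      by (rule act_local[OF mfd ca gm os[OF a] div_smooth[OF mfd ca gm D es[OF a]] Dgs[OF a] U]) (rule De[OF _ a])
    also have "\<dots> = (\<Sum>b<p. act E (o' a) (\<lambda>y. A a b y * D (o' b) y + act E (o' b) (A a b) y) x)"
      unfolding Dg_def[abs_def] by (rule act_sum[OF mfd ca gm os[OF a]]) (use As aAs Ds a in \<open>auto intro!: sadd smul\<close>)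
    also have "\<dots> = (\<Sum>b<p. (A a b x * act E (o' a) (D (o' b)) x + D (o' b) x * \<theta> a a b) + H a b a b)"
    proof (intro sum.cong refl)
      fix b assume "b \<in> {..<p}"
      then have b: "b < p" by simp
      have "act E (o' a) (\<lambda>y. A a b y * D (o' b) y + act E (o' b) (A a b) y) x
        = act E (o' a) (\<lambda>y. A a b y * D (o' b) y) x + H a b a b"
        unfolding H_def by (rule act_add[OF mfd ca gm os[OF a]]) (use As aAs Ds a b in \<open>auto intro!: smul\<close>)
      also have "act E (o' a) (\<lambda>y. A a b y * D (o' b) y) x = A a b x * act E (o' a) (D (o' b)) x + D (o' b) x * \<theta> a a b"
        unfolding \<theta>_def by (rule act_mult[OF mfd ca gm os[OF a] As[OF a b] Ds[OF b]])
      finally show "act E (o' a) (\<lambda>y. A a b y * D (o' b) y + act E (o' b) (A a b) y) x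
        = (A a b x * act E (o' a) (D (o' b)) x + D (o' b) x * \<theta> a a b) + H a b a b" .
    qed
    also have "\<dots> = act E (o' a) (D (o' a)) x + (\<Sum>b<p. \<theta> a a b * D (o' b) x + H a b a b)"
      using delta[OF a, of "\<lambda>b. act E (o' a) (D (o' b)) x"] by (simp add: sum.distrib mult.commute)
    finally show ?thesis .
  qed
  have oflip: "bracket E (o' a) (o' b) x = - bracket E (o' b) (o' a) x" if "a < p" "b < p" for a b
  proof -
    have "dE E (inner_sec E (o' a) (o' b)) x = 0"
      by (rule dE_local_const[OF mfd ca gm inner_smooth[OF mfd ca] U]) (use os oo that in auto)
    then show ?thesis using br_symmetric_part[OF mfd ca gm os[OF that(1)] os[OF that(2)], of x]
      by (simp add: eq_neg_iff_add_eq_0)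
  qed
  define T where "T a b c = \<theta> a b c - \<theta> b a c" for a b c
  have right: "bracket E w (e b) x = bracket E w (o' b) x + (\<Sum>c<p. act E w (A b c) x *\<^sub>R o' c x)"
    if w: "w \<in> sections M E" and b: "b < p" for w b
  proof -
    have "bracket E w (e b) x = bracket E w (e' b) x"
      by (rule br_local_right[OF mfd ca gm w es[OF b] e's[OF b] U]) (rule ee'[OF _ b])
    also have "\<dots> = (\<Sum>c<p. A b c x *\<^sub>R bracket E w (o' c) x + act E w (A b c) x *\<^sub>R o' c x)"
      unfolding e'_def[abs_def] by (rule br_sum_right[OF mfd ca gm w]) (use os As b in auto)
    also have "\<dots> = (\<Sum>c<p. if c = b then bracket E w (o' b) x else 0) + (\<Sum>c<p. act E w (A b c) x *\<^sub>R o' c x)"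
      unfolding sum.distrib using Ax b by (intro arg_cong2[where f = "(+)"] sum.cong refl) auto
    finally show ?thesis using b by (simp add: sum.delta)
  qed
  \<comment> \<open>Only the Leibniz rule in the second argument is an axiom; the first argument is treated by
    swapping the arguments, which produces \<open>G a b\<close>.\<close>
  have K: "bracket E (e a) (e b) x = Bk a b + (\<Sum>c<p. T a b c *\<^sub>R o' c x) + G a b" if a: "a < p" and b: "b < p" for a b
  proof -
    have "bracket E (e a) (e b) x = bracket E (e a) (o' b) x + (\<Sum>c<p. \<theta> a b c *\<^sub>R o' c x)"
      unfolding right[OF es[OF a] b] \<theta>_def ap[OF a] ..
    moreover have "bracket E (e a) (o' b) x = G a b - bracket E (o' b) (e a) x"
      using br_symmetric_part[OF mfd ca gm es[OF a] os[OF b], of x] by (simp add: G_def A_def eq_diff_eq)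
    moreover have "bracket E (o' b) (e a) x = - Bk a b + (\<Sum>c<p. \<theta> b a c *\<^sub>R o' c x)"
      unfolding right[OF os[OF b] a] Bk_def \<theta>_def using oflip[OF b a] by simp
    ultimately show ?thesis by (simp add: T_def scaleR_left_diff_distrib sum_subtractf)
  qed
  have of: "o' c x \<in> fibre E x" if "c < p" for c using sf os that by blast
  have Bf: "Bk a b \<in> fibre E x" if "a < p" "b < p" for a b
    unfolding Bk_def using sf br_sec[OF mfd ca gm os os] that by blast
  have Gf: "G a b \<in> fibre E x" if "a < p" "b < p" for a b
    unfolding G_def by (rule dE_fibre[OF mfd ca gm As[OF that]])
  have oG: "pairing E x (o' c x) (G a b) = \<theta> c a b" if "a < p" "b < p" "c < p" for a b c
    unfolding G_def using pairing_dE[OF mfd ca gm As[OF that(1,2)] of[OF that(3)]] by (simp add: \<theta>_def act_def rho_def)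
  have BG: "pairing E x (Bk a b) (G a b) = Bv a b" if "a < p" "b < p" for a b
    unfolding G_def using pairing_dE[OF mfd ca gm As[OF that] Bf[OF that]] by (simp add: Bv_def Bk_def act_def rho_def)
  have GG: "pairing E x (G a b) (G a b) = 0" if "a < p" "b < p" for a b
    unfolding G_def using pairing_dE[OF mfd ca gm As[OF that] dE_fibre[OF mfd ca gm As[OF that]]]
      anchor_dE_inner[OF mfd ca gm es[OF that(1)] os[OF that(2)] As[OF that], of x] by (simp add: A_def)
  define n where "n a b c = pairing E x (o' c x) (Bk a b)" for a b c
  have on: "pairing E x (o' b x) (o' c x) = (if b = c then 1 else 0)" if "b < p" "c < p" for b c
    using oo[OF U(2) that] by (simp add: inner_sec_def)
  have n1: "n a b c = - n b a c" if "a < p" "b < p" "c < p" for a b c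
  proof -
    have "Bk a b = (-1) *\<^sub>R Bk b a" using oflip[OF that(1,2)] by (simp add: Bk_def)
    moreover have "pairing E x (o' c x) ((-1) *\<^sub>R Bk b a) = - pairing E x (o' c x) (Bk b a)"
      using pairing_sum_right[OF mfd ca, of "{0::nat}" "\<lambda>_. Bk b a" x "o' c x" "\<lambda>_. -1"] Bf of that by simp
    ultimately show ?thesis by (simp add: n_def)
  qed
  have n2: "n a b c = - n a c b" if "a < p" "b < p" "c < p" for a b c
  proof -
    have "act E (o' a) (inner_sec E (o' b) (o' c)) x = act E (o' a) (\<lambda>y. if b = c then 1 else 0) x"
      by (rule act_local[OF mfd ca gm os[OF that(1)] inner_smooth[OF mfd ca os[OF that(2)] os[OF that(3)]] smooth_fun_const[OF mfd ca gm] U])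
        (use oo that in auto)
    then have "inner_sec E (bracket E (o' a) (o' b)) (o' c) x + inner_sec E (o' b) (bracket E (o' a) (o' c)) x = 0"
      using br_invariance[OF mfd ca gm os[OF that(1)] os[OF that(2)] os[OF that(3)], of x] act_const[OF mfd ca gm os[OF that(1)]] by simp
    then show ?thesis using pairing_sym[OF mfd ca Bf[OF that(1,2)] of[OF that(3)]] by (simp add: n_def Bk_def inner_sec_def)
  qed
  have KK: "inner_sec E (bracket E (e a) (e b)) (bracket E (e a) (e b)) x =
      pairing E x (Bk a b) (Bk a b) + (\<Sum>c<p. T a b c * T a b c) + 2 * (\<Sum>c<p. T a b c * n a b c) + 2 * Bv a b
      + 2 * (\<Sum>c<p. T a b c * \<theta> c a b)" if "a < p" "b < p" for a b
    using pairing_square_expand(1)[OF Bf[OF that] Gf[OF that] of on K[OF that]] that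
    by (simp add: inner_sec_def n_def oG BG GG cong: sum.cong_simp)
  have oK: "inner_sec E (e c) (bracket E (e a) (e b)) x = n a b c + T a b c + \<theta> c a b" if "a < p" "b < p" "c < p" for a b c
    using pairing_square_expand(2)[OF Bf[OF that(1,2)] Gf[OF that(1,2)] of on K[OF that(1,2)] that(3)] that ex
    by (simp add: inner_sec_def n_def oG)
  have "frame_curvature E D p e x =
    (\<Sum>a<p. (D (o' a) x + (\<Sum>b<p. \<theta> b a b))\<^sup>2 + 2 * (act E (o' a) (D (o' a)) x + (\<Sum>b<p. \<theta> a a b * D (o' b) x + H a b a b)))
     - 1/2 * (\<Sum>a<p. \<Sum>b<p. pairing E x (Bk a b) (Bk a b) + (\<Sum>c<p. T a b c * T a b c) + 2 * (\<Sum>c<p. T a b c * n a b c) + 2 * Bv a b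
          + 2 * (\<Sum>c<p. T a b c * \<theta> c a b))
     + 1/3 * (\<Sum>a<p. \<Sum>b<p. \<Sum>c<p. (n a b c + T a b c + \<theta> c a b)\<^sup>2)"
    unfolding frame_curvature_def
    by (intro arg_cong2[where f = "(+)"] arg_cong2[where f = "(-)"] arg_cong2[where f = "(*)"] refl sum.cong)
      (simp_all add: T1 T2 KK oK)
  also have "\<dots> = (\<Sum>a<p. (D (o' a) x)\<^sup>2 + 2 * act E (o' a) (D (o' a)) x) - 1/2 * (\<Sum>a<p. \<Sum>b<p. pairing E x (Bk a b) (Bk a b))
      + 1/3 * (\<Sum>a<p. \<Sum>b<p. \<Sum>c<p. (n a b c)\<^sup>2)"
    unfolding T_def
  proof (rule frame_change_algebra[where ?h2.0 = "\<lambda>a b. H a b b a"])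
    show "H a b a b + H a b b a + (\<Sum>c<p. \<theta> b a c * \<theta> a b c + \<theta> a a c * \<theta> b b c) = 0" if "a < p" "b < p" for a b
      by (rule second[OF that that])
    show "H a b a b - H b a a b = Bv a b" if "a < p" "b < p" for a b by (rule comm[OF that])
    show "\<theta> a b c = - \<theta> a c b" if "a < p" "b < p" "c < p" for a b c by (rule th[OF that])
    show "n a b c = - n b a c" if "a < p" "b < p" "c < p" for a b c by (rule n1[OF that])
    show "n a b c = - n a c b" if "a < p" "b < p" "c < p" for a b c by (rule n2[OF that])
  qed
  also have "\<dots> = frame_curvature E D p o' x"
    unfolding frame_curvature_def n_def Bk_def inner_sec_def ..
  finally show ?thesis .
qed

end

section \<open>The scalar curvature in an orthonormal frame\<close>

text \<open>Linearity over the reals, on smooth sections only.\<close>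

definition sec_linear ::
  "('m::{t2_space, second_countable_topology}, 'n::finite) mfd \<Rightarrow> ('m, 'v::real_vector) calg \<Rightarrow>
   (('m \<Rightarrow> 'v) \<Rightarrow> 'w::real_vector) \<Rightarrow> bool"
where
  "sec_linear M E P \<longleftrightarrow> (\<forall>u\<in>sections M E. \<forall>v\<in>sections M E. \<forall>a b.
     P (\<lambda>x. a *\<^sub>R u x + b *\<^sub>R v x) = a *\<^sub>R P u + b *\<^sub>R P v)"

text \<open>Unlike \<open>orthonormal_frame\<close>, this involves a frame of \<open>V\<close> only, and it is what pulls back.\<close>

definition orthonormal_subframe where
  "orthonormal_subframe M E V x p w \<longleftrightarrow> (\<forall>a<p. w a \<in> sections M E) \<and>
     (\<exists>U. open U \<and> x \<in> U \<and> (\<forall>y\<in>U. basis_family (V y) {..<p} (\<lambda>a. w a y) \<and>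
       (\<forall>a<p. \<forall>b<p. inner_sec E (w a) (w b) y = (if a = b then 1 else 0))))"

context
  fixes M :: "('m::{t2_space, second_countable_topology}, 'n::finite) mfd"
    and E :: "('m, 'v::real_vector) calg" and V :: "'m \<Rightarrow> 'v set"
  assumes mfd: "manifold M" and ca: "courant_algebroid M E" and gm: "generalized_metric M E V"
begin

lemma sec_linear_sum:
  assumes P: "sec_linear M E P" and "\<And>i. i \<in> S \<Longrightarrow> u i \<in> sections M E"
  shows "P (\<lambda>x. \<Sum>i\<in>S. k i *\<^sub>R u i x) = (\<Sum>i\<in>S. k i *\<^sub>R P (u i))"
proof -
  have z: "P (\<lambda>x. 0) = 0"
    using P[unfolded sec_linear_def, rule_format, OF sections_zero[OF mfd ca_vb[OF mfd ca]] sections_zero[OF mfd ca_vb[OF mfd ca]], of 0 0] by simp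
  show ?thesis using assms(2)
  proof (induction S rule: infinite_finite_induct)
    case (insert i S)
    have s: "(\<lambda>x. \<Sum>i\<in>S. k i *\<^sub>R u i x) \<in> sections M E"
      using sections_sum[OF mfd ca_vb[OF mfd ca], of S u "\<lambda>i x. k i"] insert.prems smooth_fun_const[OF mfd ca gm] by auto
    have "u i \<in> sections M E" using insert.prems by simp
    then have "P (\<lambda>x. k i *\<^sub>R u i x + 1 *\<^sub>R (\<Sum>i\<in>S. k i *\<^sub>R u i x)) = k i *\<^sub>R P (u i) + 1 *\<^sub>R P (\<lambda>x. \<Sum>i\<in>S. k i *\<^sub>R u i x)"
      by (rule P[unfolded sec_linear_def, rule_format, OF _ s])
    then show ?case using insert by simp
  qed (simp_all add: z)
qed

text \<open>Expanding both arguments in \<open>q\<close> produces the product of the matrices \<open>G\<close> and \<open>H\<close>, which are inverse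
  to each other. For dual families \<open>e\<close>, \<open>f\<close> this says that a contraction may be computed in an orthonormal
  frame.\<close>
lemma contraction_change:
  fixes B :: "('m \<Rightarrow> 'v) \<Rightarrow> ('m \<Rightarrow> 'v) \<Rightarrow> real" and p :: nat
  assumes B1: "\<And>v. v \<in> sections M E \<Longrightarrow> sec_linear M E (\<lambda>u. B u v)"
    and B2: "\<And>u. u \<in> sections M E \<Longrightarrow> sec_linear M E (\<lambda>v. B u v)"
    and q: "\<And>c. c < p \<Longrightarrow> q c \<in> sections M E"
    and e: "\<And>a. a < p \<Longrightarrow> e a = (\<lambda>y. \<Sum>c<p. H a c *\<^sub>R q c y)"
    and f: "\<And>a. a < p \<Longrightarrow> f a = (\<lambda>y. \<Sum>c<p. G c a *\<^sub>R q c y)"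
    and GH: "\<And>c d. c < p \<Longrightarrow> d < p \<Longrightarrow> (\<Sum>a<p. G c a * H a d) = (if c = d then 1 else 0)"
  shows "(\<Sum>a<p. B (e a) (f a)) = (\<Sum>c<p. B (q c) (q c))"
proof -
  have "B (e a) (f a) = (\<Sum>d<p. \<Sum>c<p. (G c a * H a d) * B (q d) (q c))" if a: "a < p" for a
  proof -
    have fs: "f a \<in> sections M E" unfolding f[OF a]
      using sections_sum[OF mfd ca_vb[OF mfd ca], of "{..<p}" q "\<lambda>c x. G c a"] q smooth_fun_const[OF mfd ca gm] by auto
    have "B (e a) (f a) = (\<Sum>d<p. H a d *\<^sub>R B (q d) (f a))"
      unfolding e[OF a] by (rule sec_linear_sum[OF B1[OF fs]]) (use q in auto)
    also have "\<dots> = (\<Sum>d<p. H a d *\<^sub>R (\<Sum>c<p. G c a *\<^sub>R B (q d) (q c)))"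
      unfolding f[OF a] by (intro sum.cong refl arg_cong2[where f = "(*\<^sub>R)"] sec_linear_sum[OF B2]) (use q in auto)
    finally show ?thesis by (simp add: sum_distrib_left mult_ac)
  qed
  then have "(\<Sum>a<p. B (e a) (f a)) = (\<Sum>a<p. \<Sum>d<p. \<Sum>c<p. (G c a * H a d) * B (q d) (q c))" by simp
  also have "\<dots> = (\<Sum>d<p. \<Sum>a<p. \<Sum>c<p. (G c a * H a d) * B (q d) (q c))" by (rule sum.swap)
  also have "\<dots> = (\<Sum>d<p. \<Sum>c<p. \<Sum>a<p. (G c a * H a d) * B (q d) (q c))" by (intro sum.cong refl sum.swap)
  also have "\<dots> = (\<Sum>d<p. \<Sum>c<p. if c = d then B (q d) (q d) else 0)"
    by (intro sum.cong refl) (simp add: sum_distrib_right[symmetric] GH)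
  finally show ?thesis by (simp add: sum.delta)
qed

lemma br_combine_left:
  assumes "u \<in> sections M E" "v \<in> sections M E" "w \<in> sections M E"
  shows "bracket E (\<lambda>x. a *\<^sub>R u x + b *\<^sub>R v x) w x = a *\<^sub>R bracket E u w x + b *\<^sub>R bracket E v w x"
proof -
  have "bracket E (\<lambda>x. a *\<^sub>R u x + b *\<^sub>R v x) w = (\<lambda>x. a *\<^sub>R bracket E u w x + b *\<^sub>R bracket E v w x)"
    using ca assms unfolding courant_algebroid_def courant_bracket_def by blast
  then show ?thesis by simp
qed

lemma subframe_expand:
  assumes b: "basis_family (V y) {..<p} (\<lambda>a. w a y)" and w: "\<And>a. a < p \<Longrightarrow> w a \<in> sections M E"
    and o: "\<And>a b. a < p \<Longrightarrow> b < p \<Longrightarrow> inner_sec E (w a) (w b) y = (if a = b then 1 else 0)"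
    and v: "v \<in> V y"
  shows "v = (\<Sum>a<p. pairing E y v (w a y) *\<^sub>R w a y)"
proof -
  obtain g where g: "v = (\<Sum>a<p. g a *\<^sub>R w a y)" by (rule basis_family_expand[OF b finite_lessThan v])
  have "g a = pairing E y v (w a y)" if a: "a < p" for a
  proof -
    have "g a = frame_sign p a * pairing E y v (w a y)"
      by (rule ortho_coeff[OF mfd ca _ _ _ g]) (use section_in_fibre[OF mfd ca gm] w o a in \<open>auto simp: inner_sec_def frame_sign_def\<close>)
    then show ?thesis using a by (simp add: frame_sign_def)
  qed
  then have "(\<Sum>a<p. pairing E y v (w a y) *\<^sub>R w a y) = (\<Sum>a<p. g a *\<^sub>R w a y)"
    by (intro sum.cong refl) auto
  from trans[OF g this[symmetric]] show ?thesis .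
qed

lemma orthonormal_imp_adapted:
  assumes "orthonormal_frame M E V x p w" shows "adapted_frame M E V x p w"
proof -
  obtain U where U: "open U" "x \<in> U" "orthonormal_on E V p w U" "p \<le> fibre_dim E" "\<forall>k<fibre_dim E. w k \<in> sections M E"
    using assms unfolding orthonormal_frame_def by blast
  then show ?thesis unfolding adapted_frame_def orthonormal_on_def by (intro conjI exI[of _ U]) auto
qed

lemma orthonormal_imp_subframe:
  assumes "orthonormal_frame M E V x p w" shows "orthonormal_subframe M E V x p w"
proof -
  obtain U where U: "open U" "x \<in> U" "orthonormal_on E V p w U" "p \<le> fibre_dim E" "\<forall>k<fibre_dim E. w k \<in> sections M E"
    using assms unfolding orthonormal_frame_def by blast
  then show ?thesis unfolding orthonormal_subframe_def orthonormal_on_def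
    by (intro conjI exI[of _ U]) (auto simp: frame_sign_def)
qed

lemma fibre_split:
  assumes v: "v \<in> fibre E x"
  obtains a b where "a \<in> V x" "b \<in> perp E V x" "v = a + b"
proof -
  let ?r = "fibre_dim E"
  obtain p w where "orthonormal_frame M E V x p w" using orthonormal_frame_exists[OF mfd ca gm] by blast
  then obtain U where w: "p \<le> ?r" "\<And>k. k < ?r \<Longrightarrow> w k \<in> sections M E" and U: "x \<in> U" "orthonormal_on E V p w U"
    unfolding orthonormal_frame_def by blast
  have bV: "basis_family (V x) {..<p} (\<lambda>a. w a x)" and bP: "basis_family (perp E V x) {p..<?r} (\<lambda>a. w a x)"
    using U by (auto simp: orthonormal_on_def)
  let ?g = "\<lambda>k. (frame_sign p k * pairing E x v (w k x)) *\<^sub>R w k x"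
  have "v = (\<Sum>k<?r. ?g k)" by (rule frame_expand[OF mfd ca gm U(2,1) v w(2,1)])
  also have "\<dots> = (\<Sum>k<p. ?g k) + (\<Sum>k\<in>{p..<?r}. ?g k)"
    using sum.atLeastLessThan_concat[of 0 p ?r ?g] w(1) by (simp add: atLeast0LessThan)
  finally have "v = (\<Sum>k<p. ?g k) + (\<Sum>k\<in>{p..<?r}. ?g k)" .
  moreover have "(\<Sum>k<p. ?g k) \<in> V x"
    by (intro subspace_sum subspace_scale V_subspace[OF mfd ca gm] basis_family_mem[OF bV])
  moreover have "(\<Sum>k\<in>{p..<?r}. ?g k) \<in> perp E V x"
  proof -
    have "(\<Sum>k\<in>{p..<?r}. ?g k) \<in> span ((\<lambda>a. w a x) ` {p..<?r})" by (intro span_sum span_scale span_base imageI)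
    then show ?thesis using bP by (simp add: basis_family_def)
  qed
  ultimately show thesis using that by blast
qed

lemma V_perp_zero: "v \<in> V x \<Longrightarrow> v \<in> perp E V x \<Longrightarrow> v = 0"
  using V_pos[OF mfd ca gm, of v x] by (auto simp: perp_def)

text \<open>The component of \<open>v\<close> in the complement of \<open>V\<close> is orthogonal to itself, and the pairing is definite there.\<close>
lemma perp_perp:
  assumes v: "v \<in> fibre E x" and o: "\<And>z. z \<in> perp E V x \<Longrightarrow> pairing E x v z = 0"
  shows "v \<in> V x"
proof -
  obtain a b where ab: "a \<in> V x" "b \<in> perp E V x" "v = a + b" by (rule fibre_split[OF v])
  have f: "a \<in> fibre E x" "b \<in> fibre E x" using ab V_fibre[OF mfd ca gm] by (auto simp: perp_def)
  have "pairing E x b b = pairing E x v b - pairing E x a b" using pairing_add[OF mfd ca f f(2)] ab(3) by simp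
  also have "pairing E x a b = 0" using ab pairing_sym[OF mfd ca f] by (simp add: perp_def)
  finally have "pairing E x b b = 0" using o[OF ab(2)] by simp
  then have "b = 0" using perp_neg[OF mfd ca gm ab(2)] by force
  then show ?thesis using ab by simp
qed

text \<open>A frame with constant pairings near the point is turned, by a constant matrix \<open>G\<close>, into an
  orthonormal frame \<open>q\<close> of \<open>V\<close> with prescribed value at the point. The dual frame is expressed by the
  transposed matrix, so that contractions over the frame and its dual become sums of squares.\<close>
lemma adapted_frame_orthonormalize:
  assumes af: "adapted_frame M E V x p e" and w: "orthonormal_subframe M E V x p' w"
  obtains G H q U where "p' = p" "open U" "x \<in> U" "\<And>a. a < p \<Longrightarrow> q a \<in> sections M E"
    "\<And>a. a < p \<Longrightarrow> q a x = w a x"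
    "\<And>y a b. y \<in> U \<Longrightarrow> a < p \<Longrightarrow> b < p \<Longrightarrow> inner_sec E (q a) (q b) y = (if a = b then 1 else 0)"
    "\<And>y a. y \<in> U \<Longrightarrow> a < p \<Longrightarrow> q a y \<in> V y"
    "\<And>a. a < p \<Longrightarrow> e a = (\<lambda>y. \<Sum>c<p. H a c *\<^sub>R q c y)"
    "\<And>a. a < p \<Longrightarrow> raised E x e a = (\<lambda>y. \<Sum>c<p. G c a *\<^sub>R q c y)"
    "\<And>c d. c < p \<Longrightarrow> d < p \<Longrightarrow> (\<Sum>a<p. G c a * H a d) = (if c = d then 1 else 0)"
    "\<And>a. a < fibre_dim E \<Longrightarrow> raised E x e a \<in> sections M E"
    "\<And>y a b. y \<in> U \<Longrightarrow> a < fibre_dim E \<Longrightarrow> b < fibre_dim E \<Longrightarrow> inner_sec E (e a) (e b) y = inner_sec E (e a) (e b) x"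
    "\<And>y a b. y \<in> U \<Longrightarrow> a < fibre_dim E \<Longrightarrow> b < fibre_dim E \<Longrightarrow>
      inner_sec E (raised E x e a) (raised E x e b) y = inner_sec E (raised E x e a) (raised E x e b) x"
    "\<And>Y Z. Y \<in> fibre E x \<Longrightarrow> Z \<in> fibre E x \<Longrightarrow>
      (\<Sum>c<fibre_dim E. pairing E x Y (e c x) * pairing E x Z (raised E x e c x)) = pairing E x Y Z"
proof -
  let ?r = "fibre_dim E"
  obtain U0 where pr: "p \<le> ?r" and es: "\<And>a. a < ?r \<Longrightarrow> e a \<in> sections M E" and U0: "open U0" "x \<in> U0"
    and bas: "\<forall>y\<in>U0. basis_family (V y) {..<p} (\<lambda>a. e a y) \<and> basis_family (perp E V y) {p..<?r} (\<lambda>a. e a y)"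
    and cst: "\<forall>\<alpha><?r. \<forall>\<beta><?r. \<forall>y\<in>U0. inner_sec E (e \<alpha>) (e \<beta>) y = inner_sec E (e \<alpha>) (e \<beta>) x"
    using af unfolding adapted_frame_def by blast
  obtain U1 where ws: "\<And>a. a < p' \<Longrightarrow> w a \<in> sections M E" and U1: "open U1" "x \<in> U1"
    and wb: "\<forall>y\<in>U1. basis_family (V y) {..<p'} (\<lambda>a. w a y) \<and> (\<forall>a<p'. \<forall>b<p'. inner_sec E (w a) (w b) y = (if a = b then 1 else 0))"
    using w unfolding orthonormal_subframe_def by blast
  have eV: "basis_family (V x) {..<p} (\<lambda>a. e a x)" and eP: "basis_family (perp E V x) {p..<?r} (\<lambda>a. e a x)"
    using bas U0 by auto
  have wV: "basis_family (V x) {..<p'} (\<lambda>a. w a x)" using wb U1 by auto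
  have pp: "p' = p" using basis_family_card_le[OF eV _ wV] basis_family_card_le[OF wV _ eV] by simp
  have ef: "e a y \<in> fibre E y" if "a < ?r" for a y using section_in_fibre[OF mfd ca gm] es that by blast
  \<comment> \<open>At \<open>x\<close> the frame is a basis of the fibre, since \<open>V\<close> meets its complement in zero only.\<close>
  have einj: "g a = 0" if z: "(\<Sum>a<?r. g a *\<^sub>R e a x) = 0" and a: "a < ?r" for g a
  proof -
    let ?v = "\<Sum>a<p. g a *\<^sub>R e a x" and ?z = "\<Sum>a\<in>{p..<?r}. g a *\<^sub>R e a x"
    have spl: "(\<Sum>a<?r. g a *\<^sub>R e a x) = ?v + ?z"
      using sum.atLeastLessThan_concat[of 0 p ?r "\<lambda>a. g a *\<^sub>R e a x"] pr by (simp add: atLeast0LessThan)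
    have vV: "?v \<in> V x" using basis_family_mem[OF eV] by (intro subspace_sum subspace_scale V_subspace[OF mfd ca gm]) auto
    have "?z \<in> span ((\<lambda>a. e a x) ` {p..<?r})" by (intro span_sum span_scale span_base imageI)
    then have zP: "?z \<in> perp E V x" using eP by (simp add: basis_family_def)
    have "?v = - ?z" using z spl by (simp add: eq_neg_iff_add_eq_0)
    then have "- ?v \<in> perp E V x" using zP by simp
    moreover have "- ?v \<in> V x" using vV V_subspace[OF mfd ca gm] by (simp add: subspace_neg)
    ultimately have v0: "?v = 0" using V_perp_zero[of "- ?v"] by simp
    then have z0: "?z = 0" using z spl by simp
    show ?thesis
    proof (cases "a < p")
      case True then show ?thesis using basis_family_coeff_0[OF eV _ v0] by simp
    next
      case False then show ?thesis using basis_family_coeff_0[OF eP _ z0] a by simp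
    qed
  qed
  have eexp: "\<exists>g. v = (\<Sum>a<?r. g a *\<^sub>R e a x)" if v: "v \<in> fibre E x" for v
  proof -
    obtain a b where ab: "a \<in> V x" "b \<in> perp E V x" "v = a + b" by (rule fibre_split[OF v])
    obtain g where g: "a = (\<Sum>j<p. g j *\<^sub>R e j x)" by (rule basis_family_expand[OF eV finite_lessThan ab(1)])
    obtain h where h: "b = (\<Sum>j\<in>{p..<?r}. h j *\<^sub>R e j x)" by (rule basis_family_expand[OF eP finite_atLeastLessThan ab(2)])
    let ?k = "\<lambda>j. (if j < p then g j else h j) *\<^sub>R e j x"
    have "(\<Sum>j<?r. ?k j) = (\<Sum>j<p. ?k j) + (\<Sum>j\<in>{p..<?r}. ?k j)"
      using sum.atLeastLessThan_concat[of 0 p ?r ?k] pr by (simp add: atLeast0LessThan)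
    also have "(\<Sum>j<p. ?k j) = a" unfolding g by (intro sum.cong) auto
    also have "(\<Sum>j\<in>{p..<?r}. ?k j) = b" unfolding h by (intro sum.cong) auto
    finally have "v = (\<Sum>j<?r. (if j < p then g j else h j) *\<^sub>R e j x)" using ab(3) by simp
    then show ?thesis by (rule exI[of _ "\<lambda>j. if j < p then g j else h j"])
  qed
  define h where "h = gram_inverse E x e"
  have h: "(\<Sum>\<beta><?r. h \<alpha> \<beta> * inner_sec E (e \<beta>) (e \<gamma>) x) = (if \<alpha> = \<gamma> then 1 else 0)" if "\<alpha> < ?r" "\<gamma> < ?r" for \<alpha> \<gamma>
  proof -
    obtain p2 f where "orthonormal_frame M E V x p2 f" using orthonormal_frame_exists[OF mfd ca gm] by blast
    then obtain U2 where f: "p2 \<le> ?r" "\<And>k. k < ?r \<Longrightarrow> f k \<in> sections M E" and U2: "x \<in> U2" "orthonormal_on E V p2 f U2"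
      unfolding orthonormal_frame_def by blast
    have ff: "f k x \<in> fibre E x" if "k < ?r" for k using section_in_fibre[OF mfd ca gm] f(2)[OF that] by blast
    have "\<forall>k. \<exists>g. k < ?r \<longrightarrow> f k x = (\<Sum>a<?r. g a *\<^sub>R e a x)" using eexp[OF ff] by blast
    then obtain K where K: "\<And>k. k < ?r \<Longrightarrow> f k x = (\<Sum>a<?r. K k a *\<^sub>R e a x)" by metis
    \<comment> \<open>The inverse Gram matrix is built from the coefficients of a pseudo-orthonormal basis.\<close>
    let ?h = "\<lambda>\<alpha> \<beta>. \<Sum>k<?r. frame_sign p2 k * K k \<alpha> * K k \<beta>"
    have "\<forall>\<alpha><?r. \<forall>\<gamma><?r. (\<Sum>\<beta><?r. ?h \<alpha> \<beta> * inner_sec E (e \<beta>) (e \<gamma>) x) = (if \<alpha> = \<gamma> then 1 else 0)"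
    proof (intro allI impI)
      fix \<alpha> \<gamma> assume \<alpha>: "\<alpha> < ?r" and \<gamma>: "\<gamma> < ?r"
      have fe: "pairing E x (f k x) (e \<gamma> x) = (\<Sum>\<beta><?r. K k \<beta> * inner_sec E (e \<beta>) (e \<gamma>) x)" if "k < ?r" for k
        unfolding K[OF that] inner_sec_def by (rule pairing_sum[OF mfd ca]) (use ef \<gamma> in auto)
      have "(\<Sum>\<beta><?r. ?h \<alpha> \<beta> * inner_sec E (e \<beta>) (e \<gamma>) x)
        = (\<Sum>k<?r. \<Sum>\<beta><?r. frame_sign p2 k * K k \<alpha> * K k \<beta> * inner_sec E (e \<beta>) (e \<gamma>) x)"
        unfolding sum_distrib_right by (rule sum.swap)
      also have "\<dots> = (\<Sum>k<?r. frame_sign p2 k * K k \<alpha> * pairing E x (f k x) (e \<gamma> x))"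
        by (intro sum.cong refl) (simp add: fe sum_distrib_left mult_ac)
      also have "\<dots> = (if \<alpha> = \<gamma> then 1 else 0)"
      proof -
        let ?g = "\<lambda>\<alpha>. (\<Sum>k<?r. frame_sign p2 k * K k \<alpha> * pairing E x (f k x) (e \<gamma> x)) - (if \<alpha> = \<gamma> then 1 else 0)"
        have "e \<gamma> x = (\<Sum>k<?r. (frame_sign p2 k * pairing E x (e \<gamma> x) (f k x)) *\<^sub>R f k x)"
          by (rule frame_expand[OF mfd ca gm U2(2,1) ef[OF \<gamma>] f(2,1)])
        also have "\<dots> = (\<Sum>k<?r. \<Sum>a<?r. (frame_sign p2 k * K k a * pairing E x (f k x) (e \<gamma> x)) *\<^sub>R e a x)"
          by (intro sum.cong refl, subst (2) K) (use pairing_sym[OF mfd ca ef[OF \<gamma>] ff] in \<open>auto simp: scaleR_sum_right mult_ac\<close>)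
        also have "\<dots> = (\<Sum>a<?r. (\<Sum>k<?r. frame_sign p2 k * K k a * pairing E x (f k x) (e \<gamma> x)) *\<^sub>R e a x)"
          unfolding scaleR_sum_left by (rule sum.swap)
        finally have A: "e \<gamma> x = (\<Sum>a<?r. (\<Sum>k<?r. frame_sign p2 k * K k a * pairing E x (f k x) (e \<gamma> x)) *\<^sub>R e a x)" .
        have "(\<Sum>a<?r. (if a = \<gamma> then 1 else 0::real) *\<^sub>R e a x) = (\<Sum>a<?r. if a = \<gamma> then e a x else 0)"
          by (intro sum.cong refl) auto
        also have "\<dots> = e \<gamma> x" using \<gamma> by (simp add: sum.delta)
        finally have "(\<Sum>a<?r. ?g a *\<^sub>R e a x) = 0"
          using A by (simp only: scaleR_left_diff_distrib sum_subtractf) simp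
        then have "?g \<alpha> = 0" by (rule einj[OF _ \<alpha>])
        then show ?thesis by simp
      qed
      finally show "(\<Sum>\<beta><?r. ?h \<alpha> \<beta> * inner_sec E (e \<beta>) (e \<gamma>) x) = (if \<alpha> = \<gamma> then 1 else 0)" .
    qed
    then have "\<forall>\<alpha><?r. \<forall>\<gamma><?r. (\<Sum>\<beta><?r. h \<alpha> \<beta> * inner_sec E (e \<beta>) (e \<gamma>) x) = (if \<alpha> = \<gamma> then 1 else 0)"
      unfolding h_def gram_inverse_def by (rule someI[of _ ?h])
    then show ?thesis using that by blast
  qed
  define f where "f = raised E x e"
  have fdef: "f a = (\<lambda>y. \<Sum>b<?r. h a b *\<^sub>R e b y)" for a by (simp add: f_def raised_def[abs_def] h_def)
  have fs: "f a \<in> sections M E" for a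
    unfolding fdef by (rule sections_sum[OF mfd ca_vb[OF mfd ca]]) (use es smooth_fun_const[OF mfd ca gm] in auto)
  have ffib: "f a y \<in> fibre E y" for a y using section_in_fibre[OF mfd ca gm] fs by blast
  have fe: "pairing E x (f a x) (e c x) = (if a = c then 1 else 0)" if "a < ?r" "c < ?r" for a c
    unfolding fdef using h[OF that] pairing_sum[OF mfd ca, of "{..<?r}" "\<lambda>b. e b x" x "e c x" "h a"] ef that
    by (simp add: inner_sec_def)
  have fcst: "inner_sec E (f a) (f b) y = inner_sec E (f a) (f b) x" if y: "y \<in> U0" for a b y
  proof -
    have "inner_sec E (f a) (f b) z = (\<Sum>c<?r. h a c * (\<Sum>d<?r. h b d * inner_sec E (e c) (e d) z))" for z
    proof -
      have "inner_sec E (f a) (f b) z = (\<Sum>c<?r. h a c * pairing E z (e c z) (f b z))"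
        unfolding inner_sec_def fdef[of a] by (rule pairing_sum[OF mfd ca]) (use ef ffib in auto)
      also have "\<dots> = (\<Sum>c<?r. h a c * (\<Sum>d<?r. h b d * inner_sec E (e c) (e d) z))"
        unfolding fdef[of b] inner_sec_def
        by (intro sum.cong refl arg_cong2[where f = "(*)"] pairing_sum_right[OF mfd ca]) (use ef in auto)
      finally show ?thesis .
    qed
    then show ?thesis using cst y by simp
  qed
  have complete: "(\<Sum>c<?r. pairing E x Y (e c x) * pairing E x Z (f c x)) = pairing E x Y Z"
    if Y: "Y \<in> fibre E x" and Z: "Z \<in> fibre E x" for Y Z
  proof -
    obtain g where g: "Z = (\<Sum>c<?r. g c *\<^sub>R e c x)" using eexp[OF Z] by blast
    have "pairing E x Z (f c x) = g c" if c: "c < ?r" for c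
    proof -
      have "pairing E x Z (f c x) = pairing E x (f c x) Z" by (rule pairing_sym[OF mfd ca Z ffib])
      also have "\<dots> = (\<Sum>b<?r. g b * pairing E x (f c x) (e b x))"
        unfolding g by (rule pairing_sum_right[OF mfd ca]) (use ef ffib in auto)
      also have "\<dots> = (\<Sum>b<?r. if b = c then g c else 0)" by (intro sum.cong refl) (use fe c in auto)
      finally show ?thesis using c by (simp add: sum.delta)
    qed
    moreover have "pairing E x Y Z = (\<Sum>c<?r. g c * pairing E x Y (e c x))"
      unfolding g by (rule pairing_sum_right[OF mfd ca]) (use ef Y in auto)
    ultimately show ?thesis by (simp add: mult.commute)
  qed
  have "\<forall>a. \<exists>g. a < p \<longrightarrow> w a x = (\<Sum>b<p. g b *\<^sub>R e b x)"
  proof (intro allI)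
    fix a show "\<exists>g. a < p \<longrightarrow> w a x = (\<Sum>b<p. g b *\<^sub>R e b x)"
    proof (cases "a < p")
      case True
      then have "w a x \<in> V x" using basis_family_mem[OF wV] pp by simp
      then show ?thesis using basis_family_expand[OF eV finite_lessThan] by metis
    qed auto
  qed
  then obtain G where G: "\<And>a. a < p \<Longrightarrow> w a x = (\<Sum>b<p. G a b *\<^sub>R e b x)" by metis
  define q where "q a = (\<lambda>y. \<Sum>b<p. G a b *\<^sub>R e b y)" for a
  define H where "H a c = inner_sec E (e a) (w c) x" for a c
  have qs: "q a \<in> sections M E" for a
    unfolding q_def by (rule sections_sum[OF mfd ca_vb[OF mfd ca]]) (use es pr smooth_fun_const[OF mfd ca gm] in auto)
  have qx: "q a x = w a x" if "a < p" for a using G[OF that] by (simp add: q_def)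
  have wx: "inner_sec E (w a) (w b) x = (if a = b then 1 else 0)" if "a < p" "b < p" for a b using wb U1 that pp by auto
  have qin: "inner_sec E (q a) (q b) y = (if a = b then 1 else 0)" if y: "y \<in> U0" and ab: "a < p" "b < p" for a b y
  proof -
    have "inner_sec E (q a) (q b) z = (\<Sum>c<p. G a c * (\<Sum>d<p. G b d * inner_sec E (e c) (e d) z))" for z
    proof -
      have "inner_sec E (q a) (q b) z = (\<Sum>c<p. G a c * pairing E z (e c z) (q b z))"
        unfolding inner_sec_def q_def[of a] by (rule pairing_sum[OF mfd ca]) (use ef pr section_in_fibre[OF mfd ca gm qs] in auto)
      also have "\<dots> = (\<Sum>c<p. G a c * (\<Sum>d<p. G b d * inner_sec E (e c) (e d) z))"
        unfolding q_def[of b] inner_sec_def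
        by (intro sum.cong refl arg_cong2[where f = "(*)"] pairing_sum_right[OF mfd ca]) (use ef pr in auto)
      finally show ?thesis .
    qed
    then have "inner_sec E (q a) (q b) y = inner_sec E (q a) (q b) x" using cst y pr by simp
    also have "\<dots> = inner_sec E (w a) (w b) x" using qx ab by (simp add: inner_sec_def)
    finally show ?thesis using wx[OF ab] by simp
  qed
  have qV: "q a y \<in> V y" if "y \<in> U0" for a y
    unfolding q_def using bas that basis_family_mem[of "V y" "{..<p}" "\<lambda>a. e a y"]
    by (intro subspace_sum subspace_scale V_subspace[OF mfd ca gm]) auto
  have wexp: "v = (\<Sum>c<p. pairing E x v (w c x) *\<^sub>R w c x)" if "v \<in> V x" for v
    by (rule subframe_expand) (use wV pp ws wx that in auto)
  have comb: "(\<lambda>y. \<Sum>c<p. k c *\<^sub>R q c y) = (\<lambda>y. \<Sum>b<p. (\<Sum>c<p. k c * G c b) *\<^sub>R e b y)" for k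
  proof
    fix y
    have "(\<Sum>c<p. k c *\<^sub>R q c y) = (\<Sum>c<p. \<Sum>b<p. (k c * G c b) *\<^sub>R e b y)" by (simp add: q_def scaleR_sum_right)
    also have "\<dots> = (\<Sum>b<p. \<Sum>c<p. (k c * G c b) *\<^sub>R e b y)" by (rule sum.swap)
    finally show "(\<Sum>c<p. k c *\<^sub>R q c y) = (\<Sum>b<p. (\<Sum>c<p. k c * G c b) *\<^sub>R e b y)" by (simp add: scaleR_sum_left)
  qed
  \<comment> \<open>Combinations of the frame with constant coefficients that agree at \<open>x\<close> agree everywhere.\<close>
  have glob: "(\<lambda>y. \<Sum>b<p. g b *\<^sub>R e b y) = (\<lambda>y. \<Sum>c<p. k c *\<^sub>R q c y)"
    if "(\<Sum>b<p. g b *\<^sub>R e b x) = (\<Sum>c<p. k c *\<^sub>R q c x)" for g k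
  proof -
    have E0: "(\<Sum>b<p. g b *\<^sub>R e b x) = (\<Sum>b<p. (\<Sum>c<p. k c * G c b) *\<^sub>R e b x)" using that fun_cong[OF comb, of k x] by simp
    have "g b = (\<Sum>c<p. k c * G c b)" if "b < p" for b
      using basis_family_coeff_unique[OF eV finite_lessThan E0] that by simp
    then show ?thesis unfolding comb by (intro ext sum.cong) auto
  qed
  have eq: "e a = (\<lambda>y. \<Sum>c<p. H a c *\<^sub>R q c y)" if a: "a < p" for a
  proof -
    have E1: "(\<lambda>y. \<Sum>b<p. (if b = a then 1 else 0::real) *\<^sub>R e b y) = e a"
    proof
      fix y
      have "(\<Sum>b<p. (if b = a then 1 else 0::real) *\<^sub>R e b y) = (\<Sum>b<p. if b = a then e b y else 0)" by (intro sum.cong) auto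
      then show "(\<Sum>b<p. (if b = a then 1 else 0::real) *\<^sub>R e b y) = e a y" using a by (simp add: sum.delta)
    qed
    have "e a x = (\<Sum>c<p. H a c *\<^sub>R q c x)"
      using wexp[of "e a x"] basis_family_mem[OF eV] a by (simp add: H_def inner_sec_def qx)
    then have "(\<Sum>b<p. (if b = a then 1 else 0::real) *\<^sub>R e b x) = (\<Sum>c<p. H a c *\<^sub>R q c x)"
      using fun_cong[OF E1, of x] by simp
    from glob[OF this] show ?thesis unfolding E1 .
  qed
  have fV: "f a x \<in> V x" if a: "a < p" for a
  proof (rule perp_perp[OF ffib])
    fix z assume z: "z \<in> perp E V x"
    obtain g where g: "z = (\<Sum>j\<in>{p..<?r}. g j *\<^sub>R e j x)" by (rule basis_family_expand[OF eP finite_atLeastLessThan z])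
    have "pairing E x (f a x) z = (\<Sum>j\<in>{p..<?r}. g j * pairing E x (f a x) (e j x))"
      unfolding g by (rule pairing_sum_right[OF mfd ca]) (use ef ffib in auto)
    also have "\<dots> = 0" by (rule sum.neutral) (use fe a pr in auto)
    finally show "pairing E x (f a x) z = 0" .
  qed
  \<comment> \<open>The inverse Gram matrix is block diagonal, so the dual vectors of the frame of \<open>V\<close> lie in \<open>V\<close>.\<close>
  have hz: "h a b = 0" if a: "a < p" and b: "b < ?r" "\<not> b < p" for a b
  proof -
    obtain g where g: "f a x = (\<Sum>j<p. g j *\<^sub>R e j x)" by (rule basis_family_expand[OF eV finite_lessThan fV[OF a]])
    have "(\<Sum>j<?r. (if j < p then g j else 0) *\<^sub>R e j x) = (\<Sum>j<p. (if j < p then g j else 0) *\<^sub>R e j x)"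
      by (rule sum.mono_neutral_right) (use pr in auto)
    also have "\<dots> = f a x" unfolding g by (intro sum.cong) auto
    finally have "(\<Sum>j<?r. (h a j - (if j < p then g j else 0)) *\<^sub>R e j x) = 0"
      by (simp add: scaleR_left_diff_distrib sum_subtractf fdef)
    from einj[OF this b(1)] show ?thesis using b by simp
  qed
  have fq: "f a = (\<lambda>y. \<Sum>c<p. G c a *\<^sub>R q c y)" if a: "a < p" for a
  proof -
    have F1: "f a = (\<lambda>y. \<Sum>b<p. h a b *\<^sub>R e b y)"
      unfolding fdef by (intro ext sum.mono_neutral_right) (use pr hz a in auto)
    have "pairing E x (f a x) (w c x) = G c a" if c: "c < p" for c
    proof -
      have "pairing E x (f a x) (w c x) = (\<Sum>b<p. G c b * pairing E x (f a x) (e b x))"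
        unfolding G[OF c] by (rule pairing_sum_right[OF mfd ca]) (use ef ffib pr in auto)
      also have "\<dots> = (\<Sum>b<p. if b = a then G c a else 0)" by (intro sum.cong refl) (use fe a pr in auto)
      finally show ?thesis using a by (simp add: sum.delta)
    qed
    then have "f a x = (\<Sum>c<p. G c a *\<^sub>R q c x)" using wexp[OF fV[OF a]] by (simp add: qx)
    then have "(\<Sum>b<p. h a b *\<^sub>R e b x) = (\<Sum>c<p. G c a *\<^sub>R q c x)" using fun_cong[OF F1, of x] by simp
    from glob[OF this] show ?thesis unfolding F1 .
  qed
  have GH: "(\<Sum>a<p. G c a * H a d) = (if c = d then 1 else 0)" if "c < p" "d < p" for c d
  proof -
    have "(\<Sum>a<p. G c a * H a d) = pairing E x (\<Sum>a<p. G c a *\<^sub>R e a x) (w d x)"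
      unfolding H_def inner_sec_def
      by (rule pairing_sum[OF mfd ca, symmetric]) (use ef pr section_in_fibre[OF mfd ca gm ws] pp that in auto)
    then show ?thesis using wx[OF that] G[OF that(1)] by (simp add: inner_sec_def)
  qed
  show thesis
    by (rule that[OF pp U0 qs qx qin qV eq fq[unfolded f_def] GH fs[unfolded f_def] _ fcst[unfolded f_def] complete[unfolded f_def]])
      (use cst in auto)
qed

end

lemma sec_linear_cmult: "sec_linear M E P \<Longrightarrow> sec_linear M E (\<lambda>u. (k::real) * P u)"
  "sec_linear M E P \<Longrightarrow> sec_linear M E (\<lambda>u. P u * (k::real))"
  unfolding sec_linear_def by (simp_all add: algebra_simps)

context
  fixes M :: "('m::{t2_space, second_countable_topology}, 'n::finite) mfd"
    and E :: "('m, 'v::real_vector) calg" and V :: "'m \<Rightarrow> 'v set"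
  assumes mfd: "manifold M" and ca: "courant_algebroid M E" and gm: "generalized_metric M E V"
begin

lemma sec_linear_bracket:
  "v \<in> sections M E \<Longrightarrow> sec_linear M E (\<lambda>u. bracket E u v x)"
  "v \<in> sections M E \<Longrightarrow> sec_linear M E (\<lambda>u. bracket E v u x)"
  unfolding sec_linear_def using br_combine_left[OF mfd ca gm] br_combine_right[OF mfd ca gm] by blast+

lemma sec_linear_pairing:
  assumes P: "sec_linear M E P" and "\<And>u. u \<in> sections M E \<Longrightarrow> P u \<in> fibre E x" and w: "w \<in> fibre E x"
  shows "sec_linear M E (\<lambda>u. pairing E x (P u) w)" and "sec_linear M E (\<lambda>u. pairing E x w (P u))"
proof -
  have 1: "pairing E x (P (\<lambda>y. a *\<^sub>R u y + b *\<^sub>R v y)) w = a * pairing E x (P u) w + b * pairing E x (P v) w"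
    if "u \<in> sections M E" "v \<in> sections M E" for u v a b
    using P[unfolded sec_linear_def, rule_format, OF that] pairing_combine[OF mfd ca assms(2)[OF that(1)] assms(2)[OF that(2)] w] by simp
  then show "sec_linear M E (\<lambda>u. pairing E x (P u) w)" unfolding sec_linear_def by simp
  have "pairing E x w (P u) = pairing E x (P u) w" if "u \<in> sections M E" for u
    by (rule pairing_sym[OF mfd ca w assms(2)[OF that]])
  moreover have "(\<lambda>y. a *\<^sub>R u y + b *\<^sub>R v y) \<in> sections M E" if "u \<in> sections M E" "v \<in> sections M E" for u v a b
    by (rule sections_combine[OF mfd ca_vb[OF mfd ca] that]) (rule smooth_fun_const[OF mfd ca gm])+
  ultimately show "sec_linear M E (\<lambda>u. pairing E x w (P u))" using 1 unfolding sec_linear_def by simp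
qed

lemma sec_linear_point: "sec_linear M E (\<lambda>u. u x)"
  by (simp add: sec_linear_def)

text \<open>Constant pairings make the structure functions antisymmetric in each pair of neighbouring slots: in one
  by the invariance of the pairing, in the other since the symmetric part of the bracket is \<open>d\<^sub>E\<close> of a
  locally constant function.\<close>
lemma inner_bracket_cyclic:
  assumes u: "u \<in> sections M E" and v: "v \<in> sections M E" and t: "t \<in> sections M E" and U: "open U" "x \<in> U"
    and c: "\<And>y. y \<in> U \<Longrightarrow> inner_sec E u t y = k" "\<And>y. y \<in> U \<Longrightarrow> inner_sec E u v y = l"
  shows "inner_sec E u (bracket E v t) x = inner_sec E (bracket E u v) t x"
proof -
  note bs = br_sec[OF mfd ca gm] and sf = section_in_fibre[OF mfd ca gm]
  have "act E v (inner_sec E u t) x = act E v (\<lambda>y. k) x"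
    by (rule act_local[OF mfd ca gm v inner_smooth[OF mfd ca u t] smooth_fun_const[OF mfd ca gm] U c(1)])
  then have "inner_sec E (bracket E v u) t x + inner_sec E u (bracket E v t) x = 0"
    using br_invariance[OF mfd ca gm v u t, of x] act_const[OF mfd ca gm v] by simp
  moreover have "bracket E u v x + bracket E v u x = 0"
    using br_symmetric_part[OF mfd ca gm u v, of x] dE_local_const[OF mfd ca gm inner_smooth[OF mfd ca u v] U c(2)] by simp
  then have "inner_sec E (bracket E u v) t x + inner_sec E (bracket E v u) t x = 0"
    using pairing_add[OF mfd ca sf[OF bs[OF u v]] sf[OF bs[OF v u]] sf[OF t], of x] pairing_zero[OF mfd ca sf[OF t], of x]
    by (simp add: inner_sec_def)
  ultimately show ?thesis by linarith
qed

text \<open>The expression of the Laplacian in an adapted frame, evaluated by contraction. The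
  contributions of the complement of \<open>V\<close> are complete sums over a frame and its dual minus sums over
  \<open>V\<close>.\<close>
lemma adapted_frame_curvature:
  assumes D: "divergence M E D" and af: "adapted_frame M E V x p e" and w: "orthonormal_subframe M E V x p' w"
  shows "(\<Sum>a<p. D (raised E x e a) x * D (e a) x + 2 * act E (raised E x e a) (D (e a)) x)
     - 1/6 * (\<Sum>a<p. \<Sum>b<p. \<Sum>c<p. c_low E x e a b c * c_up E x e a b c)
     - 1/2 * (\<Sum>a<p. \<Sum>b<p. \<Sum>c\<in>{p..<fibre_dim E}. c_low E x e a b c * c_up E x e a b c)
     = frame_curvature E D p' w x"
proof -
  let ?r = "fibre_dim E"
  \<comment> \<open>Hiding the dependence of the dual frame on \<open>x\<close> keeps it fixed in unification.\<close>
  define f where "f = raised E x e"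
  let ?br = "bracket E"
  let ?ip = "\<lambda>u v. inner_sec E u v x"
  note bs = br_sec[OF mfd ca gm] and sf = section_in_fibre[OF mfd ca gm]
  obtain G H q U where pp: "p' = p" and U: "open U" "x \<in> U" and qs: "\<And>a. a < p \<Longrightarrow> q a \<in> sections M E"
    and qx: "\<And>a. a < p \<Longrightarrow> q a x = w a x"
    and qq: "\<And>y a b. y \<in> U \<Longrightarrow> a < p \<Longrightarrow> b < p \<Longrightarrow> inner_sec E (q a) (q b) y = (if a = b then 1 else 0)"
    and qV: "\<And>y a. y \<in> U \<Longrightarrow> a < p \<Longrightarrow> q a y \<in> V y"
    and eq: "\<And>a. a < p \<Longrightarrow> e a = (\<lambda>y. \<Sum>c<p. H a c *\<^sub>R q c y)"
    and fq: "\<And>a. a < p \<Longrightarrow> f a = (\<lambda>y. \<Sum>c<p. G c a *\<^sub>R q c y)"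
    and GH: "\<And>c d. c < p \<Longrightarrow> d < p \<Longrightarrow> (\<Sum>a<p. G c a * H a d) = (if c = d then 1 else 0)"
    and fs: "\<And>a. a < ?r \<Longrightarrow> f a \<in> sections M E"
    and ecst: "\<And>y a b. y \<in> U \<Longrightarrow> a < ?r \<Longrightarrow> b < ?r \<Longrightarrow> inner_sec E (e a) (e b) y = inner_sec E (e a) (e b) x"
    and fcst: "\<And>y a b. y \<in> U \<Longrightarrow> a < ?r \<Longrightarrow> b < ?r \<Longrightarrow> inner_sec E (f a) (f b) y = inner_sec E (f a) (f b) x"
    and complete: "\<And>Y Z. Y \<in> fibre E x \<Longrightarrow> Z \<in> fibre E x \<Longrightarrow>
      (\<Sum>c<?r. pairing E x Y (e c x) * pairing E x Z (f c x)) = pairing E x Y Z"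
    by (rule adapted_frame_orthonormalize[OF mfd ca gm af w, folded f_def], rule that, assumption+)
  have pr: "p \<le> ?r" and es: "\<And>a. a < ?r \<Longrightarrow> e a \<in> sections M E" using af unfolding adapted_frame_def by blast+
  have es': "a < p \<Longrightarrow> e a \<in> sections M E" and fs': "a < p \<Longrightarrow> f a \<in> sections M E" for a using es fs pr by auto
  have clow: "c_low E x e a b c = ?ip (?br (e a) (e b)) (e c)" if "a < ?r" "b < ?r" "c < ?r" for a b c
    unfolding c_low_def
    by (rule inner_bracket_cyclic[OF es[OF that(1)] es[OF that(2)] es[OF that(3)] U]) (use ecst that in blast)+
  have cup: "c_up E x e a b c = ?ip (?br (f a) (f b)) (f c)" if abc: "a < ?r" "b < ?r" "c < ?r" for a b c
  proof -
    let ?h = "gram_inverse E x e"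
    have fd: "f a = (\<lambda>y. \<Sum>\<beta><?r. ?h a \<beta> *\<^sub>R e \<beta> y)" for a by (simp add: f_def raised_def[abs_def])
    have 1: "?ip (e \<alpha>) (?br (e \<beta>) (f c)) = (\<Sum>\<gamma><?r. ?h c \<gamma> * c_low E x e \<alpha> \<beta> \<gamma>)" if "\<alpha> < ?r" "\<beta> < ?r" for \<alpha> \<beta>
      unfolding fd[of c] c_low_def inner_sec_def
      by (subst sec_linear_sum[OF mfd ca gm sec_linear_pairing(2)[OF sec_linear_bracket(2)[OF es[OF that(2)]]]])
        (use sf es bs that in auto)
    have 2: "?ip (e \<alpha>) (?br (f b) (f c)) = (\<Sum>\<beta><?r. ?h b \<beta> * ?ip (e \<alpha>) (?br (e \<beta>) (f c)))" if "\<alpha> < ?r" for \<alpha>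
      unfolding fd[of b] inner_sec_def
      by (subst sec_linear_sum[OF mfd ca gm sec_linear_pairing(2)[OF sec_linear_bracket(1)[OF fs[OF abc(3)]]]])
        (use sf es fs bs that abc in auto)
    have 3: "?ip (f a) (?br (f b) (f c)) = (\<Sum>\<alpha><?r. ?h a \<alpha> * ?ip (e \<alpha>) (?br (f b) (f c)))"
      unfolding fd[of a] inner_sec_def by (rule pairing_sum[OF mfd ca]) (use sf es fs bs abc in auto)
    have "?ip (f a) (?br (f b) (f c)) = c_up E x e a b c"
      unfolding 3 c_up_def by (intro sum.cong refl) (simp add: 2 1 sum_distrib_left mult.assoc)
    moreover have "?ip (f a) (?br (f b) (f c)) = ?ip (?br (f a) (f b)) (f c)"
      by (rule inner_bracket_cyclic[OF fs[OF abc(1)] fs[OF abc(2)] fs[OF abc(3)] U]) (use fcst abc in blast)+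
    ultimately show ?thesis by simp
  qed
  define X where "X = (\<Sum>a<p. \<Sum>b<p. \<Sum>c<p. ?ip (?br (e a) (e b)) (e c) * ?ip (?br (f a) (f b)) (f c))"
  define Y where "Y = (\<Sum>a<p. \<Sum>b<p. ?ip (?br (e a) (e b)) (?br (f a) (f b)))"
  have S1: "(\<Sum>a<p. \<Sum>b<p. \<Sum>c<p. c_low E x e a b c * c_up E x e a b c) = X"
    unfolding X_def by (intro sum.cong refl) (use clow cup pr in auto)
  have S2: "(\<Sum>a<p. \<Sum>b<p. \<Sum>c\<in>{p..<?r}. c_low E x e a b c * c_up E x e a b c) = Y - X"
  proof -
    have "(\<Sum>c\<in>{p..<?r}. c_low E x e a b c * c_up E x e a b c)
      = ?ip (?br (e a) (e b)) (?br (f a) (f b)) - (\<Sum>c<p. ?ip (?br (e a) (e b)) (e c) * ?ip (?br (f a) (f b)) (f c))"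
      if a: "a < p" and b: "b < p" for a b
    proof -
      let ?g = "\<lambda>c. ?ip (?br (e a) (e b)) (e c) * ?ip (?br (f a) (f b)) (f c)"
      have "(\<Sum>c\<in>{p..<?r}. c_low E x e a b c * c_up E x e a b c) = (\<Sum>c\<in>{p..<?r}. ?g c)"
        by (intro sum.cong refl) (use clow cup pr a b in auto)
      moreover have "(\<Sum>c<?r. ?g c) = (\<Sum>c<p. ?g c) + (\<Sum>c\<in>{p..<?r}. ?g c)"
        using sum.atLeastLessThan_concat[of 0 p ?r ?g] pr by (simp add: atLeast0LessThan)
      moreover have "(\<Sum>c<?r. ?g c) = ?ip (?br (e a) (e b)) (?br (f a) (f b))"
        unfolding inner_sec_def by (rule complete) (use sf bs es' fs' a b in auto)
      ultimately show ?thesis by linarith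
    qed
    then show ?thesis unfolding X_def Y_def sum_subtractf[symmetric] by (intro sum.cong refl) auto
  qed
  note contract = contraction_change[OF mfd ca gm _ _ qs eq fq GH]
  have LD: "sec_linear M E (\<lambda>u. D u x)" unfolding sec_linear_def using div_combine[OF mfd ca gm D] by simp
  have C1: "(\<Sum>a<p. D (f a) x * D (e a) x) = (\<Sum>a<p. D (q a) x * D (q a) x)"
    by (rule contract[of "\<lambda>u v. D v x * D u x"]) (intro sec_linear_cmult LD)+
  have C2: "(\<Sum>a<p. act E (f a) (D (e a)) x) = (\<Sum>a<p. act E (q a) (D (q a)) x)"
  proof (rule contract[of "\<lambda>u v. act E v (D u) x"])
    fix v assume v: "v \<in> sections M E"
    show "sec_linear M E (\<lambda>u. act E v (D u) x)"
      unfolding sec_linear_def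
    proof (intro ballI allI)
      fix s t a b assume s: "s \<in> sections M E" and t: "t \<in> sections M E"
      note Ds = div_smooth[OF mfd ca gm D s] div_smooth[OF mfd ca gm D t]
      note cm = smooth_fun_mult[OF mfd ca gm smooth_fun_const[OF mfd ca gm]]
      have "D (\<lambda>y. a *\<^sub>R s y + b *\<^sub>R t y) = (\<lambda>y. a * D s y + b * D t y)"
        using div_combine[OF mfd ca gm D s t] by (rule ext)
      then have "act E v (D (\<lambda>y. a *\<^sub>R s y + b *\<^sub>R t y)) x = act E v (\<lambda>y. a * D s y) x + act E v (\<lambda>y. b * D t y) x"
        using act_add[OF mfd ca gm v cm[OF Ds(1)] cm[OF Ds(2)]] by simp
      then show "act E v (D (\<lambda>y. a *\<^sub>R s y + b *\<^sub>R t y)) x = a *\<^sub>R act E v (D s) x + b *\<^sub>R act E v (D t) x"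
        using act_mult[OF mfd ca gm v smooth_fun_const[OF mfd ca gm] Ds(1)] act_mult[OF mfd ca gm v smooth_fun_const[OF mfd ca gm] Ds(2)]
          act_const[OF mfd ca gm v] by simp
    qed
  next
    fix u assume u: "u \<in> sections M E"
    show "sec_linear M E (\<lambda>v. act E v (D u) x)"
      unfolding sec_linear_def act_def rho_def
      using anchor_combine[OF mfd ca gm sf sf div_smooth[OF mfd ca gm D u]] by simp
  qed
  have C3: "Y = (\<Sum>a<p. \<Sum>b<p. ?ip (?br (q a) (q b)) (?br (q a) (q b)))"
  proof -
    have "Y = (\<Sum>b<p. \<Sum>a<p. ?ip (?br (e a) (e b)) (?br (f a) (f b)))" unfolding Y_def by (rule sum.swap)
    also have "\<dots> = (\<Sum>b<p. \<Sum>a<p. ?ip (?br (q a) (e b)) (?br (q a) (f b)))"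
    proof (rule sum.cong[OF refl])
      fix b assume b: "b \<in> {..<p}"
      show "(\<Sum>a<p. ?ip (?br (e a) (e b)) (?br (f a) (f b))) = (\<Sum>a<p. ?ip (?br (q a) (e b)) (?br (q a) (f b)))"
        unfolding inner_sec_def
        by (rule contract[of "\<lambda>u v. pairing E x (?br u (e b) x) (?br v (f b) x)"];
            (intro sec_linear_pairing sec_linear_bracket sf bs es' fs')?; use b in simp)
    qed
    also have "\<dots> = (\<Sum>a<p. \<Sum>b<p. ?ip (?br (q a) (e b)) (?br (q a) (f b)))" by (rule sum.swap)
    also have "\<dots> = (\<Sum>a<p. \<Sum>b<p. ?ip (?br (q a) (q b)) (?br (q a) (q b)))"
    proof (rule sum.cong[OF refl])
      fix a assume a: "a \<in> {..<p}"
      show "(\<Sum>b<p. ?ip (?br (q a) (e b)) (?br (q a) (f b))) = (\<Sum>b<p. ?ip (?br (q a) (q b)) (?br (q a) (q b)))"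
        unfolding inner_sec_def
        by (rule contract[of "\<lambda>u v. pairing E x (?br (q a) u x) (?br (q a) v x)"];
            (intro sec_linear_pairing sec_linear_bracket sf bs qs)?; use a in simp)
    qed
    finally show ?thesis .
  qed
  have C4: "X = (\<Sum>a<p. \<Sum>b<p. \<Sum>c<p. ?ip (?br (q a) (q b)) (q c) * ?ip (?br (q a) (q b)) (q c))"
  proof -
    have "X = (\<Sum>a<p. \<Sum>b<p. \<Sum>c<p. ?ip (?br (e a) (e b)) (q c) * ?ip (?br (f a) (f b)) (q c))"
      unfolding X_def
    proof (rule sum.cong[OF refl], rule sum.cong[OF refl])
      fix a b assume ab: "a \<in> {..<p}" "b \<in> {..<p}"
      show "(\<Sum>c<p. ?ip (?br (e a) (e b)) (e c) * ?ip (?br (f a) (f b)) (f c))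
        = (\<Sum>c<p. ?ip (?br (e a) (e b)) (q c) * ?ip (?br (f a) (f b)) (q c))"
        unfolding inner_sec_def
        by (rule contract[of "\<lambda>u v. pairing E x (?br (e a) (e b) x) (u x) * pairing E x (?br (f a) (f b) x) (v x)"];
            (intro sec_linear_cmult sec_linear_pairing sec_linear_point sf bs es' fs')?; use ab in simp)
    qed
    also have "\<dots> = (\<Sum>a<p. \<Sum>c<p. \<Sum>b<p. ?ip (?br (e a) (e b)) (q c) * ?ip (?br (f a) (f b)) (q c))"
      by (intro sum.cong refl sum.swap)
    also have "\<dots> = (\<Sum>a<p. \<Sum>c<p. \<Sum>b<p. ?ip (?br (e a) (q b)) (q c) * ?ip (?br (f a) (q b)) (q c))"
    proof (rule sum.cong[OF refl], rule sum.cong[OF refl])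
      fix a c assume ac: "a \<in> {..<p}" "c \<in> {..<p}"
      show "(\<Sum>b<p. ?ip (?br (e a) (e b)) (q c) * ?ip (?br (f a) (f b)) (q c))
        = (\<Sum>b<p. ?ip (?br (e a) (q b)) (q c) * ?ip (?br (f a) (q b)) (q c))"
        unfolding inner_sec_def
        by (rule contract[of "\<lambda>u v. pairing E x (?br (e a) u x) (q c x) * pairing E x (?br (f a) v x) (q c x)"];
            (intro sec_linear_cmult sec_linear_pairing sec_linear_bracket sf bs es' fs' qs)?; use ac in simp)
    qed
    also have "\<dots> = (\<Sum>c<p. \<Sum>a<p. \<Sum>b<p. ?ip (?br (e a) (q b)) (q c) * ?ip (?br (f a) (q b)) (q c))"
      by (rule sum.swap)
    also have "\<dots> = (\<Sum>c<p. \<Sum>b<p. \<Sum>a<p. ?ip (?br (e a) (q b)) (q c) * ?ip (?br (f a) (q b)) (q c))"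
      by (intro sum.cong refl sum.swap)
    also have "\<dots> = (\<Sum>c<p. \<Sum>b<p. \<Sum>a<p. ?ip (?br (q a) (q b)) (q c) * ?ip (?br (q a) (q b)) (q c))"
    proof (rule sum.cong[OF refl], rule sum.cong[OF refl])
      fix c b assume cb: "c \<in> {..<p}" "b \<in> {..<p}"
      show "(\<Sum>a<p. ?ip (?br (e a) (q b)) (q c) * ?ip (?br (f a) (q b)) (q c))
        = (\<Sum>a<p. ?ip (?br (q a) (q b)) (q c) * ?ip (?br (q a) (q b)) (q c))"
        unfolding inner_sec_def
        by (rule contract[of "\<lambda>u v. pairing E x (?br u (q b) x) (q c x) * pairing E x (?br v (q b) x) (q c x)"];
            (intro sec_linear_cmult sec_linear_pairing sec_linear_bracket sf bs qs)?; use cb in simp)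
    qed
    also have "\<dots> = (\<Sum>b<p. \<Sum>c<p. \<Sum>a<p. ?ip (?br (q a) (q b)) (q c) * ?ip (?br (q a) (q b)) (q c))" by (rule sum.swap)
    also have "\<dots> = (\<Sum>b<p. \<Sum>a<p. \<Sum>c<p. ?ip (?br (q a) (q b)) (q c) * ?ip (?br (q a) (q b)) (q c))"
      by (intro sum.cong refl sum.swap)
    also have "\<dots> = (\<Sum>a<p. \<Sum>b<p. \<Sum>c<p. ?ip (?br (q a) (q b)) (q c) * ?ip (?br (q a) (q b)) (q c))" by (rule sum.swap)
    finally show ?thesis .
  qed
  have "(\<Sum>a<p. D (f a) x * D (e a) x + 2 * act E (f a) (D (e a)) x)
     - 1/6 * (\<Sum>a<p. \<Sum>b<p. \<Sum>c<p. c_low E x e a b c * c_up E x e a b c)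
     - 1/2 * (\<Sum>a<p. \<Sum>b<p. \<Sum>c\<in>{p..<?r}. c_low E x e a b c * c_up E x e a b c)
     = (\<Sum>a<p. D (q a) x * D (q a) x) + 2 * (\<Sum>a<p. act E (q a) (D (q a)) x) - 1/2 * Y + 1/3 * X"
    unfolding S1 S2 sum.distrib C1 sum_distrib_left[symmetric] C2 by (simp add: field_simps)
  also have "\<dots> = frame_curvature E D p q x"
  proof -
    have "?ip (q c) (?br (q a) (q b)) = ?ip (?br (q a) (q b)) (q c)" if "a < p" "b < p" "c < p" for a b c
      using fun_cong[OF inner_sym[OF mfd ca qs[OF that(3)] bs[OF qs[OF that(1)] qs[OF that(2)]]]] .
    then show ?thesis unfolding frame_curvature_def C3 C4
      by (simp add: sum.distrib sum_distrib_left power2_eq_square)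
  qed
  also have "\<dots> = frame_curvature E D p w x"
  proof -
    obtain U1 where ws: "\<And>a. a < p' \<Longrightarrow> w a \<in> sections M E" and U1: "open U1" "x \<in> U1"
      and wb: "\<forall>y\<in>U1. basis_family (V y) {..<p'} (\<lambda>a. w a y) \<and> (\<forall>a<p'. \<forall>b<p'. inner_sec E (w a) (w b) y = (if a = b then 1 else 0))"
      using w unfolding orthonormal_subframe_def by blast
    show ?thesis
    proof (rule frame_curvature_invariant_pointed[OF mfd ca gm D])
      show "open (U \<inter> U1)" "x \<in> U \<inter> U1" using U U1 by auto
      show "w a \<in> sections M E" if "a < p" for a using ws pp that by simp
      show "inner_sec E (w a) (w b) y = (if a = b then 1 else 0)" if "y \<in> U \<inter> U1" "a < p" "b < p" for y a b
        using wb pp that by auto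
      show "q a y = (\<Sum>b<p. inner_sec E (q a) (w b) y *\<^sub>R w b y)" if "y \<in> U \<inter> U1" "a < p" for y a
        unfolding inner_sec_def by (rule subframe_expand[OF mfd ca gm]) (use wb ws qV pp that in auto)
    qed (use qs qq qx in auto)
  qed
  finally show ?thesis by (simp add: pp f_def)
qed

section \<open>The vector between two divergences\<close>

lemma sections_localI:
  assumes "\<And>x. \<exists>U v. open U \<and> x \<in> U \<and> v \<in> sections M E \<and> (\<forall>y\<in>U. u y = v y)"
  shows "u \<in> sections M E"
  unfolding sections_def mem_Collect_eq
proof (rule smooth_section_local[OF mfd ca_vb[OF mfd ca] open_UNIV])
  fix x
  obtain U v where v: "open U" "x \<in> U" "v \<in> sections M E" "\<forall>y\<in>U. u y = v y" using assms by blast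
  have "smooth_section_on M E U u"
  proof (rule smooth_section_cong[OF mfd ca_vb[OF mfd ca] v(1)])
    show "smooth_section_on M E U v"
      by (rule smooth_section_subset[OF mfd ca_vb[OF mfd ca] _ subset_UNIV]) (use v(3) in \<open>simp add: sections_def\<close>)
  qed (use v in auto)
  then show "\<exists>U. open U \<and> x \<in> U \<and> smooth_section_on M E (UNIV \<inter> U) u" using v by auto
qed

text \<open>The difference of two divergences is linear over functions, so in a frame it is determined by its values
  on the frame, and these are the coefficients of the vector. Uniqueness makes the local vectors agree.\<close>
lemma div_difference_property:
  assumes D: "divergence M E D" and D0: "divergence M E D0"
  shows "div_difference M E D D0 \<in> sections M E \<and>
    (\<forall>u\<in>sections M E. \<forall>x. D u x - D0 u x = inner_sec E (div_difference M E D D0) u x)"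
proof -
  let ?r = "fibre_dim E"
  note vb = ca_vb[OF mfd ca] and sf = section_in_fibre[OF mfd ca gm]
  define F where "F u x = D u x - D0 u x" for u x
  have Fs: "F u \<in> smooth_functions M" if "u \<in> sections M E" for u
    using div_smooth[OF mfd ca gm D that] div_smooth[OF mfd ca gm D0 that] smooth_on_diff[OF mfd open_UNIV]
    by (simp add: F_def[abs_def] smooth_functions_iff)
  have Floc: "F u x = F v x" if "u \<in> sections M E" "v \<in> sections M E" "open U" "x \<in> U" "\<And>y. y \<in> U \<Longrightarrow> u y = v y" for u v U x
    unfolding F_def using div_local[OF mfd ca gm D that] div_local[OF mfd ca gm D0 that] by simp
  have Fsum: "F (\<lambda>y. \<Sum>i\<in>S. f i y *\<^sub>R v i y) x = (\<Sum>i\<in>S. f i x * F (v i) x)"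
    if "\<And>i. i \<in> S \<Longrightarrow> v i \<in> sections M E" "\<And>i. i \<in> S \<Longrightarrow> f i \<in> smooth_functions M" for f v x and S :: "nat set"
    unfolding F_def using div_sum[OF mfd ca gm D, of S v f x] div_sum[OF mfd ca gm D0, of S v f x] that
    by (simp add: sum_subtractf[symmetric] right_diff_distrib)
  have "\<exists>p w U. p \<le> ?r \<and> (\<forall>k<?r. w k \<in> sections M E) \<and> open U \<and> x \<in> U \<and> orthonormal_on E V p w U" for x
    using orthonormal_frame_exists[OF mfd ca gm, of x] unfolding orthonormal_frame_def by blast
  then obtain p w U where fr: "\<And>x. p x \<le> ?r" "\<And>x k. k < ?r \<Longrightarrow> w x k \<in> sections M E"
    "\<And>x. open (U x)" "\<And>x. x \<in> U x" "\<And>x. orthonormal_on E V (p x) (w x) (U x)" by metis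
  have exp: "F u y = (\<Sum>k<?r. frame_sign (p x) k * F (w x k) y * pairing E y (w x k y) (u y))"
    if u: "u \<in> sections M E" and y: "y \<in> U x" for u x y
  proof -
    let ?c = "\<lambda>k z. frame_sign (p x) k * inner_sec E u (w x k) z"
    have cs: "?c k \<in> smooth_functions M" if "k < ?r" for k
      by (rule smooth_fun_mult[OF mfd ca gm smooth_fun_const[OF mfd ca gm] inner_smooth[OF mfd ca u fr(2)[OF that]]])
    have ss: "(\<lambda>z. \<Sum>k<?r. ?c k z *\<^sub>R w x k z) \<in> sections M E" by (rule sections_sum[OF mfd vb]) (use cs fr(2) in auto)
    have "F u y = F (\<lambda>z. \<Sum>k<?r. ?c k z *\<^sub>R w x k z) y"
    proof (rule Floc[OF u ss fr(3) y])
      fix z assume z: "z \<in> U x"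
      show "u z = (\<Sum>k<?r. ?c k z *\<^sub>R w x k z)" unfolding inner_sec_def
        by (rule frame_expand[OF mfd ca gm fr(5) z sf[OF u] fr(2,1)])
    qed
    also have "\<dots> = (\<Sum>k<?r. ?c k y * F (w x k) y)" by (rule Fsum) (use cs fr(2) in auto)
    also have "\<dots> = (\<Sum>k<?r. frame_sign (p x) k * F (w x k) y * pairing E y (w x k y) (u y))"
      by (intro sum.cong refl) (use pairing_sym[OF mfd ca sf[OF u] sf[OF fr(2)]] in \<open>auto simp: inner_sec_def mult_ac\<close>)
    finally show ?thesis .
  qed
  define t where "t x y = (\<Sum>k<?r. (frame_sign (p x) k * F (w x k) y) *\<^sub>R w x k y)" for x y
  have ts: "t x \<in> sections M E" for x
    unfolding t_def[abs_def]
    by (rule sections_sum[OF mfd vb]) (use fr(2) Fs smooth_fun_mult[OF mfd ca gm smooth_fun_const[OF mfd ca gm]] in auto)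
  have tF: "inner_sec E (t x) u y = F u y" if "u \<in> sections M E" "y \<in> U x" for u x y
    unfolding exp[OF that] inner_sec_def t_def by (rule pairing_sum[OF mfd ca]) (use sf fr(2) that in auto)
  have uniq: "a = b" if a: "a \<in> fibre E y" and b: "b \<in> fibre E y"
    and ab: "\<And>u. u \<in> sections M E \<Longrightarrow> pairing E y a (u y) = pairing E y b (u y)" for a b y
  proof -
    have "a - b = 0"
    proof (rule pairing_nondegenerate[OF mfd ca])
      show "a - b \<in> fibre E y" using a b by (intro subspace_diff ca_fibre_subspace[OF mfd ca])
      fix v assume v: "v \<in> fibre E y"
      obtain u where "u \<in> sections M E" "u y = v" by (rule section_through[OF mfd vb v])
      then show "pairing E y (a - b) v = 0" using ab[of u] pairing_diff[OF mfd ca a b v] by simp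
    qed
    then show ?thesis by simp
  qed
  define d where "d y = t y y" for y
  have dt: "d y = t x y" if "y \<in> U x" for x y
    unfolding d_def
    by (rule uniq[OF sf[OF ts] sf[OF ts]]) (use tF that fr(4) in \<open>auto simp: inner_sec_def\<close>)
  have ds: "d \<in> sections M E"
  proof (rule sections_localI)
    fix x show "\<exists>U' v. open U' \<and> x \<in> U' \<and> v \<in> sections M E \<and> (\<forall>y\<in>U'. d y = v y)"
      using fr(3,4)[of x] ts[of x] dt by blast
  qed
  have dF: "F u x = inner_sec E d u x" if "u \<in> sections M E" for u x
    using tF[OF that fr(4)[of x]] by (simp add: inner_sec_def d_def)
  have "\<exists>!e. e \<in> sections M E \<and> (\<forall>u\<in>sections M E. \<forall>x. D u x - D0 u x = inner_sec E e u x)"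
  proof (rule ex1I[of _ d])
    show "d \<in> sections M E \<and> (\<forall>u\<in>sections M E. \<forall>x. D u x - D0 u x = inner_sec E d u x)"
      using ds dF by (simp add: F_def)
    fix e assume e: "e \<in> sections M E \<and> (\<forall>u\<in>sections M E. \<forall>x. D u x - D0 u x = inner_sec E e u x)"
    show "e = d"
    proof
      fix x show "e x = d x"
      proof (rule uniq)
        show "e x \<in> fibre E x" "d x \<in> fibre E x" using sf e ds by auto
        fix u assume u: "u \<in> sections M E"
        have "inner_sec E e u x = F u x" using e u by (simp add: F_def)
        then show "pairing E x (e x) (u x) = pairing E x (d x) (u x)" using dF[OF u, of x] by (simp add: inner_sec_def)
      qed
    qed
  qed
  then show ?thesis unfolding div_difference_def by (rule theI')
qed

lemma div_density_divergence:
  assumes dens: "is_density M 1 \<mu>" and nv: "nonvanishing M \<mu>"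
  shows "divergence M E (div_density M E \<mu>)"
proof -
  note vb = ca_vb[OF mfd ca] and sf = section_in_fibre[OF mfd ca gm] and rv = rho_smooth_vf[OF mfd ca gm]
  note cs = smooth_fun_const[OF mfd ca gm]
  have dv: "div_density M E \<mu> u = vf_div M \<mu> (rho E u)" for u by (simp add: div_density_def[abs_def] vf_div_def fun_eq_iff)
  have comb: "vf_div M \<mu> (rho E (\<lambda>x. f x *\<^sub>R u x + h x *\<^sub>R v x)) x
      = f x * vf_div M \<mu> (rho E u) x + rho E u x f + h x * vf_div M \<mu> (rho E v) x + rho E v x h"
    if u: "u \<in> sections M E" and v: "v \<in> sections M E" and f: "f \<in> smooth_functions M" and h: "h \<in> smooth_functions M" for u v f h x
    by (rule vf_div_combine[OF mfd dens nv rv[OF u] rv[OF v] rv[OF sections_combine[OF mfd vb u v f h]] f h])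
      (simp add: rho_def anchor_combine[OF mfd ca gm sf[OF u] sf[OF v]])
  have tc: "rho E u x (\<lambda>y. a) = 0" if "u \<in> sections M E" for u x a
    by (rule tangent_const[OF mfd act_tangent[OF mfd ca gm that]])
  show ?thesis
    unfolding divergence_def dv
  proof (intro conjI ballI allI)
    fix u assume u: "u \<in> sections M E"
    show "vf_div M \<mu> (rho E u) \<in> smooth_functions M" by (rule vf_div_smooth[OF mfd dens nv rv[OF u]])
    fix f assume f: "f \<in> smooth_functions M"
    show "vf_div M \<mu> (rho E (\<lambda>x. f x *\<^sub>R u x)) = (\<lambda>x. f x * vf_div M \<mu> (rho E u) x + act E u f x)"
      using comb[OF u u f cs[of 0]] tc[OF u] by (auto simp: act_def)
  next
    fix u v and a b :: real assume u: "u \<in> sections M E" and v: "v \<in> sections M E"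
    show "vf_div M \<mu> (rho E (\<lambda>x. a *\<^sub>R u x + b *\<^sub>R v x)) = (\<lambda>x. a * vf_div M \<mu> (rho E u) x + b * vf_div M \<mu> (rho E v) x)"
      using comb[OF u v cs cs, of a b] tc[OF u] tc[OF v] by auto
  qed
qed

section \<open>The local formula for the scalar curvature\<close>

text \<open>Whatever adapted frame the definition of the Laplacian selects, its dual frames turn the expression into
  the curvature of the given orthonormal frame.\<close>
lemma laplacian_ratio:
  assumes half: "is_density M (1/2) \<sigma>" and nv: "nonvanishing M \<sigma>" and w: "orthonormal_subframe M E V x p w"
  shows "density_ratio M (laplacian M E V \<sigma>) \<sigma> x
    = frame_curvature E (div_density M E (\<lambda>k y. (\<sigma> k y)\<^sup>2)) p w x"
proof -
  define D0 where "D0 = div_density M E (\<lambda>k y. (\<sigma> k y)\<^sup>2)"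
  note rv = rho_smooth_vf[OF mfd ca gm]
  have dv: "D0 u = vf_div M (\<lambda>k y. (\<sigma> k y)\<^sup>2) (rho E u)" for u by (simp add: D0_def div_density_def[abs_def] vf_div_def fun_eq_iff)
  have D0: "divergence M E D0" unfolding D0_def
    by (rule div_density_divergence[OF half_density_square[OF mfd half nv] nonvanishing_square[OF mfd half nv]])
  define k where "k = (SOME c. c \<in> atlas M \<and> x \<in> fst c)"
  have "\<exists>c. c \<in> atlas M \<and> x \<in> fst c" using atlas_cover[OF mfd, of x] by blast
  from someI_ex[OF this] have k: "k \<in> atlas M" "x \<in> fst k" by (auto simp: k_def)
  obtain p1 e1 where s: "(SOME (p, e). adapted_frame M E V x p e) = (p1, e1)" by (metis surj_pair)
  obtain p2 w2 where "orthonormal_frame M E V x p2 w2" using orthonormal_frame_exists[OF mfd ca gm] by blast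
  then have "adapted_frame M E V x p2 w2" by (rule orthonormal_imp_adapted[OF mfd ca gm])
  then have "\<exists>pe. case pe of (p, e) \<Rightarrow> adapted_frame M E V x p e" by auto
  from someI_ex[OF this] have af: "adapted_frame M E V x p1 e1" unfolding s by simp
  let ?f = "raised E x e1"
  have pr: "p1 \<le> fibre_dim E" and es: "\<And>a. a < fibre_dim E \<Longrightarrow> e1 a \<in> sections M E"
    using af unfolding adapted_frame_def by blast+
  have fs: "?f a \<in> sections M E" for a
    unfolding raised_def[abs_def]
    by (rule sections_sum[OF mfd ca_vb[OF mfd ca]]) (use es smooth_fun_const[OF mfd ca gm] in auto)
  have lie: "4 * lie_density M (1/2) (rho E (?f a)) (lie_density M (1/2) (rho E (e1 a)) \<sigma>) k x
      = (D0 (?f a) x * D0 (e1 a) x + 2 * act E (?f a) (D0 (e1 a)) x) * \<sigma> k x" if "a < p1" for a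
    using lie_half_density_twice[OF mfd half nv rv[OF es] rv[OF fs] k, of a a] that pr
    by (simp add: dv act_def)
  have nz: "\<sigma> k x \<noteq> 0" using nv k by (simp add: nonvanishing_def)
  have "density_ratio M (laplacian M E V \<sigma>) \<sigma> x = laplacian_in_frame M E p1 e1 \<sigma> k x / \<sigma> k x"
    unfolding density_ratio_def laplacian_def s by (simp add: Let_def k_def)
  also have "laplacian_in_frame M E p1 e1 \<sigma> k x =
    ((\<Sum>a<p1. D0 (?f a) x * D0 (e1 a) x + 2 * act E (?f a) (D0 (e1 a)) x)
     - 1/6 * (\<Sum>a<p1. \<Sum>b<p1. \<Sum>c<p1. c_low E x e1 a b c * c_up E x e1 a b c)
     - 1/2 * (\<Sum>a<p1. \<Sum>b<p1. \<Sum>c\<in>{p1..<fibre_dim E}. c_low E x e1 a b c * c_up E x e1 a b c)) * \<sigma> k x"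
    unfolding laplacian_in_frame_def sum_distrib_left[of 4] left_diff_distrib sum_distrib_right[of _ _ "\<sigma> k x"]
    by (intro arg_cong2[where f = "(-)"] refl sum.cong) (use lie in auto)
  also have "\<dots> / \<sigma> k x = frame_curvature E D0 p w x"
    unfolding adapted_frame_curvature[OF D0 af w] using nz by simp
  finally show ?thesis by (simp add: D0_def)
qed

lemma proj_plus_eqI:
  assumes "w \<in> V x" "u x - w \<in> perp E V x" shows "proj_plus E V u x = w"
  unfolding proj_plus_def
proof (rule the_equality)
  show "w \<in> V x \<and> u x - w \<in> perp E V x" using assms by simp
  fix v assume v: "v \<in> V x \<and> u x - v \<in> perp E V x"
  have "subspace (perp E V x)"
    using ca_fibre_subspace[OF mfd ca] V_fibre[OF mfd ca gm]
    by (auto simp: perp_def subspace_def pairing_zero[OF mfd ca] pairing_add[OF mfd ca] pairing_scale[OF mfd ca] subset_iff)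
  from subspace_diff[OF this, of "u x - w" "u x - v"] have "v - w \<in> perp E V x" using v assms by simp
  moreover have "v - w \<in> V x" using v assms by (intro subspace_diff[OF V_subspace[OF mfd ca gm]]) auto
  ultimately have "v - w = 0" using V_perp_zero[OF mfd ca gm, of "v - w" x] by simp
  then show "v = w" by simp
qed

text \<open>Near \<open>x\<close> the projection \<open>e\<^sub>+\<close> is \<open>\<Sum>\<^sub>a \<epsilon>\<^sub>a o\<^sub>a\<close> with \<open>\<epsilon>\<^sub>a = \<langle>e, o\<^sub>a\<rangle> = D o\<^sub>a - D\<^sub>0 o\<^sub>a\<close>. Inserting
  \<open>D o\<^sub>a = D\<^sub>0 o\<^sub>a + \<epsilon>\<^sub>a\<close> into the divergence terms for \<open>D\<close> gives those for \<open>D\<^sub>0\<close> plus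
  \<open>\<Sum>\<^sub>a \<epsilon>\<^sub>a\<^sup>2 + 2 (\<epsilon>\<^sub>a D\<^sub>0 o\<^sub>a + o\<^sub>a \<cdot> \<epsilon>\<^sub>a)\<close>, which are the two terms in \<open>e\<^sub>+\<close>.\<close>
theorem scalar_curvature_eq_frame_curvature:
  assumes D: "divergence M E D" and w: "orthonormal_subframe M E V x p w"
  shows "scalar_curvature M E V D x = frame_curvature E D p w x"
proof -
  note vb = ca_vb[OF mfd ca] and sf = section_in_fibre[OF mfd ca gm]
  define \<sigma> where "\<sigma> = (SOME \<sigma>. is_density M (1/2) \<sigma> \<and> nonvanishing M \<sigma>)"
  have half: "is_density M (1/2) \<sigma>" and nv: "nonvanishing M \<sigma>"
    using someI_ex[OF nonvanishing_half_density_exists[OF mfd]] by (auto simp: \<sigma>_def)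
  define \<mu> where "\<mu> = (\<lambda>k y. (\<sigma> k y)\<^sup>2)"
  note dens = half_density_square[OF mfd half nv, folded \<mu>_def] and nvm = nonvanishing_square[OF mfd half nv, folded \<mu>_def]
  define D0 where "D0 = div_density M E \<mu>"
  have D0: "divergence M E D0" unfolding D0_def by (rule div_density_divergence[OF dens nvm])
  define e where "e = div_difference M E D D0"
  have es: "e \<in> sections M E" and eD: "\<And>u x. u \<in> sections M E \<Longrightarrow> D u x - D0 u x = inner_sec E e u x"
    using div_difference_property[OF D D0] by (auto simp: e_def)
  define ep where "ep = proj_plus E V e"
  obtain U where ws: "\<And>a. a < p \<Longrightarrow> w a \<in> sections M E" and U: "open U" "x \<in> U"
    and wb: "\<forall>y\<in>U. basis_family (V y) {..<p} (\<lambda>a. w a y) \<and> (\<forall>a<p. \<forall>b<p. inner_sec E (w a) (w b) y = (if a = b then 1 else 0))"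
    using w unfolding orthonormal_subframe_def by blast
  have wfib: "w a y \<in> fibre E y" if "a < p" for a y using sf ws[OF that] by blast
  define \<epsilon> where "\<epsilon> a = inner_sec E e (w a)" for a
  have eps: "\<epsilon> a \<in> smooth_functions M" if "a < p" for a unfolding \<epsilon>_def by (rule inner_smooth[OF mfd ca es ws[OF that]])
  define s where "s y = (\<Sum>a<p. \<epsilon> a y *\<^sub>R w a y)" for y
  have ss: "s \<in> sections M E" unfolding s_def[abs_def] by (rule sections_sum[OF mfd vb]) (use ws eps in auto)
  have ep_s: "ep y = s y" if y: "y \<in> U" for y
    unfolding ep_def
  proof (rule proj_plus_eqI)
    have bV: "basis_family (V y) {..<p} (\<lambda>a. w a y)" using wb y by blast
    have o: "pairing E y (w a y) (w b y) = (if a = b then 1 else 0)" if "a < p" "b < p" for a b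
      using wb y that by (auto simp: inner_sec_def)
    show "s y \<in> V y" unfolding s_def using basis_family_mem[OF bV] by (intro subspace_sum subspace_scale V_subspace[OF mfd ca gm]) auto
    have df: "e y - s y \<in> fibre E y" using sf[OF es] sf[OF ss] by (intro subspace_diff ca_fibre_subspace[OF mfd ca])
    have z: "pairing E y (e y - s y) (w b y) = 0" if b: "b < p" for b
    proof -
      have "pairing E y (s y) (w b y) = (\<Sum>a<p. \<epsilon> a y * pairing E y (w a y) (w b y))"
        unfolding s_def by (rule pairing_sum[OF mfd ca]) (use wfib b in auto)
      also have "\<dots> = (\<Sum>a<p. if a = b then \<epsilon> b y else 0)" by (intro sum.cong refl) (use o b in auto)
      also have "\<dots> = pairing E y (e y) (w b y)" using b by (simp add: sum.delta \<epsilon>_def inner_sec_def)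
      finally show ?thesis using pairing_diff[OF mfd ca sf[OF es] sf[OF ss] wfib[OF b]] by simp
    qed
    have "pairing E y (e y - s y) v = 0" if v: "v \<in> V y" for v
    proof -
      obtain g where g: "v = (\<Sum>b<p. g b *\<^sub>R w b y)" by (rule basis_family_expand[OF bV finite_lessThan v])
      have "pairing E y (e y - s y) v = (\<Sum>b<p. g b * pairing E y (e y - s y) (w b y))"
        unfolding g by (rule pairing_sum_right[OF mfd ca]) (use wfib df in auto)
      then show ?thesis using z by simp
    qed
    then show "e y - s y \<in> perp E V y" using df by (simp add: perp_def)
  qed
  have ip: "inner_sec E ep ep x = (\<Sum>a<p. (\<epsilon> a x)\<^sup>2)"
  proof -
    have o: "pairing E x (w a x) (w b x) = (if a = b then 1 else 0)" if "a < p" "b < p" for a b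
      using wb U that by (auto simp: inner_sec_def)
    have "inner_sec E ep ep x = pairing E x (s x) (s x)" using ep_s[OF U(2)] by (simp add: inner_sec_def)
    also have "\<dots> = (\<Sum>a<p. \<epsilon> a x * pairing E x (w a x) (s x))"
      unfolding s_def[of x] by (rule pairing_sum[OF mfd ca]) (use wfib sf[OF ss, of x] in \<open>auto simp: s_def\<close>)
    also have "\<dots> = (\<Sum>a<p. \<epsilon> a x * \<epsilon> a x)"
    proof (intro sum.cong refl arg_cong2[where f = "(*)"])
      fix a assume "a \<in> {..<p}"
      then have a: "a < p" by simp
      have "pairing E x (w a x) (s x) = (\<Sum>b<p. \<epsilon> b x * pairing E x (w a x) (w b x))"
        unfolding s_def by (rule pairing_sum_right[OF mfd ca]) (use wfib a in auto)
      also have "\<dots> = (\<Sum>b<p. if b = a then \<epsilon> a x else 0)" by (intro sum.cong refl) (use o a in auto)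
      finally show "pairing E x (w a x) (s x) = \<epsilon> a x" using a by (simp add: sum.delta)
    qed
    finally show ?thesis by (simp add: power2_eq_square)
  qed
  have dv: "div_density M E \<mu> ep x = (\<Sum>a<p. \<epsilon> a x * D0 (w a) x + act E (w a) (\<epsilon> a) x)"
  proof -
    have "div_density M E \<mu> ep x = vf_div M \<mu> (rho E ep) x" by (simp add: div_density_def vf_div_def)
    also have "\<dots> = vf_div M \<mu> (rho E s) x"
      by (rule vf_div_local[OF mfd dens nvm U]) (simp add: rho_def ep_s)
    also have "\<dots> = D0 s x" by (simp add: D0_def div_density_def vf_div_def)
    also have "\<dots> = (\<Sum>a<p. \<epsilon> a x * D0 (w a) x + act E (w a) (\<epsilon> a) x)"
      unfolding s_def[abs_def] by (rule div_sum[OF mfd ca gm D0]) (use ws eps in auto)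
    finally show ?thesis .
  qed
  have Dw: "D (w a) = (\<lambda>y. D0 (w a) y + \<epsilon> a y)" if "a < p" for a
    using eD[OF ws[OF that]] by (auto simp: \<epsilon>_def fun_eq_iff algebra_simps)
  have aD: "act E (w a) (D (w a)) x = act E (w a) (D0 (w a)) x + act E (w a) (\<epsilon> a) x" if "a < p" for a
    unfolding Dw[OF that] by (rule act_add[OF mfd ca gm ws[OF that] div_smooth[OF mfd ca gm D0 ws[OF that]] eps[OF that]])
  have "scalar_curvature M E V D x = frame_curvature E D0 p w x + inner_sec E ep ep x + 2 * div_density M E \<mu> ep x"
    unfolding scalar_curvature_def scalar_curvature_via_def \<sigma>_def[symmetric] Let_def
      laplacian_ratio[OF half nv w] by (simp add: \<mu>_def D0_def e_def ep_def)
  also have "\<dots> = frame_curvature E D p w x"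
  proof -
    have "(\<Sum>a<p. (D (w a) x)\<^sup>2 + 2 * act E (w a) (D (w a)) x)
      = (\<Sum>a<p. ((D0 (w a) x)\<^sup>2 + 2 * act E (w a) (D0 (w a)) x) + ((\<epsilon> a x)\<^sup>2 + 2 * (\<epsilon> a x * D0 (w a) x + act E (w a) (\<epsilon> a) x)))"
    proof (intro sum.cong refl)
      fix a assume "a \<in> {..<p}"
      then have a: "a < p" by simp
      show "(D (w a) x)\<^sup>2 + 2 * act E (w a) (D (w a)) x = ((D0 (w a) x)\<^sup>2 + 2 * act E (w a) (D0 (w a)) x)
        + ((\<epsilon> a x)\<^sup>2 + 2 * (\<epsilon> a x * D0 (w a) x + act E (w a) (\<epsilon> a) x))"
        unfolding aD[OF a] fun_cong[OF Dw[OF a], of x] by (simp add: power2_eq_square algebra_simps)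
    qed
    also have "\<dots> = (\<Sum>a<p. (D0 (w a) x)\<^sup>2 + 2 * act E (w a) (D0 (w a)) x)
        + (inner_sec E ep ep x + 2 * div_density M E \<mu> ep x)"
      unfolding ip dv by (simp add: sum.distrib sum_distrib_left distrib_left)
    finally show ?thesis unfolding frame_curvature_def by simp
  qed
  finally show ?thesis .
qed

end

section \<open>Pullbacks\<close>

context
  fixes M :: "('m::{t2_space, second_countable_topology}, 'n::finite) mfd"
    and M' :: "('k::{t2_space, second_countable_topology}, 'l::finite) mfd"
    and E :: "('m, 'v::real_vector) calg"
    and E' :: "('k, 'v) calg"
    and V :: "'m \<Rightarrow> 'v set"
    and \<tau> :: "'k \<Rightarrow> 'm"
  assumes mfd: "manifold M" and mfd': "manifold M'" and ca: "courant_algebroid M E"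
    and gm: "generalized_metric M E V" and \<tau>: "smooth_map M' M \<tau>" and pb: "ca_pullback M' M \<tau> E E'"
begin

lemma pullback_fibre: "fibre E' x = fibre E (\<tau> x)" and pullback_dim: "fibre_dim E' = fibre_dim E"
  and pullback_trivs: "trivs E' = (\<lambda>(U, s). (\<tau> -` U, \<lambda>i. s i \<circ> \<tau>)) ` trivs E"
proof -
  have "vbundle.truncate E' = pullback_bundle \<tau> E" using pb by (simp add: ca_pullback_def)
  then have "fibre E' = fibre E \<circ> \<tau> \<and> fibre_dim E' = fibre_dim E \<and> trivs E' = (\<lambda>(U, s). (\<tau> -` U, \<lambda>i. s i \<circ> \<tau>)) ` trivs E"
    by (simp add: vbundle.truncate_def pullback_bundle_def)
  then show "fibre E' x = fibre E (\<tau> x)" "fibre_dim E' = fibre_dim E"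
    "trivs E' = (\<lambda>(U, s). (\<tau> -` U, \<lambda>i. s i \<circ> \<tau>)) ` trivs E" by simp_all
qed

text \<open>The pulled back section has the pulled back coefficients in the pulled back trivializations, and these
  are smooth by the chain rule.\<close>
lemma pullback_smooth_section:
  assumes W: "open W" and u: "smooth_section_on M E W u"
  shows "smooth_section_on M' E' (\<tau> -` W) (u \<circ> \<tau>)"
  unfolding smooth_section_on_def
proof (intro conjI ballI)
  show "(u \<circ> \<tau>) x \<in> fibre E' x" if "x \<in> \<tau> -` W" for x
    using u that by (simp add: smooth_section_on_def pullback_fibre)
  fix t assume "t \<in> trivs E'"
  then obtain U s where Us: "(U, s) \<in> trivs E" and t: "t = (\<tau> -` U, \<lambda>i. s i \<circ> \<tau>)"
    unfolding pullback_trivs by auto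
  note vb = ca_vb[OF mfd ca]
  obtain g where g: "\<And>i. i < fibre_dim E \<Longrightarrow> smooth_on M (U \<inter> W) (g i)"
    "\<And>x. x \<in> U \<inter> W \<Longrightarrow> u x = (\<Sum>i<fibre_dim E. g i x *\<^sub>R s i x)"
    by (rule smooth_section_on_coeff[OF mfd vb u Us], rule that, assumption+)
  have o: "open (U \<inter> W)" using triv_open[OF mfd vb Us] W by (rule open_Int)
  have "\<exists>g. (\<forall>i<fibre_dim E'. smooth_on M' (\<tau> -` U \<inter> \<tau> -` W) (g i)) \<and>
      (\<forall>x\<in>\<tau> -` U \<inter> \<tau> -` W. (u \<circ> \<tau>) x = (\<Sum>i<fibre_dim E'. g i x *\<^sub>R (s i \<circ> \<tau>) x))"
  proof (intro exI[of _ "\<lambda>i x. g i (\<tau> x)"] conjI allI impI ballI)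
    show "smooth_on M' (\<tau> -` U \<inter> \<tau> -` W) (\<lambda>x. g i (\<tau> x))" if "i < fibre_dim E'" for i
      using smooth_on_compose[OF mfd mfd' \<tau> o g(1)[of i]] that by (simp add: pullback_dim)
    show "(u \<circ> \<tau>) x = (\<Sum>i<fibre_dim E'. g i (\<tau> x) *\<^sub>R (s i \<circ> \<tau>) x)" if "x \<in> \<tau> -` U \<inter> \<tau> -` W" for x
      using g(2)[of "\<tau> x"] that by (simp add: pullback_dim)
  qed
  then show "case t of (U, s) \<Rightarrow> \<exists>g. (\<forall>i<fibre_dim E'. smooth_on M' (U \<inter> \<tau> -` W) (g i)) \<and>
      (\<forall>x\<in>U \<inter> \<tau> -` W. (u \<circ> \<tau>) x = (\<Sum>i<fibre_dim E'. g i x *\<^sub>R s i x))" by (simp add: t)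
qed

lemma pullback_section: "u \<in> sections M E \<Longrightarrow> u \<circ> \<tau> \<in> sections M' E'"
  using pullback_smooth_section[OF open_UNIV, of u] by (simp add: sections_def)

text \<open>The pullback condition speaks of sections; through every vector there is one.\<close>
lemma pullback_pairing:
  assumes "v \<in> fibre E (\<tau> x)" "w \<in> fibre E (\<tau> x)"
  shows "pairing E' x v w = pairing E (\<tau> x) v w"
proof -
  note vb = ca_vb[OF mfd ca]
  obtain u where u: "u \<in> sections M E" "u (\<tau> x) = v" by (rule section_through[OF mfd vb assms(1)])
  obtain t where t: "t \<in> sections M E" "t (\<tau> x) = w" by (rule section_through[OF mfd vb assms(2)])
  have "inner_sec E' (u \<circ> \<tau>) (t \<circ> \<tau>) = inner_sec E u t \<circ> \<tau>" using pb u t by (simp add: ca_pullback_def)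
  from fun_cong[OF this, of x] show ?thesis using u t by (simp add: inner_sec_def)
qed

lemma pullback_perp: "perp E' (V \<circ> \<tau>) x = perp E V (\<tau> x)"
  using V_fibre[OF mfd ca gm, of "\<tau> x"] pullback_pairing by (auto simp: perp_def pullback_fibre subset_iff)

lemma pullback_generalized_metric: "generalized_metric M' E' (V \<circ> \<tau>)"
proof -
  note Vf = V_fibre[OF mfd ca gm] and Vs = V_subspace[OF mfd ca gm]
  have cont: "continuous_on UNIV \<tau>" by (rule smooth_map_continuous[OF \<tau>])
  have "subbundle M E V" using gm by (simp add: generalized_metric_def generalized_pseudometric_def)
  then obtain p where p: "\<forall>x. \<exists>U e. open U \<and> x \<in> U \<and> (\<forall>a<p. smooth_section_on M E U (e a)) \<and>
        (\<forall>y\<in>U. basis_family (V y) {..<p} (\<lambda>a. e a y))" unfolding subbundle_def by blast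
  have "subbundle M' E' (V \<circ> \<tau>)"
    unfolding subbundle_def
  proof (intro conjI exI[of _ p] allI)
    show "subspace ((V \<circ> \<tau>) x)" for x using Vs by simp
    show "(V \<circ> \<tau>) x \<subseteq> fibre E' x" for x using Vf by (simp add: pullback_fibre)
    fix x
    obtain U e where U: "open U" "\<tau> x \<in> U" "\<forall>a<p. smooth_section_on M E U (e a)"
      "\<forall>y\<in>U. basis_family (V y) {..<p} (\<lambda>a. e a y)" using p by blast
    show "\<exists>U e. open U \<and> x \<in> U \<and> (\<forall>a<p. smooth_section_on M' E' U (e a)) \<and>
        (\<forall>y\<in>U. basis_family ((V \<circ> \<tau>) y) {..<p} (\<lambda>a. e a y))"
      using U pullback_smooth_section[OF U(1)] open_vimage[OF U(1) cont]
      by (intro exI[of _ "\<tau> -` U"] exI[of _ "\<lambda>a. e a \<circ> \<tau>"]) auto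
  qed
  moreover have "nondegenerate_on E' (V \<circ> \<tau>)"
    unfolding nondegenerate_on_def
  proof (intro allI ballI impI)
    fix x v assume v: "v \<in> (V \<circ> \<tau>) x" and z: "\<forall>w\<in>(V \<circ> \<tau>) x. pairing E' x v w = 0"
    have "pairing E (\<tau> x) v v = 0" using z v pullback_pairing[of v x v] Vf[of "\<tau> x"] by auto
    then show "v = 0" using V_pos[OF mfd ca gm, of v "\<tau> x"] v by force
  qed
  moreover have "pairing E' x v v > 0" if "v \<in> (V \<circ> \<tau>) x" "v \<noteq> 0" for x v
    using that V_pos[OF mfd ca gm, of v "\<tau> x"] pullback_pairing[of v x v] Vf[of "\<tau> x"] by auto
  moreover have "pairing E' x v v < 0" if "v \<in> perp E' (V \<circ> \<tau>) x" "v \<noteq> 0" for x v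
    using that perp_neg[OF mfd ca gm, of v "\<tau> x"] pullback_pairing[of v x v]
    unfolding pullback_perp by (auto simp: perp_def)
  ultimately show ?thesis unfolding generalized_metric_def generalized_pseudometric_def by blast
qed

lemma pullback_subframe:
  assumes "orthonormal_subframe M E V (\<tau> x) p w"
  shows "orthonormal_subframe M' E' (V \<circ> \<tau>) x p (\<lambda>a. w a \<circ> \<tau>)"
proof -
  obtain U where ws: "\<And>a. a < p \<Longrightarrow> w a \<in> sections M E" and U: "open U" "\<tau> x \<in> U"
    and wb: "\<forall>y\<in>U. basis_family (V y) {..<p} (\<lambda>a. w a y) \<and> (\<forall>a<p. \<forall>b<p. inner_sec E (w a) (w b) y = (if a = b then 1 else 0))"
    using assms unfolding orthonormal_subframe_def by blast
  have "open (\<tau> -` U)" by (rule open_vimage[OF U(1) smooth_map_continuous[OF \<tau>]])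
  moreover have "inner_sec E' (w a \<circ> \<tau>) (w b \<circ> \<tau>) y = inner_sec E (w a) (w b) (\<tau> y)" if "a < p" "b < p" for a b y
    using pb ws that by (simp add: ca_pullback_def)
  ultimately show ?thesis
    unfolding orthonormal_subframe_def using ws U wb pullback_section by (intro conjI exI[of _ "\<tau> -` U"]) auto
qed

lemma pullback_frame_curvature:
  assumes D: "divergence M E D" and D': "pullback_divergence M' M \<tau> E E' D D'" and w: "\<And>a. a < p \<Longrightarrow> w a \<in> sections M E"
  shows "frame_curvature E' D' p (\<lambda>a. w a \<circ> \<tau>) x = frame_curvature E D p w (\<tau> x)"
proof -
  have 1: "D' (w a \<circ> \<tau>) = D (w a) \<circ> \<tau>" if "a < p" for a
    using D' w[OF that] by (simp add: pullback_divergence_def)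
  have 2: "act E' (w a \<circ> \<tau>) (D (w a) \<circ> \<tau>) x = act E (w a) (D (w a)) (\<tau> x)" if "a < p" for a
    using pb w[OF that] div_smooth[OF mfd ca gm D w[OF that]] by (simp add: ca_pullback_def act_def)
  have b: "bracket E' (w a \<circ> \<tau>) (w b \<circ> \<tau>) = bracket E (w a) (w b) \<circ> \<tau>" if "a < p" "b < p" for a b
    using pb w that by (simp add: ca_pullback_def)
  have i: "inner_sec E' (u \<circ> \<tau>) (v \<circ> \<tau>) x = inner_sec E u v (\<tau> x)" if "u \<in> sections M E" "v \<in> sections M E" for u v
    using pb that by (simp add: ca_pullback_def)
  have bs: "bracket E (w a) (w b) \<in> sections M E" if "a < p" "b < p" for a b
    using br_sec[OF mfd ca gm w w] that by blast
  show ?thesis unfolding frame_curvature_def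
    by (intro arg_cong2[where f = "(+)"] arg_cong2[where f = "(-)"] arg_cong2[where f = "(*)"] refl sum.cong)
      (simp_all add: 1 2 b i bs w)
qed

end

theorem theorem5p7:
  fixes M :: "('m::{t2_space, second_countable_topology}, 'n::finite) mfd"
    and M' :: "('k::{t2_space, second_countable_topology}, 'l::finite) mfd"
    and E :: "('m, 'v::real_vector) calg"
    and E' :: "('k, 'v) calg"
    and V :: "'m \<Rightarrow> 'v set"
    and D :: "('m \<Rightarrow> 'v) \<Rightarrow> 'm \<Rightarrow> real"
    and D' :: "('k \<Rightarrow> 'v) \<Rightarrow> 'k \<Rightarrow> real"
    and \<tau> :: "'k \<Rightarrow> 'm"
  assumes "manifold M" and "manifold M'"
    and "courant_algebroid M E"
    and "generalized_metric M E V"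
    and "divergence M E D"
    and "smooth_map M' M \<tau>"
    and "ca_pullback M' M \<tau> E E'"
    and "pullback_divergence M' M \<tau> E E' D D'"
  shows "scalar_curvature M' E' (V \<circ> \<tau>) D' = scalar_curvature M E V D \<circ> \<tau>"
proof
  fix x
  note a = assms
  have gm': "generalized_metric M' E' (V \<circ> \<tau>)" by (rule pullback_generalized_metric[OF a(1-4,6,7)])
  have ca': "courant_algebroid M' E'" using a(7) by (simp add: ca_pullback_def)
  have D': "divergence M' E' D'" using a(8) by (simp add: pullback_divergence_def)
  obtain p w where "orthonormal_frame M E V (\<tau> x) p w" using orthonormal_frame_exists[OF a(1,3,4)] by blast
  then have w: "orthonormal_subframe M E V (\<tau> x) p w" by (rule orthonormal_imp_subframe[OF a(1,3,4)])
  have ws: "w b \<in> sections M E" if "b < p" for b using w that by (simp add: orthonormal_subframe_def)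
  have "scalar_curvature M' E' (V \<circ> \<tau>) D' x = frame_curvature E' D' p (\<lambda>b. w b \<circ> \<tau>) x"
    by (rule scalar_curvature_eq_frame_curvature[OF a(2) ca' gm' D' pullback_subframe[OF a(1-4,6,7) w]])
  also have "\<dots> = frame_curvature E D p w (\<tau> x)"
    by (rule pullback_frame_curvature[OF a(1-4,6,7,5,8) ws])
  also have "\<dots> = scalar_curvature M E V D (\<tau> x)"
    by (rule scalar_curvature_eq_frame_curvature[OF a(1,3,4,5) w, symmetric])
  finally show "scalar_curvature M' E' (V \<circ> \<tau>) D' x = (scalar_curvature M E V D \<circ> \<tau>) x" by simp
qed

end
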